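(* Let $X$ be a (reduced) orbifold with orbifold universal cover $Y$ and orbifold fundamental group $H=\pi_1^{orb}(X)$, let $\alpha\in H^2(H,\mathrm U(1))$ be a discrete torsion, and let $\mathcal L_\alpha$ be the gerbe $\mathcal R_Y\times\widetilde H\to\mathcal R_Y\times H$ over the groupoid $\mathcal R_Y\times H\rightrightarrows\mathcal U_Y$ representing $X$, where $\widetilde H$ is the central extension of $H$ by $\mathrm U(1)$ defined by $\alpha$. Then $${}^{\mathcal L_\alpha}K_{\mathrm{gpd}}(X)\;\cong\;{}^{\alpha}K^{AR}_{\mathrm{orb}}(X).$$
   Context: Groupoid conventions. A groupoid $\mathcal R\rightrightarrows\mathcal U$ has source $s$, target $t$, unit $e$, inverse $i$, multiplication $m$; if $t(r)=s(r')$ then $m(r,r')$ is the composite arrow $s(r)\to t(r')$; $\pi_1,\pi_2$ are the projections of $\mathcal R\,{}_t\!\times_s\mathcal R$. The groupoid representing $X$. Let $n=\dim X$, $P(Y)$ the frame bundle of $Y$ (a smooth manifold with smooth $\mathrm O(n)$-action having finite isotropy, $Y\simeq[P(Y)/\mathrm O(n)]$). Put $\mathcal U_Y=P(Y)$, $\mathcal R_Y=P(Y)\times\mathrm O(n)$, the action groupoid (with $s_Y(g,u)=u$, $t_Y(g,u)=gu$). $H$ acts on $Y$ by deck transformations, and this lifts to $P(Y)$, commuting with $\mathrm O(n)$, so $H$ acts on $\mathcal R_Y\rightrightarrows\mathcal U_Y$ by groupoid automorphisms. The groupoid $\mathcal R_Y\times H\rightrightarrows\mathcal U_Y$ has $s(r,h)=s_Y(r)$,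 $t(r,h)=h(t_Y(r))$, $e(x)=(e_Y(x),1)$, $i(r,h)=(h(i_Y(r)),h^{-1})$, $m((r_1,h_1),(r_2,h_2))=(m_Y(r_1,h_1^{-1}(r_2)),h_2h_1)$. Gerbes. A gerbe over $\mathcal R\rightrightarrows\mathcal U$ is a complex line bundle $\mathcal L\to\mathcal R$ with $i^*\mathcal L\cong\mathcal L^{-1}$ and a trivialization $\theta_{\mathcal L}$ of $\pi_1^*\mathcal L\otimes\pi_2^*\mathcal L\otimes m^*i^*\mathcal L$ which is a $\mathrm U(1)$-valued 2-cocycle. The extension $1\to\mathrm U(1)\to\widetilde H\to H\to1$ given by $\alpha$, multiplied by $\mathcal R_Y$, gives a circle bundle (hence a line bundle) over $\mathcal R_Y\times H$; with the gerbe structure induced from multiplication in $\widetilde H$ this is $\mathcal L_\alpha$. Its cocycle is $\theta((r,h),(r',j))=\alpha(j,h)$ for $\alpha$ a representing cocycle. Twisted $K$-theory. An $n$-dimensional $\mathcal L$-twisted bundle over $\mathcal R\rightrightarrows\mathcal U$ is given by $\mathcal R\times\mathbf C^n\rightrightarrows\mathcal U\times\mathbf C^n$ and a map $\rho:\mathcal R\to\mathrm{GL}_n(\mathbf C)$ with $\rho(i(r))=\rho(r)^{-1}$ and $\rho(r')\rho(r)=\theta_{\mathcal L}(r,r')\,\rho(m(r,r'))$ for composable $(r,r')$; here, by the paper's standing convention, groupoid representatives are taken fine enough (Leray) that bundles are trivial over $\mathcal U$. Equivalently (the paper's coordinate-free form, up to the evident convention for the direction of arrows): a vector bundle $E\to\mathcal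 U$ with an isomorphism $\mathcal L\otimes t^*E\cong s^*E$ compatible with $\theta_{\mathcal L}$. Whitney sum makes isomorphism classes into a monoid, and ${}^{\mathcal L}K_{\mathrm{gpd}}(X)$ is its Grothendieck group; it does not depend on the groupoid chosen to represent $X$. Adem–Ruan twisted $K$-theory. An $\alpha$-twisted $H$-orbibundle over $Y$ is a complex orbibundle $E\to Y$ with an action of $\widetilde H$ on $E$ lifting the action of $H$ on $Y$ and such that $\mathrm U(1)\subset\widetilde H$ acts on the fibers by complex multiplication. ${}^{\alpha}K^{AR}_{\mathrm{orb}}(X)$ is the Grothendieck group of isomorphism classes of $\alpha$-twisted $\pi_1^{orb}(X)$-orbibundles over $Y$. *)

theory Defs
  imports "HOL-Analysis.Analysis" "HOL-Algebra.Coset"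
begin

section \<open>Smooth local diffeomorphisms and topologies\<close>

fun times_differentiable_on ::
    "nat \<Rightarrow> 'a::real_normed_vector set \<Rightarrow> ('a \<Rightarrow> 'b::real_normed_vector) \<Rightarrow> bool" where
  "times_differentiable_on 0 S f \<longleftrightarrow> continuous_on S f"
| "times_differentiable_on (Suc k) S f \<longleftrightarrow>
     (\<forall>x\<in>S. f differentiable (at x)) \<and>
     (\<forall>v. times_differentiable_on k S (\<lambda>x. frechet_derivative f (at x) v))"

text \<open>Only used on open subsets of finite-dimensional spaces, where it is the usual
  \<open>C\<close>-infinity condition.\<close>

definition smooth_on :: "'a::real_normed_vector set \<Rightarrow> ('a \<Rightarrow> 'b::real_normed_vector) \<Rightarrow> bool" where
  "smooth_on S f \<longleftrightarrow> (\<forall>k. times_differentiable_on k S f)"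

definition final_topology :: "'b set \<Rightarrow> 'i set \<Rightarrow> ('i \<Rightarrow> 'a topology) \<Rightarrow> ('i \<Rightarrow> 'a \<Rightarrow> 'b) \<Rightarrow> 'b topology" where
  "final_topology S I T f =
     topology (\<lambda>U. U \<subseteq> S \<and> (\<forall>i\<in>I. openin (T i) {x \<in> topspace (T i). f i x \<in> U}))"

lemma openin_final_topology:
  "openin (final_topology S I T f) U \<longleftrightarrow>
     U \<subseteq> S \<and> (\<forall>i\<in>I. openin (T i) {x \<in> topspace (T i). f i x \<in> U})"
proof -
  let ?P = "\<lambda>U. U \<subseteq> S \<and> (\<forall>i\<in>I. openin (T i) {x \<in> topspace (T i). f i x \<in> U})"
  have "istopology ?P"
    unfolding istopology_def
  proof (intro conjI allI impI)
    fix A B assume A: "?P A" and B: "?P B"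
    have eq: "{x \<in> topspace (T i). f i x \<in> A \<inter> B} =
        {x \<in> topspace (T i). f i x \<in> A} \<inter> {x \<in> topspace (T i). f i x \<in> B}" for i
      by blast
    show "A \<inter> B \<subseteq> S" using A by blast
    show "\<forall>i\<in>I. openin (T i) {x \<in> topspace (T i). f i x \<in> A \<inter> B}"
      unfolding eq using A B by blast
  next
    fix K assume K: "\<forall>A\<in>K. ?P A"
    have eq: "{x \<in> topspace (T i). f i x \<in> \<Union>K} =
        (\<Union>A\<in>K. {x \<in> topspace (T i). f i x \<in> A})" for i
      by blast
    show "\<Union>K \<subseteq> S" using K by blast
    show "\<forall>i\<in>I. openin (T i) {x \<in> topspace (T i). f i x \<in> \<Union>K}"
      unfolding eq using K by blast
  qed
  then show ?thesis
    unfolding final_topology_def by simp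
qed

section \<open>Effective orbifolds\<close>

text \<open>A chart is a triple (connected open domain in Euclidean space, finite group of
  diffeomorphisms of the domain, map to the underlying space).  The group is a set of
  maps of the domain, so it acts effectively: this is what makes orbifolds reduced.\<close>

record ('n, 'x) chart =
  cdom :: "(real^'n) set"
  cgrp :: "(real^'n \<Rightarrow> real^'n) set"
  cmap :: "real^'n \<Rightarrow> 'x"

record ('n, 'x) orbifold =
  ospace :: "'x topology"
  charts :: "('n, 'x) chart set"

abbreviation cimg :: "('n::finite, 'x) chart \<Rightarrow> 'x set" where
  "cimg c \<equiv> cmap c ` cdom c"

text \<open>The last three conditions say that the map induces a homeomorphism from the
  quotient of the domain by the group onto an open subset of the space.\<close>

definition orbifold_chart :: "'x topology \<Rightarrow> ('n::finite, 'x) chart \<Rightarrow> bool" where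
  "orbifold_chart S c \<longleftrightarrow>
     open (cdom c) \<and> connected (cdom c) \<and> cdom c \<noteq> {} \<and>
     finite (cgrp c) \<and> restrict id (cdom c) \<in> cgrp c \<and>
     (\<forall>g\<in>cgrp c. g \<in> extensional (cdom c) \<and> bij_betw g (cdom c) (cdom c) \<and> smooth_on (cdom c) g \<and>
        (\<exists>g'\<in>cgrp c. compose (cdom c) g' g = restrict id (cdom c))) \<and>
     (\<forall>g\<in>cgrp c. \<forall>g'\<in>cgrp c. compose (cdom c) g g' \<in> cgrp c) \<and>
     continuous_map (top_of_set (cdom c)) S (cmap c) \<and>
     open_map (top_of_set (cdom c)) S (cmap c) \<and>
     (\<forall>u\<in>cdom c. \<forall>v\<in>cdom c. cmap c u = cmap c v \<longleftrightarrow> (\<exists>g\<in>cgrp c. v = g u))"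

text \<open>A diffeomorphism from an open subset \<open>W\<close> of the domain of \<open>c\<close> onto an open subset of
  the domain of \<open>d\<close> that covers the map \<open>h\<close> of underlying spaces.  For the identity map these
  are the changes of charts (the usual pseudogroup, which contains the embeddings of charts).\<close>

definition local_lift :: "('x \<Rightarrow> 'y) \<Rightarrow> ('n::finite, 'x) chart \<Rightarrow> ('n, 'y) chart \<Rightarrow>
    (real^'n) set \<Rightarrow> (real^'n \<Rightarrow> real^'n) \<Rightarrow> bool" where
  "local_lift h c d W l \<longleftrightarrow>
     open W \<and> W \<subseteq> cdom c \<and> l \<in> extensional W \<and> l ` W \<subseteq> cdom d \<and> inj_on l W \<and> open (l ` W) \<and>
     smooth_on W l \<and> smooth_on (l ` W) (inv_into W l) \<and>
     (\<forall>u\<in>W. cmap d (l u) = h (cmap c u))"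

definition lifts_locally :: "('x \<Rightarrow> 'y) \<Rightarrow> ('n::finite, 'x) chart \<Rightarrow> ('n, 'y) chart \<Rightarrow> bool" where
  "lifts_locally h c d \<longleftrightarrow>
     (\<forall>u\<in>cdom c. \<forall>v\<in>cdom d. cmap d v = h (cmap c u) \<longrightarrow>
        (\<exists>W l. local_lift h c d W l \<and> u \<in> W \<and> l u = v))"

abbreviation compatible :: "('n::finite, 'x) chart \<Rightarrow> ('n, 'x) chart \<Rightarrow> bool" where
  "compatible \<equiv> lifts_locally (\<lambda>x. x)"

definition effective_orbifold :: "('n::finite, 'x) orbifold \<Rightarrow> bool" where
  "effective_orbifold X \<longleftrightarrow>
     Hausdorff_space (ospace X) \<and> second_countable (ospace X) \<and>
     (\<forall>c\<in>charts X. orbifold_chart (ospace X) c) \<and>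
     (\<Union>c\<in>charts X. cimg c) = topspace (ospace X) \<and>
     (\<forall>c\<in>charts X. \<forall>d\<in>charts X. compatible c d)"

text \<open>Charts of the maximal atlas.\<close>

definition admissible_chart :: "('n::finite, 'x) orbifold \<Rightarrow> ('n, 'x) chart \<Rightarrow> bool" where
  "admissible_chart X c \<longleftrightarrow>
     orbifold_chart (ospace X) c \<and> (\<forall>d\<in>charts X. compatible c d \<and> compatible d c)"

definition orbifold_automorphism :: "('n::finite, 'x) orbifold \<Rightarrow> ('x \<Rightarrow> 'x) \<Rightarrow> bool" where
  "orbifold_automorphism Y h \<longleftrightarrow>
     homeomorphic_map (ospace Y) (ospace Y) h \<and>
     (\<forall>c\<in>charts Y. \<forall>d\<in>charts Y. lifts_locally h c d)"

definition regular_point :: "('n::finite, 'x) orbifold \<Rightarrow> 'x \<Rightarrow> bool" where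
  "regular_point X x \<longleftrightarrow>
     x \<in> topspace (ospace X) \<and>
     (\<forall>c\<in>charts X. \<forall>u\<in>cdom c. cmap c u = x \<longrightarrow>
        {g \<in> cgrp c. g u = u} = {restrict id (cdom c)})"

section \<open>Orbifold coverings and the orbifold fundamental group, after Thurston\<close>

definition orbifold_covering ::
    "('n::finite, 'y) orbifold \<Rightarrow> ('n, 'x) orbifold \<Rightarrow> ('y \<Rightarrow> 'x) \<Rightarrow> bool" where
  "orbifold_covering Y X p \<longleftrightarrow>
     continuous_map (ospace Y) (ospace X) p \<and> p ` topspace (ospace Y) = topspace (ospace X) \<and>
     (\<forall>x\<in>topspace (ospace X). \<exists>c. admissible_chart X c \<and> x \<in> cimg c \<and>
        (\<forall>V\<in>connected_components_of (subtopology (ospace Y) {y \<in> topspace (ospace Y). p y \<in> cimg c}).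
           \<exists>\<Gamma> \<psi>. \<Gamma> \<subseteq> cgrp c \<and>
             admissible_chart Y \<lparr>cdom = cdom c, cgrp = \<Gamma>, cmap = \<psi>\<rparr> \<and>
             \<psi> ` cdom c = V \<and> (\<forall>u\<in>cdom c. p (\<psi> u) = cmap c u)))"

text \<open>Thurston's universal property.  It is tested against coverings whose points have the type
  \<open>'y\<close> of the points of \<open>Y\<close>; this is no restriction, because connected orbifolds
  (Hausdorff, second countable) have at most continuum many points, and \<open>Y\<close>, having positive
  dimension, has exactly that many unless it is empty.\<close>

definition universal_orbifold_cover ::
    "('n::finite, 'y) orbifold \<Rightarrow> ('n, 'x) orbifold \<Rightarrow> ('y \<Rightarrow> 'x) \<Rightarrow> bool" where
  "universal_orbifold_cover Y X p \<longleftrightarrow>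
     connected_space (ospace Y) \<and> orbifold_covering Y X p \<and>
     (\<forall>(Z :: ('n, 'y) orbifold) q.
        effective_orbifold Z \<and> connected_space (ospace Z) \<and> orbifold_covering Z X q \<longrightarrow>
        (\<forall>y\<in>topspace (ospace Y). \<forall>z\<in>topspace (ospace Z). regular_point X (p y) \<and> q z = p y \<longrightarrow>
           (\<exists>f. orbifold_covering Y Z f \<and> f y = z \<and> (\<forall>y'\<in>topspace (ospace Y). q (f y') = p y'))))"

text \<open>For the universal cover this is the orbifold fundamental group.\<close>

definition deck_group :: "('n::finite, 'y) orbifold \<Rightarrow> ('y \<Rightarrow> 'x) \<Rightarrow> ('y \<Rightarrow> 'y) monoid" where
  "deck_group Y p =
     \<lparr>carrier = {h \<in> extensional (topspace (ospace Y)). orbifold_automorphism Y h \<and>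
                   (\<forall>y\<in>topspace (ospace Y). p (h y) = p y)},
      mult = compose (topspace (ospace Y)),
      one = restrict id (topspace (ospace Y))\<rparr>"

section \<open>Discrete torsion\<close>

definition Z2 :: "('h, 'm) monoid_scheme \<Rightarrow> ('h \<times> 'h \<Rightarrow> complex) monoid" where
  "Z2 H =
     \<lparr>carrier = {a \<in> carrier H \<times> carrier H \<rightarrow>\<^sub>E sphere 0 1.
        \<forall>g\<in>carrier H. \<forall>h\<in>carrier H. \<forall>k\<in>carrier H.
          a (g, h) * a (g \<otimes>\<^bsub>H\<^esub> h, k) = a (g, h \<otimes>\<^bsub>H\<^esub> k) * a (h, k)},
      mult = (\<lambda>a b. \<lambda>x\<in>carrier H \<times> carrier H. a x * b x),
      one = (\<lambda>x\<in>carrier H \<times> carrier H. 1)\<rparr>"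

definition B2 :: "('h, 'm) monoid_scheme \<Rightarrow> ('h \<times> 'h \<Rightarrow> complex) set" where
  "B2 H = {(\<lambda>(g, h)\<in>carrier H \<times> carrier H. b g * b h / b (g \<otimes>\<^bsub>H\<^esub> h)) | b.
             b \<in> carrier H \<rightarrow> sphere 0 1}"

definition H2 :: "('h, 'm) monoid_scheme \<Rightarrow> ('h \<times> 'h \<Rightarrow> complex) set monoid" where
  "H2 H = Z2 H Mod B2 H"

text \<open>The central extension of \<open>H\<close> by U(1) given by a (not necessarily normalized) cocycle;
  the projection to \<open>H\<close> is \<open>snd\<close>, and \<open>central\<close> is the inclusion of U(1).\<close>

definition extension :: "('h, 'm) monoid_scheme \<Rightarrow> ('h \<times> 'h \<Rightarrow> complex) \<Rightarrow> (complex \<times> 'h) monoid" where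
  "extension H a =
     \<lparr>carrier = sphere 0 1 \<times> carrier H,
      mult = (\<lambda>(z, g) (w, h). (z * w * a (g, h), g \<otimes>\<^bsub>H\<^esub> h)),
      one = (inverse (a (\<one>\<^bsub>H\<^esub>, \<one>\<^bsub>H\<^esub>)), \<one>\<^bsub>H\<^esub>)\<rparr>"

definition central :: "('h, 'm) monoid_scheme \<Rightarrow> ('h \<times> 'h \<Rightarrow> complex) \<Rightarrow> complex \<Rightarrow> complex \<times> 'h" where
  "central H a z = (z * inverse (a (\<one>\<^bsub>H\<^esub>, \<one>\<^bsub>H\<^esub>)), \<one>\<^bsub>H\<^esub>)"

section \<open>Complex vector bundles\<close>

record ('b, 'e) vbundle =
  vtot :: "'e topology"
  vproj :: "'e \<Rightarrow> 'b"
  vadd :: "'e \<Rightarrow> 'e \<Rightarrow> 'e"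
  vscl :: "complex \<Rightarrow> 'e \<Rightarrow> 'e"

definition fibre :: "('b, 'e) vbundle \<Rightarrow> 'b \<Rightarrow> 'e set" where
  "fibre E b = {e \<in> topspace (vtot E). vproj E e = b}"

abbreviation coordinate_space :: "nat \<Rightarrow> (nat \<Rightarrow> complex) topology" where
  "coordinate_space k \<equiv> product_topology (\<lambda>_. euclidean) {..<k}"

text \<open>The rank is allowed to be only locally constant, and the vector space axioms in the fibres
  follow from local triviality.\<close>

definition vector_bundle :: "'b topology \<Rightarrow> ('b, 'e) vbundle \<Rightarrow> bool" where
  "vector_bundle B E \<longleftrightarrow>
     continuous_map (vtot E) B (vproj E) \<and>
     (\<forall>b\<in>topspace B. \<exists>V k f. openin B V \<and> b \<in> V \<and>
        homeomorphic_map (subtopology (vtot E) {e. vproj E e \<in> V})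
          (prod_topology (subtopology B V) (coordinate_space k)) f \<and>
        (\<forall>v\<in>V. \<forall>e\<in>fibre E v.
           fst (f e) = v \<and>
           (\<forall>e'\<in>fibre E v. vadd E e e' \<in> fibre E v \<and>
              snd (f (vadd E e e')) = (\<lambda>i\<in>{..<k}. snd (f e) i + snd (f e') i)) \<and>
           (\<forall>z. vscl E z e \<in> fibre E v \<and>
              snd (f (vscl E z e)) = (\<lambda>i\<in>{..<k}. z * snd (f e) i))))"

definition fibre_hom :: "('b, 'e) vbundle \<Rightarrow> 'b \<Rightarrow> ('c, 'f) vbundle \<Rightarrow> 'c \<Rightarrow> ('e \<Rightarrow> 'f) \<Rightarrow> bool" where
  "fibre_hom E b F c T \<longleftrightarrow>
     T ` fibre E b \<subseteq> fibre F c \<and>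
     (\<forall>e\<in>fibre E b. \<forall>e'\<in>fibre E b. T (vadd E e e') = vadd F (T e) (T e')) \<and>
     (\<forall>e\<in>fibre E b. \<forall>z. T (vscl E z e) = vscl F z (T e))"

definition fibre_iso :: "('b, 'e) vbundle \<Rightarrow> 'b \<Rightarrow> ('c, 'f) vbundle \<Rightarrow> 'c \<Rightarrow> ('e \<Rightarrow> 'f) \<Rightarrow> bool" where
  "fibre_iso E b F c T \<longleftrightarrow> fibre_hom E b F c T \<and> bij_betw T (fibre E b) (fibre F c)"

definition bundle_iso :: "'b topology \<Rightarrow> ('b, 'e) vbundle \<Rightarrow> ('b, 'f) vbundle \<Rightarrow> ('e \<Rightarrow> 'f) \<Rightarrow> bool" where
  "bundle_iso B E F T \<longleftrightarrow>
     homeomorphic_map (vtot E) (vtot F) T \<and> (\<forall>b\<in>topspace B. fibre_iso E b F b T)"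

text \<open>\<open>G\<close> with the two projections is (isomorphic to) the fibre product of \<open>E\<close> and \<open>F\<close>.\<close>

definition whitney_sum :: "'b topology \<Rightarrow> ('b, 'g) vbundle \<Rightarrow> ('b, 'e) vbundle \<Rightarrow> ('b, 'f) vbundle \<Rightarrow>
    ('g \<Rightarrow> 'e) \<Rightarrow> ('g \<Rightarrow> 'f) \<Rightarrow> bool" where
  "whitney_sum B G E F p q \<longleftrightarrow>
     homeomorphic_map (vtot G)
       (subtopology (prod_topology (vtot E) (vtot F)) {(e, f). vproj E e = vproj F f})
       (\<lambda>x. (p x, q x)) \<and>
     (\<forall>b\<in>topspace B. fibre_hom G b E b p \<and> fibre_hom G b F b q)"

section \<open>Grothendieck groups\<close>

text \<open>The Grothendieck group of the monoid of isomorphism classes of a set \<open>S\<close> of objects, where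
  \<open>isom\<close> says that two objects are isomorphic and \<open>issum G E F\<close> that \<open>G\<close> is a sum of \<open>E\<close> and \<open>F\<close>.\<close>

definition iso_classes :: "'o set \<Rightarrow> ('o \<Rightarrow> 'o \<Rightarrow> bool) \<Rightarrow> 'o set set" where
  "iso_classes S isom = S // {(E, F). E \<in> S \<and> F \<in> S \<and> isom E F}"

definition class_sum :: "'o set \<Rightarrow> ('o \<Rightarrow> 'o \<Rightarrow> 'o \<Rightarrow> bool) \<Rightarrow> 'o set \<Rightarrow> 'o set \<Rightarrow> 'o set" where
  "class_sum S issum x y = {G \<in> S. \<exists>E\<in>x. \<exists>F\<in>y. issum G E F}"

definition group_completion :: "'m set \<Rightarrow> ('m \<Rightarrow> 'm \<Rightarrow> 'm) \<Rightarrow> ('m \<times> 'm) set monoid" where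
  "group_completion M add =
     (let R = {((a, b), (c, d)). a \<in> M \<and> b \<in> M \<and> c \<in> M \<and> d \<in> M \<and>
                 (\<exists>k\<in>M. add (add a d) k = add (add c b) k)}
      in \<lparr>carrier = (M \<times> M) // R,
          mult = (\<lambda>P Q. R `` {(add a c, add b d) | a b c d. (a, b) \<in> P \<and> (c, d) \<in> Q}),
          one = R `` {(a, a) | a. a \<in> M}\<rparr>)"

definition grothendieck_group ::
    "'o set \<Rightarrow> ('o \<Rightarrow> 'o \<Rightarrow> bool) \<Rightarrow> ('o \<Rightarrow> 'o \<Rightarrow> 'o \<Rightarrow> bool) \<Rightarrow> ('o set \<times> 'o set) set monoid" where
  "grothendieck_group S isom issum = group_completion (iso_classes S isom) (class_sum S issum)"

section \<open>Groupoids, gerbes and twisted K-theory\<close>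

text \<open>\<open>gcomp r r'\<close> is meaningful if \<open>gtgt r = gsrc r'\<close>, and is then an arrow from \<open>gsrc r\<close>
  to \<open>gtgt r'\<close>.\<close>

record ('u, 'r) groupoid =
  gobj :: "'u topology"
  garr :: "'r topology"
  gsrc :: "'r \<Rightarrow> 'u"
  gtgt :: "'r \<Rightarrow> 'u"
  gunit :: "'u \<Rightarrow> 'r"
  ginv :: "'r \<Rightarrow> 'r"
  gcomp :: "'r \<Rightarrow> 'r \<Rightarrow> 'r"

text \<open>The data of a gerbe: a line bundle \<open>L\<close> over the arrows and products
  \<open>L\<^sub>r \<otimes> L\<^sub>r' \<longrightarrow> L\<^bsub>gcomp r r'\<^esub>\<close>.  In view of the isomorphism between \<open>i\<^sup>*L\<close> and the inverse of \<open>L\<close>,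
  the products are the same thing as a trivialization of \<open>\<pi>\<^sub>1\<^sup>*L \<otimes> \<pi>\<^sub>2\<^sup>*L \<otimes> m\<^sup>*i\<^sup>*L\<close>, and
  the cocycle condition is associativity.\<close>

record ('r, 'l) gerbe =
  line :: "('r, 'l) vbundle"
  lmult :: "'l \<Rightarrow> 'l \<Rightarrow> 'l"

text \<open>A twisted bundle: a vector bundle \<open>E\<close> over the objects with an isomorphism
  \<open>L \<otimes> s\<^sup>*E \<cong> t\<^sup>*E\<close>, given as a bilinear action of \<open>L\<close>, that is compatible with the products
  of \<open>L\<close>.  In terms of trivializations, a unit vector over the arrow \<open>r\<close> acts by \<open>\<rho> r\<close>, and
  compatibility reads \<open>\<rho> r' \<circ> \<rho> r = \<theta> (r, r') \<cdot> \<rho> (gcomp r r')\<close>.\<close>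

definition twisted_bundle :: "('u, 'r) groupoid \<Rightarrow> ('r, 'l) gerbe \<Rightarrow>
    ('u, 'e) vbundle \<times> ('l \<Rightarrow> 'e \<Rightarrow> 'e) \<Rightarrow> bool" where
  "twisted_bundle \<G> \<L> = (\<lambda>(E, act). let L = line \<L> in
     vector_bundle (gobj \<G>) E \<and>
     continuous_map
       (subtopology (prod_topology (vtot L) (vtot E)) {(l, e). gsrc \<G> (vproj L l) = vproj E e})
       (vtot E) (\<lambda>(l, e). act l e) \<and>
     (\<forall>l\<in>topspace (vtot L). fibre_hom E (gsrc \<G> (vproj L l)) E (gtgt \<G> (vproj L l)) (act l)) \<and>
     (\<forall>l\<in>topspace (vtot L). l \<noteq> vscl L 0 l \<longrightarrow>
        fibre_iso E (gsrc \<G> (vproj L l)) E (gtgt \<G> (vproj L l)) (act l)) \<and>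
     (\<forall>r\<in>topspace (garr \<G>). \<forall>l\<in>fibre L r. \<forall>e\<in>fibre E (gsrc \<G> r).
        (\<forall>l'\<in>fibre L r. act (vadd L l l') e = vadd E (act l e) (act l' e)) \<and>
        (\<forall>z. act (vscl L z l) e = vscl E z (act l e))) \<and>
     (\<forall>r\<in>topspace (garr \<G>). \<forall>r'\<in>topspace (garr \<G>). gtgt \<G> r = gsrc \<G> r' \<longrightarrow>
        (\<forall>l\<in>fibre L r. \<forall>l'\<in>fibre L r'. \<forall>e\<in>fibre E (gsrc \<G> r).
           act l' (act l e) = act (lmult \<L> l l') e)))"

definition twisted_iso :: "('u, 'r) groupoid \<Rightarrow> ('r, 'l) gerbe \<Rightarrow>
    ('u, 'e) vbundle \<times> ('l \<Rightarrow> 'e \<Rightarrow> 'e) \<Rightarrow> ('u, 'e) vbundle \<times> ('l \<Rightarrow> 'e \<Rightarrow> 'e) \<Rightarrow> bool" where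
  "twisted_iso \<G> \<L> = (\<lambda>(E, act) (E', act'). \<exists>T. bundle_iso (gobj \<G>) E E' T \<and>
     (\<forall>l\<in>topspace (vtot (line \<L>)). \<forall>e\<in>fibre E (gsrc \<G> (vproj (line \<L>) l)).
        T (act l e) = act' l (T e)))"

definition twisted_sum :: "('u, 'r) groupoid \<Rightarrow> ('r, 'l) gerbe \<Rightarrow>
    ('u, 'e) vbundle \<times> ('l \<Rightarrow> 'e \<Rightarrow> 'e) \<Rightarrow> ('u, 'e) vbundle \<times> ('l \<Rightarrow> 'e \<Rightarrow> 'e) \<Rightarrow>
    ('u, 'e) vbundle \<times> ('l \<Rightarrow> 'e \<Rightarrow> 'e) \<Rightarrow> bool" where
  "twisted_sum \<G> \<L> = (\<lambda>(G, actG) (E, actE) (F, actF). \<exists>p q.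
     whitney_sum (gobj \<G>) G E F p q \<and>
     (\<forall>l\<in>topspace (vtot (line \<L>)). \<forall>x\<in>fibre G (gsrc \<G> (vproj (line \<L>) l)).
        p (actG l x) = actE l (p x) \<and> q (actG l x) = actF l (q x)))"

text \<open>The total spaces are taken in the type \<open>'u \<times> (nat \<Rightarrow> complex)\<close>, which is large enough to
  represent every isomorphism class of vector bundles over a space with points in \<open>'u\<close>.\<close>

definition K_gpd where
  "K_gpd (\<G> :: ('u, 'r) groupoid) (\<L> :: ('r, 'l) gerbe) =
     grothendieck_group
       {E :: ('u, 'u \<times> (nat \<Rightarrow> complex)) vbundle \<times>
            ('l \<Rightarrow> 'u \<times> (nat \<Rightarrow> complex) \<Rightarrow> 'u \<times> (nat \<Rightarrow> complex)). twisted_bundle \<G> \<L> E}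
       (twisted_iso \<G> \<L>) (twisted_sum \<G> \<L>)"

section \<open>The frame bundle and the groupoid representing the orbifold\<close>

text \<open>A Riemannian metric is a family of metrics on the chart domains.\<close>

type_synonym ('n, 'x) metric = "('n, 'x) chart \<Rightarrow> real^'n \<Rightarrow> real^'n \<Rightarrow> real^'n \<Rightarrow> real"

definition isometric :: "('n::finite, 'x) orbifold \<Rightarrow> ('n, 'x) metric \<Rightarrow> ('x \<Rightarrow> 'x) \<Rightarrow> bool" where
  "isometric Y \<mu> h \<longleftrightarrow>
     (\<forall>c\<in>charts Y. \<forall>d\<in>charts Y. \<forall>W l. local_lift h c d W l \<longrightarrow>
        (\<forall>u\<in>W. \<forall>v w. \<mu> d (l u) (frechet_derivative l (at u) v) (frechet_derivative l (at u) w)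
                      = \<mu> c u v w))"

definition riemannian_metric :: "('n::finite, 'x) orbifold \<Rightarrow> ('n, 'x) metric \<Rightarrow> bool" where
  "riemannian_metric Y \<mu> \<longleftrightarrow>
     (\<forall>c\<in>charts Y. (\<forall>u\<in>cdom c. bilinear (\<mu> c u) \<and> (\<forall>v w. \<mu> c u v w = \<mu> c u w v) \<and>
                                  (\<forall>v. v \<noteq> 0 \<longrightarrow> \<mu> c u v v > 0)) \<and>
                   (\<forall>v w. smooth_on (cdom c) (\<lambda>u. \<mu> c u v w))) \<and>
     isometric Y \<mu> (\<lambda>y. y)"

text \<open>An orthonormal frame of the tangent space at \<open>u\<close> is a matrix \<open>A\<close> whose columns are the
  frame vectors.  A frame at a point of \<open>Y\<close> is a class of triples (chart, \<open>u\<close>, \<open>A\<close>) modulo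
  changes of charts; \<open>frame_push h\<close> is the action of an automorphism \<open>h\<close> of \<open>Y\<close> on such classes.\<close>

type_synonym ('n, 'x) frame = "(('n, 'x) chart \<times> (real^'n) \<times> (real^'n^'n)) set"

definition chart_frames :: "('n::finite, 'x) metric \<Rightarrow> ('n, 'x) chart \<Rightarrow> ((real^'n) \<times> (real^'n^'n)) set" where
  "chart_frames \<mu> c = {(u, A). u \<in> cdom c \<and> (\<forall>v w. \<mu> c u (A *v v) (A *v w) = v \<bullet> w)}"

definition frame_push :: "('n::finite, 'x) orbifold \<Rightarrow> ('x \<Rightarrow> 'x) \<Rightarrow> ('n, 'x) frame \<Rightarrow> ('n, 'x) frame" where
  "frame_push Y h \<xi> =
     {(d, l u, matrix (frechet_derivative l (at u)) ** A) | c d W l u A.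
        (c, u, A) \<in> \<xi> \<and> c \<in> charts Y \<and> d \<in> charts Y \<and> local_lift h c d W l \<and> u \<in> W}"

definition frame_class :: "('n::finite, 'x) orbifold \<Rightarrow> ('n, 'x) chart \<Rightarrow>
    (real^'n) \<times> (real^'n^'n) \<Rightarrow> ('n, 'x) frame" where
  "frame_class Y c = (\<lambda>(u, A). frame_push Y (\<lambda>y. y) {(c, u, A)})"

definition frame_bundle :: "('n::finite, 'x) orbifold \<Rightarrow> ('n, 'x) metric \<Rightarrow> ('n, 'x) frame topology" where
  "frame_bundle Y \<mu> =
     final_topology (\<Union>c\<in>charts Y. frame_class Y c ` chart_frames \<mu> c)
       (charts Y) (\<lambda>c. top_of_set (chart_frames \<mu> c)) (frame_class Y)"

definition frame_rotate :: "real^'n^'n \<Rightarrow> ('n::finite, 'x) frame \<Rightarrow> ('n, 'x) frame" where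
  "frame_rotate Q \<xi> = (\<lambda>(c, u, A). (c, u, A ** transpose Q)) ` \<xi>"

text \<open>The action groupoid of the orthogonal group on the frame bundle.\<close>

definition frame_groupoid :: "('n::finite, 'x) orbifold \<Rightarrow> ('n, 'x) metric \<Rightarrow>
    (('n, 'x) frame, ('n, 'x) frame \<times> (real^'n^'n)) groupoid" where
  "frame_groupoid Y \<mu> =
     \<lparr>gobj = frame_bundle Y \<mu>,
      garr = prod_topology (frame_bundle Y \<mu>) (top_of_set {Q. orthogonal_matrix Q}),
      gsrc = fst,
      gtgt = (\<lambda>(\<xi>, Q). frame_rotate Q \<xi>),
      gunit = (\<lambda>\<xi>. (\<xi>, mat 1)),
      ginv = (\<lambda>(\<xi>, Q). (frame_rotate Q \<xi>, transpose Q)),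
      gcomp = (\<lambda>(\<xi>, Q) (\<xi>', Q'). (\<xi>, Q' ** Q))\<rparr>"

text \<open>The groupoid with arrows \<open>\<R> \<times> H\<close>, for a (discrete) group \<open>H\<close> of automorphisms of a
  groupoid, acting on objects by \<open>on_obj\<close> and on arrows by \<open>on_arr\<close>.\<close>

definition groupoid_times_group :: "('u, 'r) groupoid \<Rightarrow> ('h, 'm) monoid_scheme \<Rightarrow>
    ('h \<Rightarrow> 'u \<Rightarrow> 'u) \<Rightarrow> ('h \<Rightarrow> 'r \<Rightarrow> 'r) \<Rightarrow> ('u, 'r \<times> 'h) groupoid" where
  "groupoid_times_group \<G> H on_obj on_arr =
     \<lparr>gobj = gobj \<G>,
      garr = prod_topology (garr \<G>) (discrete_topology (carrier H)),
      gsrc = (\<lambda>(r, h). gsrc \<G> r),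
      gtgt = (\<lambda>(r, h). on_obj h (gtgt \<G> r)),
      gunit = (\<lambda>x. (gunit \<G> x, \<one>\<^bsub>H\<^esub>)),
      ginv = (\<lambda>(r, h). (on_arr h (ginv \<G> r), inv\<^bsub>H\<^esub> h)),
      gcomp = (\<lambda>(r, h) (r', h'). (gcomp \<G> r (on_arr (inv\<^bsub>H\<^esub> h) r'), h' \<otimes>\<^bsub>H\<^esub> h))\<rparr>"

text \<open>The gerbe of a central extension of \<open>H\<close>: the line bundle associated with the circle bundle
  from \<open>\<R> \<times> extension H a\<close> to \<open>\<R> \<times> H\<close>.  Its points are classes of triples (arrow, element of the
  extension, complex number) modulo U(1), and products are induced by those of \<open>\<R>\<close>, of the
  extension and of the complex numbers.\<close>

definition line_class :: "('h, 'm) monoid_scheme \<Rightarrow> ('h \<times> 'h \<Rightarrow> complex) \<Rightarrow>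
    'r \<times> (complex \<times> 'h) \<times> complex \<Rightarrow> ('r \<times> (complex \<times> 'h) \<times> complex) set" where
  "line_class H a = (\<lambda>(r, x, w). {(r, central H a z \<otimes>\<^bsub>extension H a\<^esub> x, w / z) | z. z \<in> sphere 0 1})"

definition extension_gerbe :: "('u, 'r) groupoid \<Rightarrow> ('h, 'm) monoid_scheme \<Rightarrow> ('h \<Rightarrow> 'r \<Rightarrow> 'r) \<Rightarrow>
    ('h \<times> 'h \<Rightarrow> complex) \<Rightarrow> ('r \<times> 'h, ('r \<times> (complex \<times> 'h) \<times> complex) set) gerbe" where
  "extension_gerbe \<G> H on_arr a =
     (let T = prod_topology (garr \<G>) (prod_topology
                (prod_topology (top_of_set (sphere 0 1)) (discrete_topology (carrier H))) euclidean)
      in \<lparr>line =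
            \<lparr>vtot = final_topology (line_class H a ` topspace T) {()} (\<lambda>_. T) (\<lambda>_. line_class H a),
             vproj = (\<lambda>l. the_elem ((\<lambda>(r, x, w). (r, snd x)) ` l)),
             vadd = (\<lambda>l l'. {(r, x, w + w') | r x w w'. (r, x, w) \<in> l \<and> (r, x, w') \<in> l'}),
             vscl = (\<lambda>z l. {(r, x, z * w) | r x w. (r, x, w) \<in> l})\<rparr>,
          lmult = (\<lambda>l l'. {(gcomp \<G> r (on_arr (inv\<^bsub>H\<^esub> (snd x)) r'), x' \<otimes>\<^bsub>extension H a\<^esub> x, w * w') |
                              r x w r' x' w'. (r, x, w) \<in> l \<and> (r', x', w') \<in> l'})\<rparr>)"

section \<open>Orbibundles and Adem--Ruan twisted K-theory\<close>

text \<open>A family of maps between total spaces of bundles over chart domains, one for each local lift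
  (source chart, domain \<open>W\<close>, map, target chart) of a given automorphism of the orbifold.\<close>

type_synonym ('n, 'x, 'e) lift_family =
  "('n, 'x) chart \<Rightarrow> (real^'n) set \<Rightarrow> (real^'n \<Rightarrow> real^'n) \<Rightarrow> ('n, 'x) chart \<Rightarrow> 'e \<Rightarrow> 'e"

definition covers_automorphism :: "('n::finite, 'x) orbifold \<Rightarrow> ('x \<Rightarrow> 'x) \<Rightarrow>
    (('n, 'x) chart \<Rightarrow> (real^'n, 'e) vbundle) \<Rightarrow> ('n, 'x, 'e) lift_family \<Rightarrow> bool" where
  "covers_automorphism Y h E T \<longleftrightarrow>
     (\<forall>c\<in>charts Y. \<forall>d\<in>charts Y. \<forall>W l. local_lift h c d W l \<longrightarrow>
        continuous_map (subtopology (vtot (E c)) {e. vproj (E c) e \<in> W}) (vtot (E d)) (T c W l d) \<and>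
        (\<forall>u\<in>W. fibre_iso (E c) u (E d) (l u) (T c W l d)))"

text \<open>\<open>R\<close> (over \<open>k \<circ> h\<close>) is the composite of \<open>S\<close> (over \<open>k\<close>) after \<open>T\<close> (over \<open>h\<close>).\<close>

definition composite_family :: "('n::finite, 'x) orbifold \<Rightarrow> (('n, 'x) chart \<Rightarrow> (real^'n, 'e) vbundle) \<Rightarrow>
    ('x \<Rightarrow> 'x) \<Rightarrow> ('n, 'x, 'e) lift_family \<Rightarrow> ('x \<Rightarrow> 'x) \<Rightarrow> ('n, 'x, 'e) lift_family \<Rightarrow>
    ('n, 'x, 'e) lift_family \<Rightarrow> bool" where
  "composite_family Y E k S h T R \<longleftrightarrow>
     (\<forall>b\<in>charts Y. \<forall>c\<in>charts Y. \<forall>d\<in>charts Y. \<forall>W l V m.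
        local_lift h b c W l \<and> local_lift k c d V m \<and> l ` W \<subseteq> V \<longrightarrow>
        (\<forall>u\<in>W. \<forall>e\<in>fibre (E b) u. S c V m d (T b W l c e) = R b W (compose W m l) d e))"

text \<open>An orbibundle: a vector bundle over each chart domain and a functorial action of the changes
  of charts.  (Applied to inclusions, the composition law includes compatibility with shrinking
  the domain of a change of charts.)\<close>

record ('n, 'x, 'e) orbibundle =
  obun :: "('n, 'x) chart \<Rightarrow> (real^'n, 'e) vbundle"
  otrans :: "('n, 'x, 'e) lift_family"

definition complex_orbibundle :: "('n::finite, 'x) orbifold \<Rightarrow> ('n, 'x, 'e) orbibundle \<Rightarrow> bool" where
  "complex_orbibundle Y E \<longleftrightarrow>
     (\<forall>c\<in>charts Y. vector_bundle (top_of_set (cdom c)) (obun E c)) \<and>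
     covers_automorphism Y (\<lambda>y. y) (obun E) (otrans E) \<and>
     composite_family Y (obun E) (\<lambda>y. y) (otrans E) (\<lambda>y. y) (otrans E) (otrans E)"

text \<open>A map of orbibundles covering an automorphism \<open>h\<close> of \<open>Y\<close>, an isomorphism on fibres.\<close>

definition orbibundle_automorphism :: "('n::finite, 'x) orbifold \<Rightarrow> ('n, 'x, 'e) orbibundle \<Rightarrow>
    ('x \<Rightarrow> 'x) \<Rightarrow> ('n, 'x, 'e) lift_family \<Rightarrow> bool" where
  "orbibundle_automorphism Y E h T \<longleftrightarrow>
     covers_automorphism Y h (obun E) T \<and>
     composite_family Y (obun E) h T (\<lambda>y. y) (otrans E) T \<and>
     composite_family Y (obun E) (\<lambda>y. y) (otrans E) h T T"

text \<open>Here \<open>H\<close> is a group of automorphisms of \<open>Y\<close>, and \<open>A\<close> the lift of its action to an action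
  of the central extension on \<open>E\<close>.\<close>

definition twisted_orbibundle :: "('n::finite, 'x) orbifold \<Rightarrow> ('x \<Rightarrow> 'x, 'm) monoid_scheme \<Rightarrow>
    (('x \<Rightarrow> 'x) \<times> ('x \<Rightarrow> 'x) \<Rightarrow> complex) \<Rightarrow>
    ('n, 'x, 'e) orbibundle \<times> (complex \<times> ('x \<Rightarrow> 'x) \<Rightarrow> ('n, 'x, 'e) lift_family) \<Rightarrow> bool" where
  "twisted_orbibundle Y H a = (\<lambda>(E, A).
     complex_orbibundle Y E \<and>
     (\<forall>x\<in>carrier (extension H a). orbibundle_automorphism Y E (snd x) (A x)) \<and>
     (\<forall>x\<in>carrier (extension H a). \<forall>y\<in>carrier (extension H a).
        composite_family Y (obun E) (snd x) (A x) (snd y) (A y) (A (x \<otimes>\<^bsub>extension H a\<^esub> y))) \<and>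
     (\<forall>z\<in>sphere 0 1. \<forall>c\<in>charts Y. \<forall>d\<in>charts Y. \<forall>W l. local_lift (\<lambda>y. y) c d W l \<longrightarrow>
        (\<forall>u\<in>W. \<forall>e\<in>fibre (obun E c) u.
           A (central H a z) c W l d e = vscl (obun E d) z (otrans E c W l d e))))"

text \<open>Fibrewise maps \<open>T c\<close> over the chart domains commute with the changes of charts and with the
  action.\<close>

definition equivariant :: "('n::finite, 'x) orbifold \<Rightarrow> ('x \<Rightarrow> 'x, 'm) monoid_scheme \<Rightarrow>
    (('x \<Rightarrow> 'x) \<times> ('x \<Rightarrow> 'x) \<Rightarrow> complex) \<Rightarrow>
    ('n, 'x, 'e) orbibundle \<times> (complex \<times> ('x \<Rightarrow> 'x) \<Rightarrow> ('n, 'x, 'e) lift_family) \<Rightarrow>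
    ('n, 'x, 'e) orbibundle \<times> (complex \<times> ('x \<Rightarrow> 'x) \<Rightarrow> ('n, 'x, 'e) lift_family) \<Rightarrow>
    (('n, 'x) chart \<Rightarrow> 'e \<Rightarrow> 'e) \<Rightarrow> bool" where
  "equivariant Y H a = (\<lambda>(E, A) (F, B) T.
     (\<forall>c\<in>charts Y. \<forall>d\<in>charts Y. \<forall>W l. local_lift (\<lambda>y. y) c d W l \<longrightarrow>
        (\<forall>u\<in>W. \<forall>e\<in>fibre (obun E c) u. T d (otrans E c W l d e) = otrans F c W l d (T c e))) \<and>
     (\<forall>x\<in>carrier (extension H a).
        \<forall>c\<in>charts Y. \<forall>d\<in>charts Y. \<forall>W l. local_lift (snd x) c d W l \<longrightarrow>
        (\<forall>u\<in>W. \<forall>e\<in>fibre (obun E c) u. T d (A x c W l d e) = B x c W l d (T c e))))"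

definition orbi_iso where
  "orbi_iso Y H a \<E> \<F> \<longleftrightarrow>
     (\<exists>T. (\<forall>c\<in>charts Y. bundle_iso (top_of_set (cdom c)) (obun (fst \<E>) c) (obun (fst \<F>) c) (T c)) \<and>
          equivariant Y H a \<E> \<F> T)"

definition orbi_sum where
  "orbi_sum Y H a \<D> \<E> \<F> \<longleftrightarrow>
     (\<exists>p q. (\<forall>c\<in>charts Y. whitney_sum (top_of_set (cdom c))
               (obun (fst \<D>) c) (obun (fst \<E>) c) (obun (fst \<F>) c) (p c) (q c)) \<and>
            equivariant Y H a \<D> \<E> p \<and> equivariant Y H a \<D> \<F> q)"

definition K_AR where
  "K_AR (Y :: ('n::finite, 'x) orbifold) H a =
     grothendieck_group
       {\<E> :: ('n, 'x, (real^'n) \<times> (nat \<Rightarrow> complex)) orbibundle \<times>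
            (complex \<times> ('x \<Rightarrow> 'x) \<Rightarrow> ('n, 'x, (real^'n) \<times> (nat \<Rightarrow> complex)) lift_family).
          twisted_orbibundle Y H a \<E>}
       (orbi_iso Y H a) (orbi_sum Y H a)"

section \<open>The groupoid and the gerbe in question\<close>

definition orbifold_groupoid where
  "orbifold_groupoid Y \<mu> H =
     groupoid_times_group (frame_groupoid Y \<mu>) H (frame_push Y) (\<lambda>h. apfst (frame_push Y h))"

definition discrete_torsion_gerbe where
  "discrete_torsion_gerbe Y \<mu> H a =
     extension_gerbe (frame_groupoid Y \<mu>) H (\<lambda>h. apfst (frame_push Y h)) a"

end

theory Submission
  imports Defs
begin

text \<open>Both sides are Grothendieck groups of monoids of isomorphism classes.  So it suffices to exhibit a
  correspondence between twisted bundles over the groupoid and twisted orbibundles that reaches every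
  object on both sides and respects isomorphisms and sums (\<open>grothendieck_group_iso\<close>).

  An arrow of the groupoid consists of a frame, an orthogonal matrix and an element \<open>h\<close> of \<open>H\<close>, and
  the unit vectors of the gerbe over it are the elements of the central extension over \<open>h\<close>.  So a
  twisted bundle is a vector bundle \<open>E\<close> over the frame bundle on which the orthogonal group and the
  extension act compatibly, the central circle acting by scalars (\<open>frame_action\<close>).  A twisted
  orbibundle is a family of vector bundles over the chart domains on which an element \<open>x\<close> of the
  extension acts along every local lift of its image in \<open>H\<close>; the changes of charts are the action of
  the unit.

  The two notions are related by descent.  The orthonormal frames over the domain of a chart \<open>c\<close> form
  a space \<open>FC c\<close> that lies over both bases: it is a principal bundle over the chart domain, and it
  maps to the frame bundle.  The objects correspond to each other if their pullbacks to all \<open>FC c\<close> are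
  identified, compatibly with all actions (\<open>comparison\<close>).  Given such identifications, maps on one
  side determine maps on the other side (\<open>down\<close>, \<open>up\<close>), and whether these are continuous,
  homeomorphic, linear or equivariant can be tested over the \<open>FC c\<close>
  (\<open>related_homeomorphic\<close>, \<open>morphism_transfer\<close>).

  From \<open>E\<close> one obtains an orbibundle by pulling back along a section of orthonormal frames, which
  exists by the Gram--Schmidt process; the orthogonal matrices by which local lifts rotate these
  sections define the action (\<open>twisted_bundle_has_orbibundle\<close>).  From an orbibundle one obtains \<open>E\<close> by
  gluing the pullbacks to the \<open>FC c\<close> (\<open>orbibundle_has_twisted_bundle\<close>).  This uses that the orbifold
  is effective: a local lift of an automorphism is determined near a point by its 1-jet there
  (\<open>local_lift_jet\<close>), because the finite chart groups can be linearized.  Therefore the action on an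
  orbibundle passes to frames (\<open>action_by_jet\<close>), and \<open>FC c\<close> maps to the frame bundle by a local
  homeomorphism (\<open>open_frame_class\<close>, \<open>frame_class_locally_injective\<close>), so that the glued space is
  locally a pullback of the orbibundle and hence a vector bundle.\<close>

section \<open>Comparing Grothendieck groups\<close>

text \<open>Addition is controlled on a set \<open>D\<close> that may be larger than \<open>M\<close>: in the application two
  isomorphism classes without a sum add up to the empty set, which lies in \<open>D\<close> without being an
  isomorphism class.\<close>

lemma group_completion_iso:
  assumes inj: "inj_on \<Phi> D" and sub: "M \<subseteq> D" and M': "M' = \<Phi> ` M"
    and add: "\<And>x y. x \<in> D \<Longrightarrow> y \<in> D \<Longrightarrow> add x y \<in> D \<and> \<Phi> (add x y) = add' (\<Phi> x) (\<Phi> y)"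
  shows "group_completion M add \<cong> group_completion M' add'"
proof -
  define R where "R = {((a, b), (c, d)). a \<in> M \<and> b \<in> M \<and> c \<in> M \<and> d \<in> M \<and>
                 (\<exists>k\<in>M. add (add a d) k = add (add c b) k)}"
  define R' where "R' = {((a, b), (c, d)). a \<in> M' \<and> b \<in> M' \<and> c \<in> M' \<and> d \<in> M' \<and>
                 (\<exists>k\<in>M'. add' (add' a d) k = add' (add' c b) k)}"
  define \<phi> where "\<phi> = map_prod \<Phi> \<Phi>"
  have G: "group_completion M add = \<lparr>carrier = (M \<times> M) // R,
          mult = (\<lambda>P Q. R `` {(add a c, add b d) | a b c d. (a, b) \<in> P \<and> (c, d) \<in> Q}),
          one = R `` {(a, a) | a. a \<in> M}\<rparr>"
    unfolding group_completion_def R_def Let_def ..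
  have G': "group_completion M' add' = \<lparr>carrier = (M' \<times> M') // R',
          mult = (\<lambda>P Q. R' `` {(add' a c, add' b d) | a b c d. (a, b) \<in> P \<and> (c, d) \<in> Q}),
          one = R' `` {(a, a) | a. a \<in> M'}\<rparr>"
    unfolding group_completion_def R'_def Let_def ..
  have inM: "x \<in> M" if "x \<in> D" "\<Phi> x \<in> M'" for x
    using that inj sub unfolding M' by (auto simp: inj_on_def)
  have eqv: "add (add a d) k = add (add c b) k \<longleftrightarrow>
      add' (add' (\<Phi> a) (\<Phi> d)) (\<Phi> k) = add' (add' (\<Phi> c) (\<Phi> b)) (\<Phi> k)"
    if "a \<in> D" "b \<in> D" "c \<in> D" "d \<in> D" "k \<in> D" for a b c d k
  proof -
    have "add' (add' (\<Phi> a) (\<Phi> d)) (\<Phi> k) = \<Phi> (add (add a d) k)"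
      "add' (add' (\<Phi> c) (\<Phi> b)) (\<Phi> k) = \<Phi> (add (add c b) k)"
      using that add by presburger+
    moreover have "add (add a d) k \<in> D" "add (add c b) k \<in> D" using that add by blast+
    ultimately show ?thesis using inj by (auto simp: inj_on_def)
  qed
  have RR: "R' `` (\<phi> ` A) = \<phi> ` (R `` A)" if A: "A \<subseteq> D \<times> D" for A
  proof (intro equalityI subsetI)
    fix q assume "q \<in> R' `` (\<phi> ` A)"
    then obtain p where p: "p \<in> A" and r: "(\<phi> p, q) \<in> R'" by blast
    obtain a b where ab: "p = (a, b)" by fastforce
    obtain c d where cd: "c \<in> M" "d \<in> M" "q = (\<Phi> c, \<Phi> d)"
      using r unfolding R'_def M' \<phi>_def ab by auto
    have "a \<in> D" "b \<in> D" using p A ab by auto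
    then have m: "a \<in> M" "b \<in> M" using r inM unfolding R'_def \<phi>_def ab by auto
    obtain k where k: "k \<in> M" "add' (add' (\<Phi> a) (\<Phi> d)) (\<Phi> k) = add' (add' (\<Phi> c) (\<Phi> b)) (\<Phi> k)"
      using r unfolding R'_def \<phi>_def ab cd M' by auto
    then have "add (add a d) k = add (add c b) k" using eqv m cd sub by blast
    then have "(p, (c, d)) \<in> R" unfolding R_def ab using m cd k by blast
    then show "q \<in> \<phi> ` (R `` A)" unfolding \<phi>_def cd using p by force
  next
    fix q assume "q \<in> \<phi> ` (R `` A)"
    then obtain a b c d where p: "(a, b) \<in> A" "((a, b), (c, d)) \<in> R" "q = (\<Phi> c, \<Phi> d)"
      unfolding \<phi>_def by auto
    then obtain k where k: "a \<in> M" "b \<in> M" "c \<in> M" "d \<in> M" "k \<in> M"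
       "add (add a d) k = add (add c b) k" unfolding R_def by auto
    then have "add' (add' (\<Phi> a) (\<Phi> d)) (\<Phi> k) = add' (add' (\<Phi> c) (\<Phi> b)) (\<Phi> k)"
      using eqv sub by blast
    then have "((\<Phi> a, \<Phi> b), (\<Phi> c, \<Phi> d)) \<in> R'" unfolding R'_def M' using k by blast
    then show "q \<in> R' `` (\<phi> ` A)" unfolding \<phi>_def p(3) using p(1) by force
  qed
  have MM: "M' \<times> M' = \<phi> ` (M \<times> M)" unfolding \<phi>_def M' by (rule map_prod_surj_on[symmetric]) auto
  have cl: "R' `` {\<phi> p} = \<phi> ` (R `` {p})" if "p \<in> M \<times> M" for p
  proof -
    have "{p} \<subseteq> D \<times> D" using that sub by auto
    from RR[OF this] show ?thesis by (simp only: image_insert image_empty)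
  qed
  have RM: "R `` A \<subseteq> M \<times> M" for A unfolding R_def by auto
  have carr: "(M' \<times> M') // R' = (\<lambda>P. \<phi> ` P) ` ((M \<times> M) // R)"
    unfolding quotient_def MM using cl by (auto simp: image_iff)
  have sub2: "P \<subseteq> M \<times> M" if "P \<in> (M \<times> M) // R" for P
    using that RM unfolding quotient_def by auto
  have "inj_on \<phi> (M \<times> M)" unfolding \<phi>_def using inj sub
    by (intro map_prod_inj_on) (auto simp: inj_on_def)
  then have inj2: "inj_on (\<lambda>P. \<phi> ` P) ((M \<times> M) // R)"
    using sub2 by (intro inj_onI) (metis inj_on_image_eq_iff)
  have hom: "\<phi> ` (R `` {(add a c, add b d) | a b c d. (a, b) \<in> P \<and> (c, d) \<in> Q}) =
     R' `` {(add' a c, add' b d) | a b c d. (a, b) \<in> \<phi> ` P \<and> (c, d) \<in> \<phi> ` Q}"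
    if P: "P \<subseteq> M \<times> M" and Q: "Q \<subseteq> M \<times> M" for P Q
  proof -
    let ?A = "{(add a c, add b d) | a b c d. (a, b) \<in> P \<and> (c, d) \<in> Q}"
    have D: "a \<in> D" "b \<in> D" if "(a, b) \<in> P \<or> (a, b) \<in> Q" for a b using that P Q sub by blast+
    have AD: "?A \<subseteq> D \<times> D" using D add by blast
    have A: "{(add' a c, add' b d) | a b c d. (a, b) \<in> \<phi> ` P \<and> (c, d) \<in> \<phi> ` Q} = \<phi> ` ?A"
    proof (intro equalityI subsetI)
      fix x assume "x \<in> {(add' a c, add' b d) | a b c d. (a, b) \<in> \<phi> ` P \<and> (c, d) \<in> \<phi> ` Q}"
      then obtain a b c d where x: "(a, b) \<in> P" "(c, d) \<in> Q"
          "x = (add' (\<Phi> a) (\<Phi> c), add' (\<Phi> b) (\<Phi> d))"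
        unfolding \<phi>_def by auto
      then have "x = \<phi> (add a c, add b d)" unfolding \<phi>_def using add D by (metis map_prod_simp)
      then show "x \<in> \<phi> ` ?A" using x by blast
    next
      fix x assume "x \<in> \<phi> ` ?A"
      then obtain a b c d where x: "(a, b) \<in> P" "(c, d) \<in> Q" "x = \<phi> (add a c, add b d)" by blast
      then have "x = (add' (\<Phi> a) (\<Phi> c), add' (\<Phi> b) (\<Phi> d))" unfolding \<phi>_def using add D by (metis map_prod_simp)
      moreover have "(\<Phi> a, \<Phi> b) \<in> \<phi> ` P" "(\<Phi> c, \<Phi> d) \<in> \<phi> ` Q" using x unfolding \<phi>_def by force+
      ultimately show "x \<in> {(add' a c, add' b d) | a b c d. (a, b) \<in> \<phi> ` P \<and> (c, d) \<in> \<phi> ` Q}" by blast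
    qed
    show ?thesis unfolding A by (rule RR[OF AD, symmetric])
  qed
  have "(\<lambda>P. \<phi> ` P) \<in> hom (group_completion M add) (group_completion M' add')"
  proof (rule homI)
    fix P assume "P \<in> carrier (group_completion M add)"
    then show "\<phi> ` P \<in> carrier (group_completion M' add')" unfolding G G' carr by simp
  next
    fix P Q assume "P \<in> carrier (group_completion M add)" "Q \<in> carrier (group_completion M add)"
    then have "P \<subseteq> M \<times> M" "Q \<subseteq> M \<times> M" using sub2 unfolding G by simp_all
    from hom[OF this] show "\<phi> ` (P \<otimes>\<^bsub>group_completion M add\<^esub> Q) =
        \<phi> ` P \<otimes>\<^bsub>group_completion M' add'\<^esub> \<phi> ` Q"
      unfolding G G' by simp
  qed
  moreover have "bij_betw (\<lambda>P. \<phi> ` P) (carrier (group_completion M add)) (carrier (group_completion M' add'))"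
    unfolding G G' bij_betw_def using carr inj2 by simp
  ultimately have "(\<lambda>P. \<phi> ` P) \<in> iso (group_completion M add) (group_completion M' add')"
    by (simp add: iso_def)
  then show ?thesis unfolding is_iso_def by blast
qed

text \<open>The correspondence \<open>C\<close> induces a bijection between unions of isomorphism classes on the two sides,
  which respects addition.  Unions are used so that no representative for a sum has to be produced.\<close>

lemma grothendieck_group_iso:
  assumes equiv: "equiv S {(E, F). E \<in> S \<and> F \<in> S \<and> isom E F}"
    and left: "\<And>E. E \<in> S \<Longrightarrow> \<exists>E'\<in>S'. C E E'"
    and right: "\<And>E'. E' \<in> S' \<Longrightarrow> \<exists>E\<in>S. C E E'"
    and isom: "\<And>E F E' F'. E \<in> S \<Longrightarrow> F \<in> S \<Longrightarrow> E' \<in> S' \<Longrightarrow> F' \<in> S' \<Longrightarrow> C E E' \<Longrightarrow> C F F' \<Longrightarrow>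
        isom E F \<longleftrightarrow> isom' E' F'"
    and issum: "\<And>G E F G' E' F'. G \<in> S \<Longrightarrow> E \<in> S \<Longrightarrow> F \<in> S \<Longrightarrow> G' \<in> S' \<Longrightarrow> E' \<in> S' \<Longrightarrow> F' \<in> S' \<Longrightarrow>
        C G G' \<Longrightarrow> C E E' \<Longrightarrow> C F F' \<Longrightarrow> issum G E F \<longleftrightarrow> issum' G' E' F'"
    and invar: "\<And>G G2 E F. G \<in> S \<Longrightarrow> G2 \<in> S \<Longrightarrow> E \<in> S \<Longrightarrow> F \<in> S \<Longrightarrow> issum G E F \<Longrightarrow> isom G G2 \<Longrightarrow>
        issum G2 E F"
  shows "grothendieck_group S isom issum \<cong> grothendieck_group S' isom' issum'"
proof -
  \<comment> \<open>\<open>D\<close> consists of the unions of isomorphism classes.  All sums of two classes form such a union,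
    which may a priori be empty or contain several classes.\<close>
  define D where "D = {A. A \<subseteq> S \<and> (\<forall>E\<in>A. \<forall>F\<in>S. isom E F \<longrightarrow> F \<in> A)}"
  define \<Phi> where "\<Phi> A = {E'\<in>S'. \<exists>E\<in>A. C E E'}" for A
  have refl: "isom E E" if "E \<in> S" for E
    using equiv that by (auto simp: equiv_def refl_on_def)
  have trans: "isom E G" if "E \<in> S" "F \<in> S" "G \<in> S" "isom E F" "isom F G" for E F G
    using equiv that unfolding equiv_def trans_def by blast
  have inD: "F \<in> A" if "A \<in> D" "E \<in> A" "F \<in> S" "isom E F" for A E F
    using that unfolding D_def by blast
  have DS: "A \<subseteq> S" if "A \<in> D" for A using that unfolding D_def by blast
  have joint: "isom E F" if "E \<in> S" "F \<in> S" "E' \<in> S'" "C E E'" "C F E'" for E F E'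
    using that isom refl by metis
  have inj: "inj_on \<Phi> D"
  proof (rule inj_on_inverseI[where g = "\<lambda>B. {E\<in>S. \<exists>E'\<in>B. C E E'}"])
    fix A assume A: "A \<in> D"
    show "{E\<in>S. \<exists>E'\<in>\<Phi> A. C E E'} = A"
      unfolding \<Phi>_def using left joint inD[OF A] DS[OF A] by blast
  qed
  have M: "iso_classes S isom = (\<lambda>E. {F\<in>S. isom E F}) ` S"
    unfolding iso_classes_def quotient_def by auto
  have M': "iso_classes S' isom' = (\<lambda>E. {F\<in>S'. isom' E F}) ` S'"
    unfolding iso_classes_def quotient_def by auto
  have cls: "\<Phi> {F\<in>S. isom E F} = {F\<in>S'. isom' E' F}" if "E \<in> S" "E' \<in> S'" "C E E'" for E E'
  proof -
    have "(\<exists>F\<in>{F\<in>S. isom E F}. C F X) \<longleftrightarrow> isom' E' X" if X: "X \<in> S'" for X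
      using right[OF X] isom[OF \<open>E \<in> S\<close> _ \<open>E' \<in> S'\<close> X \<open>C E E'\<close>] by blast
    then show ?thesis unfolding \<Phi>_def by blast
  qed
  have MD: "iso_classes S isom \<subseteq> D"
    unfolding M D_def using trans by blast
  have MM': "iso_classes S' isom' = \<Phi> ` iso_classes S isom"
    unfolding M M' image_image
  proof (intro equalityI subsetI)
    fix x assume "x \<in> (\<lambda>E. {F\<in>S'. isom' E F}) ` S'"
    then obtain E' where "E' \<in> S'" "x = {F\<in>S'. isom' E' F}" by blast
    then show "x \<in> (\<lambda>E. \<Phi> {F\<in>S. isom E F}) ` S" using right[of E'] cls by fastforce
  next
    fix x assume "x \<in> (\<lambda>E. \<Phi> {F\<in>S. isom E F}) ` S"
    then obtain E where "E \<in> S" "x = \<Phi> {F\<in>S. isom E F}" by blast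
    then show "x \<in> (\<lambda>E. {F\<in>S'. isom' E F}) ` S'" using left[of E] cls by fastforce
  qed
  have add: "class_sum S issum x y \<in> D \<and>
      \<Phi> (class_sum S issum x y) = class_sum S' issum' (\<Phi> x) (\<Phi> y)" if x: "x \<in> D" and y: "y \<in> D" for x y
  proof
    have xy: "x \<subseteq> S" "y \<subseteq> S" using x y DS by auto
    show D: "class_sum S issum x y \<in> D"
      unfolding D_def mem_Collect_eq
    proof (intro conjI ballI impI)
      show "class_sum S issum x y \<subseteq> S" unfolding class_sum_def by blast
      fix G H assume G: "G \<in> class_sum S issum x y" and H: "H \<in> S" "isom G H"
      then obtain E F where EF: "G \<in> S" "E \<in> x" "F \<in> y" "issum G E F"
        unfolding class_sum_def by blast
      have "E \<in> S" "F \<in> S" using EF xy by auto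
      then have "issum H E F" using invar[OF EF(1) H(1) _ _ EF(4) H(2)] by simp
      then show "H \<in> class_sum S issum x y" unfolding class_sum_def using EF H by blast
    qed
    show "\<Phi> (class_sum S issum x y) = class_sum S' issum' (\<Phi> x) (\<Phi> y)"
    proof (intro equalityI subsetI)
      fix G' assume "G' \<in> \<Phi> (class_sum S issum x y)"
      then obtain G E F where G: "G' \<in> S'" "C G G'" "G \<in> S" "E \<in> x" "F \<in> y" "issum G E F"
        unfolding \<Phi>_def class_sum_def by blast
      obtain E' F' where E': "E' \<in> S'" "F' \<in> S'" "C E E'" "C F F'"
        using left[of E] left[of F] xy G(4,5) by blast
      have EF: "E \<in> S" "F \<in> S" using G xy by auto
      have "issum' G' E' F'" using issum[OF G(3) EF G(1) E'(1,2) G(2) E'(3,4)] G(6) by simp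
      then show "G' \<in> class_sum S' issum' (\<Phi> x) (\<Phi> y)"
        unfolding \<Phi>_def class_sum_def using G E' by blast
    next
      fix G' assume "G' \<in> class_sum S' issum' (\<Phi> x) (\<Phi> y)"
      then obtain E' F' E F where G: "G' \<in> S'" "E' \<in> S'" "F' \<in> S'" "E \<in> x" "F \<in> y"
          "C E E'" "C F F'" "issum' G' E' F'"
        unfolding \<Phi>_def class_sum_def by blast
      obtain H where H: "H \<in> S" "C H G'" using right[OF G(1)] by blast
      have EF: "E \<in> S" "F \<in> S" using G xy by auto
      have "issum H E F" using issum[OF H(1) EF G(1-3) H(2) G(6,7)] G(8) by simp
      then show "G' \<in> \<Phi> (class_sum S issum x y)"
        unfolding \<Phi>_def class_sum_def using G H by blast
    qed
  qed
  show ?thesis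
    unfolding grothendieck_group_def by (rule group_completion_iso[OF inj MD MM'], rule add)
qed

section \<open>Continuity tested locally and after pullback\<close>

lemma continuous_map_app:
  "continuous_map X Y g \<Longrightarrow> continuous_map Y Z f \<Longrightarrow> continuous_map X Z (\<lambda>x. f (g x))"
  using continuous_map_compose[of X Y g Z f] by (simp add: o_def)

lemma continuous_map_locally:
  assumes "\<And>x. x \<in> topspace X \<Longrightarrow> \<exists>U. openin X U \<and> x \<in> U \<and> continuous_map (subtopology X U) Y f"
  shows "continuous_map X Y f"
proof -
  obtain U where U: "\<And>x. x \<in> topspace X \<Longrightarrow> openin X (U x) \<and> x \<in> U x \<and>
      continuous_map (subtopology X (U x)) Y f"
    using assms by metis
  show ?thesis
    by (rule pasting_lemma[where I = "topspace X" and T = U and f = "\<lambda>_. f"]) (use U in auto)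
qed

lemma topspace_final_topology:
  assumes "\<And>i x. i \<in> I \<Longrightarrow> x \<in> topspace (T i) \<Longrightarrow> f i x \<in> S"
  shows "topspace (final_topology S I T f) = S"
proof (rule equalityI)
  show "topspace (final_topology S I T f) \<subseteq> S"
    using openin_topspace[of "final_topology S I T f"] unfolding openin_final_topology by blast
  have "{x \<in> topspace (T i). f i x \<in> S} = topspace (T i)" if "i \<in> I" for i using assms that by blast
  then have "openin (final_topology S I T f) S" unfolding openin_final_topology by simp
  then show "S \<subseteq> topspace (final_topology S I T f)" by (rule openin_subset)
qed

lemma continuous_map_into_final_topology:
  assumes "\<And>i x. i \<in> I \<Longrightarrow> x \<in> topspace (T i) \<Longrightarrow> f i x \<in> S" and "i \<in> I"
  shows "continuous_map (T i) (final_topology S I T f) (f i)"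
proof -
  have "topspace (final_topology S I T f) = S"
    by (rule topspace_final_topology) (use assms in blast)
  then show ?thesis unfolding continuous_map openin_final_topology using assms by auto
qed

lemma continuous_map_from_final_topology:
  assumes S: "\<And>i x. i \<in> I \<Longrightarrow> x \<in> topspace (T i) \<Longrightarrow> f i x \<in> S"
    and g: "g \<in> S \<rightarrow> topspace Z" and cont: "\<And>i. i \<in> I \<Longrightarrow> continuous_map (T i) Z (\<lambda>x. g (f i x))"
  shows "continuous_map (final_topology S I T f) Z g"
proof -
  have "openin (T i) {x \<in> topspace (T i). f i x \<in> {y \<in> S. g y \<in> U}}" if "openin Z U" "i \<in> I" for U i
  proof -
    have "{x \<in> topspace (T i). f i x \<in> {y \<in> S. g y \<in> U}} = {x \<in> topspace (T i). g (f i x) \<in> U}"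
      using S that by blast
    then show ?thesis using openin_continuous_map_preimage[OF cont[OF that(2)] that(1)] by simp
  qed
  moreover have "topspace (final_topology S I T f) = S"
    by (rule topspace_final_topology) (use S in blast)
  ultimately show ?thesis unfolding continuous_map openin_final_topology using g by auto
qed

definition pullback_space :: "'q topology \<Rightarrow> ('q \<Rightarrow> 'b) \<Rightarrow> 'e topology \<Rightarrow> ('e \<Rightarrow> 'b) \<Rightarrow> ('q \<times> 'e) topology" where
  "pullback_space Q b T \<pi> = subtopology (prod_topology Q T) {(p, e). b p = \<pi> e}"

lemma topspace_pullback_space:
  "topspace (pullback_space Q b T \<pi>) = {(p, e). p \<in> topspace Q \<and> e \<in> topspace T \<and> b p = \<pi> e}"
  unfolding pullback_space_def by auto

lemma continuous_map_pullback_fst: "continuous_map (pullback_space Q b T \<pi>) Q fst"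
  and continuous_map_pullback_snd: "continuous_map (pullback_space Q b T \<pi>) T snd"
  unfolding pullback_space_def by (rule continuous_intros)+

lemma continuous_map_into_pullback:
  assumes "continuous_map Z Q f" "continuous_map Z T g" "\<And>z. z \<in> topspace Z \<Longrightarrow> b (f z) = \<pi> (g z)"
  shows "continuous_map Z (pullback_space Q b T \<pi>) (\<lambda>z. (f z, g z))"
  unfolding pullback_space_def using assms
  by (intro continuous_map_into_subtopology continuous_map_pairedI) auto

text \<open>The pullback of an open map is open.  Hence continuity over the base of a map between spaces
  over it can be tested after pulling back along a jointly surjective family of open maps.\<close>

lemma continuous_map_by_pullbacks:
  assumes op: "\<And>i. i \<in> I \<Longrightarrow> open_map (Q i) B (b i)"
    and surj: "topspace B \<subseteq> (\<Union>i\<in>I. b i ` topspace (Q i))"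
    and \<pi>: "continuous_map T B \<pi>" and f: "f \<in> topspace T \<rightarrow> topspace T'"
    and cont: "\<And>i. i \<in> I \<Longrightarrow> continuous_map (pullback_space (Q i) (b i) T \<pi>) T' (\<lambda>x. f (snd x))"
  shows "continuous_map T T' f"
  unfolding continuous_map
proof (intro conjI allI impI)
  show "f ` topspace T \<subseteq> topspace T'" using f by blast
  fix U assume U: "openin T' U"
  have key: "\<exists>V. openin T V \<and> e \<in> V \<and> V \<subseteq> {e \<in> topspace T. f e \<in> U}" if e: "e \<in> topspace T" "f e \<in> U" for e
  proof -
    have "\<pi> e \<in> topspace B" using \<pi> e by (auto simp: continuous_map_def)
    then have "\<pi> e \<in> (\<Union>i\<in>I. b i ` topspace (Q i))" using surj by (rule subsetD[rotated])
    then obtain i where i1: "i \<in> I" "\<pi> e \<in> b i ` topspace (Q i)" by (rule UN_E)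
    from i1(2) obtain p where p1: "\<pi> e = b i p" "p \<in> topspace (Q i)" by (rule imageE)
    note i = i1(1) p1(2) p1(1)[symmetric]
    have "openin (pullback_space (Q i) (b i) T \<pi>)
        {x \<in> topspace (pullback_space (Q i) (b i) T \<pi>). f (snd x) \<in> U}" (is "openin _ ?W")
      by (rule openin_continuous_map_preimage[OF cont[OF i(1)] U])
    then obtain O' where O': "openin (prod_topology (Q i) T) O'" "?W = O' \<inter> {(p, e). b i p = \<pi> e}"
      unfolding pullback_space_def openin_subtopology by blast
    have "(p, e) \<in> ?W" using i e by (auto simp: topspace_pullback_space)
    then have "(p, e) \<in> O'" using O' by blast
    from O'(1)[unfolded openin_prod_topology_alt, rule_format, OF this]
    obtain N V where NV: "openin (Q i) N" "openin T V" "p \<in> N" "e \<in> V" "N \<times> V \<subseteq> O'"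
      by blast
    have "openin B (b i ` N)" using op[OF i(1)] NV(1) by (simp add: open_map_def)
    then have op: "openin T {e \<in> topspace T. \<pi> e \<in> b i ` N}" (is "openin T ?V2")
      by (rule openin_continuous_map_preimage[OF \<pi>])
    have "f e' \<in> U" if e': "e' \<in> V \<inter> ?V2" for e'
    proof -
      obtain p' where "p' \<in> N" "b i p' = \<pi> e'" using e' by auto
      then have "(p', e') \<in> ?W" unfolding O'(2) using NV e' by blast
      then show ?thesis by simp
    qed
    then have "V \<inter> ?V2 \<subseteq> {e \<in> topspace T. f e \<in> U}" by blast
    moreover have "openin T (V \<inter> ?V2)" by (rule openin_Int[OF NV(2) op])
    moreover have "\<pi> e \<in> b i ` N" using NV(3) i(3) by (metis imageI)
    then have "e \<in> V \<inter> ?V2" using NV(4) e by simp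
    ultimately show ?thesis by metis
  qed
  show "openin T {e \<in> topspace T. f e \<in> U}"
    unfolding openin_subopen[of T "{e \<in> topspace T. f e \<in> U}"] using key by simp
qed

section \<open>Smooth maps\<close>

abbreviation der :: "('a::real_normed_vector \<Rightarrow> 'b::real_normed_vector) \<Rightarrow> 'a \<Rightarrow> 'a \<Rightarrow> 'b" where
  "der f x \<equiv> frechet_derivative f (at x)"

lemma der_eqI: "(f has_derivative D) (at x) \<Longrightarrow> der f x = D"
  using frechet_derivative_at by metis

lemma der_transform:
  assumes "open S" "x \<in> S" "\<And>y. y \<in> S \<Longrightarrow> f y = g y" "(f has_derivative D) (at x)"
  shows "(g has_derivative D) (at x)"
  using has_derivative_transform_within_open[OF assms(4,1,2)] assms(3) by blast

lemma times_differentiable_onI: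
  fixes f :: "'a::real_normed_vector \<Rightarrow> 'b::real_normed_vector"
  assumes "open S" and D: "\<And>x. x \<in> S \<Longrightarrow> (f has_derivative D x) (at x)"
    and k: "\<And>v. times_differentiable_on k S (\<lambda>x. D x v)"
    and cong: "\<And>f' g' :: 'a \<Rightarrow> 'b.
        (\<And>x. x \<in> S \<Longrightarrow> f' x = g' x) \<Longrightarrow> times_differentiable_on k S f' \<Longrightarrow> times_differentiable_on k S g'"
  shows "times_differentiable_on (Suc k) S f"
  unfolding times_differentiable_on.simps
proof (intro conjI ballI allI)
  show "f differentiable (at x)" if "x \<in> S" for x using D[OF that] by (auto simp: differentiable_def)
  show "times_differentiable_on k S (\<lambda>x. der f x v)" for v
    by (rule cong[of "\<lambda>x. D x v"]) (use der_eqI[OF D] k in simp_all)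
qed

lemma times_differentiable_on_cong_imp:
  assumes "open S" "\<And>x. x \<in> S \<Longrightarrow> f x = g x" "times_differentiable_on k S f"
  shows "times_differentiable_on k S g"
  using assms(2,3)
proof (induction k arbitrary: f g)
  case 0
  then show ?case using continuous_on_cong[of S S f g] by simp
next
  case (Suc k)
  have D: "(g has_derivative der f x) (at x)" if "x \<in> S" for x
  proof -
    have "(f has_derivative der f x) (at x)"
      using Suc.prems(2) that by (simp add: frechet_derivative_works[symmetric])
    then show ?thesis using der_transform[OF assms(1) that, of f g] Suc.prems(1) by blast
  qed
  show ?case
  proof (rule times_differentiable_onI[OF assms(1) D])
    show "times_differentiable_on k S (\<lambda>x. der f x v)" for v
      using times_differentiable_on.simps(2) Suc.prems(2) by blast
  next
    fix f' g' :: "'a \<Rightarrow> 'b"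
    assume "\<And>x. x \<in> S \<Longrightarrow> f' x = g' x" "times_differentiable_on k S f'"
    then show "times_differentiable_on k S g'" by (rule Suc.IH)
  qed
qed

lemma times_differentiable_on_SucI:
  assumes "open S" and "\<And>x. x \<in> S \<Longrightarrow> (f has_derivative D x) (at x)"
    and "\<And>v. times_differentiable_on k S (\<lambda>x. D x v)"
  shows "times_differentiable_on (Suc k) S f"
  by (rule times_differentiable_onI[OF assms]) (auto intro: times_differentiable_on_cong_imp[OF assms(1)])

lemma times_differentiable_on_SucD:
  assumes "times_differentiable_on (Suc k) S f"
  shows "\<And>x. x \<in> S \<Longrightarrow> (f has_derivative der f x) (at x)"
    and "\<And>v. times_differentiable_on k S (\<lambda>x. der f x v)"
  using assms by (simp_all add: frechet_derivative_works[symmetric])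

lemma times_differentiable_on_pred:
  "times_differentiable_on (Suc k) S f \<Longrightarrow> times_differentiable_on k S f"
proof (induction k arbitrary: f)
  case 0
  then show ?case
    by (auto intro!: continuous_at_imp_continuous_on differentiable_imp_continuous_within)
next
  case (Suc k)
  have "times_differentiable_on (Suc k) S (\<lambda>x. der f x v)" for v
    using times_differentiable_on_SucD(2)[OF Suc.prems] .
  then show ?case using Suc.IH Suc.prems by simp
qed

lemma times_differentiable_on_subset:
  "times_differentiable_on k S f \<Longrightarrow> T \<subseteq> S \<Longrightarrow> times_differentiable_on k T f"
  by (induction k arbitrary: f) (auto intro: continuous_on_subset)

lemma times_differentiable_on_const: "open S \<Longrightarrow> times_differentiable_on k S (\<lambda>x. c)"
proof (induction k arbitrary: c)
  case (Suc k)
  then show ?case by (intro times_differentiable_on_SucI[where D = "\<lambda>x v. 0"]) auto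
qed simp

lemma times_differentiable_on_linear:
  assumes "open S" "bounded_linear h"
  shows "times_differentiable_on k S f \<Longrightarrow> times_differentiable_on k S (\<lambda>x. h (f x))"
proof (induction k arbitrary: f)
  case 0
  then show ?case using bounded_linear.continuous_on[OF assms(2)] by simp
next
  case (Suc k)
  show ?case
    by (rule times_differentiable_on_SucI[OF assms(1), where D = "\<lambda>x v. h (der f x v)"])
      (use times_differentiable_on_SucD[OF Suc.prems] Suc.IH
        in \<open>auto intro: bounded_linear.has_derivative[OF assms(2)]\<close>)
qed

lemma times_differentiable_on_add:
  assumes "open S"
  shows "times_differentiable_on k S f \<Longrightarrow> times_differentiable_on k S g \<Longrightarrow>
    times_differentiable_on k S (\<lambda>x. f x + g x)"
proof (induction k arbitrary: f g)
  case 0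
  then show ?case by (simp add: continuous_on_add)
next
  case (Suc k)
  show ?case
    by (rule times_differentiable_on_SucI[OF assms(1), where D = "\<lambda>x v. der f x v + der g x v"])
      (use times_differentiable_on_SucD[OF Suc.prems(1)] times_differentiable_on_SucD[OF Suc.prems(2)] Suc.IH
        in \<open>auto intro: has_derivative_add\<close>)
qed

lemma times_differentiable_on_sum:
  assumes "open S" "finite I" "\<And>i. i \<in> I \<Longrightarrow> times_differentiable_on k S (f i)"
  shows "times_differentiable_on k S (\<lambda>x. \<Sum>i\<in>I. f i x)"
  using assms(2,3)
  by (induction I rule: finite_induct)
    (auto intro: times_differentiable_on_const times_differentiable_on_add assms(1))

lemma times_differentiable_on_scaleR:
  assumes "open S"
  shows "times_differentiable_on k S f \<Longrightarrow> times_differentiable_on k S g \<Longrightarrow>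
    times_differentiable_on k S (\<lambda>x. f x *\<^sub>R g x)"
proof (induction k arbitrary: f g)
  case 0
  then show ?case by (simp add: continuous_on_scaleR)
next
  case (Suc k)
  note f = times_differentiable_on_SucD[OF Suc.prems(1)] and g = times_differentiable_on_SucD[OF Suc.prems(2)]
  have "times_differentiable_on k S (\<lambda>x. f x *\<^sub>R der g x v + der f x v *\<^sub>R g x)" for v
    by (rule times_differentiable_on_add[OF assms
          Suc.IH[OF times_differentiable_on_pred[OF Suc.prems(1)] g(2)]
          Suc.IH[OF f(2) times_differentiable_on_pred[OF Suc.prems(2)]]])
  moreover have "((\<lambda>x. f x *\<^sub>R g x) has_derivative (\<lambda>v. f x *\<^sub>R der g x v + der f x v *\<^sub>R g x)) (at x)"
    if "x \<in> S" for x
    by (rule has_derivative_scaleR[OF f(1)[OF that] g(1)[OF that]])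
  ultimately show ?case by (intro times_differentiable_on_SucI[OF assms]) auto
qed

text \<open>The derivative of a composite is expanded in an orthonormal basis.  This turns the chain rule
  into sums of products, to which the induction hypothesis applies.\<close>

lemma times_differentiable_on_compose:
  fixes f :: "'a::real_normed_vector \<Rightarrow> 'b::euclidean_space" and g :: "'b \<Rightarrow> 'c::real_normed_vector"
  assumes "open S" "open T" "f ` S \<subseteq> T"
  shows "times_differentiable_on k S f \<Longrightarrow> times_differentiable_on k T g \<Longrightarrow>
    times_differentiable_on k S (\<lambda>x. g (f x))"
proof (induction k arbitrary: g)
  case 0
  then show ?case using assms(3) continuous_on_compose2[of T g S f] by simp
next
  case (Suc k)
  note f = times_differentiable_on_SucD[OF Suc.prems(1)] and g = times_differentiable_on_SucD[OF Suc.prems(2)]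
  have "times_differentiable_on k S (\<lambda>x. \<Sum>i\<in>Basis. (der f x v \<bullet> i) *\<^sub>R der g (f x) i)" for v
  proof (intro times_differentiable_on_sum[OF assms(1)] times_differentiable_on_scaleR[OF assms(1)])
    fix i :: 'b
    show "times_differentiable_on k S (\<lambda>x. der f x v \<bullet> i)"
      using times_differentiable_on_linear[OF assms(1) bounded_linear_inner_left f(2)] .
    show "times_differentiable_on k S (\<lambda>x. der g (f x) i)"
      using Suc.IH[OF times_differentiable_on_pred[OF Suc.prems(1)] g(2)] .
  qed simp
  moreover have "((\<lambda>x. g (f x)) has_derivative (\<lambda>v. \<Sum>i\<in>Basis. (der f x v \<bullet> i) *\<^sub>R der g (f x) i)) (at x)"
    if "x \<in> S" for x
  proof -
    have "f x \<in> T" using assms(3) that by blast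
    then have d: "(g has_derivative der g (f x)) (at (f x))" using g(1) by blast
    then have l: "linear (der g (f x))" using has_derivative_linear by blast
    have eq: "der g (f x) w = (\<Sum>i\<in>Basis. (w \<bullet> i) *\<^sub>R der g (f x) i)" for w
    proof -
      have "der g (f x) w = der g (f x) (\<Sum>i\<in>Basis. (w \<bullet> i) *\<^sub>R i)" by (simp add: euclidean_representation)
      also have "\<dots> = (\<Sum>i\<in>Basis. (w \<bullet> i) *\<^sub>R der g (f x) i)" by (simp add: linear_sum[OF l] linear_scale[OF l])
      finally show ?thesis .
    qed
    have "(der g (f x) \<circ> der f x) = (\<lambda>v. \<Sum>i\<in>Basis. (der f x v \<bullet> i) *\<^sub>R der g (f x) i)"
      unfolding o_def by (rule ext, rule eq)
    then show ?thesis using diff_chain_at[OF f(1)[OF that] d] by (simp add: o_def)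
  qed
  ultimately show ?case by (intro times_differentiable_on_SucI[OF assms(1)]) auto
qed

lemma smooth_on_compose:
  fixes f :: "'a::real_normed_vector \<Rightarrow> 'b::euclidean_space" and g :: "'b \<Rightarrow> 'c::real_normed_vector"
  shows "open S \<Longrightarrow> open T \<Longrightarrow> f ` S \<subseteq> T \<Longrightarrow> smooth_on S f \<Longrightarrow> smooth_on T g \<Longrightarrow> smooth_on S (\<lambda>x. g (f x))"
  unfolding smooth_on_def using times_differentiable_on_compose by blast

lemma smooth_on_cong:
  assumes "open S" "\<And>x. x \<in> S \<Longrightarrow> f x = g x" "smooth_on S f"
  shows "smooth_on S g"
  using assms times_differentiable_on_cong_imp unfolding smooth_on_def by metis

lemma smooth_on_subset: "smooth_on S f \<Longrightarrow> T \<subseteq> S \<Longrightarrow> smooth_on T f"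
  unfolding smooth_on_def using times_differentiable_on_subset by blast

lemma smooth_on_id: "open S \<Longrightarrow> smooth_on S (\<lambda>x. x)"
  unfolding smooth_on_def
proof
  show "times_differentiable_on k S (\<lambda>x. x)" if "open S" for k
  proof (cases k)
    case (Suc m)
    then show ?thesis using that
      by (auto intro!: times_differentiable_on_SucI[where D = "\<lambda>x v. v"] times_differentiable_on_const)
  qed simp
qed

lemma smooth_on_imp_continuous_on: "smooth_on S f \<Longrightarrow> continuous_on S f"
  unfolding smooth_on_def by (metis times_differentiable_on.simps(1))

lemma smooth_on_imp_has_derivative: "smooth_on S f \<Longrightarrow> x \<in> S \<Longrightarrow> (f has_derivative der f x) (at x)"
  unfolding smooth_on_def by (metis times_differentiable_on_SucD(1))

lemma smooth_on_imp_continuous_der: "smooth_on S f \<Longrightarrow> continuous_on S (\<lambda>x. der f x v)"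
  unfolding smooth_on_def by (metis times_differentiable_on_SucD(2) times_differentiable_on.simps(1))

abbreviation jac :: "(real^'n \<Rightarrow> real^'m) \<Rightarrow> real^'n \<Rightarrow> real^'n^'m" where
  "jac f x \<equiv> matrix (der f x)"

lemma continuous_on_jac:
  fixes f :: "real^'n::finite \<Rightarrow> real^'m::finite"
  assumes "smooth_on S f"
  shows "continuous_on S (jac f)"
  unfolding matrix_def
  by (intro continuous_on_vec_lambda continuous_on_component smooth_on_imp_continuous_der[OF assms])

lemma jac_compose:
  fixes f :: "real^'n::finite \<Rightarrow> real^'m::finite" and g :: "real^'m \<Rightarrow> real^'k::finite"
  assumes "smooth_on S f" "x \<in> S" "smooth_on T g" "f x \<in> T"
    and "open U" "x \<in> U" "\<And>y. y \<in> U \<Longrightarrow> k y = g (f y)"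
  shows "jac k x = jac g (f x) ** jac f x"
proof -
  note df = smooth_on_imp_has_derivative[OF assms(1,2)] and dg = smooth_on_imp_has_derivative[OF assms(3,4)]
  have "((g \<circ> f) has_derivative der g (f x) \<circ> der f x) (at x)" by (rule diff_chain_at[OF df dg])
  then have "(k has_derivative der g (f x) \<circ> der f x) (at x)"
    by (rule der_transform[OF assms(5,6), rotated]) (use assms(7) in simp)
  then have "der k x = der g (f x) \<circ> der f x" by (rule der_eqI)
  moreover have "linear (der f x)" "linear (der g (f x))" using df dg has_derivative_linear by blast+
  ultimately show ?thesis by (simp add: matrix_compose)
qed

lemma jac_identity:
  fixes f :: "real^'n::finite \<Rightarrow> real^'n"
  assumes "open U" "x \<in> U" "\<And>y. y \<in> U \<Longrightarrow> f y = y"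
  shows "jac f x = mat 1"
proof -
  have "((\<lambda>y. y) has_derivative (\<lambda>y. y)) (at x)" by simp
  then have "(f has_derivative (\<lambda>y. y)) (at x)"
    by (rule der_transform[OF assms(1,2), rotated]) (use assms(3) in simp)
  then have "der f x = id" using der_eqI by (auto simp: id_def)
  then show ?thesis by (simp add: matrix_id_mat_1)
qed

lemma der_cong:
  assumes "open U" "x \<in> U" "\<And>y. y \<in> U \<Longrightarrow> f y = g y"
  shows "der f x = der g x"
proof -
  have "(f has_derivative D) (at x) \<longleftrightarrow> (g has_derivative D) (at x)" for D
    using der_transform[OF assms(1,2), of f g D] der_transform[OF assms(1,2), of g f D] assms(3) by metis
  then show ?thesis unfolding frechet_derivative_def by simp
qed

lemma der_eq_jac:
  fixes f :: "real^'n::finite \<Rightarrow> real^'m::finite"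
  assumes "smooth_on S f" "x \<in> S"
  shows "der f x v = jac f x *v v"
proof -
  have "linear (der f x)" using smooth_on_imp_has_derivative[OF assms] has_derivative_linear by blast
  then show ?thesis by (simp add: matrix_works linear_def scalar_mult_eq_scaleR)
qed

section \<open>Local lifts\<close>

lemma local_liftI:
  assumes "open W" "open V" "W \<subseteq> cdom c" "V \<subseteq> cdom d" "l \<in> extensional W"
    and "\<And>u. u \<in> W \<Longrightarrow> l u \<in> V \<and> m (l u) = u" "\<And>v. v \<in> V \<Longrightarrow> m v \<in> W \<and> l (m v) = v"
    and "smooth_on W l" "smooth_on V m" "\<And>u. u \<in> W \<Longrightarrow> cmap d (l u) = h (cmap c u)"
  shows "local_lift h c d W l" and "l ` W = V"
proof -
  show img: "l ` W = V" using assms(6,7) by force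
  have inj: "inj_on l W" using assms(6) by (metis inj_onI)
  have "inv_into W l v = m v" if "v \<in> V" for v
    using inv_into_f_eq[OF inj] assms(7)[OF that] by blast
  then have "smooth_on V (inv_into W l)" using smooth_on_cong[OF assms(2) _ assms(9)] by metis
  then show "local_lift h c d W l" unfolding local_lift_def img using assms inj by auto
qed

lemma local_liftD:
  assumes "local_lift h c d W l"
  shows "open W" "W \<subseteq> cdom c" "l \<in> extensional W" "l ` W \<subseteq> cdom d" "open (l ` W)" "smooth_on W l"
    "smooth_on (l ` W) (inv_into W l)" "\<And>u. u \<in> W \<Longrightarrow> cmap d (l u) = h (cmap c u)"
    "\<And>u. u \<in> W \<Longrightarrow> inv_into W l (l u) = u" "\<And>v. v \<in> l ` W \<Longrightarrow> inv_into W l v \<in> W"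
    "\<And>v. v \<in> l ` W \<Longrightarrow> l (inv_into W l v) = v" "\<And>u. u \<in> W \<Longrightarrow> l u \<in> cdom d" "inj_on l W"
  using assms unfolding local_lift_def by (auto simp: inv_into_into f_inv_into_f)

lemma local_lift_cong:
  assumes "\<And>u. u \<in> cdom c \<Longrightarrow> h (cmap c u) = k (cmap c u)"
  shows "local_lift h c d W l \<longleftrightarrow> local_lift k c d W l"
proof -
  have "(\<forall>u\<in>W. cmap d (l u) = h (cmap c u)) \<longleftrightarrow> (\<forall>u\<in>W. cmap d (l u) = k (cmap c u))" if "W \<subseteq> cdom c"
    using assms that by (metis subsetD)
  then show ?thesis unfolding local_lift_def by metis
qed

lemma local_lift_restrict:
  assumes l: "local_lift h c d W l" and "open W'" "W' \<subseteq> W"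
  shows "local_lift h c d W' (restrict l W')"
proof (rule local_liftI(1)[where V = "l ` W' " and m = "inv_into W l"])
  have sub: "l ` W' \<subseteq> l ` W" using assms(3) by blast
  have "continuous_on (l ` W) (inv_into W l)" by (rule smooth_on_imp_continuous_on[OF local_liftD(7)[OF l]])
  then have "open (inv_into W l -` W' \<inter> l ` W)"
    using continuous_open_preimage[OF _ local_liftD(5)[OF l] assms(2)] by (simp add: Int_commute)
  moreover have "inv_into W l -` W' \<inter> l ` W = l ` W'"
    using assms(3) local_liftD(9)[OF l] by (auto simp: subset_iff) 
  ultimately show "open (l ` W')" by simp
  show "smooth_on W' (restrict l W')"
    by (rule smooth_on_cong[OF assms(2) _ smooth_on_subset[OF local_liftD(6)[OF l] assms(3)]]) simp
  show "smooth_on (l ` W') (inv_into W l)" by (rule smooth_on_subset[OF local_liftD(7)[OF l] sub])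
  show "l ` W' \<subseteq> cdom d" using local_liftD(4)[OF l] sub by blast
  show "W' \<subseteq> cdom c" using local_liftD(2)[OF l] assms(3) by blast
  show "cmap d (restrict l W' u) = h (cmap c u)" if "u \<in> W'" for u
    using local_liftD(8)[OF l] assms(3) that by auto
  show "restrict l W' u \<in> l ` W' \<and> inv_into W l (restrict l W' u) = u" if "u \<in> W'" for u
    using local_liftD(9)[OF l] assms(3) that by auto
  show "inv_into W l v \<in> W' \<and> restrict l W' (inv_into W l v) = v" if "v \<in> l ` W'" for v
    using local_liftD(9)[OF l] assms(3) that by auto
qed (use assms in auto)

lemma local_lift_compose:
  fixes b c d :: "('n::finite, 'x) chart"
  assumes l: "local_lift h b c W l" and m: "local_lift k c d V m" and sub: "l ` W \<subseteq> V"
  shows "local_lift (\<lambda>x. k (h x)) b d W (compose W m l)"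
proof (rule local_liftI(1)[where V = "m ` (l ` W)" and m = "\<lambda>v. inv_into W l (inv_into V m v)"])
  note L = local_liftD[OF l] and M = local_liftD[OF m]
  have "local_lift k c d (l ` W) (restrict m (l ` W))" by (rule local_lift_restrict[OF m L(5) sub])
  then show op: "open (m ` (l ` W))" using local_liftD(5) by (metis image_restrict_eq)
  have "smooth_on W (\<lambda>x. m (l x))" by (rule smooth_on_compose[OF L(1) M(1) sub L(6) M(6)])
  then show "smooth_on W (compose W m l)"
    by (rule smooth_on_cong[OF L(1), rotated]) (simp add: compose_def)
  have s: "m ` (l ` W) \<subseteq> m ` V" using sub by blast
  have "inv_into V m ` (m ` (l ` W)) \<subseteq> l ` W" using M(9) sub by auto
  then show "smooth_on (m ` (l ` W)) (\<lambda>v. inv_into W l (inv_into V m v))"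
    by (rule smooth_on_compose[OF op L(5) _ smooth_on_subset[OF M(7) s] L(7)])
  show "m ` (l ` W) \<subseteq> cdom d" using M(4) s by blast
  show "cmap d (compose W m l u) = k (h (cmap b u))" if "u \<in> W" for u
    using L(8) M(8) sub that by (auto simp: compose_def)
  show "compose W m l u \<in> m ` (l ` W) \<and> inv_into W l (inv_into V m (compose W m l u)) = u" if "u \<in> W" for u
    using L(9) M(9) sub that by (auto simp: compose_def)
  show "inv_into W l (inv_into V m v) \<in> W \<and> compose W m l (inv_into W l (inv_into V m v)) = v"
    if "v \<in> m ` (l ` W)" for v
    using L(9) M(9) sub that by (auto simp: compose_def)
qed (use local_liftD[OF l] in \<open>auto simp: compose_def\<close>)

lemma local_lift_inverse:
  fixes c d :: "('n::finite, 'x) chart"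
  assumes l: "local_lift h c d W l" and k: "\<And>u. u \<in> W \<Longrightarrow> k (h (cmap c u)) = cmap c u"
  shows "local_lift k d c (l ` W) (restrict (inv_into W l) (l ` W))"
    and "restrict (inv_into W l) (l ` W) ` (l ` W) = W"
proof -
  note L = local_liftD[OF l]
  have s: "smooth_on (l ` W) (restrict (inv_into W l) (l ` W))"
    by (rule smooth_on_cong[OF L(5) _ L(7)]) simp
  have "cmap c (restrict (inv_into W l) (l ` W) v) = k (cmap d v)" if "v \<in> l ` W" for v
    using L(8,9) k that by auto
  note * = local_liftI[where W = "l ` W" and V = W and m = l and c = d and d = c, OF L(5,1,4,2) restrict_extensional _ _ s L(6) this]
  show "local_lift k d c (l ` W) (restrict (inv_into W l) (l ` W))"
    "restrict (inv_into W l) (l ` W) ` (l ` W) = W"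
    by (rule *(1); use L(9-11) in auto) (rule *(2); use L(9-11) in auto)
qed

lemma local_lift_id:
  assumes "open W" "W \<subseteq> cdom c"
  shows "local_lift (\<lambda>x. x) c c W (restrict id W)"
proof -
  have "smooth_on W (restrict id W)" by (rule smooth_on_cong[OF assms(1) _ smooth_on_id[OF assms(1)]]) simp
  then show ?thesis
    by (intro local_liftI(1)[where V = W and m = "\<lambda>x. x"]) (use assms smooth_on_id in auto)
qed

section \<open>Changes of charts are determined by their 1-jets\<close>

lemma chart_group_smooth:
  assumes "orbifold_chart S c" "g \<in> cgrp c"
  shows "open (cdom c)" "smooth_on (cdom c) g" "bij_betw g (cdom c) (cdom c)" "\<And>x. x \<in> cdom c \<Longrightarrow> g x \<in> cdom c"
    "finite (cgrp c)" "\<exists>g'\<in>cgrp c. \<forall>x\<in>cdom c. g' (g x) = x"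
proof -
  show "open (cdom c)" "smooth_on (cdom c) g" "finite (cgrp c)" and b: "bij_betw g (cdom c) (cdom c)"
    using assms unfolding orbifold_chart_def by auto
  show "g x \<in> cdom c" if "x \<in> cdom c" for x using b that by (metis bij_betwE)
  obtain g' where g': "g' \<in> cgrp c" "compose (cdom c) g' g = restrict id (cdom c)"
    using assms unfolding orbifold_chart_def by blast
  have "g' (g x) = x" if "x \<in> cdom c" for x using fun_cong[OF g'(2), of x] that by (simp add: compose_def)
  then show "\<exists>g'\<in>cgrp c. \<forall>x\<in>cdom c. g' (g x) = x" using g'(1) by blast
qed

lemma chart_group_finite_order:
  assumes "orbifold_chart S c" "g \<in> cgrp c"
  obtains m where "m > 0" "\<And>x. x \<in> cdom c \<Longrightarrow> (g ^^ m) x = x"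
    "\<And>k x. x \<in> cdom c \<Longrightarrow> (g ^^ k) x \<in> cdom c" "\<And>k. smooth_on (cdom c) (g ^^ k)"
proof -
  let ?D = "cdom c"
  note g = chart_group_smooth[OF assms]
  have maps: "(g ^^ k) x \<in> ?D" if "x \<in> ?D" for k x by (induction k) (use g(4) that in auto)
  have smooth: "smooth_on ?D (g ^^ k)" for k
  proof (induction k)
    case 0
    show ?case using smooth_on_id[OF g(1)] by (simp add: id_def)
  next
    case (Suc k)
    have "smooth_on ?D (\<lambda>x. g ((g ^^ k) x))"
      by (rule smooth_on_compose[OF g(1) g(1) _ Suc g(2)]) (use maps in auto)
    then show ?case by (simp add: o_def)
  qed
  have "restrict (g ^^ k) ?D \<in> cgrp c" for k
  proof (induction k)
    case 0
    have "restrict id ?D \<in> cgrp c" using assms unfolding orbifold_chart_def by blast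
    then show ?case by (simp only: funpow.simps)
  next
    case (Suc k)
    have "compose ?D g (restrict (g ^^ k) ?D) \<in> cgrp c" using Suc assms unfolding orbifold_chart_def by blast
    moreover have "compose ?D g (restrict (g ^^ k) ?D) = restrict (g ^^ Suc k) ?D"
      by (auto simp: compose_def)
    ultimately show ?case by metis
  qed
  then have "range (\<lambda>k. restrict (g ^^ k) ?D) \<subseteq> cgrp c" by blast
  then have "\<not> inj (\<lambda>k. restrict (g ^^ k) ?D)"
    using g(5) finite_subset range_inj_infinite by metis
  then obtain i j where "i \<noteq> j" "restrict (g ^^ i) ?D = restrict (g ^^ j) ?D" unfolding inj_def by blast
  then obtain i j where ij: "i < j" "restrict (g ^^ i) ?D = restrict (g ^^ j) ?D"
    by (metis linorder_neqE_nat)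
  have eq: "(g ^^ i) x = (g ^^ j) x" if "x \<in> ?D" for x using fun_cong[OF ij(2), of x] that by simp
  have inj: "inj_on (g ^^ i) ?D"
  proof (induction i)
    case (Suc i)
    have "inj_on g ((g ^^ i) ` ?D)" using g(3) maps by (auto simp: bij_betw_def intro: inj_on_subset)
    then show ?case unfolding funpow.simps by (rule comp_inj_on[OF Suc])
  qed simp
  have "(g ^^ (j - i)) x = x" if "x \<in> ?D" for x
  proof -
    have "(g ^^ i) ((g ^^ (j - i)) x) = (g ^^ (i + (j - i))) x" by (simp add: funpow_add)
    then have "(g ^^ i) ((g ^^ (j - i)) x) = (g ^^ i) x" using ij(1) eq[OF that] by simp
    then show ?thesis using inj maps that by (auto simp: inj_on_def)
  qed
  then show ?thesis using that[of "j - i"] ij(1) maps smooth by simp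
qed

text \<open>A finite group of diffeomorphisms can be linearized at a fixed point: the average \<open>\<phi>\<close> of the
  iterates of \<open>g\<close> is invariant under \<open>g\<close>, and it is a local diffeomorphism if the derivative of \<open>g\<close> is
  the identity, so that \<open>\<phi> (g x) = \<phi> x\<close> forces \<open>g x = x\<close>.\<close>

lemma chart_group_identity_jet:
  fixes c :: "('n::finite, 'x) chart"
  assumes c: "orbifold_chart S c" and g: "g \<in> cgrp c" and u: "u \<in> cdom c" "g u = u" and jac: "jac g u = mat 1"
  shows "\<forall>\<^sub>F x in nhds u. g x = x"
proof -
  let ?D = "cdom c"
  note G = chart_group_smooth[OF c g]
  obtain m where m: "m > 0" "\<And>x. x \<in> ?D \<Longrightarrow> (g ^^ m) x = x"
    "\<And>k x. x \<in> ?D \<Longrightarrow> (g ^^ k) x \<in> ?D" "\<And>k. smooth_on ?D (g ^^ k)"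
    using chart_group_finite_order[OF c g] by blast
  define \<phi> where "\<phi> x = (\<Sum>k<m. (g ^^ k) x)" for x
  have inv: "\<phi> (g x) = \<phi> x" if "x \<in> ?D" for x
  proof -
    have "\<phi> (g x) = (\<Sum>k<m. (g ^^ Suc k) x)" unfolding \<phi>_def by (simp add: funpow_swap1)
    also have "\<dots> = (\<Sum>k<Suc m. (g ^^ k) x) - x" by (subst sum.lessThan_Suc_shift) simp
    also have "\<dots> = \<phi> x" unfolding \<phi>_def using m(2)[OF that] by simp
    finally show ?thesis .
  qed
  have smooth: "smooth_on ?D \<phi>"
    unfolding \<phi>_def smooth_on_def
    by (intro allI times_differentiable_on_sum[OF G(1)]) (use m(4) in \<open>auto simp: smooth_on_def\<close>)
  have fix_u: "(g ^^ k) u = u" for k by (induction k) (use u in auto)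
  have jk: "jac (g ^^ k) u = mat 1" for k
  proof (induction k)
    case 0
    show ?case by (rule jac_identity[of UNIV]) auto
  next
    case (Suc k)
    have "jac (g ^^ Suc k) u = jac g ((g ^^ k) u) ** jac (g ^^ k) u"
      by (rule jac_compose[OF m(4) u(1) G(2) _ G(1) u(1)]) (use u fix_u in auto)
    then show ?case by (simp only: fix_u jac Suc matrix_mul_lid)
  qed
  have "(\<phi> has_derivative (\<lambda>v. \<Sum>k<m. der (g ^^ k) u v)) (at u)"
    unfolding \<phi>_def by (intro has_derivative_sum smooth_on_imp_has_derivative[OF m(4) u(1)])
  then have "der \<phi> u = (\<lambda>v. \<Sum>k<m. der (g ^^ k) u v)" by (rule der_eqI)
  then have d: "der \<phi> u v = real m *\<^sub>R v" for v
    by (simp add: der_eq_jac[OF m(4) u(1)] jk sum_constant_scaleR del: sum_constant)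
  \<comment> \<open>The derivative of \<open>\<phi>\<close> at \<open>u\<close> is \<open>m\<close> times the identity, so \<open>\<phi>\<close> is injective near \<open>u\<close>.\<close>
  obtain r where r: "r > 0" "ball u r \<subseteq> ?D" "inj_on \<phi> (ball u r)"
  proof (rule has_derivative_locally_injective[of u ?D "\<lambda>v. (1 / real m) *\<^sub>R v" "\<lambda>x. der \<phi> x" \<phi>])
    show "(*\<^sub>R) (1 / real m) \<circ> der \<phi> u = id" using m(1) by (auto simp: d)
    show "(\<phi> has_derivative der \<phi> x) (at x)" if "x \<in> ?D" for x
      by (rule smooth_on_imp_has_derivative[OF smooth that])
    fix e :: real assume e: "e > 0"
    let ?s = "\<lambda>x. \<Sum>i\<in>Basis. norm (der \<phi> x i - der \<phi> u i)"
    have "continuous_on ?D ?s" by (intro continuous_intros smooth_on_imp_continuous_der[OF smooth])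
    then have "isCont ?s u" using G(1) u(1) by (simp add: continuous_on_eq_continuous_at)
    then obtain s where s: "s > 0" "\<And>x. dist x u < s \<Longrightarrow> dist (?s x) (?s u) < e"
      using e unfolding continuous_at_eps_delta by blast
    obtain t where t: "t > 0" "ball u t \<subseteq> ?D" using G(1) u(1) open_contains_ball by blast
    have "onorm (\<lambda>v. der \<phi> x v - der \<phi> u v) < e" if x: "dist u x < min s t" for x
    proof -
      have xD: "x \<in> ?D" using x t by auto
      have bl: "bounded_linear (\<lambda>v. der \<phi> x v - der \<phi> u v)"
        by (intro bounded_linear_sub) (use smooth_on_imp_has_derivative[OF smooth] xD u(1) has_derivative_bounded_linear in blast)+
      have "?s x < e" using s(2)[of x] x by (simp add: dist_commute sum_nonneg)
      then show ?thesis using onorm_componentwise[OF bl] by linarith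
    qed
    then show "\<exists>d>0. \<forall>x. dist u x < d \<longrightarrow> onorm (\<lambda>v. der \<phi> x v - der \<phi> u v) < e"
      using s(1) t(1) by (intro exI[of _ "min s t"]) simp
  qed (use u G bounded_linear_scaleR_right in auto)
  have "isCont g u" using smooth_on_imp_continuous_on[OF G(2)] G(1) u(1) by (simp add: continuous_on_eq_continuous_at)
  then have "(g \<longlongrightarrow> g u) (nhds u)" unfolding isCont_def tendsto_at_iff_tendsto_nhds .
  from topological_tendstoD[OF this open_ball[of u r]] have "\<forall>\<^sub>F x in nhds u. g x \<in> ball u r"
    using r(1) u(2) by simp
  moreover have "\<forall>\<^sub>F x in nhds u. x \<in> ball u r" using r(1) by (intro eventually_nhds_in_open) auto
  ultimately show ?thesis
  proof eventually_elim
    case (elim x)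
    then show ?case using inv[of x] r by (auto simp: inj_on_def)
  qed
qed

lemma agree_on_closure:
  fixes f g :: "'a::first_countable_topology \<Rightarrow> 'b::t2_space"
  assumes "continuous_on W f" "continuous_on W g" "I \<subseteq> W" "\<And>x. x \<in> I \<Longrightarrow> f x = g x" "u \<in> W" "u \<in> closure I"
  shows "f u = g u"
proof -
  obtain s where s: "\<And>n. s n \<in> I" "s \<longlonglongrightarrow> u" using assms(6) unfolding closure_sequential by blast
  have sW: "\<forall>\<^sub>F n in sequentially. s n \<in> W" using s(1) assms(3) by (auto intro: always_eventually)
  have "(\<lambda>n. f (s n)) \<longlonglongrightarrow> f u" "(\<lambda>n. g (s n)) \<longlonglongrightarrow> g u"
    by (rule continuous_on_tendsto_compose[OF assms(1) s(2) assms(5) sW],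
        rule continuous_on_tendsto_compose[OF assms(2) s(2) assms(5) sW])
  moreover have "(\<lambda>n. f (s n)) = (\<lambda>n. g (s n))" using assms(4) s(1) by auto
  ultimately show ?thesis using LIMSEQ_unique by metis
qed

text \<open>The finite case of the Baire category theorem, by induction on the number of closed sets: the part
  of the open set outside the first one is open and either empty or covered by the others.\<close>

lemma finite_closed_cover_interior:
  fixes C :: "'i \<Rightarrow> 'a::topological_space set"
  assumes "finite I" "open U" "U \<noteq> {}" "U \<subseteq> (\<Union>i\<in>I. C i)" "\<And>i. i \<in> I \<Longrightarrow> closedin (top_of_set W) (C i)" "U \<subseteq> W"
  shows "\<exists>i\<in>I. \<exists>U'. open U' \<and> U' \<noteq> {} \<and> U' \<subseteq> U \<and> U' \<subseteq> C i"
  using assms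
proof (induction I arbitrary: U rule: finite_induct)
  case (insert i I)
  show ?case
  proof (cases "U \<subseteq> C i")
    case True
    then show ?thesis using insert.prems by blast
  next
    case False
    obtain K where K: "closed K" "C i = W \<inter> K" using insert.prems(4)[of i] by (auto simp: closedin_closed)
    have "open (U - C i)" using K insert.prems(1,5) by (metis Diff_Int Diff_eq_empty_iff Un_empty_left open_Diff)
    moreover have "U - C i \<noteq> {}" "U - C i \<subseteq> (\<Union>i\<in>I. C i)" "U - C i \<subseteq> W" using False insert.prems by auto
    ultimately have "\<exists>j\<in>I. \<exists>U'. open U' \<and> U' \<noteq> {} \<and> U' \<subseteq> U - C i \<and> U' \<subseteq> C j"
      using insert.IH insert.prems(4) by blast
    then show ?thesis by blast
  qed
qed simp

text \<open>The composite of \<open>g\<close> with the inverse of \<open>g'\<close> fixes \<open>u\<close> with trivial derivative, so it is the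
  identity near \<open>u\<close>.\<close>

lemma chart_group_jet:
  fixes c :: "('n::finite, 'x) chart"
  assumes c: "orbifold_chart S c" and g: "g \<in> cgrp c" "g' \<in> cgrp c" and u: "u \<in> cdom c" "g u = g' u" "jac g u = jac g' u"
  shows "\<forall>\<^sub>F x in nhds u. g x = g' x"
proof -
  note G = chart_group_smooth[OF c g(1)] and G' = chart_group_smooth[OF c g(2)]
  obtain h where h: "h \<in> cgrp c" "\<And>x. x \<in> cdom c \<Longrightarrow> h (g' x) = x" using G'(6) by blast
  note H = chart_group_smooth[OF c h(1)]
  define k where "k = compose (cdom c) h g"
  have k: "k \<in> cgrp c" unfolding k_def using c h g unfolding orbifold_chart_def by blast
  have kx: "k x = h (g x)" if "x \<in> cdom c" for x unfolding k_def using that by (simp add: compose_def)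
  have "jac k u = jac h (g u) ** jac g u"
    by (rule jac_compose[OF G(2) u(1) H(2) G(4)[OF u(1)] G(1) u(1) kx])
  moreover have "jac (\<lambda>x. h (g' x)) u = jac h (g' u) ** jac g' u"
    by (rule jac_compose[OF G'(2) u(1) H(2) G'(4)[OF u(1)] G(1) u(1)]) simp
  moreover have "jac (\<lambda>x. h (g' x)) u = mat 1" by (rule jac_identity[OF G(1) u(1) h(2)])
  ultimately have "jac k u = mat 1" using u by simp
  moreover have "k u = u" using kx h(2) u by simp
  ultimately have "\<forall>\<^sub>F x in nhds u. k x = x" using chart_group_identity_jet[OF c k u(1)] by blast
  moreover have "\<forall>\<^sub>F x in nhds u. x \<in> cdom c" by (rule eventually_nhds_in_open[OF G(1) u(1)])
  ultimately show ?thesis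
  proof eventually_elim
    case (elim x)
    then have "h (g x) = h (g' x)" using kx h(2) by simp
    then show ?case using H(3) G(4) G'(4) elim(2) by (metis bij_betw_def inj_on_def)
  qed
qed

text \<open>On a dense open set a change of charts from \<open>c\<close> to itself agrees with one of the finitely many
  elements of the chart group.  Those elements that occur arbitrarily close to \<open>u\<close> have the same
  1-jet at \<open>u\<close>, hence agree near \<open>u\<close>.\<close>

lemma change_of_charts_is_group_element:
  fixes c :: "('n::finite, 'x) chart"
  assumes c: "orbifold_chart S c" and l: "local_lift (\<lambda>x. x) c c W l" and u: "u \<in> W"
  shows "\<exists>g\<in>cgrp c. (\<forall>\<^sub>F x in nhds u. l x = g x) \<and> l u = g u \<and> jac l u = jac g u"
proof -
  note L = local_liftD[OF l]
  note G = chart_group_smooth[OF c]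
  have fin: "finite (cgrp c)" using c unfolding orbifold_chart_def by blast
  \<comment> \<open>\<open>I g\<close> is the interior of the set where \<open>l\<close> agrees with \<open>g\<close>; the union of these sets is dense.\<close>
  define I where "I g = {x \<in> W. \<exists>U. open U \<and> x \<in> U \<and> U \<subseteq> W \<and> (\<forall>y\<in>U. l y = g y)}" for g
  have IW: "I g \<subseteq> W" for g unfolding I_def by blast
  have cl: "continuous_on W l" by (rule smooth_on_imp_continuous_on[OF L(6)])
  have sg: "smooth_on W g" if "g \<in> cgrp c" for g by (rule smooth_on_subset[OF G(2)[OF that] L(2)])
  have cg: "continuous_on W g" if "g \<in> cgrp c" for g by (rule smooth_on_imp_continuous_on[OF sg[OF that]])
  have dense: "\<exists>g\<in>cgrp c. I g \<inter> U \<noteq> {}" if U: "open U" "U \<noteq> {}" "U \<subseteq> W" for U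
  proof -
    have "U \<subseteq> (\<Union>g\<in>cgrp c. {x \<in> W. l x = g x})"
    proof
      fix x assume x: "x \<in> U"
      then have "cmap c x = cmap c (l x)" "x \<in> cdom c" "l x \<in> cdom c" using L(2,8,12) U by (auto simp: subset_iff)
      then have "\<exists>g\<in>cgrp c. l x = g x" using c unfolding orbifold_chart_def by blast
      then show "x \<in> (\<Union>g\<in>cgrp c. {x \<in> W. l x = g x})" using x U by blast
    qed
    moreover have "closedin (top_of_set W) {x \<in> W. l x = g x}" if "g \<in> cgrp c" for g
      using continuous_closedin_preimage_constant[OF continuous_on_diff[OF cl cg[OF that]], of 0] by simp
    ultimately obtain g U' where "g \<in> cgrp c" "open U'" "U' \<noteq> {}" "U' \<subseteq> U" "U' \<subseteq> {x \<in> W. l x = g x}"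
      using finite_closed_cover_interior[OF fin U(1,2), of "\<lambda>g. {x \<in> W. l x = g x}" W] U(3) by blast
    moreover obtain x where "x \<in> U'" using \<open>U' \<noteq> {}\<close> by blast
    ultimately have "x \<in> I g \<inter> U" unfolding I_def by blast
    then show ?thesis using \<open>g \<in> cgrp c\<close> by blast
  qed
  have "u \<in> closure (\<Union>g\<in>cgrp c. I g)"
  proof (rule closure_iff_nhds_not_empty[THEN iffD2], intro allI impI)
    fix A V assume A: "V \<subseteq> A" "open V" "u \<in> V"
    have "\<exists>g\<in>cgrp c. I g \<inter> (V \<inter> W) \<noteq> {}" by (rule dense) (use A u L(1) in auto)
    then show "(\<Union>g\<in>cgrp c. I g) \<inter> A \<noteq> {}" using A by blast
  qed
  moreover have "closure (\<Union>g\<in>cgrp c. I g) = (\<Union>g\<in>cgrp c. closure (I g))"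
    using fin by (induction rule: finite_induct) auto
  ultimately obtain g0 where g0: "g0 \<in> cgrp c" "u \<in> closure (I g0)" by blast
  have jet: "l u = g u \<and> jac l u = jac g u" if g: "g \<in> cgrp c" "u \<in> closure (I g)" for g
  proof
    show "l u = g u" by (rule agree_on_closure[OF cl cg[OF g(1)] IW _ u g(2)]) (auto simp: I_def)
    show "jac l u = jac g u"
    proof (rule agree_on_closure[OF continuous_on_jac[OF L(6)] continuous_on_jac[OF sg[OF g(1)]] IW _ u g(2)])
      fix x assume "x \<in> I g"
      then obtain U where "open U" "x \<in> U" "\<forall>y\<in>U. l y = g y" unfolding I_def by blast
      then show "jac l x = jac g x" using der_cong[of U x l g] by simp
    qed
  qed
  have "\<forall>\<^sub>F x in nhds u. x \<in> I g \<longrightarrow> l x = g0 x" if g: "g \<in> cgrp c" for g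
  proof (cases "u \<in> closure (I g)")
    case True
    have "\<forall>\<^sub>F x in nhds u. g x = g0 x"
      by (rule chart_group_jet[OF c g g0(1)]) (use jet[OF g True] jet[OF g0] u L(2) in auto)
    then show ?thesis by eventually_elim (auto simp: I_def)
  next
    case False
    have "\<forall>\<^sub>F x in nhds u. x \<in> - closure (I g)" by (rule eventually_nhds_in_open) (use False in auto)
    then show ?thesis by eventually_elim (use closure_subset in blast)
  qed
  then have "\<forall>\<^sub>F x in nhds u. \<forall>g\<in>cgrp c. x \<in> I g \<longrightarrow> l x = g0 x" by (intro eventually_ball_finite[OF fin]) blast
  then obtain U where U: "open U" "u \<in> U" "\<And>x g. x \<in> U \<Longrightarrow> g \<in> cgrp c \<Longrightarrow> x \<in> I g \<Longrightarrow> l x = g0 x"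
    unfolding eventually_nhds by blast
  have "l x = g0 x" if x: "x \<in> U \<inter> W" for x
  proof (rule agree_on_closure[OF cl cg[OF g0(1)]])
    show "(\<Union>g\<in>cgrp c. I g) \<inter> U \<subseteq> W" using IW by blast
    show "l y = g0 y" if "y \<in> (\<Union>g\<in>cgrp c. I g) \<inter> U" for y using U(3) that by blast
    show "x \<in> W" using x by blast
    show "x \<in> closure ((\<Union>g\<in>cgrp c. I g) \<inter> U)"
    proof (rule closure_iff_nhds_not_empty[THEN iffD2], intro allI impI)
      fix A V assume A: "V \<subseteq> A" "open V" "x \<in> V"
      have "\<exists>g\<in>cgrp c. I g \<inter> (V \<inter> U \<inter> W) \<noteq> {}" by (rule dense) (use A x U(1) L(1) in auto)
      then show "(\<Union>g\<in>cgrp c. I g) \<inter> U \<inter> A \<noteq> {}" using A by blast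
    qed
  qed
  moreover have "\<forall>\<^sub>F x in nhds u. x \<in> U \<inter> W" by (rule eventually_nhds_in_open) (use U L(1) u in auto)
  ultimately have "\<forall>\<^sub>F x in nhds u. l x = g0 x" by (auto elim: eventually_mono)
  then show ?thesis using g0 jet[OF g0] by blast
qed

text \<open>Two lifts of the same map with the same 1-jet differ by a change of charts with trivial 1-jet.\<close>

lemma local_lift_jet:
  fixes c d :: "('n::finite, 'x) chart"
  assumes c: "orbifold_chart S c" and h: "inj_on h (cmap c ` cdom c)"
    and l: "local_lift h c d W l" and l': "local_lift h c d W' l'"
    and u: "u \<in> W" "u \<in> W'" "l u = l' u" "jac l u = jac l' u"
  shows "\<exists>U. open U \<and> u \<in> U \<and> U \<subseteq> W \<and> U \<subseteq> W' \<and> (\<forall>x\<in>U. l x = l' x)"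
proof -
  note L = local_liftD[OF l] and L' = local_liftD[OF l']
  define W0 where "W0 = W \<inter> l -` (l' ` W')"
  have W0: "open W0" unfolding W0_def
    by (rule continuous_open_preimage[OF smooth_on_imp_continuous_on[OF L(6)] L(1) L'(5)])
  have u0: "u \<in> W0" unfolding W0_def using u by auto
  define m where "m = restrict (inv_into W' l') (l' ` W')"
  define k where "k = inv_into (cmap c ` cdom c) h"
  have k: "k (h (cmap c x)) = cmap c x" if "x \<in> cdom c" for x unfolding k_def using h that by simp
  have m: "local_lift k d c (l' ` W') m" unfolding m_def
    by (rule local_lift_inverse(1)[OF l']) (use k L'(2) in auto)
  note M = local_liftD[OF m]
  have r: "local_lift h c d W0 (restrict l W0)" by (rule local_lift_restrict[OF l W0]) (auto simp: W0_def)
  define q where "q = compose W0 m (restrict l W0)"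
  have q: "local_lift (\<lambda>x. k (h x)) c c W0 q" unfolding q_def
    by (rule local_lift_compose[OF r m]) (auto simp: W0_def)
  then have q: "local_lift (\<lambda>x. x) c c W0 q" using k local_lift_cong[of c "\<lambda>x. k (h x)" "\<lambda>x. x" c W0 q] by blast
  have qx: "q x = m (l x)" if "x \<in> W0" for x unfolding q_def using that by (simp add: compose_def)
  have ml': "m (l' x) = x" if "x \<in> W'" for x unfolding m_def using L'(9) that by simp
  have "jac q u = jac m (l u) ** jac l u"
    by (rule jac_compose[OF L(6) u(1) M(6) _ W0 u0 qx]) (use u in auto)
  moreover have "jac (\<lambda>x. m (l' x)) u = jac m (l' u) ** jac l' u"
    by (rule jac_compose[OF L'(6) u(2) M(6) _ L'(1) u(2)]) (use u in auto)
  moreover have "jac (\<lambda>x. m (l' x)) u = mat 1" by (rule jac_identity[OF L'(1) u(2) ml'])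
  ultimately have jq: "jac q u = mat 1" using u by simp
  obtain g where g: "g \<in> cgrp c" "\<forall>\<^sub>F x in nhds u. q x = g x" "q u = g u" "jac q u = jac g u"
    using change_of_charts_is_group_element[OF c q u0] by blast
  have "\<forall>\<^sub>F x in nhds u. g x = x"
    by (rule chart_group_identity_jet[OF c g(1)]) (use g jq qx[OF u0] u ml' L(2) in auto)
  moreover have "\<forall>\<^sub>F x in nhds u. x \<in> W0 \<inter> W'" by (rule eventually_nhds_in_open) (use W0 u0 u L'(1) in auto)
  ultimately have "\<forall>\<^sub>F x in nhds u. x \<in> W0 \<and> x \<in> W' \<and> l x = l' x"
    using g(2)
  proof eventually_elim
    case (elim x)
    then have "m (l x) = x" "l x \<in> l' ` W'" using qx[of x] by (auto simp: W0_def)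
    then have "l' x = l x" unfolding m_def using L'(11) by auto
    then show ?case using elim by simp
  qed
  then obtain U where "open U" "u \<in> U" "\<And>x. x \<in> U \<Longrightarrow> x \<in> W0 \<and> x \<in> W' \<and> l x = l' x"
    unfolding eventually_nhds by blast
  then show ?thesis unfolding W0_def by (intro exI[of _ U]) blast
qed

section \<open>The group of deck transformations\<close>

lemma effective_orbifoldD:
  assumes "effective_orbifold Y"
  shows "\<And>c. c \<in> charts Y \<Longrightarrow> orbifold_chart (ospace Y) c"
    and "\<And>c u. c \<in> charts Y \<Longrightarrow> u \<in> cdom c \<Longrightarrow> cmap c u \<in> topspace (ospace Y)"
    and "\<And>y. y \<in> topspace (ospace Y) \<Longrightarrow> \<exists>c\<in>charts Y. \<exists>u\<in>cdom c. cmap c u = y"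
    and "\<And>c d. c \<in> charts Y \<Longrightarrow> d \<in> charts Y \<Longrightarrow> lifts_locally (\<lambda>y. y) c d"
    and "\<And>c. c \<in> charts Y \<Longrightarrow> open (cdom c)"
proof -
  show "orbifold_chart (ospace Y) c" if "c \<in> charts Y" for c using assms that unfolding effective_orbifold_def by blast
  then show "open (cdom c)" if "c \<in> charts Y" for c using that unfolding orbifold_chart_def by blast
  have eq: "(\<Union>c\<in>charts Y. cimg c) = topspace (ospace Y)" using assms unfolding effective_orbifold_def by blast
  show "cmap c u \<in> topspace (ospace Y)" if "c \<in> charts Y" "u \<in> cdom c" for c u using eq that by blast
  show "\<exists>c\<in>charts Y. \<exists>u\<in>cdom c. cmap c u = y" if "y \<in> topspace (ospace Y)" for y
    using that unfolding eq[symmetric] by blast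
  show "lifts_locally (\<lambda>y. y) c d" if "c \<in> charts Y" "d \<in> charts Y" for c d
    using assms that unfolding effective_orbifold_def by blast
qed

lemma lifts_locally_cong:
  assumes "\<And>u. u \<in> cdom c \<Longrightarrow> h (cmap c u) = k (cmap c u)"
  shows "lifts_locally h c d \<longleftrightarrow> lifts_locally k c d"
proof -
  have "local_lift h c d W l = local_lift k c d W l" for W l by (rule local_lift_cong) (rule assms)
  then show ?thesis unfolding lifts_locally_def using assms by auto
qed

lemma orbifold_automorphism_cong:
  assumes Y: "effective_orbifold Y" and hk: "\<And>y. y \<in> topspace (ospace Y) \<Longrightarrow> h y = k y"
    and "orbifold_automorphism Y h"
  shows "orbifold_automorphism Y k"
proof -
  have "lifts_locally h c d = lifts_locally k c d" if "c \<in> charts Y" for c d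
    by (rule lifts_locally_cong) (use hk effective_orbifoldD(2)[OF Y that] in blast)
  moreover have "homeomorphic_map (ospace Y) (ospace Y) k"
    by (rule homeomorphic_map_eq[OF _ hk]) (use assms(3) in \<open>simp add: orbifold_automorphism_def\<close>)
  ultimately show ?thesis using assms(3) unfolding orbifold_automorphism_def by simp
qed

lemma orbifold_automorphism_id:
  "effective_orbifold Y \<Longrightarrow> orbifold_automorphism Y (\<lambda>y. y)"
  unfolding orbifold_automorphism_def using effective_orbifoldD(4)[of Y]
  by (simp add: homeomorphic_map_id[unfolded id_def])

lemma orbifold_automorphism_compose:
  assumes Y: "effective_orbifold Y" and h: "orbifold_automorphism Y h" and k: "orbifold_automorphism Y k"
  shows "orbifold_automorphism Y (\<lambda>y. k (h y))"
  unfolding orbifold_automorphism_def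
proof (intro conjI ballI)
  show "homeomorphic_map (ospace Y) (ospace Y) (\<lambda>y. k (h y))"
    using homeomorphic_map_compose[of "ospace Y" "ospace Y" h "ospace Y" k] h k
    unfolding orbifold_automorphism_def o_def by blast
  fix c d assume c: "c \<in> charts Y" and d: "d \<in> charts Y"
  show "lifts_locally (\<lambda>y. k (h y)) c d"
    unfolding lifts_locally_def
  proof (intro ballI impI)
    fix u v assume u: "u \<in> cdom c" and v: "v \<in> cdom d" and eq: "cmap d v = k (h (cmap c u))"
    have "h (cmap c u) \<in> topspace (ospace Y)"
      using h effective_orbifoldD(2)[OF Y c u] homeomorphic_imp_surjective_map
      unfolding orbifold_automorphism_def by blast
    then obtain b w where b: "b \<in> charts Y" "w \<in> cdom b" "cmap b w = h (cmap c u)"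
      using effective_orbifoldD(3)[OF Y] by blast
    obtain W l where l: "local_lift h c b W l" "u \<in> W" "l u = w"
      using h c b u unfolding orbifold_automorphism_def lifts_locally_def by blast
    obtain V m where m: "local_lift k b d V m" "w \<in> V" "m w = v"
      using k b d v eq unfolding orbifold_automorphism_def lifts_locally_def by metis
    note L = local_liftD[OF l(1)] and M = local_liftD[OF m(1)]
    define W' where "W' = W \<inter> l -` V"
    have W': "open W'" unfolding W'_def
      by (rule continuous_open_preimage[OF smooth_on_imp_continuous_on[OF L(6)] L(1) M(1)])
    have "local_lift h c b W' (restrict l W')"
      by (rule local_lift_restrict[OF l(1) W']) (auto simp: W'_def)
    then have "local_lift (\<lambda>y. k (h y)) c d W' (compose W' m (restrict l W'))"
      by (rule local_lift_compose[OF _ m(1)]) (auto simp: W'_def)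
    moreover have "u \<in> W'" using l m unfolding W'_def by simp
    moreover have "compose W' m (restrict l W') u = v" using \<open>u \<in> W'\<close> l m by (simp add: compose_def)
    ultimately show "\<exists>W l. local_lift (\<lambda>y. k (h y)) c d W l \<and> u \<in> W \<and> l u = v" by blast
  qed
qed

lemma orbifold_automorphism_inverse:
  assumes Y: "effective_orbifold Y" and h: "orbifold_automorphism Y h"
  shows "orbifold_automorphism Y (inv_into (topspace (ospace Y)) h)"
    and "bij_betw h (topspace (ospace Y)) (topspace (ospace Y))"
proof -
  let ?S = "topspace (ospace Y)" and ?k = "inv_into (topspace (ospace Y)) h"
  have hm: "homeomorphic_map (ospace Y) (ospace Y) h" using h unfolding orbifold_automorphism_def by blast
  show bij: "bij_betw h ?S ?S"
    using hm homeomorphic_imp_surjective_map homeomorphic_imp_injective_map unfolding bij_betw_def by blast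
  have inv: "?k (h y) = y" "?k y \<in> ?S" "h (?k y) = y" if "y \<in> ?S" for y
    using bij that by (auto simp: bij_betw_def inv_into_into f_inv_into_f)
  obtain g where g: "homeomorphic_maps (ospace Y) (ospace Y) h g" using hm homeomorphic_map_maps by blast
  have "g y = ?k y" if "y \<in> ?S" for y
  proof -
    have "h (g y) = y" "g y \<in> ?S" using g that by (auto simp: homeomorphic_maps_def continuous_map_def)
    then show ?thesis using inv(1) by metis
  qed
  then have "homeomorphic_map (ospace Y) (ospace Y) ?k"
    using homeomorphic_map_eq g homeomorphic_maps_map by blast
  moreover have "lifts_locally ?k c d" if c: "c \<in> charts Y" and d: "d \<in> charts Y" for c d
    unfolding lifts_locally_def
  proof (intro ballI impI)
    fix u v assume u: "u \<in> cdom c" and v: "v \<in> cdom d" and eq: "cmap d v = ?k (cmap c u)"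
    have "cmap c u = h (cmap d v)" using eq inv effective_orbifoldD(2)[OF Y c u] by metis
    then obtain W l where l: "local_lift h d c W l" "v \<in> W" "l v = u"
      using h c d u v unfolding orbifold_automorphism_def lifts_locally_def by metis
    have "local_lift ?k c d (l ` W) (restrict (inv_into W l) (l ` W))"
      by (rule local_lift_inverse(1)[OF l(1)])
        (use inv effective_orbifoldD(2)[OF Y d] local_liftD(2)[OF l(1)] in blast)
    moreover have "u \<in> l ` W" using l by blast
    moreover have "restrict (inv_into W l) (l ` W) u = v" using l local_liftD(9)[OF l(1)] by auto
    ultimately show "\<exists>W l. local_lift ?k c d W l \<and> u \<in> W \<and> l u = v" by blast
  qed
  ultimately show "orbifold_automorphism Y ?k" unfolding orbifold_automorphism_def by blast
qed

lemma group_deck_group: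
  assumes Y: "effective_orbifold Y"
  shows "group (deck_group Y p)"
proof -
  let ?S = "topspace (ospace Y)" and ?H = "deck_group Y p"
  have carr: "h \<in> carrier ?H \<longleftrightarrow> h \<in> extensional ?S \<and> orbifold_automorphism Y h \<and> (\<forall>y\<in>?S. p (h y) = p y)" for h
    unfolding deck_group_def by simp
  have mult: "h \<otimes>\<^bsub>?H\<^esub> k = compose ?S h k" and one: "\<one>\<^bsub>?H\<^esub> = restrict id ?S" for h k
    unfolding deck_group_def by simp_all
  have maps: "h y \<in> ?S" if "h \<in> carrier ?H" "y \<in> ?S" for h y
    using orbifold_automorphism_inverse(2)[OF Y] carr that bij_betwE by metis
  show ?thesis
  proof (rule groupI)
    fix h k assume h: "h \<in> carrier ?H" and k: "k \<in> carrier ?H"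
    have "orbifold_automorphism Y (compose ?S h k)"
      by (rule orbifold_automorphism_cong[OF Y _ orbifold_automorphism_compose[OF Y, of k h]])
        (use h k carr in \<open>auto simp: compose_def\<close>)
    then show "h \<otimes>\<^bsub>?H\<^esub> k \<in> carrier ?H"
      unfolding carr mult using h k maps[OF k] by (auto simp: carr compose_def)
  next
    have "orbifold_automorphism Y (restrict id ?S)"
      by (rule orbifold_automorphism_cong[OF Y _ orbifold_automorphism_id[OF Y]]) simp
    then show "\<one>\<^bsub>?H\<^esub> \<in> carrier ?H" unfolding carr one by simp
  next
    fix h k j assume h: "h \<in> carrier ?H" and k: "k \<in> carrier ?H" and j: "j \<in> carrier ?H"
    show "h \<otimes>\<^bsub>?H\<^esub> k \<otimes>\<^bsub>?H\<^esub> j = h \<otimes>\<^bsub>?H\<^esub> (k \<otimes>\<^bsub>?H\<^esub> j)"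
      unfolding mult using maps[OF j] by (auto simp: compose_def)
  next
    fix h assume h: "h \<in> carrier ?H"
    show "\<one>\<^bsub>?H\<^esub> \<otimes>\<^bsub>?H\<^esub> h = h"
      unfolding mult one using maps[OF h] h carr by (auto simp: compose_def extensional_def)
    let ?k = "restrict (inv_into ?S h) ?S"
    have bij: "bij_betw h ?S ?S" using orbifold_automorphism_inverse(2)[OF Y] h carr by blast
    have "orbifold_automorphism Y ?k"
      by (rule orbifold_automorphism_cong[OF Y _ orbifold_automorphism_inverse(1)[OF Y]])
        (use h carr in auto)
    moreover have "p (?k y) = p y" if "y \<in> ?S" for y
    proof -
      have "?k y \<in> ?S" "h (?k y) = y" using bij that by (auto simp: bij_betw_def inv_into_into f_inv_into_f)
      then show ?thesis using h carr by metis
    qed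
    ultimately have "?k \<in> carrier ?H" unfolding carr by simp
    moreover have "?k \<otimes>\<^bsub>?H\<^esub> h = \<one>\<^bsub>?H\<^esub>"
    proof
      fix y show "(?k \<otimes>\<^bsub>?H\<^esub> h) y = \<one>\<^bsub>?H\<^esub> y"
        unfolding mult one using bij maps[OF h, of y] by (auto simp: compose_def bij_betw_def)
    qed
    ultimately show "\<exists>k\<in>carrier ?H. k \<otimes>\<^bsub>?H\<^esub> h = \<one>\<^bsub>?H\<^esub>" by blast
  qed
qed

section \<open>Orthonormal frames\<close>

definition inner_product_form :: "(real^'n::finite \<Rightarrow> real^'n \<Rightarrow> real) \<Rightarrow> bool" where
  "inner_product_form B \<longleftrightarrow> bilinear B \<and> (\<forall>v w. B v w = B w v) \<and> (\<forall>v. v \<noteq> 0 \<longrightarrow> B v v > 0)"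

lemma bilinear_form_expansion:
  assumes "bilinear B"
  shows "B v w = (\<Sum>i\<in>UNIV. \<Sum>j\<in>UNIV. v $ i * w $ j * B (axis i 1) (axis j (1::real)))"
proof -
  have l: "linear (\<lambda>v. B v w)" "linear (\<lambda>w. B v w)" for v w using assms unfolding bilinear_def by auto
  have e: "v = (\<Sum>i\<in>UNIV. v $ i *\<^sub>R axis i (1::real))" for v :: "real^'c"
    by (simp add: vec_eq_iff axis_def if_distrib[of "\<lambda>x. _ * x"] cong: if_cong)
  have "B v w = (\<Sum>i\<in>UNIV. v $ i * B (axis i 1) w)"
    by (subst e[of v]) (simp add: linear_sum[OF l(1)] linear_scale[OF l(1)])
  moreover have "B (axis i 1) w = (\<Sum>j\<in>UNIV. w $ j * B (axis i 1) (axis j 1))" for i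
    by (subst e[of w]) (simp add: linear_sum[OF l(2)] linear_scale[OF l(2)])
  ultimately show ?thesis by (simp add: sum_distrib_left mult.assoc)
qed

lemma continuous_on_bilinear_form:
  fixes B :: "'a::topological_space \<Rightarrow> real^'n::finite \<Rightarrow> real^'n \<Rightarrow> real"
  assumes "\<And>u. u \<in> U \<Longrightarrow> bilinear (B u)" "\<And>v w. continuous_on U (\<lambda>u. B u v w)"
    and "continuous_on Z f" "f ` Z \<subseteq> U" "continuous_on Z v" "continuous_on Z w"
  shows "continuous_on Z (\<lambda>z. B (f z) (v z) (w z))"
proof -
  have "continuous_on Z (\<lambda>z. B (f z) x y)" for x y
    using continuous_on_compose2[OF assms(2,3,4)] .
  then have c: "continuous_on Z (\<lambda>z. \<Sum>i\<in>UNIV. \<Sum>j\<in>UNIV. v z $ i * w z $ j * B (f z) (axis i 1) (axis j 1))"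
    by (intro continuous_intros assms(5,6))
  have eq: "B (f z) (v z) (w z) =
      (\<Sum>i\<in>UNIV. \<Sum>j\<in>UNIV. v z $ i * w z $ j * B (f z) (axis i 1) (axis j 1))" if "z \<in> Z" for z
    by (rule bilinear_form_expansion) (use assms(1,4) that in blast)
  show ?thesis by (rule continuous_on_eq[OF c eq[symmetric]])
qed

text \<open>The Gram--Schmidt process, applied to the standard basis, depends continuously on the form.
  That the vectors obtained from \<open>S\<close> have vanishing coordinates outside \<open>S\<close> shows that the next
  vector to be normalized is nonzero.\<close>

lemma gram_schmidt:
  fixes B :: "'a::topological_space \<Rightarrow> real^'n::finite \<Rightarrow> real^'n \<Rightarrow> real" and S :: "'n set"
  assumes B: "\<And>u. u \<in> U \<Longrightarrow> inner_product_form (B u)" and cont: "\<And>v w. continuous_on U (\<lambda>u. B u v w)"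
  shows "\<exists>e :: 'n \<Rightarrow> 'a \<Rightarrow> real^'n. (\<forall>i\<in>S. continuous_on U (e i)) \<and>
     (\<forall>u\<in>U. \<forall>i\<in>S. (\<forall>j\<in>S. B u (e i u) (e j u) = (if i = j then 1 else 0)) \<and> (\<forall>k. k \<notin> S \<longrightarrow> e i u $ k = 0))"
proof -
  have "finite S" by simp
  then show ?thesis
  proof (induction S rule: finite_induct)
    case (insert a S)
    obtain e :: "'n \<Rightarrow> 'a \<Rightarrow> real^'n" where e: "\<And>i. i \<in> S \<Longrightarrow> continuous_on U (e i)"
        "\<And>u i j. u \<in> U \<Longrightarrow> i \<in> S \<Longrightarrow> j \<in> S \<Longrightarrow> B u (e i u) (e j u) = (if i = j then 1 else 0)"
        "\<And>u i k. u \<in> U \<Longrightarrow> i \<in> S \<Longrightarrow> k \<notin> S \<Longrightarrow> e i u $ k = 0"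
      using insert.IH by blast
    have bil: "bilinear (B u)" if "u \<in> U" for u using B that unfolding inner_product_form_def by blast
    have sym: "B u v w = B u w v" if "u \<in> U" for u v w using B that unfolding inner_product_form_def by blast
    define w where "w u = axis a 1 - (\<Sum>j\<in>S. B u (e j u) (axis a 1) *\<^sub>R e j u)" for u
    define r where "r u = sqrt (B u (w u) (w u))" for u
    define e' where "e' = e(a := \<lambda>u. (1 / r u) *\<^sub>R w u)"
    have contw: "continuous_on U w" unfolding w_def
      by (intro continuous_intros continuous_on_bilinear_form[OF bil cont _ _ e(1)] e(1)) auto
    then have contr: "continuous_on U r" unfolding r_def
      by (intro continuous_intros continuous_on_bilinear_form[OF bil cont]) auto
    have wk: "w u $ k = (if k = a then 1 else 0)" if "u \<in> U" "k \<notin> S" for u k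
      unfolding w_def using e(3)[OF that(1) _ that(2)] by (simp add: axis_def)
    have pos: "B u (w u) (w u) > 0" if "u \<in> U" for u
    proof -
      have "w u \<noteq> 0" using wk[OF that insert.hyps(2)] by (metis zero_index zero_neq_one)
      then show ?thesis using B that unfolding inner_product_form_def by blast
    qed
    then have rpos: "r u > 0" "r u * r u = B u (w u) (w u)" if "u \<in> U" for u
      unfolding r_def using that by (auto simp: less_imp_le)
    have orth: "B u (w u) (e j u) = 0" if u: "u \<in> U" and j: "j \<in> S" for u j
    proof -
      have l: "linear (\<lambda>v. B u v x)" for x using bil[OF u] unfolding bilinear_def by auto
      have "B u (w u) (e j u) = B u (axis a 1) (e j u) - (\<Sum>i\<in>S. B u (e i u) (axis a 1) * B u (e i u) (e j u))"
        unfolding w_def by (simp add: linear_diff[OF l] linear_sum[OF l] linear_scale[OF l])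
      also have "(\<Sum>i\<in>S. B u (e i u) (axis a 1) * B u (e i u) (e j u)) = (\<Sum>i\<in>S. if i = j then B u (e i u) (axis a 1) else 0)"
        by (rule sum.cong) (use e(2)[OF u _ j] in auto)
      also have "\<dots> = B u (e j u) (axis a 1)" using insert.hyps(1) j by simp
      finally show ?thesis using sym[OF u] by simp
    qed
    have sc: "B u (x *\<^sub>R v) y = x * B u v y" "B u y (x *\<^sub>R v) = x * B u y v" if "u \<in> U" for u x v y
      using bil[OF that] by (auto simp: bilinear_lmul bilinear_rmul)
    have 1: "continuous_on U (e' i)" if "i \<in> insert a S" for i
    proof (cases "i = a")
      case True
      have "\<forall>u\<in>U. r u \<noteq> 0" using rpos(1) by force
      then show ?thesis unfolding e'_def True by (simp add: continuous_intros contw contr)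
    next
      case False
      then show ?thesis unfolding e'_def using e(1) that by simp
    qed
    have 2: "B u (e' i u) (e' j u) = (if i = j then 1 else 0)"
      if u: "u \<in> U" and ij: "i \<in> insert a S" "j \<in> insert a S" for u i j
    proof -
      have "r u \<noteq> 0" "B u (w u) (w u) = r u * r u" using rpos[OF u] by auto
      then show ?thesis
        using ij e(2)[OF u] orth[OF u] sym[OF u] insert.hyps(2) unfolding e'_def by (auto simp: sc[OF u])
    qed
    have 3: "e' i u $ k = 0" if "u \<in> U" "i \<in> insert a S" "k \<notin> insert a S" for u i k
      using e(3) wk that unfolding e'_def by auto
    show ?case using 1 2 3 by (intro exI[of _ e']) blast
  qed auto
qed

text \<open>The matrix that turns the frame \<open>A\<close> into the frame \<open>A'\<close>.  Its entries are inner products of frame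
  vectors, so it depends continuously on both frames.\<close>

definition frame_transition :: "(real^'n \<Rightarrow> real^'n \<Rightarrow> real) \<Rightarrow> real^'n^'n \<Rightarrow> real^'n^'n \<Rightarrow> real^'n^'n::finite" where
  "frame_transition B A A' = (\<chi> j i. B (A *v axis i 1) (A' *v axis j 1))"

lemma orthogonal_matrix_iff_inner:
  fixes R :: "real^'n::finite^'n"
  shows "orthogonal_matrix R \<longleftrightarrow> (\<forall>v w. (R *v v) \<bullet> (R *v w) = v \<bullet> w)"
proof -
  have "orthogonal_matrix R \<longleftrightarrow> orthogonal_transformation ((*v) R)"
    using orthogonal_transformation_matrix[of "(*v) R"] by simp
  then show ?thesis unfolding orthogonal_transformation_def by simp
qed

lemma frame_invertible:
  assumes "inner_product_form B" "\<forall>v w. B (A *v v) (A *v w) = v \<bullet> w"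
  shows "invertible (A :: real^'n::finite^'n)"
proof -
  have "v = 0" if "A *v v = 0" for v
  proof -
    have "B 0 0 = 0" using assms(1) unfolding inner_product_form_def by (metis bilinear_lzero)
    then have "v \<bullet> v = 0" using assms(2) that by metis
    then show ?thesis by simp
  qed
  then show ?thesis using matrix_left_invertible_ker invertible_left_inverse by blast
qed

lemma frame_transition:
  fixes A A' :: "real^'n::finite^'n"
  assumes B: "inner_product_form B" and A: "\<forall>v w. B (A *v v) (A *v w) = v \<bullet> w"
    and A': "\<forall>v w. B (A' *v v) (A' *v w) = v \<bullet> w"
  shows "orthogonal_matrix (frame_transition B A A')" "A ** transpose (frame_transition B A A') = A'"
proof -
  obtain A2 where A2: "A ** A2 = mat 1" using frame_invertible[OF B A] unfolding invertible_def by blast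
  define R where "R = A2 ** A'"
  have AR: "A ** R = A'" unfolding R_def by (simp add: matrix_mul_assoc A2)
  have "(R *v v) \<bullet> (R *v w) = v \<bullet> w" for v w
    using A A' AR by (metis matrix_vector_mul_assoc)
  then have oR: "orthogonal_matrix R" unfolding orthogonal_matrix_iff_inner by blast
  have "R $ i $ j = B (A *v axis i 1) (A' *v axis j 1)" for i j
  proof -
    have "R $ i $ j = axis i 1 \<bullet> (R *v axis j 1)"
      by (simp add: inner_axis' matrix_vector_mul_component row_def inner_axis)
    also have "\<dots> = B (A *v axis i 1) (A *v (R *v axis j 1))" using A by simp
    also have "A *v (R *v axis j 1) = A' *v axis j 1" by (simp add: matrix_vector_mul_assoc AR)
    finally show ?thesis .
  qed
  then have "frame_transition B A A' = transpose R"
    unfolding frame_transition_def transpose_def by (simp add: vec_eq_iff)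
  then show "orthogonal_matrix (frame_transition B A A')" "A ** transpose (frame_transition B A A') = A'"
    using oR AR by (simp_all add: orthogonal_matrix_transpose)
qed

lemma continuous_map_into_euclidean_compose:
  assumes "continuous_map Z euclidean f" "f \<in> topspace Z \<rightarrow> S" "continuous_on S g"
  shows "continuous_map Z euclidean (\<lambda>z. g (f z))"
proof -
  have "continuous_map Z (top_of_set S) f" using assms(1,2) by (simp add: continuous_map_in_subtopology)
  moreover have "continuous_map (top_of_set S) euclidean g" using assms(3) by simp
  ultimately show ?thesis by (rule continuous_map_app)
qed

lemma continuous_map_euclidean_pair:
  assumes "continuous_map Z euclidean f" "continuous_map Z euclidean g"
  shows "continuous_map Z euclidean (\<lambda>z. (f z, g z))"
  using continuous_map_pairedI[OF assms] by simp

lemma continuous_map_euclidean_fst: "continuous_map Z euclidean f \<Longrightarrow> continuous_map Z euclidean (\<lambda>z. fst (f z))"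
  by (rule continuous_map_into_euclidean_compose[where S = UNIV]; auto intro: continuous_intros)+

lemma continuous_on_matrix_mult:
  fixes f :: "'a::topological_space \<Rightarrow> real^'m::finite^'k::finite" and g :: "'a \<Rightarrow> real^'n::finite^'m"
  assumes "continuous_on S f" "continuous_on S g"
  shows "continuous_on S (\<lambda>x. f x ** g x)"
  unfolding matrix_matrix_mult_def by (intro continuous_intros assms)

lemma continuous_on_transpose:
  fixes f :: "'a::topological_space \<Rightarrow> real^'m::finite^'k::finite"
  assumes "continuous_on S f"
  shows "continuous_on S (\<lambda>x. transpose (f x))"
  unfolding transpose_def by (intro continuous_intros assms)

section \<open>Frames as classes of representatives\<close>

text \<open>The relation on representatives of frames that underlies \<open>frame_push\<close>: a class of frames is a
  class modulo the steps over the identity, and \<open>h\<close> acts on classes by the steps over \<open>h\<close>.\<close>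

definition jet_step :: "('n::finite, 'x) orbifold \<Rightarrow> ('x \<Rightarrow> 'x) \<Rightarrow>
    ('n, 'x) chart \<times> (real^'n) \<times> (real^'n^'n) \<Rightarrow> ('n, 'x) chart \<times> (real^'n) \<times> (real^'n^'n) \<Rightarrow> bool" where
  "jet_step Y h t t' \<longleftrightarrow> (\<exists>c u A d W l. t = (c, u, A) \<and> t' = (d, l u, jac l u ** A) \<and>
      c \<in> charts Y \<and> d \<in> charts Y \<and> local_lift h c d W l \<and> u \<in> W)"

definition lift_frame :: "(real^'n \<Rightarrow> real^'n) \<Rightarrow> (real^'n) \<times> (real^'n^'n) \<Rightarrow> (real^'n) \<times> (real^'n^'n::finite)" where
  "lift_frame l = (\<lambda>(u, A). (l u, jac l u ** A))"

definition rotate_frame :: "real^'n^'n \<Rightarrow> (real^'n) \<times> (real^'n^'n) \<Rightarrow> (real^'n) \<times> (real^'n^'n::finite)" where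
  "rotate_frame Q = (\<lambda>(u, A). (u, A ** transpose Q))"

lemma jet_stepI:
  "c \<in> charts Y \<Longrightarrow> d \<in> charts Y \<Longrightarrow> local_lift h c d W l \<Longrightarrow> fst p \<in> W \<Longrightarrow> jet_step Y h (c, p) (d, lift_frame l p)"
  unfolding jet_step_def lift_frame_def by (cases p) auto

lemma jet_stepE:
  assumes "jet_step Y h (c, p) (d, q)"
  obtains W l where "c \<in> charts Y" "d \<in> charts Y" "local_lift h c d W l" "fst p \<in> W" "q = lift_frame l p"
  using assms unfolding jet_step_def lift_frame_def by auto

lemma frame_push_eq: "frame_push Y h \<xi> = {t'. \<exists>t\<in>\<xi>. jet_step Y h t t'}"
  unfolding frame_push_def jet_step_def by blast

lemma frame_class_eq: "frame_class Y c p = {t'. jet_step Y (\<lambda>y. y) (c, p) t'}"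
  unfolding frame_class_def by (cases p) (simp add: frame_push_eq)

lemma frame_rotate_eq: "frame_rotate Q \<xi> = (\<lambda>(c, p). (c, rotate_frame Q p)) ` \<xi>"
  unfolding frame_rotate_def rotate_frame_def by (simp add: case_prod_unfold)

lemma fst_rotate_frame [simp]: "fst (rotate_frame Q p) = fst p"
  unfolding rotate_frame_def by (cases p) auto

lemma fst_lift_frame [simp]: "fst (lift_frame l p) = l (fst p)"
  unfolding lift_frame_def by (cases p) auto

lemma rotate_rotate: "rotate_frame Q (rotate_frame Q' p) = rotate_frame (Q ** Q') p"
  unfolding rotate_frame_def by (cases p) (simp add: matrix_transpose_mul matrix_mul_assoc)

lemma rotate_one [simp]: "rotate_frame (mat 1) p = p"
  unfolding rotate_frame_def by (cases p) simp

lemma rotate_lift: "rotate_frame Q (lift_frame l p) = lift_frame l (rotate_frame Q p)"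
  unfolding rotate_frame_def lift_frame_def by (cases p) (simp add: matrix_mul_assoc)

lemma jet_step_charts: "jet_step Y h (c, p) (d, q) \<Longrightarrow> c \<in> charts Y \<and> d \<in> charts Y"
  unfolding jet_step_def by auto

lemma jet_step_rotate:
  "jet_step Y h (c, p) (d, q) \<Longrightarrow> jet_step Y h (c, rotate_frame Q p) (d, rotate_frame Q q)"
  by (erule jet_stepE) (auto simp: rotate_lift intro!: jet_stepI)

lemma jet_step_cong:
  assumes "effective_orbifold Y" "\<And>y. y \<in> topspace (ospace Y) \<Longrightarrow> h y = k y"
  shows "jet_step Y h t t' \<longleftrightarrow> jet_step Y k t t'"
proof -
  have "local_lift h c d W l = local_lift k c d W l" if "c \<in> charts Y" for c d W l
    by (rule local_lift_cong) (use assms effective_orbifoldD(2)[OF assms(1) that] in blast)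
  then show ?thesis unfolding jet_step_def by metis
qed

lemma jet_step_refl:
  assumes Y: "effective_orbifold Y" and "c \<in> charts Y" "fst p \<in> cdom c"
  shows "jet_step Y (\<lambda>y. y) (c, p) (c, p)"
proof -
  note op = effective_orbifoldD(5)[OF Y assms(2)]
  have l: "local_lift (\<lambda>y. y) c c (cdom c) (restrict id (cdom c))" by (rule local_lift_id[OF op]) simp
  have "jac (restrict id (cdom c)) (fst p) = mat 1" by (rule jac_identity[OF op assms(3)]) simp
  then have "lift_frame (restrict id (cdom c)) p = p" unfolding lift_frame_def using assms(3) by (cases p) simp
  then show ?thesis using jet_stepI[OF assms(2,2) l assms(3)] by simp
qed

lemma lift_frame_compose:
  fixes b c d :: "('n::finite, 'x) chart"
  assumes l: "local_lift h b c W l" and m: "local_lift k c d V m" and p: "fst p \<in> W" "l (fst p) \<in> V"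
  obtains W' where "open W'" "W' \<subseteq> W" "l ` W' \<subseteq> V" "fst p \<in> W'" "local_lift h b c W' (restrict l W')"
    "local_lift (\<lambda>x. k (h x)) b d W' (compose W' m l)"
    "lift_frame (compose W' m l) p = lift_frame m (lift_frame l p)"
proof -
  note L = local_liftD[OF l] and M = local_liftD[OF m]
  define W' where "W' = W \<inter> l -` V"
  have W': "open W'" unfolding W'_def
    by (rule continuous_open_preimage[OF smooth_on_imp_continuous_on[OF L(6)] L(1) M(1)])
  have sub: "W' \<subseteq> W" "l ` W' \<subseteq> V" and pW: "fst p \<in> W'" using p unfolding W'_def by auto
  have r: "local_lift h b c W' (restrict l W')" by (rule local_lift_restrict[OF l W' sub(1)])
  have "local_lift (\<lambda>x. k (h x)) b d W' (compose W' m (restrict l W'))"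
    by (rule local_lift_compose[OF r m]) (use sub in auto)
  moreover have "compose W' m (restrict l W') = compose W' m l" by (auto simp: compose_def)
  moreover have "jac (compose W' m l) (fst p) = jac m (l (fst p)) ** jac l (fst p)"
    by (rule jac_compose[OF L(6) p(1) M(6) p(2) W' pW]) (simp add: compose_def)
  then have "lift_frame (compose W' m l) p = lift_frame m (lift_frame l p)"
    unfolding lift_frame_def using pW by (cases p) (simp add: compose_def matrix_mul_assoc)
  ultimately show ?thesis using that W' sub pW r by metis
qed

lemma jet_step_compose:
  assumes "jet_step Y h (b, p) (c, q)" "jet_step Y k (c, q) (d, r)"
  shows "jet_step Y (\<lambda>x. k (h x)) (b, p) (d, r)"
proof -
  obtain W l where l: "b \<in> charts Y" "c \<in> charts Y" "local_lift h b c W l" "fst p \<in> W" "q = lift_frame l p"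
    using assms(1) by (rule jet_stepE)
  obtain V m where m: "d \<in> charts Y" "local_lift k c d V m" "fst q \<in> V" "r = lift_frame m q"
    using assms(2) by (rule jet_stepE)
  have "l (fst p) \<in> V" using m l by simp
  from lift_frame_compose[OF l(3) m(2) l(4) this] obtain W' where "fst p \<in> W'"
    "local_lift (\<lambda>x. k (h x)) b d W' (compose W' m l)"
    "lift_frame (compose W' m l) p = lift_frame m (lift_frame l p)" .
  then show ?thesis using jet_stepI[OF l(1) m(1)] m l by metis
qed

lemma jet_step_inverse:
  fixes c d :: "('n::finite, 'x) chart"
  assumes "jet_step Y h (c, p) (d, q)" and k: "\<And>u. u \<in> cdom c \<Longrightarrow> k (h (cmap c u)) = cmap c u"
  shows "jet_step Y k (d, q) (c, p)"
proof -
  obtain W l where l: "c \<in> charts Y" "d \<in> charts Y" "local_lift h c d W l" "fst p \<in> W" "q = lift_frame l p"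
    using assms(1) by (rule jet_stepE)
  note L = local_liftD[OF l(3)]
  let ?m = "restrict (inv_into W l) (l ` W)"
  have m: "local_lift k d c (l ` W) ?m" by (rule local_lift_inverse(1)[OF l(3)]) (use L(2) k in blast)
  have "jac (\<lambda>x. ?m (l x)) (fst p) = jac ?m (l (fst p)) ** jac l (fst p)"
    by (rule jac_compose[OF L(6) l(4) local_liftD(6)[OF m] _ L(1) l(4)]) (use l in auto)
  moreover have "jac (\<lambda>x. ?m (l x)) (fst p) = mat 1"
    by (rule jac_identity[OF L(1) l(4)]) (use L(9) in auto)
  ultimately have "lift_frame ?m q = p"
    unfolding l(5) lift_frame_def using L(9) l(4) by (cases p) (simp add: matrix_mul_assoc)
  moreover have "fst q \<in> l ` W" using l by auto
  ultimately show ?thesis using jet_stepI[OF l(2,1) m] by metis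
qed

lemma continuous_on_lift_frame:
  fixes l :: "real^'n::finite \<Rightarrow> real^'n"
  assumes "smooth_on W l"
  shows "continuous_on (W \<times> UNIV) (lift_frame l)"
proof -
  have "continuous_on (W \<times> UNIV) (\<lambda>p. (l (fst p), jac l (fst p) ** snd p))"
    by (intro continuous_intros continuous_on_matrix_mult
        continuous_on_compose2[OF smooth_on_imp_continuous_on[OF assms]]
        continuous_on_compose2[OF continuous_on_jac[OF assms]]) auto
  then show ?thesis unfolding lift_frame_def by (simp add: case_prod_unfold)
qed

lemma continuous_on_rotate_frame: "continuous_on S (\<lambda>(Q, p). rotate_frame Q p)"
proof -
  have "continuous_on S (\<lambda>x. (fst (snd x), snd (snd x) ** transpose (fst x)))"
    by (intro continuous_intros continuous_on_matrix_mult continuous_on_transpose)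
  then show ?thesis unfolding rotate_frame_def by (simp add: case_prod_unfold)
qed

section \<open>The frame bundle\<close>

locale orbifold_action =
  fixes Y :: "('n::finite, 'y) orbifold" and \<mu> :: "('n, 'y) metric" and H :: "('y \<Rightarrow> 'y, 'm) monoid_scheme"
  assumes Y: "effective_orbifold Y" and metric: "riemannian_metric Y \<mu>" and H: "group H"
    and automorphism: "\<And>h. h \<in> carrier H \<Longrightarrow> orbifold_automorphism Y h"
    and isometry: "\<And>h. h \<in> carrier H \<Longrightarrow> isometric Y \<mu> h"
    and mult_app: "\<And>h k y. h \<in> carrier H \<Longrightarrow> k \<in> carrier H \<Longrightarrow> y \<in> topspace (ospace Y) \<Longrightarrow>
        (h \<otimes>\<^bsub>H\<^esub> k) y = h (k y)"
    and one_app: "\<And>y. y \<in> topspace (ospace Y) \<Longrightarrow> \<one>\<^bsub>H\<^esub> y = y"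
begin

interpretation H: group H by (rule H)

abbreviation "FC c \<equiv> chart_frames \<mu> c"
abbreviation "FT c \<equiv> top_of_set (FC c)"
abbreviation "cls c p \<equiv> frame_class Y c p"
abbreviation "step h c p d q \<equiv> jet_step Y h (c, p) (d, q)"

lemmas chartD = effective_orbifoldD[OF Y]

lemma one_lift: "c \<in> charts Y \<Longrightarrow> local_lift \<one>\<^bsub>H\<^esub> c d W l \<longleftrightarrow> local_lift (\<lambda>y. y) c d W l"
  by (rule local_lift_cong) (use one_app chartD(2) in blast)

lemma step_one: "jet_step Y \<one>\<^bsub>H\<^esub> t t' \<longleftrightarrow> jet_step Y (\<lambda>y. y) t t'"
  by (rule jet_step_cong[OF Y one_app])

lemma cls_eq: "cls c p = {t'. jet_step Y \<one>\<^bsub>H\<^esub> (c, p) t'}"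
  unfolding frame_class_eq step_one ..

lemma inner_product: "c \<in> charts Y \<Longrightarrow> u \<in> cdom c \<Longrightarrow> inner_product_form (\<mu> c u)"
  using metric unfolding riemannian_metric_def inner_product_form_def by blast

lemma metric_continuous: "c \<in> charts Y \<Longrightarrow> continuous_on (cdom c) (\<lambda>u. \<mu> c u v w)"
  using metric smooth_on_imp_continuous_on unfolding riemannian_metric_def by blast

lemma FC_D: "p \<in> FC c \<Longrightarrow> fst p \<in> cdom c" "p \<in> FC c \<Longrightarrow> \<mu> c (fst p) (snd p *v v) (snd p *v w) = v \<bullet> w"
  unfolding chart_frames_def by auto

lemma FC_I: "fst p \<in> cdom c \<Longrightarrow> (\<And>v w. \<mu> c (fst p) (snd p *v v) (snd p *v w) = v \<bullet> w) \<Longrightarrow> p \<in> FC c"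
  unfolding chart_frames_def by (cases p) auto

lemma FC_invertible:
  assumes c: "c \<in> charts Y" and p: "p \<in> FC c"
  shows "invertible (snd p)"
  using frame_invertible[OF inner_product[OF c FC_D(1)[OF p]]] FC_D(2)[OF p] by blast

lemma rotate_FC: "p \<in> FC c \<Longrightarrow> orthogonal_matrix Q \<Longrightarrow> rotate_frame Q p \<in> FC c"
proof -
  assume p: "p \<in> FC c" and Q: "orthogonal_matrix Q"
  have "orthogonal_matrix (transpose Q)" using Q by (simp add: orthogonal_matrix_transpose)
  then have "(transpose Q *v v) \<bullet> (transpose Q *v w) = v \<bullet> w" for v w
    unfolding orthogonal_matrix_iff_inner by blast
  then show ?thesis
    by (intro FC_I) (use FC_D[OF p] in \<open>auto simp: rotate_frame_def case_prod_unfold simp flip: matrix_vector_mul_assoc\<close>)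
qed

lemma lift_frame_FC:
  assumes "isometric Y \<mu> h" "c \<in> charts Y" "d \<in> charts Y" "local_lift h c d W l" "fst p \<in> W" "p \<in> FC c"
  shows "lift_frame l p \<in> FC d"
proof (rule FC_I)
  note L = local_liftD[OF assms(4)]
  show "fst (lift_frame l p) \<in> cdom d" using L(12) assms(5) by simp
  fix v w
  have "\<mu> d (l (fst p)) (der l (fst p) (snd p *v v)) (der l (fst p) (snd p *v w)) = \<mu> c (fst p) (snd p *v v) (snd p *v w)"
    using assms(1-5) unfolding isometric_def by blast
  then show "\<mu> d (fst (lift_frame l p)) (snd (lift_frame l p) *v v) (snd (lift_frame l p) *v w) = v \<bullet> w"
    using FC_D(2)[OF assms(6)]
    by (simp add: lift_frame_def case_prod_unfold der_eq_jac[OF L(6) assms(5)] matrix_vector_mul_assoc)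
qed

lemma step_FC: "h \<in> carrier H \<Longrightarrow> step h c p d q \<Longrightarrow> p \<in> FC c \<Longrightarrow> q \<in> FC d"
  by (erule jet_stepE) (use lift_frame_FC isometry in blast)

lemma step_mult:
  assumes "h \<in> carrier H" "k \<in> carrier H" "step h b p c q" "step k c q d r"
  shows "step (k \<otimes>\<^bsub>H\<^esub> h) b p d r"
proof -
  have "step (\<lambda>y. k (h y)) b p d r" by (rule jet_step_compose[OF assms(3,4)])
  then show ?thesis using jet_step_cong[OF Y, of "\<lambda>y. k (h y)" "k \<otimes>\<^bsub>H\<^esub> h"] mult_app assms(1,2) by simp
qed

lemma inv_app: "h \<in> carrier H \<Longrightarrow> y \<in> topspace (ospace Y) \<Longrightarrow> (inv\<^bsub>H\<^esub> h) (h y) = y"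
  using mult_app[of "inv\<^bsub>H\<^esub> h" h y] one_app by simp

lemma step_inv:
  assumes "h \<in> carrier H" "step h c p d q"
  shows "step (inv\<^bsub>H\<^esub> h) d q c p"
proof (rule jet_step_inverse[OF assms(2)])
  have c: "c \<in> charts Y" using jet_step_charts[OF assms(2)] by simp
  show "(inv\<^bsub>H\<^esub> h) (h (cmap c u)) = cmap c u" if "u \<in> cdom c" for u
    by (rule inv_app[OF assms(1) chartD(2)[OF c that]])
qed

lemma step_refl: "c \<in> charts Y \<Longrightarrow> p \<in> FC c \<Longrightarrow> step \<one>\<^bsub>H\<^esub> c p c p"
  unfolding step_one using jet_step_refl[OF Y] FC_D(1) by blast

lemma step_sym: "step \<one>\<^bsub>H\<^esub> c p d q \<Longrightarrow> step \<one>\<^bsub>H\<^esub> d q c p"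
  using step_inv[OF H.one_closed] by simp

lemma step_trans: "step \<one>\<^bsub>H\<^esub> b p c q \<Longrightarrow> step \<one>\<^bsub>H\<^esub> c q d r \<Longrightarrow> step \<one>\<^bsub>H\<^esub> b p d r"
  using step_mult[OF H.one_closed H.one_closed] by simp

lemma cls_eq_iff:
  assumes "c \<in> charts Y" "p \<in> FC c" "d \<in> charts Y" "q \<in> FC d"
  shows "cls c p = cls d q \<longleftrightarrow> step \<one>\<^bsub>H\<^esub> c p d q"
proof
  assume "cls c p = cls d q"
  then show "step \<one>\<^bsub>H\<^esub> c p d q" unfolding cls_eq using step_refl[OF assms(3,4)] by blast
next
  assume "step \<one>\<^bsub>H\<^esub> c p d q"
  then have "jet_step Y \<one>\<^bsub>H\<^esub> (c, p) (b, r) \<longleftrightarrow> jet_step Y \<one>\<^bsub>H\<^esub> (d, q) (b, r)" for b r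
    using step_sym step_trans by metis
  then show "cls c p = cls d q" unfolding cls_eq by auto
qed

lemma push_cls:
  assumes h: "h \<in> carrier H" and st: "step h c p d q"
  shows "frame_push Y h (cls c p) = cls d q"
proof -
  have key: "(\<exists>t. jet_step Y \<one>\<^bsub>H\<^esub> (c, p) t \<and> jet_step Y h t (b, r)) \<longleftrightarrow> step \<one>\<^bsub>H\<^esub> d q b r" for b r
  proof
    assume "\<exists>t. jet_step Y \<one>\<^bsub>H\<^esub> (c, p) t \<and> jet_step Y h t (b, r)"
    then obtain t where t: "jet_step Y \<one>\<^bsub>H\<^esub> (c, p) t" "jet_step Y h t (b, r)" by blast
    obtain e s where "t = (e, s)" by (rule prod.exhaust)
    then have es: "step \<one>\<^bsub>H\<^esub> c p e s" "step h e s b r" using t by simp_all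
    have s1: "step (\<one>\<^bsub>H\<^esub> \<otimes>\<^bsub>H\<^esub> inv\<^bsub>H\<^esub> h) d q e s" by (rule step_mult[OF _ _ step_inv[OF h st] es(1)]) (use h in auto)
    have "step (h \<otimes>\<^bsub>H\<^esub> (\<one>\<^bsub>H\<^esub> \<otimes>\<^bsub>H\<^esub> inv\<^bsub>H\<^esub> h)) d q b r" by (rule step_mult[OF _ h s1 es(2)]) (use h in auto)
    then show "step \<one>\<^bsub>H\<^esub> d q b r" using h by simp
  next
    assume "step \<one>\<^bsub>H\<^esub> d q b r"
    then have "step (\<one>\<^bsub>H\<^esub> \<otimes>\<^bsub>H\<^esub> h) c p b r" by (rule step_mult[OF h H.one_closed st])
    then have 1: "step h c p b r" using h by simp
    have "step (inv\<^bsub>H\<^esub> h \<otimes>\<^bsub>H\<^esub> h) c p c p" by (rule step_mult[OF h _ st step_inv[OF h st]]) (use h in auto)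
    then have "step \<one>\<^bsub>H\<^esub> c p c p" using h by simp
    then show "\<exists>t. jet_step Y \<one>\<^bsub>H\<^esub> (c, p) t \<and> jet_step Y h t (b, r)" using 1 by blast
  qed
  show ?thesis unfolding frame_push_eq cls_eq
  proof (rule Set.set_eqI)
    fix t' :: "('n, 'y) chart \<times> (real^'n) \<times> (real^'n^'n)"
    obtain b r where t': "t' = (b, r)" by (rule prod.exhaust)
    show "t' \<in> {t'. \<exists>t\<in>{t'. jet_step Y \<one>\<^bsub>H\<^esub> (c, p) t'}. jet_step Y h t t'} \<longleftrightarrow>
        t' \<in> {t'. jet_step Y \<one>\<^bsub>H\<^esub> (d, q) t'}"
      unfolding t' mem_Collect_eq Bex_def by (rule key)
  qed
qed

lemma rotate_cls: "frame_rotate Q (cls c p) = cls c (rotate_frame Q p)"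
proof -
  have "(d, q) \<in> frame_rotate Q (cls c p) \<longleftrightarrow> (d, q) \<in> cls c (rotate_frame Q p)" for d q
  proof
    assume "(d, q) \<in> frame_rotate Q (cls c p)"
    then obtain r where "step \<one>\<^bsub>H\<^esub> c p d r" "q = rotate_frame Q r"
      unfolding frame_rotate_eq cls_eq by auto
    then show "(d, q) \<in> cls c (rotate_frame Q p)" unfolding cls_eq using jet_step_rotate by blast
  next
    assume "(d, q) \<in> cls c (rotate_frame Q p)"
    then obtain W l where "c \<in> charts Y" "d \<in> charts Y" "local_lift \<one>\<^bsub>H\<^esub> c d W l" "fst p \<in> W"
        "q = lift_frame l (rotate_frame Q p)"
      unfolding cls_eq by (auto elim: jet_stepE)
    then have "(d, lift_frame l p) \<in> cls c p" "q = rotate_frame Q (lift_frame l p)"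
      unfolding cls_eq by (auto simp: rotate_lift intro: jet_stepI)
    then show "(d, q) \<in> frame_rotate Q (cls c p)" unfolding frame_rotate_eq by force
  qed
  then show ?thesis by auto
qed

lemma lift_exists:
  assumes "h \<in> carrier H" "c \<in> charts Y" "u \<in> cdom c" "d \<in> charts Y" "v \<in> cdom d" "cmap d v = h (cmap c u)"
  shows "\<exists>W l. local_lift h c d W l \<and> u \<in> W \<and> l u = v"
  using automorphism[OF assms(1)] assms(2-) unfolding orbifold_automorphism_def lifts_locally_def by blast

lemma step_exists:
  assumes h: "h \<in> carrier H" and c: "c \<in> charts Y" and p: "p \<in> FC c"
  obtains d W l where "d \<in> charts Y" "local_lift h c d W l" "fst p \<in> W"
proof -
  have "h (cmap c (fst p)) \<in> topspace (ospace Y)"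
    using automorphism[OF h] chartD(2)[OF c FC_D(1)[OF p]] homeomorphic_imp_surjective_map
    unfolding orbifold_automorphism_def by blast
  then obtain d v where "d \<in> charts Y" "v \<in> cdom d" "cmap d v = h (cmap c (fst p))" using chartD(3) by blast
  then show ?thesis using that lift_exists[OF h c FC_D(1)[OF p]] by metis
qed

abbreviation "trans_Q c p q \<equiv> frame_transition (\<mu> c (fst p)) (snd p) (snd q)"

lemma trans_Q:
  assumes "c \<in> charts Y" "p \<in> FC c" "q \<in> FC c" "fst p = fst q"
  shows "orthogonal_matrix (trans_Q c p q)" "rotate_frame (trans_Q c p q) p = q"
proof -
  note * = frame_transition[OF inner_product[OF assms(1) FC_D(1)[OF assms(2)]], of "snd p" "snd q"]
  have A: "\<forall>v w. \<mu> c (fst p) (snd p *v v) (snd p *v w) = v \<bullet> w"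
    "\<forall>v w. \<mu> c (fst p) (snd q *v v) (snd q *v w) = v \<bullet> w"
    using FC_D(2)[OF assms(2)] FC_D(2)[OF assms(3)] assms(4) by auto
  show "orthogonal_matrix (trans_Q c p q)" by (rule *(1)[OF A])
  show "rotate_frame (trans_Q c p q) p = q"
    using *(2)[OF A] assms(4) unfolding rotate_frame_def by (simp add: case_prod_unfold prod_eq_iff)
qed

lemma rotate_cancel:
  assumes "c \<in> charts Y" "p \<in> FC c" "rotate_frame Q p = rotate_frame Q' p"
  shows "Q = Q'"
proof -
  obtain A2 where "A2 ** snd p = mat 1" using FC_invertible[OF assms(1,2)] unfolding invertible_def by blast
  moreover have "snd p ** transpose Q = snd p ** transpose Q'"
    using assms(3) unfolding rotate_frame_def by (simp add: case_prod_unfold)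
  then have "A2 ** snd p ** transpose Q = A2 ** snd p ** transpose Q'" by (simp flip: matrix_mul_assoc)
  ultimately have "transpose Q = transpose Q'" by simp
  then have "transpose (transpose Q) = transpose (transpose Q')" by (rule arg_cong)
  then show ?thesis by simp
qed

lemma continuous_on_trans_Q:
  assumes c: "c \<in> charts Y"
  shows "continuous_on {(p, q). fst p \<in> cdom c} (\<lambda>(p, q). trans_Q c p q)"
proof -
  let ?Z = "{(p, q). fst p \<in> cdom c}"
  have bil: "bilinear (\<mu> c u)" if "u \<in> cdom c" for u using inner_product[OF c that] unfolding inner_product_form_def by blast
  have mv: "continuous_on ?Z (\<lambda>z. M z *v x)" if "continuous_on ?Z M" for M :: "_ \<Rightarrow> real^'n^'n" and x
    unfolding matrix_vector_mult_def by (intro continuous_intros that)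
  have "continuous_on ?Z (\<lambda>z. trans_Q c (fst z) (snd z))"
    unfolding frame_transition_def
    by (intro continuous_on_vec_lambda continuous_on_bilinear_form[OF bil metric_continuous[OF c]] mv continuous_intros) auto
  then show ?thesis by (simp add: case_prod_unfold)
qed

lemma frame_section_exists:
  assumes c: "c \<in> charts Y"
  shows "\<exists>\<sigma>. continuous_on (cdom c) \<sigma> \<and> (\<forall>u\<in>cdom c. (u, \<sigma> u) \<in> FC c)"
proof -
  obtain e :: "'n \<Rightarrow> real^'n \<Rightarrow> real^'n" where e: "\<And>i. continuous_on (cdom c) (e i)"
      "\<And>u i j. u \<in> cdom c \<Longrightarrow> \<mu> c u (e i u) (e j u) = (if i = j then 1 else 0)"
    using gram_schmidt[OF inner_product[OF c] metric_continuous[OF c], of UNIV] by fastforce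
  define \<sigma> where "\<sigma> u = (\<chi> r j. e j u $ r)" for u
  have "continuous_on (cdom c) \<sigma>" unfolding \<sigma>_def by (intro continuous_intros e(1))
  moreover have "(u, \<sigma> u) \<in> FC c" if u: "u \<in> cdom c" for u
  proof (rule FC_I)
    show "fst (u, \<sigma> u) \<in> cdom c" using u by simp
    fix v w :: "real^'n"
    have s: "\<sigma> u *v v = (\<Sum>j\<in>UNIV. v $ j *\<^sub>R e j u)" for v
      unfolding \<sigma>_def by (simp add: matrix_vector_mult_def vec_eq_iff mult.commute)
    have bil: "bilinear (\<mu> c u)" using inner_product[OF c u] unfolding inner_product_form_def by blast
    then have l: "linear (\<lambda>v. \<mu> c u v w)" "linear (\<lambda>w. \<mu> c u v w)" for v w unfolding bilinear_def by auto
    have "\<mu> c u (\<sigma> u *v v) (\<sigma> u *v w) = (\<Sum>i\<in>UNIV. \<Sum>j\<in>UNIV. w $ i * (v $ j * (if j = i then 1 else 0)))"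
      unfolding s by (simp add: linear_sum[OF l(1)] linear_scale[OF l(1)] linear_sum[OF l(2)] linear_scale[OF l(2)]
          e(2)[OF u] sum_distrib_left)
    also have "\<dots> = v \<bullet> w" by (simp add: inner_vec_def if_distrib mult.commute cong: if_cong)
    finally show "\<mu> c (fst (u, \<sigma> u)) (snd (u, \<sigma> u) *v v) (snd (u, \<sigma> u) *v w) = v \<bullet> w" by simp
  qed
  ultimately show ?thesis by blast
qed

text \<open>The tangent bundle of an open set of Euclidean space is trivial, so the bundle of frames over a
  chart domain has a global continuous section.\<close>

definition frame_section :: "('n, 'y) chart \<Rightarrow> real^'n \<Rightarrow> (real^'n) \<times> (real^'n^'n)" where
  "frame_section c = (\<lambda>u. (u, (SOME \<sigma>. continuous_on (cdom c) \<sigma> \<and> (\<forall>u\<in>cdom c. (u, \<sigma> u) \<in> FC c)) u))"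

lemma frame_section:
  assumes "c \<in> charts Y"
  shows "continuous_on (cdom c) (frame_section c)" "\<And>u. u \<in> cdom c \<Longrightarrow> frame_section c u \<in> FC c"
    "fst (frame_section c u) = u"
proof -
  let ?\<sigma> = "SOME \<sigma>. continuous_on (cdom c) \<sigma> \<and> (\<forall>u\<in>cdom c. (u, \<sigma> u) \<in> FC c)"
  have s: "continuous_on (cdom c) ?\<sigma> \<and> (\<forall>u\<in>cdom c. (u, ?\<sigma> u) \<in> FC c)"
    by (rule someI_ex[OF frame_section_exists[OF assms]])
  have e: "frame_section c = (\<lambda>u. (u, ?\<sigma> u))" by (simp only: frame_section_def)
  show "continuous_on (cdom c) (frame_section c)"
    unfolding e by (intro continuous_on_Pair continuous_on_id conjunct1[OF s])
  show "frame_section c u \<in> FC c" if "u \<in> cdom c" for u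
    unfolding e by (rule bspec[OF conjunct2[OF s] that])
  show "fst (frame_section c u) = u" by (simp add: frame_section_def)
qed

abbreviation "P \<equiv> frame_bundle Y \<mu>"

lemma topspace_frame_bundle: "topspace P = (\<Union>c\<in>charts Y. frame_class Y c ` FC c)"
  unfolding frame_bundle_def by (rule topspace_final_topology) auto

lemma frame_bundleE:
  assumes "\<xi> \<in> topspace P"
  obtains c p where "c \<in> charts Y" "p \<in> FC c" "\<xi> = cls c p"
  using assms unfolding topspace_frame_bundle by blast

lemma cls_in: "c \<in> charts Y \<Longrightarrow> p \<in> FC c \<Longrightarrow> cls c p \<in> topspace P"
  unfolding topspace_frame_bundle by blast

lemma continuous_frame_class: "c \<in> charts Y \<Longrightarrow> continuous_map (FT c) P (frame_class Y c)"
  unfolding frame_bundle_def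
  by (rule continuous_map_into_final_topology[where f = "frame_class Y" and T = "\<lambda>c. FT c"]) auto

lemma openin_lift_preimage:
  assumes "h \<in> carrier H" "c \<in> charts Y" "d \<in> charts Y" "local_lift h c d W l" "openin (FT d) O'"
  shows "openin (FT c) {p \<in> FC c. fst p \<in> W \<and> lift_frame l p \<in> O'}"
proof -
  note L = local_liftD[OF assms(4)]
  obtain G where G: "open G" "O' = FC d \<inter> G" using assms(5) by (auto simp: openin_open)
  have "open ((W \<times> UNIV) \<inter> lift_frame l -` G)"
    by (rule continuous_open_preimage[OF continuous_on_lift_frame[OF L(6)] _ G(1)])
      (use L(1) in \<open>auto intro: open_Times\<close>)
  moreover have "{p \<in> FC c. fst p \<in> W \<and> lift_frame l p \<in> O'} = FC c \<inter> ((W \<times> UNIV) \<inter> lift_frame l -` G)"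
  proof -
    have "lift_frame l p \<in> FC d" if "fst p \<in> W" "p \<in> FC c" for p
      by (rule lift_frame_FC[OF isometry[OF assms(1)] assms(2-4) that])
    then show ?thesis unfolding G(2) by (intro Set.set_eqI) (simp add: mem_Times_iff, blast)
  qed
  ultimately show ?thesis by (auto simp: openin_open)
qed

text \<open>If two frames in different charts have the same class, then the change of charts that relates them
  relates all nearby frames.\<close>

lemma open_frame_class:
  assumes c: "c \<in> charts Y"
  shows "open_map (FT c) P (frame_class Y c)"
  unfolding open_map_def
proof (intro allI impI)
  fix O' assume O': "openin (FT c) O'"
  then have sub: "O' \<subseteq> FC c" using openin_imp_subset by blast
  have "openin (FT d) {q \<in> FC d. cls d q \<in> frame_class Y c ` O'}" if d: "d \<in> charts Y" for d
  proof (rule openin_subopen[THEN iffD2], intro ballI)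
    fix q assume "q \<in> {q \<in> FC d. cls d q \<in> frame_class Y c ` O'}"
    then obtain p where p: "q \<in> FC d" "p \<in> O'" "cls d q = cls c p" by blast
    then have "step \<one>\<^bsub>H\<^esub> d q c p" using cls_eq_iff[OF d p(1) c] sub by blast
    then obtain W l where l: "local_lift \<one>\<^bsub>H\<^esub> d c W l" "fst q \<in> W" "p = lift_frame l q" by (rule jet_stepE)
    let ?N = "{r \<in> FC d. fst r \<in> W \<and> lift_frame l r \<in> O'}"
    have "openin (FT d) ?N" by (rule openin_lift_preimage[OF H.one_closed d c l(1) O'])
    moreover have "q \<in> ?N" using p l by simp
    moreover have "?N \<subseteq> {q \<in> FC d. cls d q \<in> frame_class Y c ` O'}"
    proof
      fix r assume r: "r \<in> ?N"
      then have "step \<one>\<^bsub>H\<^esub> d r c (lift_frame l r)" using jet_stepI[OF d c l(1)] by blast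
      then have "cls d r = cls c (lift_frame l r)" using cls_eq_iff[OF d _ c] r sub by blast
      then show "r \<in> {q \<in> FC d. cls d q \<in> frame_class Y c ` O'}" using r by blast
    qed
    ultimately show "\<exists>T. openin (FT d) T \<and> q \<in> T \<and> T \<subseteq> {q \<in> FC d. cls d q \<in> frame_class Y c ` O'}"
      by (intro exI[of _ ?N] conjI)
  qed
  then show "openin P (frame_class Y c ` O')"
    unfolding frame_bundle_def openin_final_topology using sub c by auto
qed

text \<open>Each of the finitely many elements of the chart group either moves the frame \<open>p\<close>, and then
  separates a neighbourhood of \<open>p\<close> from its image, or has trivial 1-jet, and then is the identity
  nearby.\<close>

lemma frame_class_locally_injective:
  assumes c: "c \<in> charts Y" and p: "p \<in> FC c"
  shows "\<exists>O'. openin (FT c) O' \<and> p \<in> O' \<and> inj_on (frame_class Y c) O'"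
proof -
  note oc = chartD(1)[OF c] and op = chartD(5)[OF c]
  have fin: "finite (cgrp c)" using oc unfolding orbifold_chart_def by blast
  have "\<exists>N. open N \<and> p \<in> N \<and> (\<forall>q\<in>N. lift_frame g q \<in> N \<longrightarrow> lift_frame g q = q)" if g: "g \<in> cgrp c" for g
  proof (cases "lift_frame g p = p")
    case True
    have 1: "g (fst p) = fst p" using True by (metis fst_lift_frame)
    have "jac g (fst p) ** snd p = snd p" using True unfolding lift_frame_def by (auto simp: case_prod_unfold prod_eq_iff)
    moreover obtain A2 where "snd p ** A2 = mat 1" using FC_invertible[OF c p] unfolding invertible_def by blast
    ultimately have "jac g (fst p) = mat 1" by (metis matrix_mul_assoc matrix_mul_rid)
    then have "\<forall>\<^sub>F x in nhds (fst p). g x = x"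
      using chart_group_identity_jet[OF oc g FC_D(1)[OF p] 1] by blast
    then obtain B where B: "open B" "fst p \<in> B" "\<And>x. x \<in> B \<Longrightarrow> g x = x" unfolding eventually_nhds by blast
    have "lift_frame g q = q" if "q \<in> B \<times> UNIV" for q
    proof -
      have "fst q \<in> B" using that by auto
      then have "g (fst q) = fst q" "jac g (fst q) = mat 1" using B(3) jac_identity[OF B(1) _ B(3)] by auto
      then show ?thesis unfolding lift_frame_def by (simp add: case_prod_unfold)
    qed
    then show ?thesis using B(1,2) by (intro exI[of _ "B \<times> UNIV"]) (auto intro: open_Times simp: mem_Times_iff)
  next
    case False
    then obtain U V where UV: "open U" "open V" "lift_frame g p \<in> U" "p \<in> V" "U \<inter> V = {}"
      using hausdorff by metis
    let ?N = "V \<inter> ((cdom c \<times> UNIV) \<inter> lift_frame g -` U)"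
    have "open ((cdom c \<times> UNIV) \<inter> lift_frame g -` U)"
      by (rule continuous_open_preimage[OF continuous_on_lift_frame[OF chart_group_smooth(2)[OF oc g]] _ UV(1)])
        (use op in \<open>auto intro: open_Times\<close>)
    then have "open ?N" using UV(2) by blast
    moreover have "p \<in> ?N" using UV FC_D(1)[OF p] by (auto simp: mem_Times_iff)
    ultimately show ?thesis using UV(5) by (intro exI[of _ ?N]) blast
  qed
  then obtain N where N: "\<And>g. g \<in> cgrp c \<Longrightarrow> open (N g) \<and> p \<in> N g \<and>
      (\<forall>q\<in>N g. lift_frame g q \<in> N g \<longrightarrow> lift_frame g q = q)" by metis
  define O' where "O' = FC c \<inter> (\<Inter>g\<in>cgrp c. N g)"
  have "open (\<Inter>g\<in>cgrp c. N g)" using fin N by blast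
  then have "openin (FT c) O'" unfolding O'_def by (auto simp: openin_open)
  moreover have "p \<in> O'" unfolding O'_def using p N by blast
  moreover have "inj_on (frame_class Y c) O'"
  proof (rule inj_onI)
    fix q r assume q: "q \<in> O'" and r: "r \<in> O'" and "cls c q = cls c r"
    then have "jet_step Y (\<lambda>y. y) (c, q) (c, r)" using cls_eq_iff[OF c _ c] unfolding O'_def step_one by blast
    then obtain W l where l: "local_lift (\<lambda>y. y) c c W l" "fst q \<in> W" "r = lift_frame l q" by (rule jet_stepE)
    obtain g where g: "g \<in> cgrp c" "l (fst q) = g (fst q)" "jac l (fst q) = jac g (fst q)"
      using change_of_charts_is_group_element[OF oc l(1,2)] by blast
    then have rg: "r = lift_frame g q" unfolding l(3) lift_frame_def by (simp add: case_prod_unfold)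
    have "q \<in> N g" "lift_frame g q \<in> N g" using q r rg g(1) unfolding O'_def by auto
    then have "lift_frame g q = q" using N[OF g(1)] by blast
    then show "q = r" using rg by simp
  qed
  ultimately show ?thesis by blast
qed

end

section \<open>Vector bundles\<close>

abbreviation "tot E \<equiv> topspace (vtot E)"

lemma continuous_map_euclidean_mult:
  fixes f g :: "'a \<Rightarrow> complex"
  assumes "continuous_map Z euclidean f" "continuous_map Z euclidean g"
  shows "continuous_map Z euclidean (\<lambda>z. f z * g z)"
  using continuous_map_into_euclidean_compose[OF continuous_map_euclidean_pair[OF assms], of UNIV "\<lambda>(x, y). x * y"]
  by (simp add: case_prod_unfold continuous_intros)

lemma fibreI: "e \<in> tot E \<Longrightarrow> vproj E e = b \<Longrightarrow> e \<in> fibre E b"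
  and fibreD: "e \<in> fibre E b \<Longrightarrow> e \<in> tot E" "e \<in> fibre E b \<Longrightarrow> vproj E e = b"
  unfolding fibre_def by auto

text \<open>A local trivialization \<open>f\<close> with its inverse \<open>g\<close>.  Having \<open>g\<close> as part of the data spares the
  construction of homeomorphisms: it is enough to give two continuous maps.\<close>

definition bundle_chart :: "'b topology \<Rightarrow> ('b, 'e) vbundle \<Rightarrow> 'b set \<Rightarrow> nat \<Rightarrow>
    ('e \<Rightarrow> 'b \<times> (nat \<Rightarrow> complex)) \<Rightarrow> ('b \<times> (nat \<Rightarrow> complex) \<Rightarrow> 'e) \<Rightarrow> bool" where
  "bundle_chart B E V k f g \<longleftrightarrow> openin B V \<and>
     continuous_map (subtopology (vtot E) {e. vproj E e \<in> V}) (prod_topology B (coordinate_space k)) f \<and>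
     continuous_map (prod_topology (subtopology B V) (coordinate_space k)) (vtot E) g \<and>
     (\<forall>e\<in>tot E. vproj E e \<in> V \<longrightarrow> fst (f e) = vproj E e \<and> g (f e) = e) \<and>
     (\<forall>v\<in>V. \<forall>x\<in>topspace (coordinate_space k). vproj E (g (v, x)) = v \<and> f (g (v, x)) = (v, x)) \<and>
     (\<forall>v\<in>V. \<forall>e\<in>fibre E v.
        (\<forall>e'\<in>fibre E v. vadd E e e' \<in> fibre E v \<and>
           snd (f (vadd E e e')) = (\<lambda>i\<in>{..<k}. snd (f e) i + snd (f e') i)) \<and>
        (\<forall>z. vscl E z e \<in> fibre E v \<and> snd (f (vscl E z e)) = (\<lambda>i\<in>{..<k}. z * snd (f e) i)))"

lemma bundle_chartD:
  assumes "bundle_chart B E V k f g"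
  shows "openin B V" "V \<subseteq> topspace B"
    "continuous_map (subtopology (vtot E) {e. vproj E e \<in> V}) (prod_topology B (coordinate_space k)) f"
    "continuous_map (prod_topology (subtopology B V) (coordinate_space k)) (vtot E) g"
    "\<And>e. e \<in> tot E \<Longrightarrow> vproj E e \<in> V \<Longrightarrow> fst (f e) = vproj E e"
    "\<And>e. e \<in> tot E \<Longrightarrow> vproj E e \<in> V \<Longrightarrow> g (f e) = e"
    "\<And>v x. v \<in> V \<Longrightarrow> x \<in> topspace (coordinate_space k) \<Longrightarrow> vproj E (g (v, x)) = v"
    "\<And>v x. v \<in> V \<Longrightarrow> x \<in> topspace (coordinate_space k) \<Longrightarrow> f (g (v, x)) = (v, x)"
    "\<And>v e e'. v \<in> V \<Longrightarrow> e \<in> fibre E v \<Longrightarrow> e' \<in> fibre E v \<Longrightarrow> vadd E e e' \<in> fibre E v"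
    "\<And>v e e'. v \<in> V \<Longrightarrow> e \<in> fibre E v \<Longrightarrow> e' \<in> fibre E v \<Longrightarrow>
        snd (f (vadd E e e')) = (\<lambda>i\<in>{..<k}. snd (f e) i + snd (f e') i)"
    "\<And>v e z. v \<in> V \<Longrightarrow> e \<in> fibre E v \<Longrightarrow> vscl E z e \<in> fibre E v"
    "\<And>v e z. v \<in> V \<Longrightarrow> e \<in> fibre E v \<Longrightarrow> snd (f (vscl E z e)) = (\<lambda>i\<in>{..<k}. z * snd (f e) i)"
proof -
  note C = assms[unfolded bundle_chart_def]
  show "openin B V" by (rule conjunct1[OF C])
  then show "V \<subseteq> topspace B" by (rule openin_subset)
qed (use assms in \<open>simp_all add: bundle_chart_def\<close>)

lemma vector_bundleI:
  assumes proj: "continuous_map (vtot E) B (vproj E)"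
    and chart: "\<And>b. b \<in> topspace B \<Longrightarrow> \<exists>V k f g. b \<in> V \<and> bundle_chart B E V k f g"
  shows "vector_bundle B E"
  unfolding vector_bundle_def
proof (intro conjI ballI proj)
  fix b assume b: "b \<in> topspace B"
  obtain V k f g where bV: "b \<in> V" and c: "bundle_chart B E V k f g" using chart[OF b] by (elim exE conjE) (rule that)
  note C = bundle_chartD[OF c]
  have f: "continuous_map (subtopology (vtot E) {e. vproj E e \<in> V}) (prod_topology (subtopology B V) (coordinate_space k)) f"
    unfolding prod_topology_subtopology(1)
  proof (rule continuous_map_into_subtopology)
    show "continuous_map (subtopology (vtot E) {e. vproj E e \<in> V}) (prod_topology B (coordinate_space k)) f" by (rule C(3))
    then have "f e \<in> topspace (prod_topology B (coordinate_space k))"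
      if "e \<in> topspace (subtopology (vtot E) {e. vproj E e \<in> V})" for e
      using that by (auto simp: continuous_map_def)
    then show "f \<in> topspace (subtopology (vtot E) {e. vproj E e \<in> V}) \<rightarrow> V \<times> topspace (coordinate_space k)"
      using C(5) by (auto simp: mem_Times_iff)
  qed
  have gt: "g x \<in> tot E" "vproj E (g x) \<in> V" "f (g x) = x"
    if "x \<in> topspace (prod_topology (subtopology B V) (coordinate_space k))" for x
  proof -
    have x: "fst x \<in> V" "snd x \<in> topspace (coordinate_space k)" using that by (simp_all add: mem_Times_iff)
    show "g x \<in> tot E" using C(4) that by (auto simp: continuous_map_def)
    show "vproj E (g x) \<in> V" "f (g x) = x" using C(7,8)[OF x] x(1) by simp_all
  qed
  have "continuous_map (prod_topology (subtopology B V) (coordinate_space k)) (subtopology (vtot E) {e. vproj E e \<in> V}) g"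
    by (rule continuous_map_into_subtopology) (use C(4) gt(2) in auto)
  then have "homeomorphic_maps (subtopology (vtot E) {e. vproj E e \<in> V})
          (prod_topology (subtopology B V) (coordinate_space k)) f g"
    unfolding homeomorphic_maps_def using f gt C(6) by auto
  then have h: "homeomorphic_map (subtopology (vtot E) {e. vproj E e \<in> V})
          (prod_topology (subtopology B V) (coordinate_space k)) f"
    using homeomorphic_map_maps by blast
  have fst_f: "fst (f e) = v" if "v \<in> V" "e \<in> fibre E v" for v e
    using C(5) that unfolding fibre_def by auto
  show "\<exists>V k f. openin B V \<and> b \<in> V \<and>
        homeomorphic_map (subtopology (vtot E) {e. vproj E e \<in> V})
          (prod_topology (subtopology B V) (coordinate_space k)) f \<and>
        (\<forall>v\<in>V. \<forall>e\<in>fibre E v.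
           fst (f e) = v \<and>
           (\<forall>e'\<in>fibre E v. vadd E e e' \<in> fibre E v \<and>
              snd (f (vadd E e e')) = (\<lambda>i\<in>{..<k}. snd (f e) i + snd (f e') i)) \<and>
           (\<forall>z. vscl E z e \<in> fibre E v \<and>
              snd (f (vscl E z e)) = (\<lambda>i\<in>{..<k}. z * snd (f e) i)))"
    by (intro exI[of _ V] exI[of _ k] exI[of _ f] conjI ballI allI)
      (rule C(1) bV h | (rule fst_f C(9) C(10) C(11) C(12), assumption+))+
qed

lemma vector_bundleE:
  assumes E: "vector_bundle B E" and b: "b \<in> topspace B"
  obtains V k f g where "b \<in> V" "bundle_chart B E V k f g"
proof -
  obtain V k f where V: "openin B V" "b \<in> V"
      and h: "homeomorphic_map (subtopology (vtot E) {e. vproj E e \<in> V})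
          (prod_topology (subtopology B V) (coordinate_space k)) f"
      and alg: "\<forall>v\<in>V. \<forall>e\<in>fibre E v.
           fst (f e) = v \<and>
           (\<forall>e'\<in>fibre E v. vadd E e e' \<in> fibre E v \<and>
              snd (f (vadd E e e')) = (\<lambda>i\<in>{..<k}. snd (f e) i + snd (f e') i)) \<and>
           (\<forall>z. vscl E z e \<in> fibre E v \<and>
              snd (f (vscl E z e)) = (\<lambda>i\<in>{..<k}. z * snd (f e) i))"
    using bspec[OF conjunct2[OF E[unfolded vector_bundle_def]] b] by (elim exE conjE) (rule that)
  obtain g where fg: "homeomorphic_maps (subtopology (vtot E) {e. vproj E e \<in> V})
          (prod_topology (subtopology B V) (coordinate_space k)) f g"
    using h homeomorphic_map_maps by blast
  have VB: "V \<subseteq> topspace B" using V openin_subset by blast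
  have f1: "continuous_map (subtopology (vtot E) {e. vproj E e \<in> V}) (prod_topology B (coordinate_space k)) f"
    and g1: "continuous_map (prod_topology (subtopology B V) (coordinate_space k)) (vtot E) g"
  proof -
    have "continuous_map (subtopology (vtot E) {e. vproj E e \<in> V}) (prod_topology (subtopology B V) (coordinate_space k)) f"
      using fg unfolding homeomorphic_maps_def by blast
    then show "continuous_map (subtopology (vtot E) {e. vproj E e \<in> V}) (prod_topology B (coordinate_space k)) f"
      unfolding prod_topology_subtopology(1) by (rule continuous_map_into_fulltopology)
    have "continuous_map (prod_topology (subtopology B V) (coordinate_space k)) (subtopology (vtot E) {e. vproj E e \<in> V}) g"
      using fg unfolding homeomorphic_maps_def by blast
    then show "continuous_map (prod_topology (subtopology B V) (coordinate_space k)) (vtot E) g"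
      by (rule continuous_map_into_fulltopology)
  qed
  have fg1: "g (f e) = e" if "e \<in> tot E" "vproj E e \<in> V" for e
    using fg that unfolding homeomorphic_maps_def by simp
  have fst: "fst (f e) = vproj E e" if "e \<in> tot E" "vproj E e \<in> V" for e
    using alg that fibreI by metis
  have gf: "vproj E (g (v, x)) = v \<and> f (g (v, x)) = (v, x)" if "v \<in> V" "x \<in> topspace (coordinate_space k)" for v x
  proof -
    have m: "(v, x) \<in> topspace (prod_topology (subtopology B V) (coordinate_space k))" using that VB by (simp add: subset_iff)
    then have "f (g (v, x)) = (v, x)" "g (v, x) \<in> topspace (subtopology (vtot E) {e. vproj E e \<in> V})"
      using fg unfolding homeomorphic_maps_def continuous_map_def by auto
    then show ?thesis using fst[of "g (v, x)"] by simp
  qed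
  have "bundle_chart B E V k f g"
    unfolding bundle_chart_def using V(1) f1 g1 fg1 fst gf alg by (intro conjI) simp_all
  then show ?thesis using that V(2) by blast
qed

lemma vector_bundle_proj: "vector_bundle B E \<Longrightarrow> continuous_map (vtot E) B (vproj E)"
  unfolding vector_bundle_def by blast

lemma vector_bundle_proj_in: "vector_bundle B E \<Longrightarrow> e \<in> tot E \<Longrightarrow> vproj E e \<in> topspace B"
  using vector_bundle_proj by (fastforce simp: continuous_map_def)

text \<open>In local coordinates all vector space laws reduce to those of complex tuples.  That the fibres embed
  into \<open>nat \<Rightarrow> complex\<close> makes it possible to realize bundles on prescribed types of total spaces.\<close>

lemma fibre_coordinates:
  fixes E :: "('b, 'e) vbundle"
  assumes E: "vector_bundle B E" and b: "b \<in> topspace B"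
  shows "\<exists>(x :: 'e \<Rightarrow> nat \<Rightarrow> complex) k. inj_on x (fibre E b) \<and> (\<forall>e\<in>fibre E b. x e \<in> extensional {..<k}) \<and>
    (\<forall>e\<in>fibre E b. \<forall>e'\<in>fibre E b.
        vadd E e e' \<in> fibre E b \<and> x (vadd E e e') = (\<lambda>i\<in>{..<k}. x e i + x e' i :: complex)) \<and>
    (\<forall>e\<in>fibre E b. \<forall>z. vscl E z e \<in> fibre E b \<and> x (vscl E z e) = (\<lambda>i\<in>{..<k}. z * x e i))"
proof -
  obtain V k f g where V: "b \<in> V" and c: "bundle_chart B E V k f g" by (rule vector_bundleE[OF E b])
  note C = bundle_chartD[OF c]
  have fe: "fst (f e) = b" "g (f e) = e" if "e \<in> fibre E b" for e
    using C(5,6) that V by (auto simp: fibre_def prod_eq_iff)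
  have inj: "inj_on (\<lambda>e. snd (f e)) (fibre E b)"
    by (rule inj_onI) (metis fe prod.collapse)
  have ext: "snd (f e) \<in> extensional {..<k}" if "e \<in> fibre E b" for e
  proof -
    have "e \<in> topspace (subtopology (vtot E) {e. vproj E e \<in> V})" using that V by (auto simp: fibre_def)
    then have "f e \<in> topspace (prod_topology B (coordinate_space k))" using C(3) by (auto simp: continuous_map_def)
    then show ?thesis by (auto simp: PiE_def)
  qed
  show ?thesis
    by (intro exI[of _ "\<lambda>e. snd (f e)"] exI[of _ k]) (simp add: C(9-12)[OF V] inj ext)
qed

lemma fibre_laws:
  assumes E: "vector_bundle B E" and b: "b \<in> topspace B" and e: "e \<in> fibre E b"
  shows "\<And>e'. e' \<in> fibre E b \<Longrightarrow> vadd E e e' \<in> fibre E b" "\<And>z. vscl E z e \<in> fibre E b"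
    "vscl E 1 e = e" "\<And>z w. vscl E z (vscl E w e) = vscl E (z * w) e"
    "\<And>z w. vscl E (z + w) e = vadd E (vscl E z e) (vscl E w e)"
    "\<And>z e'. e' \<in> fibre E b \<Longrightarrow> vscl E z (vadd E e e') = vadd E (vscl E z e) (vscl E z e')"
proof -
  obtain x :: "'b \<Rightarrow> nat \<Rightarrow> complex" and k where inj: "inj_on x (fibre E b)"
    and ext: "\<forall>e\<in>fibre E b. x e \<in> extensional {..<k}"
    and add0: "\<forall>e\<in>fibre E b. \<forall>e'\<in>fibre E b.
        vadd E e e' \<in> fibre E b \<and> x (vadd E e e') = (\<lambda>i\<in>{..<k}. x e i + x e' i)"
    and scl0: "\<forall>e\<in>fibre E b. \<forall>z. vscl E z e \<in> fibre E b \<and> x (vscl E z e) = (\<lambda>i\<in>{..<k}. z * x e i)"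
    using fibre_coordinates[OF E b] by (elim exE conjE) (rule that)
  have add: "vadd E e e' \<in> fibre E b" "x (vadd E e e') = (\<lambda>i\<in>{..<k}. x e i + x e' i)"
    if "e \<in> fibre E b" "e' \<in> fibre E b" for e e' using add0 that by blast+
  have scl: "vscl E z e \<in> fibre E b" "x (vscl E z e) = (\<lambda>i\<in>{..<k}. z * x e i)"
    if "e \<in> fibre E b" for e z using scl0 that by blast+
  show a: "vadd E e e' \<in> fibre E b" if "e' \<in> fibre E b" for e' using add e that by blast
  show s: "vscl E z e \<in> fibre E b" for z using scl e by blast
  have s': "vscl E z e' \<in> fibre E b" if "e' \<in> fibre E b" for z e' using scl that by blast
  have eqI: "u = v" if "u \<in> fibre E b" "v \<in> fibre E b" "x u = x v" for u v using inj that by (auto simp: inj_on_def)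
  show "vscl E 1 e = e"
    by (rule eqI) (use s e scl ext in \<open>auto simp: extensional_def\<close>)
  show "vscl E z (vscl E w e) = vscl E (z * w) e" for z w
    by (rule eqI) (use s s' e scl in \<open>auto simp: mult.assoc\<close>)
  show "vscl E (z + w) e = vadd E (vscl E z e) (vscl E w e)" for z w
    by (rule eqI) (use s s' e scl add in \<open>auto simp: distrib_right\<close>)
  show "vscl E z (vadd E e e') = vadd E (vscl E z e) (vscl E z e')" if "e' \<in> fibre E b" for z e'
    by (rule eqI) (use s s' a e scl add that in \<open>auto simp: distrib_left\<close>)
qed

lemma continuous_map_coordinates_scale:
  assumes "continuous_map Z euclidean w" "continuous_map Z (coordinate_space k) x"
  shows "continuous_map Z (coordinate_space k) (\<lambda>z. \<lambda>i\<in>{..<k}. w z * x z i)"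
  unfolding continuous_map_componentwise
proof (intro conjI ballI)
  show "continuous_map Z euclidean (\<lambda>z. (\<lambda>i\<in>{..<k}. w z * x z i) i)" if "i \<in> {..<k}" for i
    using continuous_map_euclidean_mult[OF assms(1), of "\<lambda>z. x z i"] assms(2) that
    by (simp add: continuous_map_componentwise)
qed auto

lemma continuous_vscl:
  fixes E :: "('b, 'e) vbundle"
  assumes E: "vector_bundle B E"
  shows "continuous_map (prod_topology (euclidean :: complex topology) (vtot E)) (vtot E) (\<lambda>x. vscl E (fst x) (snd x))"
proof (rule continuous_map_locally)
  fix y assume y: "y \<in> topspace (prod_topology (euclidean :: complex topology) (vtot E))"
  then have yB: "vproj E (snd y) \<in> topspace B" using vector_bundle_proj_in[OF E] by auto
  obtain V k f g where V: "vproj E (snd y) \<in> V" and c: "bundle_chart B E V k f g"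
    by (rule vector_bundleE[OF E yB])
  note C = bundle_chartD[OF c]
  let ?U = "{x \<in> topspace (prod_topology (euclidean :: complex topology) (vtot E)). vproj E (snd x) \<in> V}"
  let ?Z = "subtopology (prod_topology (euclidean :: complex topology) (vtot E)) ?U"
  have sn: "continuous_map ?Z (vtot E) snd" and fs: "continuous_map ?Z euclidean fst"
    by (rule continuous_map_subtopology_snd continuous_map_subtopology_fst)+
  have sf: "continuous_map ?Z (subtopology (vtot E) {e. vproj E e \<in> V}) snd"
    by (rule continuous_map_into_subtopology[OF sn]) auto
  have cf: "continuous_map ?Z (prod_topology B (coordinate_space k)) (\<lambda>x. f (snd x))"
    by (rule continuous_map_app[OF sf C(3)])
  have cx: "continuous_map ?Z (coordinate_space k) (\<lambda>x. snd (f (snd x)))"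
    using continuous_map_app[OF cf continuous_map_snd] .
  have cp: "continuous_map ?Z (subtopology B V) (\<lambda>x. vproj E (snd x))"
    by (rule continuous_map_into_subtopology[OF continuous_map_app[OF sn vector_bundle_proj[OF E]]]) auto
  have "continuous_map ?Z (prod_topology (subtopology B V) (coordinate_space k))
      (\<lambda>x. (vproj E (snd x), \<lambda>i\<in>{..<k}. fst x * snd (f (snd x)) i))"
    by (rule continuous_map_pairedI[OF cp continuous_map_coordinates_scale[OF fs cx]])
  then have "continuous_map ?Z (vtot E) (\<lambda>x. g (vproj E (snd x), \<lambda>i\<in>{..<k}. fst x * snd (f (snd x)) i))"
    by (rule continuous_map_app[OF _ C(4)])
  then have "continuous_map ?Z (vtot E) (\<lambda>x. vscl E (fst x) (snd x))"
  proof (rule continuous_map_eq)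
    fix x assume "x \<in> topspace ?Z"
    then have x: "vproj E (snd x) \<in> V" "snd x \<in> fibre E (vproj E (snd x))" by (auto simp: fibre_def)
    let ?e = "vscl E (fst x) (snd x)"
    have e: "?e \<in> fibre E (vproj E (snd x))" "snd (f ?e) = (\<lambda>i\<in>{..<k}. fst x * snd (f (snd x)) i)"
      using C(11,12)[OF x] by blast+
    then have "fst (f ?e) = vproj E (snd x)" "g (f ?e) = ?e" using C(5,6) x by (auto simp: fibre_def)
    then show "g (vproj E (snd x), \<lambda>i\<in>{..<k}. fst x * snd (f (snd x)) i) = ?e" using e by (metis prod.collapse)
  qed
  moreover have "openin (prod_topology (euclidean :: complex topology) (vtot E)) ?U"
  proof (rule openin_continuous_map_preimage)
    show "continuous_map (prod_topology (euclidean :: complex topology) (vtot E)) B (\<lambda>x. vproj E (snd x))"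
      by (rule continuous_map_app[OF continuous_map_snd vector_bundle_proj[OF E]])
  qed (rule C(1))
  ultimately show "\<exists>U. openin (prod_topology (euclidean :: complex topology) (vtot E)) U \<and> y \<in> U \<and>
      continuous_map (subtopology (prod_topology (euclidean :: complex topology) (vtot E)) U) (vtot E) (\<lambda>x. vscl E (fst x) (snd x))"
    using y V by (intro exI[of _ ?U]) simp
qed

definition pullback_bundle :: "'q topology \<Rightarrow> ('q \<Rightarrow> 'b) \<Rightarrow> ('b, 'e) vbundle \<Rightarrow> ('q, 'q \<times> 'e) vbundle" where
  "pullback_bundle Q b E = \<lparr>vtot = pullback_space Q b (vtot E) (vproj E), vproj = fst,
      vadd = (\<lambda>(u, e) (u', e'). (u, vadd E e e')), vscl = (\<lambda>z (u, e). (u, vscl E z e))\<rparr>"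

lemma fibre_pullback_bundle: "u \<in> topspace Q \<Longrightarrow> fibre (pullback_bundle Q b E) u = {u} \<times> fibre E (b u)"
  unfolding fibre_def pullback_bundle_def by (auto simp: topspace_pullback_space)

lemma vector_bundle_pullback:
  assumes E: "vector_bundle B E" and b: "continuous_map Q B b"
  shows "vector_bundle Q (pullback_bundle Q b E)"
proof (rule vector_bundleI)
  let ?E = "pullback_bundle Q b E"
  show "continuous_map (vtot ?E) Q (vproj ?E)"
    unfolding pullback_bundle_def by (simp add: continuous_map_pullback_fst)
  fix u assume u: "u \<in> topspace Q"
  then have buB: "b u \<in> topspace B" using b by (auto simp: continuous_map_def)
  obtain V k f g where V: "b u \<in> V" and c: "bundle_chart B E V k f g"
    by (rule vector_bundleE[OF E buB])
  note C = bundle_chartD[OF c]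
  let ?V = "{v \<in> topspace Q. b v \<in> V}"
  let ?f = "\<lambda>x. (fst x, snd (f (snd x)))" and ?g = "\<lambda>x. (fst x, g (b (fst x), snd x))"
  have oV: "openin Q ?V" by (rule openin_continuous_map_preimage[OF b C(1)])
  let ?Z = "subtopology (vtot ?E) {e. vproj ?E e \<in> ?V}"
  have Zfst: "continuous_map ?Z Q fst" and Zsnd: "continuous_map ?Z (vtot E) snd"
    unfolding pullback_bundle_def
    by (simp_all add: continuous_map_from_subtopology continuous_map_pullback_fst continuous_map_pullback_snd)
  have Zt: "b (fst x) \<in> V" "vproj E (snd x) = b (fst x)" if "x \<in> topspace ?Z" for x
    using that unfolding pullback_bundle_def by (auto simp: topspace_pullback_space)
  have "vproj E (snd x) \<in> V" if "x \<in> topspace ?Z" for x 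
    unfolding Zt(2)[OF that] by (rule Zt(1)[OF that])
  then have "continuous_map ?Z (subtopology (vtot E) {e. vproj E e \<in> V}) snd"
    by (intro continuous_map_into_subtopology[OF Zsnd] Pi_I) simp
  then have "continuous_map ?Z (prod_topology B (coordinate_space k)) (\<lambda>x. f (snd x))"
    by (rule continuous_map_app[OF _ C(3)])
  from continuous_map_pairedI[OF Zfst continuous_map_app[OF this continuous_map_snd]]
  have cf: "continuous_map ?Z (prod_topology Q (coordinate_space k)) ?f" .
  let ?D = "prod_topology (subtopology Q ?V) (coordinate_space k)"
  have Dfst: "continuous_map ?D Q fst" and Dsnd: "continuous_map ?D (coordinate_space k) snd"
    by (intro continuous_map_into_fulltopology[OF continuous_map_fst] continuous_map_snd)+
  have "continuous_map ?D (subtopology B V) (\<lambda>x. b (fst x))"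
  proof (rule continuous_map_into_subtopology[OF continuous_map_app[OF Dfst b]], rule Pi_I)
    show "b (fst x) \<in> V" if "x \<in> topspace ?D" for x using that by (simp add: mem_Times_iff)
  qed
  from continuous_map_app[OF continuous_map_pairedI[OF this Dsnd] C(4)]
  have cg: "continuous_map ?D (vtot E) (\<lambda>x. g (b (fst x), snd x))" .
  have pr: "vproj E (g (b (fst x), snd x)) = b (fst x)" if "x \<in> topspace ?D" for x
    by (rule C(7)) (use that in \<open>simp_all add: mem_Times_iff\<close>)
  have n1: "continuous_map ?D (vtot ?E) ?g"
    unfolding pullback_bundle_def
    unfolding vbundle.simps by (rule continuous_map_into_pullback[OF Dfst cg]) (rule pr[symmetric])
  have n2: "fst (?f e) = vproj ?E e \<and> ?g (?f e) = e" if e: "e \<in> tot ?E" "vproj ?E e \<in> ?V" for e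
  proof -
    have 1: "snd e \<in> tot E" "vproj E (snd e) \<in> V" "b (fst e) = vproj E (snd e)"
      using e unfolding pullback_bundle_def by (auto simp: topspace_pullback_space)
    have 2: "g (f (snd e)) = snd e" by (rule C(6)[OF 1(1,2)])
    have "f (snd e) = (b (fst e), snd (f (snd e)))" using C(5)[OF 1(1,2)] 1(3) by (simp add: prod_eq_iff)
    then have "g (b (fst e), snd (f (snd e))) = snd e" using 2 by metis
    then show ?thesis unfolding pullback_bundle_def by (simp add: prod_eq_iff)
  qed
  have n3: "vproj ?E (?g (v, x)) = v \<and> ?f (?g (v, x)) = (v, x)"
    if "v \<in> ?V" "x \<in> topspace (coordinate_space k)" for v x
    using C(7,8) that unfolding pullback_bundle_def by auto
  have n4: "(\<forall>e'\<in>fibre ?E v. vadd ?E e e' \<in> fibre ?E v \<and>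
           snd (?f (vadd ?E e e')) = (\<lambda>i\<in>{..<k}. snd (?f e) i + snd (?f e') i)) \<and>
        (\<forall>z. vscl ?E z e \<in> fibre ?E v \<and> snd (?f (vscl ?E z e)) = (\<lambda>i\<in>{..<k}. z * snd (?f e) i))"
    if v: "v \<in> ?V" and e: "e \<in> fibre ?E v" for v e
  proof -
    have vQ: "v \<in> topspace Q" "b v \<in> V" using v by auto
    note F = fibre_pullback_bundle[OF vQ(1), of b E]
    obtain y where y: "e = (v, y)" "y \<in> fibre E (b v)" using e unfolding F by blast
    have o: "vadd ?E (v, p) (v, q) = (v, vadd E p q)" "vscl ?E z (v, p) = (v, vscl E z p)" for p q z
      unfolding pullback_bundle_def by simp_all
    show ?thesis unfolding F using C(9-12)[OF vQ(2) y(2)] by (auto simp: y(1) o)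
  qed
  have "bundle_chart Q ?E ?V k ?f ?g"
    unfolding bundle_chart_def by (intro conjI oV cf n1) (use n2 in blast, use n3 in blast, use n4 in blast)
  then show "\<exists>V k f g. u \<in> V \<and> bundle_chart Q ?E V k f g" using u V by (intro exI[of _ ?V]) blast
qed

lemma bundle_isoD:
  assumes "bundle_iso B E F T" "b \<in> topspace B" "e \<in> fibre E b"
  shows "T e \<in> fibre F b" "\<And>e'. e' \<in> fibre E b \<Longrightarrow> T (vadd E e e') = vadd F (T e) (T e')"
    "\<And>z. T (vscl E z e) = vscl F z (T e)"
  using assms unfolding bundle_iso_def fibre_iso_def fibre_hom_def by (simp_all add: image_subset_iff)

text \<open>A copy of a vector bundle whose total space is the image of an injection \<open>K\<close>: isomorphism classes
  are taken over a fixed type of total spaces, into which a constructed bundle has to be moved.\<close>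

definition transport_bundle :: "('e \<Rightarrow> 'f) \<Rightarrow> ('b, 'e) vbundle \<Rightarrow> ('b, 'f) vbundle" where
  "transport_bundle K E = (let J = inv_into (tot E) K in
     \<lparr>vtot = final_topology (K ` tot E) {()} (\<lambda>_. vtot E) (\<lambda>_. K),
      vproj = (\<lambda>x. vproj E (J x)), vadd = (\<lambda>x y. K (vadd E (J x) (J y))), vscl = (\<lambda>z x. K (vscl E z (J x)))\<rparr>)"

lemma transport_bundle:
  assumes E: "vector_bundle B E" and K: "inj_on K (tot E)"
  shows "vector_bundle B (transport_bundle K E)" "bundle_iso B E (transport_bundle K E) K"
proof -
  let ?F = "transport_bundle K E" and ?J = "inv_into (tot E) K"
  have JK: "?J (K e) = e" if "e \<in> tot E" for e using K that by simp
  have tot: "vtot ?F = final_topology (K ` tot E) {()} (\<lambda>_. vtot E) (\<lambda>_. K)"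
    and ops: "vproj ?F x = vproj E (?J x)" "vadd ?F x y = K (vadd E (?J x) (?J y))" "vscl ?F z x = K (vscl E z (?J x))" for x y z
    unfolding transport_bundle_def Let_def by simp_all
  have ts: "tot ?F = K ` tot E" unfolding tot by (rule topspace_final_topology) auto
  have cK: "continuous_map (vtot E) (vtot ?F) K"
    unfolding tot by (rule continuous_map_into_final_topology[where f = "\<lambda>_. K" and T = "\<lambda>_. vtot E"]) auto
  have cJ: "continuous_map (vtot ?F) (vtot E) ?J"
    unfolding tot by (rule continuous_map_from_final_topology) (use JK in \<open>auto intro: continuous_map_eq[OF continuous_map_id]\<close>)
  have hm: "homeomorphic_maps (vtot E) (vtot ?F) K ?J"
    unfolding homeomorphic_maps_def using cK cJ JK ts by auto
  have fib: "fibre ?F b = K ` fibre E b" for b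
    unfolding fibre_def ts ops using JK by auto
  have fE: "e \<in> tot E" if "e \<in> fibre E b" for e b using that by (auto simp: fibre_def)
  show iso: "bundle_iso B E ?F K"
    unfolding bundle_iso_def fibre_iso_def fibre_hom_def
  proof (intro conjI ballI allI)
    show "homeomorphic_map (vtot E) (vtot ?F) K" using hm homeomorphic_map_maps by blast
    fix b assume "b \<in> topspace B"
    show "K ` fibre E b \<subseteq> fibre ?F b" unfolding fib ..
    show "bij_betw K (fibre E b) (fibre ?F b)" unfolding fib
      by (rule inj_on_imp_bij_betw[OF inj_on_subset[OF K]]) (use fE in blast)
    show "K (vadd E e e') = vadd ?F (K e) (K e')" if "e \<in> fibre E b" "e' \<in> fibre E b" for e e'
      unfolding ops using that JK fE by metis
    show "K (vscl E z e) = vscl ?F z (K e)" if "e \<in> fibre E b" for e z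
      unfolding ops using that JK fE by metis
  qed
  show "vector_bundle B ?F"
  proof (rule vector_bundleI)
    show "continuous_map (vtot ?F) B (vproj ?F)"
    proof -
      have "vproj ?F = (\<lambda>x. vproj E (?J x))" using ops(1) by (rule ext)
      then show ?thesis using continuous_map_app[OF cJ vector_bundle_proj[OF E]] by simp
    qed
    fix b assume b: "b \<in> topspace B"
    obtain V k f g where V: "b \<in> V" and c: "bundle_chart B E V k f g" by (rule vector_bundleE[OF E b])
    note C = bundle_chartD[OF c]
    have VB: "V \<subseteq> topspace B" by (rule C(2))
    let ?Z = "subtopology (vtot ?F) {e. vproj ?F e \<in> V}"
    have "continuous_map ?Z (subtopology (vtot E) {e. vproj E e \<in> V}) ?J"
      by (rule continuous_map_into_subtopology[OF continuous_map_from_subtopology[OF cJ]]) (auto simp: ops)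
    then have "continuous_map ?Z (prod_topology B (coordinate_space k)) (\<lambda>x. f (?J x))"
      by (rule continuous_map_app[OF _ C(3)])
    moreover have "continuous_map (prod_topology (subtopology B V) (coordinate_space k)) (vtot ?F) (\<lambda>x. K (g x))"
      by (rule continuous_map_app[OF C(4) cK])
    moreover have "fst (f (?J e)) = vproj ?F e \<and> K (g (f (?J e))) = e"
      if "e \<in> tot ?F" "vproj ?F e \<in> V" for e
      using that C(5,6) JK unfolding ts ops by auto
    moreover have "vproj ?F (K (g (v, x))) = v \<and> f (?J (K (g (v, x)))) = (v, x)"
      if "v \<in> V" "x \<in> topspace (coordinate_space k)" for v x
    proof -
      have "(v, x) \<in> topspace (prod_topology (subtopology B V) (coordinate_space k))" using that VB by (simp add: subset_iff)
      then have "g (v, x) \<in> tot E" using C(4) by (auto simp: continuous_map_def)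
      then show ?thesis unfolding ops using JK C(7,8)[OF that] by simp
    qed
    moreover have "(\<forall>y\<in>fibre ?F v. vadd ?F x y \<in> fibre ?F v \<and>
             snd (f (?J (vadd ?F x y))) = (\<lambda>i\<in>{..<k}. snd (f (?J x)) i + snd (f (?J y)) i)) \<and>
          (\<forall>z. vscl ?F z x \<in> fibre ?F v \<and> snd (f (?J (vscl ?F z x))) = (\<lambda>i\<in>{..<k}. z * snd (f (?J x)) i))"
      if v: "v \<in> V" and x: "x \<in> fibre ?F v" for v x
    proof -
      obtain e where e: "e \<in> fibre E v" "x = K e" using x unfolding fib by blast
      have J: "?J (K e) = e" if "e \<in> fibre E v" for e using JK fE that by blast
      show ?thesis
        unfolding fib e(2) ops using C(9-12)[OF v e(1)] e(1) J by auto
    qed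
    ultimately have "bundle_chart B ?F V k (\<lambda>x. f (?J x)) (\<lambda>x. K (g x))"
      unfolding bundle_chart_def using C(1) by simp
    then show "\<exists>V k f g. b \<in> V \<and> bundle_chart B ?F V k f g" using V by blast
  qed
qed

lemma bundle_iso_inverse:
  assumes E: "vector_bundle B E" and F: "vector_bundle B F" and T: "bundle_iso B E F T"
  shows "bundle_iso B F E (inv_into (tot E) T)"
    "homeomorphic_maps (vtot E) (vtot F) T (inv_into (tot E) T)"
proof -
  let ?S = "inv_into (tot E) T"
  have h: "homeomorphic_map (vtot E) (vtot F) T" using T unfolding bundle_iso_def by blast
  then have inj: "inj_on T (tot E)" and img: "T ` tot E = tot F"
    using homeomorphic_imp_injective_map homeomorphic_imp_surjective_map by blast+
  obtain g where g: "homeomorphic_maps (vtot E) (vtot F) T g" using h homeomorphic_map_maps by blast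
  have "g y = ?S y" if "y \<in> tot F" for y
  proof -
    have "T (g y) = y" "g y \<in> tot E" using g that by (auto simp: homeomorphic_maps_def continuous_map_def)
    then show ?thesis using inj by (metis inv_into_f_f)
  qed
  then show hm: "homeomorphic_maps (vtot E) (vtot F) T ?S"
    using homeomorphic_maps_eq[OF g] by blast
  have ST: "?S (T e) = e" if "e \<in> tot E" for e using inj that by simp
  have fib: "fibre F b = T ` fibre E b" "fibre E b \<subseteq> tot E" if "b \<in> topspace B" for b
    using T that unfolding bundle_iso_def fibre_iso_def bij_betw_def fibre_def by auto
  show "bundle_iso B F E ?S"
    unfolding bundle_iso_def fibre_iso_def fibre_hom_def
  proof (intro conjI ballI allI)
    show "homeomorphic_map (vtot F) (vtot E) ?S" using hm homeomorphic_maps_map by blast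
    fix b assume b: "b \<in> topspace B"
    have S: "?S (T e) = e" if "e \<in> fibre E b" for e using ST fib(2)[OF b] that by blast
    then show "?S ` fibre F b \<subseteq> fibre E b" unfolding fib(1)[OF b] by auto
    have "?S ` fibre F b = fibre E b" unfolding fib(1)[OF b] image_image using S by simp
    moreover have "inj_on ?S (fibre F b)" unfolding fib(1)[OF b] by (rule inj_onI) (use S in auto)
    ultimately show "bij_betw ?S (fibre F b) (fibre E b)" unfolding bij_betw_def by blast
    show "?S (vadd F e e') = vadd E (?S e) (?S e')" if ee: "e \<in> fibre F b" "e' \<in> fibre F b" for e e'
    proof -
      obtain x y where x: "x \<in> fibre E b" "e = T x" and y: "y \<in> fibre E b" "e' = T y" using ee unfolding fib(1)[OF b] by blast
      have "vadd F e e' = T (vadd E x y)" using bundle_isoD(2)[OF T b x(1) y(1)] x y by simp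
      then show ?thesis using S[OF fibre_laws(1)[OF E b x(1) y(1)]] S x y by simp
    qed
    show "?S (vscl F z e) = vscl E z (?S e)" if ee: "e \<in> fibre F b" for e z
    proof -
      obtain x where x: "x \<in> fibre E b" "e = T x" using ee unfolding fib(1)[OF b] by blast
      have "vscl F z e = T (vscl E z x)" using bundle_isoD(3)[OF T b x(1)] x by simp
      then show ?thesis using S[OF fibre_laws(2)[OF E b x(1)]] S x by simp
    qed
  qed
qed

section \<open>The gerbe of the central extension\<close>

lemma fibre_homD:
  assumes "fibre_hom E b F c T" "e \<in> fibre E b"
  shows "T e \<in> fibre F c" "\<And>e'. e' \<in> fibre E b \<Longrightarrow> T (vadd E e e') = vadd F (T e) (T e')"
    "\<And>z. T (vscl E z e) = vscl F z (T e)"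
  using assms unfolding fibre_hom_def by (simp_all add: image_subset_iff)

lemma fibre_isoD:
  assumes "fibre_iso E b F c T"
  shows "fibre_hom E b F c T" "inj_on T (fibre E b)" "T ` fibre E b = fibre F c"
  using assms unfolding fibre_iso_def bij_betw_def by simp_all

lemma fibre_iso_in: "fibre_iso E b F c T \<Longrightarrow> e \<in> fibre E b \<Longrightarrow> T e \<in> fibre F c"
  by (rule fibre_homD(1)[OF fibre_isoD(1)])

lemma fibre_hom_cong:
  assumes "fibre_hom E b F c T" "\<And>e. e \<in> fibre E b \<Longrightarrow> T e = T' e"
    and "vector_bundle B E" "b \<in> topspace B"
  shows "fibre_hom E b F c T'"
  unfolding fibre_hom_def
proof (intro conjI ballI allI)
  show "T' ` fibre E b \<subseteq> fibre F c" using fibre_homD(1)[OF assms(1)] assms(2) by auto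
  fix e assume e: "e \<in> fibre E b"
  show "T' (vadd E e e') = vadd F (T' e) (T' e')" if e': "e' \<in> fibre E b" for e'
    using fibre_homD(2)[OF assms(1) e e'] assms(2) e e' fibre_laws(1)[OF assms(3,4) e e'] by simp
  show "T' (vscl E z e) = vscl F z (T' e)" for z
    using fibre_homD(3)[OF assms(1) e] assms(2) e fibre_laws(2)[OF assms(3,4) e] by simp
qed

lemma fibre_iso_cong:
  assumes "fibre_iso E b F c T" "\<And>e. e \<in> fibre E b \<Longrightarrow> T e = T' e"
    and "vector_bundle B E" "b \<in> topspace B"
  shows "fibre_iso E b F c T'"
  unfolding fibre_iso_def
  using fibre_hom_cong[OF fibre_isoD(1)[OF assms(1)] assms(2-4)] assms(1) bij_betw_cong[of "fibre E b" T T' "fibre F c"] assms(2)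
  unfolding fibre_iso_def by simp

locale twisted_action = orbifold_action Y \<mu> H
  for Y :: "('n::finite, 'y) orbifold" and \<mu> :: "('n, 'y) metric" and H :: "('y \<Rightarrow> 'y, 'm) monoid_scheme" +
  fixes a :: "('y \<Rightarrow> 'y) \<times> ('y \<Rightarrow> 'y) \<Rightarrow> complex"
  assumes a: "a \<in> carrier (Z2 H)"
begin

interpretation H: group H by (rule H)

abbreviation "X \<equiv> extension H a"
abbreviation "\<epsilon> \<equiv> \<one>\<^bsub>X\<^esub>"
abbreviation "On \<equiv> {Q :: real^'n^'n. orthogonal_matrix Q}"
abbreviation "\<G> \<equiv> orbifold_groupoid Y \<mu> H"
abbreviation "\<L> \<equiv> discrete_torsion_gerbe Y \<mu> H a"
abbreviation "tbundle \<equiv> twisted_bundle \<G> \<L>"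
abbreviation "torbibundle \<equiv> twisted_orbibundle Y H a"
abbreviation "L \<equiv> line \<L>"
abbreviation "lc r x w \<equiv> line_class H a (r, x, w)"

lemma cocycle_unit:
  assumes "g \<in> carrier H" "h \<in> carrier H"
  shows "norm (a (g, h)) = 1" "a (g, h) \<noteq> 0"
proof -
  have "a (g, h) \<in> sphere 0 1" using a assms unfolding Z2_def by (auto simp: PiE_iff)
  then show "norm (a (g, h)) = 1" by simp
  then show "a (g, h) \<noteq> 0" by auto
qed

text \<open>This is the cocycle identity for triples that contain the unit twice.\<close>

lemma cocycle_one:
  assumes "h \<in> carrier H"
  shows "a (\<one>\<^bsub>H\<^esub>, h) = a (\<one>\<^bsub>H\<^esub>, \<one>\<^bsub>H\<^esub>)" "a (h, \<one>\<^bsub>H\<^esub>) = a (\<one>\<^bsub>H\<^esub>, \<one>\<^bsub>H\<^esub>)"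
proof -
  have c: "a (g, h) * a (g \<otimes>\<^bsub>H\<^esub> h, k) = a (g, h \<otimes>\<^bsub>H\<^esub> k) * a (h, k)"
    if "g \<in> carrier H" "h \<in> carrier H" "k \<in> carrier H" for g h k using a that unfolding Z2_def by simp
  show "a (\<one>\<^bsub>H\<^esub>, h) = a (\<one>\<^bsub>H\<^esub>, \<one>\<^bsub>H\<^esub>)"
    using c[of "\<one>\<^bsub>H\<^esub>" "\<one>\<^bsub>H\<^esub>" h] cocycle_unit[of "\<one>\<^bsub>H\<^esub>" h] assms by simp
  show "a (h, \<one>\<^bsub>H\<^esub>) = a (\<one>\<^bsub>H\<^esub>, \<one>\<^bsub>H\<^esub>)"
    using c[of h "\<one>\<^bsub>H\<^esub>" "\<one>\<^bsub>H\<^esub>"] cocycle_unit[of h "\<one>\<^bsub>H\<^esub>"] assms by simp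
qed

lemma ext_carrier: "x \<in> carrier X \<longleftrightarrow> norm (fst x) = 1 \<and> snd x \<in> carrier H"
  unfolding extension_def by (auto simp: mem_Times_iff)

lemma ext_mult: "x \<otimes>\<^bsub>X\<^esub> y = (fst x * fst y * a (snd x, snd y), snd x \<otimes>\<^bsub>H\<^esub> snd y)"
  unfolding extension_def by (simp add: case_prod_unfold)

lemma ext_one: "\<epsilon> = (inverse (a (\<one>\<^bsub>H\<^esub>, \<one>\<^bsub>H\<^esub>)), \<one>\<^bsub>H\<^esub>)"
  unfolding extension_def by simp

lemma ext_one_closed: "\<epsilon> \<in> carrier X"
  unfolding ext_carrier ext_one by (simp add: norm_inverse cocycle_unit)

lemma ext_mult_closed: "x \<in> carrier X \<Longrightarrow> y \<in> carrier X \<Longrightarrow> x \<otimes>\<^bsub>X\<^esub> y \<in> carrier X"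
  unfolding ext_carrier ext_mult by (simp add: norm_mult cocycle_unit)

lemma ext_one_mult:
  assumes "x \<in> carrier X"
  shows "\<epsilon> \<otimes>\<^bsub>X\<^esub> x = x" "x \<otimes>\<^bsub>X\<^esub> \<epsilon> = x"
proof -
  have h: "snd x \<in> carrier H" using assms unfolding ext_carrier by blast
  note c = cocycle_unit(2)[OF H.one_closed H.one_closed]
  show "\<epsilon> \<otimes>\<^bsub>X\<^esub> x = x" "x \<otimes>\<^bsub>X\<^esub> \<epsilon> = x"
    unfolding ext_mult ext_one using c by (simp_all add: prod_eq_iff cocycle_one[OF h] h)
qed

lemma snd_one [simp]: "snd \<epsilon> = \<one>\<^bsub>H\<^esub>"
  unfolding ext_one by simp

lemma snd_mult: "snd (x \<otimes>\<^bsub>X\<^esub> y) = snd x \<otimes>\<^bsub>H\<^esub> snd y"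
  unfolding ext_mult by simp

lemma central_mult:
  assumes "x \<in> carrier X"
  shows "central H a z \<otimes>\<^bsub>X\<^esub> x = (z * fst x, snd x)"
proof -
  have h: "snd x \<in> carrier H" using assms unfolding ext_carrier by blast
  show ?thesis
    unfolding ext_mult central_def
    using cocycle_unit(2)[OF H.one_closed H.one_closed] by (simp add: cocycle_one[OF h] h)
qed

lemma central_one: "central H a 1 = \<epsilon>"
  unfolding central_def ext_one by simp

lemma central_closed: "norm z = 1 \<Longrightarrow> central H a z \<in> carrier X"
  unfolding ext_carrier central_def by (simp add: norm_mult norm_inverse cocycle_unit)

lemma scaled_closed: "x \<in> carrier X \<Longrightarrow> norm z = 1 \<Longrightarrow> (z * fst x, snd x) \<in> carrier X"
  unfolding ext_carrier by (simp add: norm_mult)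

lemma mem_line_class:
  assumes "x \<in> carrier X"
  shows "t \<in> lc r x w \<longleftrightarrow> (\<exists>z. norm z = 1 \<and> t = (r, (z * fst x, snd x), w / z))"
  unfolding line_class_def using central_mult[OF assms] by auto

lemma line_classI:
  assumes "x \<in> carrier X" "norm z = 1" "t = (r, (z * fst x, snd x), w / z)"
  shows "t \<in> lc r x w"
  unfolding mem_line_class[OF assms(1)] by (rule exI[of _ z]) (simp add: assms(2,3))

lemma line_classE:
  assumes x: "x \<in> carrier X" and t: "t \<in> lc r x w"
  obtains z where "norm z = 1" "z \<noteq> 0" "t = (r, (z * fst x, snd x), w / z)"
proof -
  obtain z where z: "norm z = 1" "t = (r, (z * fst x, snd x), w / z)"
    using t[unfolded mem_line_class[OF x]] by (elim exE conjE) (rule that)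
  then have "z \<noteq> 0" by auto
  then show ?thesis using that z by blast
qed

lemma image_constant_singleton: "t \<in> A \<Longrightarrow> (\<And>t. t \<in> A \<Longrightarrow> f t = c) \<Longrightarrow> f ` A = {c}"
  by force

lemma line_class_cong:
  assumes x: "x \<in> carrier X" and y: "y \<in> carrier X" and eq: "snd x = snd y" "fst x * w = fst y * v"
  shows "lc r x w = lc r y v"
proof -
  have sub: "lc r x w \<subseteq> lc r y v"
    if x: "x \<in> carrier X" and y: "y \<in> carrier X" and eq: "snd x = snd y" "fst x * w = fst y * v" for x y w v
  proof
    fix t assume "t \<in> lc r x w"
    then obtain z where z: "norm z = 1" "z \<noteq> 0" "t = (r, (z * fst x, snd x), w / z)" by (rule line_classE[OF x])
    have n: "norm (fst x) = 1" "norm (fst y) = 1" using x y unfolding ext_carrier by blast+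
    then have n0: "fst x \<noteq> 0" "fst y \<noteq> 0" by auto
    have w: "w = fst y * v / fst x" using eq(2) n0(1) by (metis nonzero_mult_div_cancel_left)
    show "t \<in> lc r y v"
    proof (rule line_classI[OF y])
      show "norm (z * fst x / fst y) = 1" by (simp add: norm_mult norm_divide n z(1))
      show "t = (r, (z * fst x / fst y * fst y, snd y), v / (z * fst x / fst y))"
        unfolding z(3) w using n0 eq(1) by (simp add: mult.commute)
    qed
  qed
  show ?thesis using sub[OF x y eq] sub[OF y x eq(1)[symmetric] eq(2)[symmetric]] by blast
qed

lemma line_class_normalize:
  assumes "x \<in> carrier X"
  shows "lc r x w = lc r (1, snd x) (fst x * w)" "(1, snd x) \<in> carrier X"
proof -
  show c: "(1, snd x) \<in> carrier X" using assms unfolding ext_carrier by simp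
  show "lc r x w = lc r (1, snd x) (fst x * w)" by (rule line_class_cong[OF assms c]) simp_all
qed

abbreviation "T0 \<equiv> prod_topology (prod_topology P (top_of_set On)) (prod_topology
    (prod_topology (top_of_set (sphere (0::complex) 1)) (discrete_topology (carrier H))) (euclidean :: complex topology))"

lemma topspace_T0: "(r, x, w) \<in> topspace T0 \<longleftrightarrow> fst r \<in> topspace P \<and> snd r \<in> On \<and> x \<in> carrier X"
  unfolding ext_carrier by (auto simp: mem_Times_iff)

lemma line_simps:
  "vtot L = final_topology (line_class H a ` topspace T0) {()} (\<lambda>_. T0) (\<lambda>_. line_class H a)"
  "vproj L = (\<lambda>l. the_elem ((\<lambda>(r, x, w). (r, snd x)) ` l))"
  "vadd L = (\<lambda>l l'. {(r, x, w + w') | r x w w'. (r, x, w) \<in> l \<and> (r, x, w') \<in> l'})"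
  "vscl L = (\<lambda>z l. {(r, x, z * w) | r x w. (r, x, w) \<in> l})"
  unfolding discrete_torsion_gerbe_def extension_gerbe_def Let_def frame_groupoid_def by simp_all

lemma topspace_L: "tot L = line_class H a ` topspace T0"
  unfolding line_simps by (rule topspace_final_topology) auto

lemma L_cases:
  assumes "l \<in> tot L"
  obtains \<xi> Q x w where "\<xi> \<in> topspace P" "Q \<in> On" "x \<in> carrier X" "l = lc (\<xi>, Q) x w"
proof -
  obtain t where t: "t \<in> topspace T0" "l = line_class H a t" using assms unfolding topspace_L by blast
  obtain \<xi> Q x w where "t = ((\<xi>, Q), x, w)" by (metis prod.exhaust)
  then show ?thesis using t topspace_T0[of "(\<xi>, Q)" x w] that[of \<xi> Q x w] by simp
qed

lemma lc_in: "\<xi> \<in> topspace P \<Longrightarrow> Q \<in> On \<Longrightarrow> x \<in> carrier X \<Longrightarrow> lc (\<xi>, Q) x w \<in> tot L"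
  unfolding topspace_L by (rule imageI) (simp only: topspace_T0 fst_conv snd_conv)

text \<open>The extension has the section \<open>h \<mapsto> (1, h)\<close>, which trivializes the line bundle.  The weight is the
  coordinate of a point in this trivialization; it does not depend on the representative.\<close>

definition line_weight :: "('r \<times> (complex \<times> 'k) \<times> complex) set \<Rightarrow> complex" where
  "line_weight l = the_elem ((\<lambda>(r, x, w). fst x * w) ` l)"

lemma line_class_ops:
  assumes x: "x \<in> carrier X"
  shows "vproj L (lc r x w) = (r, snd x)" "line_weight (lc r x w) = fst x * w"
    "vadd L (lc r x w) (lc r x w') = lc r x (w + w')" "vscl L z (lc r x w) = lc r x (z * w)"
proof -
  have one: "(r, x, w) \<in> lc r x w" for w by (rule line_classI[OF x, of 1]) simp_all
  have "(\<lambda>(r, x, w). (r, snd x)) ` lc r x w = {(r, snd x)}"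
    by (rule image_constant_singleton[OF one], erule line_classE[OF x]) simp
  then show "vproj L (lc r x w) = (r, snd x)" unfolding line_simps by simp
  have "(\<lambda>(r, x, w). fst x * w) ` lc r x w = {fst x * w}"
    by (rule image_constant_singleton[OF one], erule line_classE[OF x]) simp
  then show "line_weight (lc r x w) = fst x * w" unfolding line_weight_def by simp
  have n: "fst x \<noteq> 0" using x unfolding ext_carrier by auto
  show "vadd L (lc r x w) (lc r x w') = lc r x (w + w')"
  proof (intro equalityI subsetI)
    fix t assume "t \<in> vadd L (lc r x w) (lc r x w')"
    then obtain s y v v' where t: "t = (s, y, v + v')" "(s, y, v) \<in> lc r x w" "(s, y, v') \<in> lc r x w'"
      unfolding line_simps by blast
    obtain z where z: "norm z = 1" "z \<noteq> 0" "(s, y, v) = (r, (z * fst x, snd x), w / z)" using t(2) by (rule line_classE[OF x])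
    obtain z' where z': "norm z' = 1" "z' \<noteq> 0" "(s, y, v') = (r, (z' * fst x, snd x), w' / z')" using t(3) by (rule line_classE[OF x])
    have zz: "z' = z" using z(3) z'(3) n by simp
    show "t \<in> lc r x (w + w')"
      by (rule line_classI[OF x z(1)]) (use t(1) z(3) z'(3) in \<open>simp add: zz add_divide_distrib\<close>)
  next
    fix t assume "t \<in> lc r x (w + w')"
    then obtain z where z: "norm z = 1" "z \<noteq> 0" "t = (r, (z * fst x, snd x), (w + w') / z)" by (rule line_classE[OF x])
    have "(r, (z * fst x, snd x), v / z) \<in> lc r x v" for v by (rule line_classI[OF x z(1) refl])
    then have "\<exists>s y v v'. (r, (z * fst x, snd x), w / z + w' / z) = (s, y, v + v') \<and> (s, y, v) \<in> lc r x w \<and> (s, y, v') \<in> lc r x w'"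
      by blast
    then show "t \<in> vadd L (lc r x w) (lc r x w')" unfolding line_simps z(3) mem_Collect_eq add_divide_distrib .
  qed
  show "vscl L z (lc r x w) = lc r x (z * w)"
  proof (intro equalityI subsetI)
    fix t assume "t \<in> vscl L z (lc r x w)"
    then obtain s y v where t: "t = (s, y, z * v)" "(s, y, v) \<in> lc r x w" unfolding line_simps by blast
    obtain z' where z': "norm z' = 1" "z' \<noteq> 0" "(s, y, v) = (r, (z' * fst x, snd x), w / z')" using t(2) by (rule line_classE[OF x])
    show "t \<in> lc r x (z * w)" by (rule line_classI[OF x z'(1)]) (use t(1) z'(3) in simp)
  next
    fix t assume "t \<in> lc r x (z * w)"
    then obtain z' where z': "norm z' = 1" "z' \<noteq> 0" "t = (r, (z' * fst x, snd x), z * w / z')" by (rule line_classE[OF x])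
    have "(r, (z' * fst x, snd x), w / z') \<in> lc r x w" by (rule line_classI[OF x z'(1) refl])
    then have "\<exists>s y v. (r, (z' * fst x, snd x), z * (w / z')) = (s, y, z * v) \<and> (s, y, v) \<in> lc r x w" by blast
    then show "t \<in> vscl L z (lc r x w)" unfolding line_simps z'(3) mem_Collect_eq times_divide_eq_right .
  qed
qed

lemma lmult_line_class:
  assumes x: "x \<in> carrier X" and y: "y \<in> carrier X"
  shows "lmult \<L> (lc (\<xi>, Q) x w) (lc (\<xi>', Q') y v) = lc (\<xi>, Q' ** Q) (y \<otimes>\<^bsub>X\<^esub> x) (w * v)"
proof -
  have m: "lmult \<L> l l' = {((fst r, snd r' ** snd r), x' \<otimes>\<^bsub>X\<^esub> x, w * w') | r x w r' x' w'. (r, x, w) \<in> l \<and> (r', x', w') \<in> l'}" for l l'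
    unfolding discrete_torsion_gerbe_def extension_gerbe_def Let_def frame_groupoid_def
    by (simp add: case_prod_unfold apfst_def map_prod_def)
  note yx = ext_mult_closed[OF y x]
  have e: "(z' * fst y, snd y) \<otimes>\<^bsub>X\<^esub> (z * fst x, snd x) = (z * z' * fst (y \<otimes>\<^bsub>X\<^esub> x), snd (y \<otimes>\<^bsub>X\<^esub> x))" for z z'
    unfolding ext_mult by simp
  show ?thesis
  proof (intro equalityI subsetI)
    fix t assume "t \<in> lmult \<L> (lc (\<xi>, Q) x w) (lc (\<xi>', Q') y v)"
    then obtain r x2 w2 r' y2 v2 where t: "t = ((fst r, snd r' ** snd r), y2 \<otimes>\<^bsub>X\<^esub> x2, w2 * v2)"
        "(r, x2, w2) \<in> lc (\<xi>, Q) x w" "(r', y2, v2) \<in> lc (\<xi>', Q') y v"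
      unfolding m mem_Collect_eq by (elim exE conjE) (rule that)
    obtain z where z: "norm z = 1" "z \<noteq> 0" "(r, x2, w2) = ((\<xi>, Q), (z * fst x, snd x), w / z)"
      using t(2) by (rule line_classE[OF x])
    obtain z' where z': "norm z' = 1" "z' \<noteq> 0" "(r', y2, v2) = ((\<xi>', Q'), (z' * fst y, snd y), v / z')"
      using t(3) by (rule line_classE[OF y])
    show "t \<in> lc (\<xi>, Q' ** Q) (y \<otimes>\<^bsub>X\<^esub> x) (w * v)"
      by (rule line_classI[OF yx, of "z * z'"]) (use t(1) z z' in \<open>simp_all add: e norm_mult\<close>)
  next
    fix t assume "t \<in> lc (\<xi>, Q' ** Q) (y \<otimes>\<^bsub>X\<^esub> x) (w * v)"
    then obtain z where z: "norm z = 1" "z \<noteq> 0" "t = ((\<xi>, Q' ** Q), (z * fst (y \<otimes>\<^bsub>X\<^esub> x), snd (y \<otimes>\<^bsub>X\<^esub> x)), (w * v) / z)"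
      by (rule line_classE[OF yx])
    have 1: "((\<xi>, Q), (z * fst x, snd x), w / z) \<in> lc (\<xi>, Q) x w" by (rule line_classI[OF x z(1) refl])
    have 2: "((\<xi>', Q'), (1 * fst y, snd y), v / 1) \<in> lc (\<xi>', Q') y v" by (rule line_classI[OF y _ refl]) simp
    have "t = ((fst (\<xi>, Q), snd (\<xi>', Q') ** snd (\<xi>, Q)), (1 * fst y, snd y) \<otimes>\<^bsub>X\<^esub> (z * fst x, snd x), w / z * (v / 1))"
      unfolding z(3) e by simp
    then show "t \<in> lmult \<L> (lc (\<xi>, Q) x w) (lc (\<xi>', Q') y v)"
      unfolding m mem_Collect_eq
      by (intro exI conjI) (assumption, rule 1, rule 2)
  qed
qed

lemma groupoid_simps:
  "gobj \<G> = P" "garr \<G> = prod_topology (prod_topology P (top_of_set On)) (discrete_topology (carrier H))"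
  "gsrc \<G> ((\<xi>, Q), h) = \<xi>" "gtgt \<G> ((\<xi>, Q), h) = frame_push Y h (frame_rotate Q \<xi>)"
  unfolding orbifold_groupoid_def groupoid_times_group_def frame_groupoid_def by simp_all

lemma continuous_line_class: "continuous_map T0 (vtot L) (line_class H a)"
  unfolding line_simps
  by (rule continuous_map_into_final_topology[where f = "\<lambda>_. line_class H a" and T = "\<lambda>_. T0"]) auto

lemma continuous_line_proj: "continuous_map (vtot L) (garr \<G>) (vproj L)"
proof -
  have c: "continuous_map T0 (garr \<G>) (\<lambda>t. (fst t, snd (fst (snd t))))"
    unfolding groupoid_simps
    by (intro continuous_map_pairedI continuous_map_fst continuous_map_app[OF continuous_map_snd]
        continuous_map_app[OF continuous_map_fst] continuous_map_snd)
  have "continuous_map T0 (garr \<G>) (\<lambda>t. vproj L (line_class H a t))"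
  proof (rule continuous_map_eq[OF c])
    fix t assume t: "t \<in> topspace T0"
    obtain r x w where "t = (r, x, w)" by (metis prod.exhaust)
    then show "(fst t, snd (fst (snd t))) = vproj L (line_class H a t)"
      using t line_class_ops(1)[of x r w] topspace_T0[of r x w] by simp
  qed
  moreover have "vproj L \<in> line_class H a ` topspace T0 \<rightarrow> topspace (garr \<G>)"
  proof
    fix l assume "l \<in> line_class H a ` topspace T0"
    then obtain \<xi> Q x w where "\<xi> \<in> topspace P" "Q \<in> On" "x \<in> carrier X" "l = lc (\<xi>, Q) x w"
      unfolding topspace_L[symmetric] by (rule L_cases)
    then show "vproj L l \<in> topspace (garr \<G>)" unfolding groupoid_simps by (simp add: line_class_ops ext_carrier)
  qed
  ultimately show ?thesis unfolding line_simps(1)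
    by (intro continuous_map_from_final_topology) (rule imageI)
qed

lemma continuous_line_weight: "continuous_map (vtot L) euclidean line_weight"
proof -
  have "continuous_map T0 (top_of_set (sphere 0 1)) (\<lambda>t. fst (fst (snd t)))"
    by (intro continuous_map_app[OF continuous_map_snd] continuous_map_app[OF continuous_map_fst] continuous_map_fst)
  then have "continuous_map T0 euclidean (\<lambda>t. fst (fst (snd t)))" by (rule continuous_map_into_fulltopology)
  moreover have "continuous_map T0 euclidean (\<lambda>t. snd (snd t))"
    by (intro continuous_map_app[OF continuous_map_snd] continuous_map_snd)
  ultimately have c: "continuous_map T0 euclidean (\<lambda>t. fst (fst (snd t)) * snd (snd t))"
    by (rule continuous_map_euclidean_mult)
  have "continuous_map T0 euclidean (\<lambda>t. line_weight (line_class H a t))"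
  proof (rule continuous_map_eq[OF c])
    fix t assume t: "t \<in> topspace T0"
    obtain r x w where "t = (r, x, w)" by (metis prod.exhaust)
    then show "fst (fst (snd t)) * snd (snd t) = line_weight (line_class H a t)"
      using t line_class_ops(2)[of x r w] topspace_T0[of r x w] by simp
  qed
  then show ?thesis unfolding line_simps(1)
    by (intro continuous_map_from_final_topology) auto
qed

section \<open>Twisted bundles as bundles with a projective action\<close>

text \<open>A unit vector of the line bundle is given by an element of the extension and an orthogonal
  matrix.  So a twisted bundle is the same thing as a bundle on which the orthogonal group and the
  extension act compatibly, with the central U(1) acting by scalars.\<close>

definition frame_action :: "(('n, 'y) frame, 'e) vbundle \<Rightarrow>
    (complex \<times> ('y \<Rightarrow> 'y) \<Rightarrow> real^'n^'n \<Rightarrow> 'e \<Rightarrow> 'e) \<Rightarrow> bool" where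
  "frame_action E \<rho> \<longleftrightarrow> vector_bundle P E \<and>
     (\<forall>x\<in>carrier X. continuous_map (prod_topology (top_of_set On) (vtot E)) (vtot E) (\<lambda>y. \<rho> x (fst y) (snd y))) \<and>
     (\<forall>x\<in>carrier X. \<forall>Q\<in>On. \<forall>\<xi>\<in>topspace P.
        fibre_iso E \<xi> E (frame_push Y (snd x) (frame_rotate Q \<xi>)) (\<rho> x Q)) \<and>
     (\<forall>x\<in>carrier X. \<forall>y\<in>carrier X. \<forall>Q\<in>On. \<forall>Q'\<in>On. \<forall>e\<in>tot E.
        \<rho> y Q' (\<rho> x Q e) = \<rho> (y \<otimes>\<^bsub>X\<^esub> x) (Q' ** Q) e) \<and>
     (\<forall>x\<in>carrier X. \<forall>z\<in>sphere 0 1. \<forall>Q\<in>On. \<forall>e\<in>tot E.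
        \<rho> (z * fst x, snd x) Q e = vscl E z (\<rho> x Q e))"

text \<open>The action of the unit vector that the element \<open>x\<close> of the extension defines over the arrow of \<open>Q\<close>
  and \<open>snd x\<close>.  Bilinearity recovers the action of the whole line from it.\<close>

definition line_action where
  "line_action E act x Q e = act (lc (vproj E e, Q) x 1) e"

lemma twisted_bundle_imp_frame_action:
  assumes tw: "tbundle (E, act)"
  shows "frame_action E (line_action E act)"
    and "\<And>x Q w e. x \<in> carrier X \<Longrightarrow> Q \<in> On \<Longrightarrow> e \<in> tot E \<Longrightarrow>
      act (lc (vproj E e, Q) x w) e = vscl E w (line_action E act x Q e)"
proof -
  have E: "vector_bundle P E" and
    cont: "continuous_map
       (subtopology (prod_topology (vtot L) (vtot E)) {(l, e). gsrc \<G> (vproj L l) = vproj E e})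
       (vtot E) (\<lambda>(l, e). act l e)" and
    iso: "\<forall>l\<in>tot L. l \<noteq> vscl L 0 l \<longrightarrow>
        fibre_iso E (gsrc \<G> (vproj L l)) E (gtgt \<G> (vproj L l)) (act l)" and
    lin: "\<forall>r\<in>topspace (garr \<G>). \<forall>l\<in>fibre L r. \<forall>e\<in>fibre E (gsrc \<G> r).
        (\<forall>l'\<in>fibre L r. act (vadd L l l') e = vadd E (act l e) (act l' e)) \<and>
        (\<forall>z. act (vscl L z l) e = vscl E z (act l e))" and
    mult: "\<forall>r\<in>topspace (garr \<G>). \<forall>r'\<in>topspace (garr \<G>). gtgt \<G> r = gsrc \<G> r' \<longrightarrow>
        (\<forall>l\<in>fibre L r. \<forall>l'\<in>fibre L r'. \<forall>e\<in>fibre E (gsrc \<G> r).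
           act l' (act l e) = act (lmult \<L> l l') e)"
    using tw unfolding twisted_bundle_def Let_def groupoid_simps(1) by simp_all
  let ?\<rho> = "line_action E act"
  have lf: "lc (\<xi>, Q) x w \<in> fibre L ((\<xi>, Q), snd x)" "((\<xi>, Q), snd x) \<in> topspace (garr \<G>)"
    if "\<xi> \<in> topspace P" "Q \<in> On" "x \<in> carrier X" for \<xi> Q x w
  proof -
    show "lc (\<xi>, Q) x w \<in> fibre L ((\<xi>, Q), snd x)"
      by (rule fibreI[OF lc_in[OF that] line_class_ops(1)[OF that(3)]])
    show "((\<xi>, Q), snd x) \<in> topspace (garr \<G>)" using that unfolding groupoid_simps by (simp add: ext_carrier)
  qed
  show act: "act (lc (vproj E e, Q) x w) e = vscl E w (?\<rho> x Q e)"
    if x: "x \<in> carrier X" and Q: "Q \<in> On" and e: "e \<in> tot E" for x Q w e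
  proof -
    have \<xi>: "vproj E e \<in> topspace P" by (rule vector_bundle_proj_in[OF E e])
    have "act (vscl L w (lc (vproj E e, Q) x 1)) e = vscl E w (act (lc (vproj E e, Q) x 1) e)"
      using lin[rule_format, OF lf(2)[OF \<xi> Q x] lf(1)[OF \<xi> Q x], of e 1] fibreI[OF e refl] groupoid_simps(3) by simp
    then show ?thesis unfolding line_action_def line_class_ops(4)[OF x] by simp
  qed
  have iso1: "fibre_iso E \<xi> E (frame_push Y (snd x) (frame_rotate Q \<xi>)) (?\<rho> x Q)"
    if x: "x \<in> carrier X" and Q: "Q \<in> On" and \<xi>: "\<xi> \<in> topspace P" for x Q \<xi>
  proof -
    let ?l = "lc (\<xi>, Q) x 1"
    have "line_weight ?l \<noteq> line_weight (vscl L 0 ?l)"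
      unfolding line_class_ops[OF x] using x unfolding ext_carrier by auto
    then have "?l \<noteq> vscl L 0 ?l" by metis
    then have "fibre_iso E \<xi> E (frame_push Y (snd x) (frame_rotate Q \<xi>)) (act ?l)"
      using iso[rule_format, OF lc_in[OF \<xi> Q x], of 1] unfolding line_class_ops(1)[OF x] groupoid_simps by simp
    then show ?thesis
      by (rule fibre_iso_cong[OF _ _ E \<xi>]) (simp add: line_action_def fibreD)
  qed
  show "frame_action E ?\<rho>"
    unfolding frame_action_def
  proof (intro conjI ballI E iso1)
    fix x assume x: "x \<in> carrier X"
    let ?Z = "prod_topology (top_of_set On) (vtot E)"
    have nx: "fst x \<in> sphere 0 1" "snd x \<in> carrier H" using x unfolding ext_carrier by simp_all
    have p: "continuous_map ?Z P (\<lambda>y. vproj E (snd y))"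
      by (rule continuous_map_app[OF continuous_map_snd vector_bundle_proj[OF E]])
    have "continuous_map ?Z T0 (\<lambda>y. ((vproj E (snd y), fst y), x, 1))"
      by (intro continuous_map_pairedI p continuous_map_fst) (use nx in \<open>simp_all add: mem_Times_iff continuous_map_const\<close>)
    then have cl: "continuous_map ?Z (vtot L) (\<lambda>y. lc (vproj E (snd y), fst y) x 1)"
      by (rule continuous_map_app[OF _ continuous_line_class])
    have "continuous_map ?Z (subtopology (prod_topology (vtot L) (vtot E)) {(l, e). gsrc \<G> (vproj L l) = vproj E e})
        (\<lambda>y. (lc (vproj E (snd y), fst y) x 1, snd y))"
      by (rule continuous_map_into_subtopology[OF continuous_map_pairedI[OF cl continuous_map_snd]])
        (simp add: line_class_ops[OF x] groupoid_simps)
    from continuous_map_app[OF this cont]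
    show "continuous_map ?Z (vtot E) (\<lambda>y. ?\<rho> x (fst y) (snd y))" unfolding line_action_def by simp
  next
    fix x y Q Q' e assume x: "x \<in> carrier X" and y: "y \<in> carrier X" and Q: "Q \<in> On" and Q': "Q' \<in> On"
      and e: "e \<in> tot E"
    let ?\<xi> = "vproj E e" let ?\<xi>' = "frame_push Y (snd x) (frame_rotate Q ?\<xi>)"
    have \<xi>: "?\<xi> \<in> topspace P" by (rule vector_bundle_proj_in[OF E e])
    have 1: "?\<rho> x Q e \<in> fibre E ?\<xi>'"
      by (rule fibre_iso_in[OF iso1[OF x Q \<xi>] fibreI[OF e refl]])
    then have \<xi>': "?\<xi>' \<in> topspace P" using vector_bundle_proj_in[OF E] fibreD by metis
    have "act (lc (?\<xi>', Q') y 1) (act (lc (?\<xi>, Q) x 1) e) = act (lmult \<L> (lc (?\<xi>, Q) x 1) (lc (?\<xi>', Q') y 1)) e"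
      by (rule mult[rule_format, OF lf(2)[OF \<xi> Q x] lf(2)[OF \<xi>' Q' y] _ lf(1)[OF \<xi> Q x] lf(1)[OF \<xi>' Q' y]])
        (use fibreI[OF e refl] in \<open>simp_all add: groupoid_simps\<close>)
    then show "?\<rho> y Q' (?\<rho> x Q e) = ?\<rho> (y \<otimes>\<^bsub>X\<^esub> x) (Q' ** Q) e"
      using fibreD(2)[OF 1] unfolding line_action_def lmult_line_class[OF x y] by simp
  next
    fix x z Q e assume x: "x \<in> carrier X" and z: "z \<in> sphere (0::complex) 1" and Q: "Q \<in> On" and e: "e \<in> tot E"
    have zx: "(z * fst x, snd x) \<in> carrier X" using scaled_closed[OF x] z by simp
    have "lc (vproj E e, Q) (z * fst x, snd x) 1 = lc (vproj E e, Q) x z"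
      by (rule line_class_cong[OF zx x]) simp_all
    then show "?\<rho> (z * fst x, snd x) Q e = vscl E z (?\<rho> x Q e)"
      using act[OF x Q e, of z] unfolding line_action_def by simp
  qed
qed

lemma frame_actionD:
  assumes "frame_action E \<rho>"
  shows "vector_bundle P E"
    "\<And>x. x \<in> carrier X \<Longrightarrow> continuous_map (prod_topology (top_of_set On) (vtot E)) (vtot E) (\<lambda>y. \<rho> x (fst y) (snd y))"
    "\<And>x Q \<xi>. x \<in> carrier X \<Longrightarrow> Q \<in> On \<Longrightarrow> \<xi> \<in> topspace P \<Longrightarrow>
        fibre_iso E \<xi> E (frame_push Y (snd x) (frame_rotate Q \<xi>)) (\<rho> x Q)"
    "\<And>x y Q Q' e. x \<in> carrier X \<Longrightarrow> y \<in> carrier X \<Longrightarrow> Q \<in> On \<Longrightarrow> Q' \<in> On \<Longrightarrow> e \<in> tot E \<Longrightarrow>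
        \<rho> y Q' (\<rho> x Q e) = \<rho> (y \<otimes>\<^bsub>X\<^esub> x) (Q' ** Q) e"
    "\<And>x z Q e. x \<in> carrier X \<Longrightarrow> norm z = 1 \<Longrightarrow> Q \<in> On \<Longrightarrow> e \<in> tot E \<Longrightarrow>
        \<rho> (z * fst x, snd x) Q e = vscl E z (\<rho> x Q e)"
  using assms unfolding frame_action_def by simp_all

text \<open>The action of the section \<open>(1, h)\<close> is extended linearly to the line.  Compatibility with products
  holds because the product of \<open>(1, h)\<close> and \<open>(1, k)\<close> in the extension differs from \<open>(1, h k)\<close> by a
  central factor, the value of the cocycle, which acts as a scalar.\<close>

lemma frame_action_imp_twisted_bundle:
  assumes fa: "frame_action E \<rho>"
  defines "act \<equiv> \<lambda>l e. vscl E (line_weight l) (\<rho> (1, snd (vproj L l)) (snd (fst (vproj L l))) e)"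
  shows "tbundle (E, act)"
    and "\<And>x Q w e. x \<in> carrier X \<Longrightarrow> Q \<in> On \<Longrightarrow> e \<in> tot E \<Longrightarrow> line_action E act x Q e = \<rho> x Q e"
proof -
  note F = frame_actionD[OF fa] note E = F(1)
  have \<rho>f: "\<rho> x Q e \<in> fibre E (frame_push Y (snd x) (frame_rotate Q \<xi>))"
    if "x \<in> carrier X" "Q \<in> On" "\<xi> \<in> topspace P" "e \<in> fibre E \<xi>" for x Q \<xi> e
    by (rule fibre_iso_in[OF F(3)[OF that(1-3)] that(4)])
  have inP: "\<xi> \<in> topspace P" if "e \<in> fibre E \<xi>" for e \<xi>
    using vector_bundle_proj_in[OF E] fibreD[OF that] by metis
  have act: "act (lc (\<xi>, Q) x w) e = vscl E w (\<rho> x Q e)"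
    if x: "x \<in> carrier X" and Q: "Q \<in> On" and \<xi>: "\<xi> \<in> topspace P" and e: "e \<in> fibre E \<xi>" for x Q w \<xi> e
  proof -
    have c: "(1, snd x) \<in> carrier X" by (rule line_class_normalize(2)[OF x])
    have "act (lc (\<xi>, Q) x w) e = vscl E (fst x * w) (\<rho> (1, snd x) Q e)"
      unfolding act_def line_class_ops[OF x] by simp
    also have "\<dots> = vscl E w (vscl E (fst x) (\<rho> (1, snd x) Q e))"
      using fibre_laws(4)[OF E _ \<rho>f[OF c Q \<xi> e], of w "fst x"] inP[OF \<rho>f[OF c Q \<xi> e]] by (simp add: mult.commute)
    also have "vscl E (fst x) (\<rho> (1, snd x) Q e) = \<rho> x Q e"
      using F(5)[OF c _ Q fibreD(1)[OF e], of "fst x"] x unfolding ext_carrier by simp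
    finally show ?thesis .
  qed
  show "line_action E act x Q e = \<rho> x Q e"
    if x: "x \<in> carrier X" and Q: "Q \<in> On" and e: "e \<in> tot E" for x Q e
  proof -
    have \<xi>: "vproj E e \<in> topspace P" by (rule vector_bundle_proj_in[OF E e])
    note f = \<rho>f[OF x Q \<xi> fibreI[OF e refl]]
    show ?thesis unfolding line_action_def act[OF x Q \<xi> fibreI[OF e refl]] by (rule fibre_laws(3)[OF E inP[OF f] f])
  qed
  let ?S = "subtopology (prod_topology (vtot L) (vtot E)) {(l, e). gsrc \<G> (vproj L l) = vproj E e}"
  have cont: "continuous_map ?S (vtot E) (\<lambda>(l, e). act l e)"
  proof (rule continuous_map_locally)
    have Sfst: "continuous_map ?S (vtot L) fst" and Ssnd: "continuous_map ?S (vtot E) snd"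
      by (rule continuous_map_subtopology_fst continuous_map_subtopology_snd)+
    have pr: "continuous_map ?S (garr \<G>) (\<lambda>y. vproj L (fst y))"
      by (rule continuous_map_app[OF Sfst continuous_line_proj])
    then have pr': "continuous_map ?S (prod_topology (prod_topology P (top_of_set On)) (discrete_topology (carrier H))) (\<lambda>y. vproj L (fst y))"
      unfolding groupoid_simps .
    note prh = continuous_map_app[OF pr' continuous_map_snd]
      and prQ = continuous_map_app[OF continuous_map_app[OF pr' continuous_map_fst] continuous_map_snd]
    fix y0 assume y0: "y0 \<in> topspace ?S"
    define h where "h = snd (vproj L (fst y0))"
    have h: "h \<in> carrier H" using continuous_map_image_subset_topspace[OF prh] y0 unfolding h_def by auto
    have hX: "(1, h) \<in> carrier X" using h unfolding ext_carrier by simp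
    let ?U = "{y \<in> topspace ?S. snd (vproj L (fst y)) \<in> {h}}"
    have oU: "openin ?S ?U" by (rule openin_continuous_map_preimage[OF prh]) (use h in simp)
    let ?Z = "subtopology ?S ?U"
    have "continuous_map ?Z (prod_topology (top_of_set On) (vtot E)) (\<lambda>y. (snd (fst (vproj L (fst y))), snd y))"
      by (intro continuous_map_pairedI continuous_map_from_subtopology[OF prQ] continuous_map_from_subtopology[OF Ssnd])
    from continuous_map_app[OF this F(2)[OF hX]]
    have 1: "continuous_map ?Z (vtot E) (\<lambda>y. \<rho> (1, h) (snd (fst (vproj L (fst y)))) (snd y))" by simp
    have 2: "continuous_map ?Z euclidean (\<lambda>y. line_weight (fst y))"
      by (rule continuous_map_from_subtopology[OF continuous_map_app[OF Sfst continuous_line_weight]])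
    from continuous_map_app[OF continuous_map_pairedI[OF 2 1] continuous_vscl[OF E]]
    have "continuous_map ?Z (vtot E) (\<lambda>y. vscl E (line_weight (fst y)) (\<rho> (1, h) (snd (fst (vproj L (fst y)))) (snd y)))" by simp
    then have "continuous_map ?Z (vtot E) (\<lambda>(l, e). act l e)"
      by (rule continuous_map_eq) (simp add: act_def case_prod_unfold)
    then show "\<exists>U. openin ?S U \<and> y0 \<in> U \<and> continuous_map (subtopology ?S U) (vtot E) (\<lambda>(l, e). act l e)"
      using oU y0 by (intro exI[of _ ?U]) (simp add: h_def)
  qed
  have hom: "fibre_hom E \<xi> E (frame_push Y (snd x) (frame_rotate Q \<xi>)) (act (lc (\<xi>, Q) x w))"
    if x: "x \<in> carrier X" and Q: "Q \<in> On" and \<xi>: "\<xi> \<in> topspace P" for x Q w \<xi>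
    unfolding fibre_hom_def
  proof (intro conjI ballI allI)
    let ?\<xi> = "frame_push Y (snd x) (frame_rotate Q \<xi>)"
    note a = act[OF x Q \<xi>] note hm = fibre_homD[OF fibre_isoD(1)[OF F(3)[OF x Q \<xi>]]]
    have law: "\<rho> x Q e \<in> fibre E ?\<xi>" "?\<xi> \<in> topspace P" if "e \<in> fibre E \<xi>" for e using hm(1)[OF that] inP by auto
    show "act (lc (\<xi>, Q) x w) ` fibre E \<xi> \<subseteq> fibre E ?\<xi>"
      using a law fibre_laws(2)[OF E] by auto
    fix e assume e: "e \<in> fibre E \<xi>"
    show "act (lc (\<xi>, Q) x w) (vadd E e e') = vadd E (act (lc (\<xi>, Q) x w) e) (act (lc (\<xi>, Q) x w) e')" if e': "e' \<in> fibre E \<xi>" for e'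
      unfolding a[OF e] a[OF e'] a[OF fibre_laws(1)[OF E \<xi> e e']] hm(2)[OF e e']
      by (rule fibre_laws(6)[OF E law(2)[OF e] law(1)[OF e] law(1)[OF e']])
    show "act (lc (\<xi>, Q) x w) (vscl E z e) = vscl E z (act (lc (\<xi>, Q) x w) e)" for z
      unfolding a[OF e] a[OF fibre_laws(2)[OF E \<xi> e]] hm(3)[OF e] fibre_laws(4)[OF E law(2)[OF e] law(1)[OF e]]
      by (simp add: mult.commute)
  qed
  have iso: "fibre_iso E \<xi> E (frame_push Y (snd x) (frame_rotate Q \<xi>)) (act (lc (\<xi>, Q) x w))"
    if x: "x \<in> carrier X" and Q: "Q \<in> On" and \<xi>: "\<xi> \<in> topspace P" and w: "w \<noteq> 0" for x Q w \<xi>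
    unfolding fibre_iso_def
  proof (intro conjI hom[OF x Q \<xi>])
    let ?\<xi> = "frame_push Y (snd x) (frame_rotate Q \<xi>)"
    note a = act[OF x Q \<xi>] note iso = F(3)[OF x Q \<xi>]
    have law: "?\<xi> \<in> topspace P" if "e \<in> fibre E ?\<xi>" for e using inP[OF that] .
    have inv: "vscl E (1 / w) (vscl E w e) = e" "vscl E w (vscl E (1 / w) e) = e" if "e \<in> fibre E ?\<xi>" for e
      using fibre_laws(3,4)[OF E law[OF that] that] w by simp_all
    have "bij_betw (\<lambda>e. vscl E w e) (fibre E ?\<xi>) (fibre E ?\<xi>)"
      by (rule bij_betw_byWitness[where f' = "vscl E (1 / w)"]) (use inv fibre_laws(2)[OF E law] in auto)
    moreover have "bij_betw (\<rho> x Q) (fibre E \<xi>) (fibre E ?\<xi>)" using iso unfolding fibre_iso_def by blast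
    ultimately have "bij_betw (vscl E w \<circ> \<rho> x Q) (fibre E \<xi>) (fibre E ?\<xi>)" by (rule bij_betw_trans[rotated])
    then show "bij_betw (act (lc (\<xi>, Q) x w)) (fibre E \<xi>) (fibre E ?\<xi>)"
      by (rule bij_betw_cong[THEN iffD1, rotated]) (simp add: a)
  qed
  have fibL: "\<exists>\<xi> Q x w. \<xi> \<in> topspace P \<and> Q \<in> On \<and> x \<in> carrier X \<and> r = ((\<xi>, Q), snd x) \<and> l = lc (\<xi>, Q) x w"
    if lr: "l \<in> fibre L r" for l r
  proof -
    obtain \<xi> Q x w where l: "\<xi> \<in> topspace P" "Q \<in> On" "x \<in> carrier X" "l = lc (\<xi>, Q) x w" using fibreD(1)[OF lr] by (rule L_cases)
    then have "r = ((\<xi>, Q), snd x)" using fibreD(2)[OF lr] line_class_ops(1)[OF l(3)] l(4) by simp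
    then show ?thesis using l by blast
  qed
  show "tbundle (E, act)"
    unfolding twisted_bundle_def Let_def split_conv groupoid_simps(1)
  proof (intro conjI ballI allI impI E cont)
    fix l assume l: "l \<in> tot L"
    obtain \<xi> Q x w where lx: "\<xi> \<in> topspace P" "Q \<in> On" "x \<in> carrier X" "l = lc (\<xi>, Q) x w" using l by (rule L_cases)
    show "fibre_hom E (gsrc \<G> (vproj L l)) E (gtgt \<G> (vproj L l)) (act l)"
      unfolding lx(4) line_class_ops(1)[OF lx(3)] groupoid_simps by (rule hom[OF lx(3,2,1)])
    assume "l \<noteq> vscl L 0 l"
    then have "w \<noteq> 0" unfolding lx(4) line_class_ops(4)[OF lx(3)] by auto
    then show "fibre_iso E (gsrc \<G> (vproj L l)) E (gtgt \<G> (vproj L l)) (act l)"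
      unfolding lx(4) line_class_ops(1)[OF lx(3)] groupoid_simps by (rule iso[OF lx(3,2,1)])
  next
    fix r l e assume l: "l \<in> fibre L r" and e: "e \<in> fibre E (gsrc \<G> r)"
    obtain \<xi> Q x w where lx: "\<xi> \<in> topspace P" "Q \<in> On" "x \<in> carrier X" "r = ((\<xi>, Q), snd x)" "l = lc (\<xi>, Q) x w"
      using fibL[OF l] by (elim exE conjE) (rule that)
    have e': "e \<in> fibre E \<xi>" using e unfolding lx(4) groupoid_simps .
    note f = \<rho>f[OF lx(3,2,1) e'] note laws = fibre_laws[OF E inP[OF f] f] note a = act[OF lx(3,2,1) e']
    show "act (vscl L z l) e = vscl E z (act l e)" for z
      unfolding lx(5) line_class_ops(4)[OF lx(3)] a laws(4) ..
    fix l' assume l': "l' \<in> fibre L r"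
    obtain \<xi>' Q' x' w' where lx': "\<xi>' \<in> topspace P" "Q' \<in> On" "x' \<in> carrier X" "r = ((\<xi>', Q'), snd x')" "l' = lc (\<xi>', Q') x' w'"
      using fibL[OF l'] by (elim exE conjE) (rule that)
    have eqs: "\<xi>' = \<xi>" "Q' = Q" "snd x' = snd x" using lx(4) lx'(4) by simp_all
    have "lc (\<xi>', Q') x' w' = lc (\<xi>, Q) x (fst x' * w' / fst x)"
      unfolding eqs by (rule line_class_cong[OF lx'(3) lx(3) eqs(3)]) (use lx(3) in \<open>auto simp: ext_carrier\<close>)
    then have l2: "l' = lc (\<xi>, Q) x (fst x' * w' / fst x)" unfolding lx'(5) .
    show "act (vadd L l l') e = vadd E (act l e) (act l' e)"
      unfolding lx(5) l2 line_class_ops(3)[OF lx(3)] a laws(5) ..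
  next
    fix r r' l l' e assume rr: "gtgt \<G> r = gsrc \<G> r'" and l: "l \<in> fibre L r" and l': "l' \<in> fibre L r'"
      and e: "e \<in> fibre E (gsrc \<G> r)"
    obtain \<xi> Q x w where lx: "\<xi> \<in> topspace P" "Q \<in> On" "x \<in> carrier X" "r = ((\<xi>, Q), snd x)" "l = lc (\<xi>, Q) x w"
      using fibL[OF l] by (elim exE conjE) (rule that)
    obtain \<xi>' Q' x' w' where lx': "\<xi>' \<in> topspace P" "Q' \<in> On" "x' \<in> carrier X" "r' = ((\<xi>', Q'), snd x')" "l' = lc (\<xi>', Q') x' w'"
      using fibL[OF l'] by (elim exE conjE) (rule that)
    have e': "e \<in> fibre E \<xi>" using e unfolding lx(4) groupoid_simps .
    have \<xi>': "frame_push Y (snd x) (frame_rotate Q \<xi>) = \<xi>'" using rr unfolding lx(4) lx'(4) groupoid_simps .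
    note f = \<rho>f[OF lx(3,2,1) e', unfolded \<xi>']
    note f' = \<rho>f[OF lx'(3,2,1) f]
    have QQ: "Q' ** Q \<in> On" using lx(2) lx'(2) by (simp add: orthogonal_matrix_mul)
    have "act l' (act l e) = vscl E w' (\<rho> x' Q' (vscl E w (\<rho> x Q e)))"
      unfolding lx(5) lx'(5) act[OF lx(3,2,1) e'] by (rule act[OF lx'(3,2,1) fibre_laws(2)[OF E lx'(1) f]])
    also have "\<dots> = vscl E w' (vscl E w (\<rho> x' Q' (\<rho> x Q e)))"
      unfolding fibre_homD(3)[OF fibre_isoD(1)[OF F(3)[OF lx'(3,2,1)]] f] ..
    also have "\<dots> = vscl E (w * w') (\<rho> x' Q' (\<rho> x Q e))"
      unfolding fibre_laws(4)[OF E inP[OF f'] f'] by (simp add: mult.commute)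
    also have "\<rho> x' Q' (\<rho> x Q e) = \<rho> (x' \<otimes>\<^bsub>X\<^esub> x) (Q' ** Q) e"
      by (rule F(4)[OF lx(3) lx'(3) lx(2) lx'(2) fibreD(1)[OF e']])
    finally show "act l' (act l e) = act (lmult \<L> l l') e"
      unfolding lx(5) lx'(5) lmult_line_class[OF lx(3) lx'(3)] act[OF ext_mult_closed[OF lx'(3) lx(3)] QQ lx(1) e'] .
  qed
qed

end

section \<open>Comparing objects over the frame bundle with objects over the charts\<close>

context twisted_action
begin

interpretation H: group H by (rule H)

text \<open>A space \<open>T\<close> over the frame bundle is compared with a family of spaces \<open>S c\<close> over the chart
  domains: their pullbacks to the frames over each chart are identified by \<open>\<theta>\<close>, with inverse \<open>\<psi>\<close>.\<close>

definition over_comparison where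
  "over_comparison T \<pi> S \<omega> \<theta> \<psi> \<longleftrightarrow>
     continuous_map T P \<pi> \<and>
     (\<forall>c\<in>charts Y. continuous_map (S c) (top_of_set (cdom c)) (\<omega> c) \<and>
        continuous_map (pullback_space (FT c) fst (S c) (\<omega> c)) T (\<lambda>y. \<theta> c (fst y) (snd y)) \<and>
        continuous_map (pullback_space (FT c) (frame_class Y c) T \<pi>) (S c) (\<lambda>y. \<psi> c (fst y) (snd y)) \<and>
        (\<forall>p\<in>FC c.
           (\<forall>e\<in>topspace (S c). \<omega> c e = fst p \<longrightarrow> \<pi> (\<theta> c p e) = cls c p \<and> \<psi> c p (\<theta> c p e) = e) \<and>
           (\<forall>e\<in>topspace T. \<pi> e = cls c p \<longrightarrow> \<omega> c (\<psi> c p e) = fst p \<and> \<theta> c p (\<psi> c p e) = e)))"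

lemma over_comparisonD:
  assumes "over_comparison T \<pi> S \<omega> \<theta> \<psi>"
  shows "continuous_map T P \<pi>"
    "\<And>c. c \<in> charts Y \<Longrightarrow> continuous_map (S c) (top_of_set (cdom c)) (\<omega> c)"
    "\<And>c. c \<in> charts Y \<Longrightarrow>
        continuous_map (pullback_space (FT c) fst (S c) (\<omega> c)) T (\<lambda>y. \<theta> c (fst y) (snd y))"
    "\<And>c. c \<in> charts Y \<Longrightarrow>
        continuous_map (pullback_space (FT c) (frame_class Y c) T \<pi>) (S c) (\<lambda>y. \<psi> c (fst y) (snd y))"
    "\<And>c p e. c \<in> charts Y \<Longrightarrow> p \<in> FC c \<Longrightarrow> e \<in> topspace (S c) \<Longrightarrow> \<omega> c e = fst p \<Longrightarrow> \<pi> (\<theta> c p e) = cls c p"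
    "\<And>c p e. c \<in> charts Y \<Longrightarrow> p \<in> FC c \<Longrightarrow> e \<in> topspace (S c) \<Longrightarrow> \<omega> c e = fst p \<Longrightarrow> \<psi> c p (\<theta> c p e) = e"
    "\<And>c p e. c \<in> charts Y \<Longrightarrow> p \<in> FC c \<Longrightarrow> e \<in> topspace T \<Longrightarrow> \<pi> e = cls c p \<Longrightarrow> \<omega> c (\<psi> c p e) = fst p"
    "\<And>c p e. c \<in> charts Y \<Longrightarrow> p \<in> FC c \<Longrightarrow> e \<in> topspace T \<Longrightarrow> \<pi> e = cls c p \<Longrightarrow> \<theta> c p (\<psi> c p e) = e"
    "\<And>c p e. c \<in> charts Y \<Longrightarrow> p \<in> FC c \<Longrightarrow> e \<in> topspace (S c) \<Longrightarrow> \<omega> c e = fst p \<Longrightarrow> \<theta> c p e \<in> topspace T"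
    "\<And>c p e. c \<in> charts Y \<Longrightarrow> p \<in> FC c \<Longrightarrow> e \<in> topspace T \<Longrightarrow> \<pi> e = cls c p \<Longrightarrow> \<psi> c p e \<in> topspace (S c)"
proof -
  note A = assms[unfolded over_comparison_def]
  show "continuous_map T P \<pi>" using A by (rule conjunct1)
  note B = bspec[OF conjunct2[OF A]]
  show "continuous_map (S c) (top_of_set (cdom c)) (\<omega> c)" if "c \<in> charts Y" for c using B[OF that] by (elim conjE)
  show t: "continuous_map (pullback_space (FT c) fst (S c) (\<omega> c)) T (\<lambda>y. \<theta> c (fst y) (snd y))"
    if "c \<in> charts Y" for c using B[OF that] by (elim conjE)
  show p: "continuous_map (pullback_space (FT c) (frame_class Y c) T \<pi>) (S c) (\<lambda>y. \<psi> c (fst y) (snd y))"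
    if "c \<in> charts Y" for c using B[OF that] by (elim conjE)
  fix c p assume c: "c \<in> charts Y" and p': "p \<in> FC c"
  note Bp = bspec[OF conjunct2[OF conjunct2[OF conjunct2[OF B[OF c]]]] p']
  note C = conjunct1[OF Bp] conjunct2[OF Bp]
  show "\<pi> (\<theta> c p e) = cls c p" "\<psi> c p (\<theta> c p e) = e" "\<theta> c p e \<in> topspace T"
    if e: "e \<in> topspace (S c)" "\<omega> c e = fst p" for e
  proof -
    show "\<pi> (\<theta> c p e) = cls c p" "\<psi> c p (\<theta> c p e) = e" using C(1) e by blast+
    have "(p, e) \<in> topspace (pullback_space (FT c) fst (S c) (\<omega> c))"
      using e p' unfolding topspace_pullback_space by simp
    then show "\<theta> c p e \<in> topspace T" using t[OF c] unfolding continuous_map_def by (auto simp: Pi_iff)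
  qed
  show "\<omega> c (\<psi> c p e) = fst p" "\<theta> c p (\<psi> c p e) = e" "\<psi> c p e \<in> topspace (S c)"
    if e: "e \<in> topspace T" "\<pi> e = cls c p" for e
  proof -
    show "\<omega> c (\<psi> c p e) = fst p" "\<theta> c p (\<psi> c p e) = e" using C(2) e by blast+
    have "(p, e) \<in> topspace (pullback_space (FT c) (frame_class Y c) T \<pi>)"
      using e p' unfolding topspace_pullback_space by simp
    then show "\<psi> c p e \<in> topspace (S c)" using p[OF c] unfolding continuous_map_def by (auto simp: Pi_iff)
  qed
qed

text \<open>A map \<open>f\<close> over the frame bundle and maps \<open>\<phi> c\<close> over the charts that agree after pullback.\<close>

definition related where
  "related S \<omega> \<theta> S' \<omega>' \<theta>' f \<phi> \<longleftrightarrow> (\<forall>c\<in>charts Y. \<forall>p\<in>FC c. \<forall>e\<in>topspace (S c). \<omega> c e = fst p \<longrightarrow>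
     \<phi> c e \<in> topspace (S' c) \<and> \<omega>' c (\<phi> c e) = fst p \<and> f (\<theta> c p e) = \<theta>' c p (\<phi> c e))"

lemma relatedD:
  assumes "related S \<omega> \<theta> S' \<omega>' \<theta>' f \<phi>" "c \<in> charts Y" "p \<in> FC c" "e \<in> topspace (S c)" "\<omega> c e = fst p"
  shows "\<phi> c e \<in> topspace (S' c)" "\<omega>' c (\<phi> c e) = fst p" "f (\<theta> c p e) = \<theta>' c p (\<phi> c e)"
  using assms unfolding related_def by blast+

lemma over_comparison_section:
  assumes "over_comparison T \<pi> S \<omega> \<theta> \<psi>" "c \<in> charts Y" "e \<in> topspace (S c)"
  shows "frame_section c (\<omega> c e) \<in> FC c" "fst (frame_section c (\<omega> c e)) = \<omega> c e"
proof -
  have "\<omega> c e \<in> cdom c" using over_comparisonD(2)[OF assms(1,2)] assms(3) unfolding continuous_map_def by (auto simp: Pi_iff)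
  then show "frame_section c (\<omega> c e) \<in> FC c" "fst (frame_section c (\<omega> c e)) = \<omega> c e"
    using frame_section[OF assms(2)] by blast+
qed

lemma over_comparison_rep:
  assumes "over_comparison T \<pi> S \<omega> \<theta> \<psi>" "y \<in> topspace T"
  obtains c p e where "c \<in> charts Y" "p \<in> FC c" "\<pi> y = cls c p" "e \<in> topspace (S c)" "\<omega> c e = fst p" "y = \<theta> c p e"
proof -
  note D = over_comparisonD[OF assms(1)]
  have "\<pi> y \<in> topspace P" using D(1) assms(2) unfolding continuous_map_def by (auto simp: Pi_iff)
  then obtain c p where c: "c \<in> charts Y" "p \<in> FC c" "\<pi> y = cls c p" by (rule frame_bundleE)
  show ?thesis by (rule that[OF c D(10)[OF c(1,2) assms(2) c(3)] D(7)[OF c(1,2) assms(2) c(3)] D(8)[OF c(1,2) assms(2) c(3), symmetric]])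
qed

lemma related_maps:
  assumes T: "over_comparison T \<pi> S \<omega> \<theta> \<psi>" and T': "over_comparison T' \<pi>' S' \<omega>' \<theta>' \<psi>'"
    and rel: "related S \<omega> \<theta> S' \<omega>' \<theta>' f \<phi>" and y: "y \<in> topspace T"
  shows "f y \<in> topspace T'" "\<pi>' (f y) = \<pi> y"
proof -
  note D' = over_comparisonD[OF T']
  obtain c p e where r: "c \<in> charts Y" "p \<in> FC c" "\<pi> y = cls c p" "e \<in> topspace (S c)" "\<omega> c e = fst p" "y = \<theta> c p e"
    using over_comparison_rep[OF T y] .
  note R = relatedD[OF rel r(1,2,4,5)]
  show "f y \<in> topspace T'" "\<pi>' (f y) = \<pi> y"
    unfolding r(6) R(3) using D'(9)[OF r(1,2) R(1,2)] D'(5)[OF r(1,2) R(1,2)] r(3,6) by simp_all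
qed

text \<open>From \<open>f\<close> to \<open>\<phi>\<close> one restricts to the frames of the section over the chart.  From \<open>\<phi>\<close> to \<open>f\<close>
  one uses that the maps from the frames over charts to the frame bundle are open and jointly
  surjective.\<close>

lemma related_continuous:
  assumes T: "over_comparison T \<pi> S \<omega> \<theta> \<psi>" and T': "over_comparison T' \<pi>' S' \<omega>' \<theta>' \<psi>'"
    and rel: "related S \<omega> \<theta> S' \<omega>' \<theta>' f \<phi>"
  shows "continuous_map T T' f \<longleftrightarrow> (\<forall>c\<in>charts Y. continuous_map (S c) (S' c) (\<phi> c))"
proof
  note D = over_comparisonD[OF T] and D' = over_comparisonD[OF T']
  assume f: "continuous_map T T' f"
  show "\<forall>c\<in>charts Y. continuous_map (S c) (S' c) (\<phi> c)"
  proof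
    fix c assume c: "c \<in> charts Y"
    let ?s = "\<lambda>e. frame_section c (\<omega> c e)"
    note sec = over_comparison_section[OF T c]
    have cs: "continuous_map (S c) (FT c) ?s"
    proof (rule continuous_map_app[OF D(2)[OF c]])
      show "continuous_map (top_of_set (cdom c)) (FT c) (frame_section c)"
        using frame_section(1,2)[OF c] by simp
    qed
    have "continuous_map (S c) (pullback_space (FT c) fst (S c) (\<omega> c)) (\<lambda>e. (?s e, e))"
      by (rule continuous_map_into_pullback[OF cs]) (use sec in simp_all)
    from continuous_map_app[OF this D(3)[OF c]]
    have "continuous_map (S c) T (\<lambda>e. \<theta> c (?s e) e)" by simp
    from continuous_map_app[OF this f]
    have "continuous_map (S c) T' (\<lambda>e. f (\<theta> c (?s e) e))" .
    moreover have R: "f (\<theta> c (?s e) e) = \<theta>' c (?s e) (\<phi> c e)" "\<phi> c e \<in> topspace (S' c)" "\<omega>' c (\<phi> c e) = fst (?s e)"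
      if "e \<in> topspace (S c)" for e
      using relatedD[OF rel c sec(1)[OF that] that sec(2)[OF that, symmetric]] by simp_all
    ultimately have "continuous_map (S c) (pullback_space (FT c) (frame_class Y c) T' \<pi>') (\<lambda>e. (?s e, f (\<theta> c (?s e) e)))"
      by (intro continuous_map_into_pullback[OF cs]) (use D'(5)[OF c] sec(1) in simp_all)
    from continuous_map_app[OF this D'(4)[OF c]]
    have "continuous_map (S c) (S' c) (\<lambda>e. \<psi>' c (?s e) (f (\<theta> c (?s e) e)))" by simp
    then show "continuous_map (S c) (S' c) (\<phi> c)"
      by (rule continuous_map_eq) (use R D'(6)[OF c sec(1)] in simp)
  qed
next
  note D = over_comparisonD[OF T] and D' = over_comparisonD[OF T']
  assume \<phi>: "\<forall>c\<in>charts Y. continuous_map (S c) (S' c) (\<phi> c)"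
  show "continuous_map T T' f"
  proof (rule continuous_map_by_pullbacks[where I = "charts Y" and Q = "\<lambda>c. FT c" and b = "frame_class Y"])
    show "open_map (FT c) P (frame_class Y c)" if "c \<in> charts Y" for c by (rule open_frame_class[OF that])
    show "topspace P \<subseteq> (\<Union>c\<in>charts Y. frame_class Y c ` topspace (FT c))" unfolding topspace_frame_bundle by simp
    show "continuous_map T P \<pi>" by (rule D(1))
    show "f \<in> topspace T \<rightarrow> topspace T'" by (rule Pi_I, rule related_maps(1)[OF T T' rel])
    fix c assume c: "c \<in> charts Y"
    let ?Z = "pullback_space (FT c) (frame_class Y c) T \<pi>"
    have Z: "fst y \<in> FC c" "snd y \<in> topspace T" "\<pi> (snd y) = cls c (fst y)" if "y \<in> topspace ?Z" for y
      using that unfolding topspace_pullback_space by auto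
    have "continuous_map ?Z (S' c) (\<lambda>y. \<phi> c (\<psi> c (fst y) (snd y)))"
      by (rule continuous_map_app[OF D(4)[OF c] bspec[OF \<phi> c]])
    moreover have R: "\<omega>' c (\<phi> c (\<psi> c (fst y) (snd y))) = fst (fst y)"
        "f (snd y) = \<theta>' c (fst y) (\<phi> c (\<psi> c (fst y) (snd y)))" if "y \<in> topspace ?Z" for y
      using relatedD[OF rel c Z(1)[OF that] D(10)[OF c Z[OF that]] D(7)[OF c Z[OF that]]] D(8)[OF c Z[OF that]] by simp_all
    ultimately have "continuous_map ?Z (pullback_space (FT c) fst (S' c) (\<omega>' c)) (\<lambda>y. (fst y, \<phi> c (\<psi> c (fst y) (snd y))))"
      by (intro continuous_map_into_pullback continuous_map_pullback_fst) simp_all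
    from continuous_map_app[OF this D'(3)[OF c]]
    have "continuous_map ?Z T' (\<lambda>y. \<theta>' c (fst y) (\<phi> c (\<psi> c (fst y) (snd y))))" by simp
    then show "continuous_map ?Z T' (\<lambda>y. f (snd y))" by (rule continuous_map_eq) (simp add: R)
  qed
qed

lemma related_homeomorphic:
  assumes T: "over_comparison T \<pi> S \<omega> \<theta> \<psi>" and T': "over_comparison T' \<pi>' S' \<omega>' \<theta>' \<psi>'"
    and rel: "related S \<omega> \<theta> S' \<omega>' \<theta>' f \<phi>"
  shows "homeomorphic_map T T' f \<longleftrightarrow> (\<forall>c\<in>charts Y. homeomorphic_map (S c) (S' c) (\<phi> c))"
proof
  note D = over_comparisonD[OF T] and D' = over_comparisonD[OF T']
  assume "homeomorphic_map T T' f"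
  then obtain g where fg: "homeomorphic_maps T T' f g" using homeomorphic_map_maps by blast
  note fg1 = fg[unfolded homeomorphic_maps_def]
  note cf = conjunct1[OF fg1] and cg = conjunct1[OF conjunct2[OF fg1]]
    and gf = bspec[OF conjunct1[OF conjunct2[OF conjunct2[OF fg1]]]]
    and fg' = bspec[OF conjunct2[OF conjunct2[OF conjunct2[OF fg1]]]]
  have gT: "g y \<in> topspace T" "\<pi> (g y) = \<pi>' y" if "y \<in> topspace T'" for y
  proof -
    show 1: "g y \<in> topspace T" using cg that unfolding continuous_map_def by (auto simp: Pi_iff)
    show "\<pi> (g y) = \<pi>' y" using related_maps(2)[OF T T' rel 1] fg'[OF that] by simp
  qed
  define \<gamma> where "\<gamma> c e = \<psi> c (frame_section c (\<omega>' c e)) (g (\<theta>' c (frame_section c (\<omega>' c e)) e))" for c e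
  have G: "\<gamma> c e \<in> topspace (S c)" "\<omega> c (\<gamma> c e) = \<omega>' c e" "\<phi> c (\<gamma> c e) = e"
    if c: "c \<in> charts Y" and e: "e \<in> topspace (S' c)" for c e
  proof -
    let ?s = "frame_section c (\<omega>' c e)"
    note s = over_comparison_section[OF T' c e]
    note t = D'(9)[OF c s(1) e s(2)[symmetric]] and u = D'(5)[OF c s(1) e s(2)[symmetric]]
    have g: "g (\<theta>' c ?s e) \<in> topspace T" "\<pi> (g (\<theta>' c ?s e)) = cls c ?s" using gT[OF t] u by simp_all
    show 1: "\<gamma> c e \<in> topspace (S c)" unfolding \<gamma>_def by (rule D(10)[OF c s(1) g])
    have 2: "\<omega> c (\<gamma> c e) = fst ?s" unfolding \<gamma>_def by (rule D(7)[OF c s(1) g])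
    then show "\<omega> c (\<gamma> c e) = \<omega>' c e" using s(2) by simp
    note R = relatedD[OF rel c s(1) 1 2]
    have "\<theta>' c ?s (\<phi> c (\<gamma> c e)) = \<theta>' c ?s e"
      unfolding R(3)[symmetric] using D(8)[OF c s(1) g] fg'[OF t] unfolding \<gamma>_def by simp
    then have "\<psi>' c ?s (\<theta>' c ?s (\<phi> c (\<gamma> c e))) = \<psi>' c ?s (\<theta>' c ?s e)" by simp
    then show "\<phi> c (\<gamma> c e) = e" using D'(6)[OF c s(1) R(1,2)] D'(6)[OF c s(1) e s(2)[symmetric]] by simp
  qed
  have rl: "related S' \<omega>' \<theta>' S \<omega> \<theta> g \<gamma>"
    unfolding related_def
  proof (intro ballI impI conjI)
    fix c p e assume c: "c \<in> charts Y" and p: "p \<in> FC c" and e: "e \<in> topspace (S' c)" "\<omega>' c e = fst p"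
    show "\<gamma> c e \<in> topspace (S c)" by (rule G(1)[OF c e(1)])
    show w: "\<omega> c (\<gamma> c e) = fst p" using G(2)[OF c e(1)] e(2) by simp
    note R = relatedD[OF rel c p G(1)[OF c e(1)] w]
    have "g (\<theta>' c p (\<phi> c (\<gamma> c e))) = \<theta> c p (\<gamma> c e)"
      unfolding R(3)[symmetric] by (rule gf[OF D(9)[OF c p G(1)[OF c e(1)] w]])
    then show "g (\<theta>' c p e) = \<theta> c p (\<gamma> c e)" unfolding G(3)[OF c e(1)] .
  qed
  have cont: "\<forall>c\<in>charts Y. continuous_map (S' c) (S c) (\<gamma> c)"
    by (rule related_continuous[OF T' T rl, THEN iffD1, OF cg])
  show "\<forall>c\<in>charts Y. homeomorphic_map (S c) (S' c) (\<phi> c)"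
  proof
    fix c assume c: "c \<in> charts Y"
    have gf2: "\<gamma> c (\<phi> c e) = e" if e: "e \<in> topspace (S c)" for e
    proof -
      let ?s = "frame_section c (\<omega> c e)"
      note s = over_comparison_section[OF T c e]
      note R = relatedD[OF rel c s(1) e s(2)[symmetric]]
      have w: "\<omega>' c (\<phi> c e) = \<omega> c e" using R(2) s(2) by simp
      show ?thesis unfolding \<gamma>_def w R(3)[symmetric] gf[OF D(9)[OF c s(1) e s(2)[symmetric]]]
        by (rule D(6)[OF c s(1) e s(2)[symmetric]])
    qed
    have cphi: "continuous_map (S c) (S' c) (\<phi> c)" by (rule bspec[OF related_continuous[OF T T' rel, THEN iffD1, OF cf] c])
    have "homeomorphic_maps (S c) (S' c) (\<phi> c) (\<gamma> c)"
      unfolding homeomorphic_maps_def by (intro conjI ballI cphi bspec[OF cont c] G(3)[OF c] gf2)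
    then show "homeomorphic_map (S c) (S' c) (\<phi> c)" using homeomorphic_map_maps by blast
  qed
next
  note D = over_comparisonD[OF T] and D' = over_comparisonD[OF T']
  assume hom: "\<forall>c\<in>charts Y. homeomorphic_map (S c) (S' c) (\<phi> c)"
  define \<gamma> where "\<gamma> c = (SOME g. homeomorphic_maps (S c) (S' c) (\<phi> c) g)" for c
  have G0: "homeomorphic_maps (S c) (S' c) (\<phi> c) (\<gamma> c)" if "c \<in> charts Y" for c
    unfolding \<gamma>_def by (rule someI_ex[OF homeomorphic_map_maps[THEN iffD1, OF bspec[OF hom that]]])
  note G1 = G0[unfolded homeomorphic_maps_def]
  have G: "continuous_map (S c) (S' c) (\<phi> c)" "continuous_map (S' c) (S c) (\<gamma> c)"
    "\<And>e. e \<in> topspace (S c) \<Longrightarrow> \<gamma> c (\<phi> c e) = e" "\<And>e. e \<in> topspace (S' c) \<Longrightarrow> \<phi> c (\<gamma> c e) = e"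
    "\<And>e. e \<in> topspace (S' c) \<Longrightarrow> \<gamma> c e \<in> topspace (S c)"
    if "c \<in> charts Y" for c
  proof -
    note g = G1[OF that]
    show "continuous_map (S c) (S' c) (\<phi> c)" by (rule conjunct1[OF g])
    show cg: "continuous_map (S' c) (S c) (\<gamma> c)" by (rule conjunct1[OF conjunct2[OF g]])
    show "\<gamma> c (\<phi> c e) = e" if "e \<in> topspace (S c)" for e by (rule bspec[OF conjunct1[OF conjunct2[OF conjunct2[OF g]]] that])
    show "\<phi> c (\<gamma> c e) = e" if "e \<in> topspace (S' c)" for e by (rule bspec[OF conjunct2[OF conjunct2[OF conjunct2[OF g]]] that])
    show "\<gamma> c e \<in> topspace (S c)" if "e \<in> topspace (S' c)" for e using cg that unfolding continuous_map_def by (auto simp: Pi_iff)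
  qed
  have inj: "inj_on f (topspace T)"
  proof (rule inj_onI)
    fix y z assume y: "y \<in> topspace T" and z: "z \<in> topspace T" and eq: "f y = f z"
    obtain c p e where r: "c \<in> charts Y" "p \<in> FC c" "\<pi> y = cls c p" "e \<in> topspace (S c)" "\<omega> c e = fst p" "y = \<theta> c p e"
      using over_comparison_rep[OF T y] .
    have pz: "\<pi> z = cls c p" using related_maps(2)[OF T T' rel y] related_maps(2)[OF T T' rel z] eq r(3) by simp
    define e2 where "e2 = \<psi> c p z"
    have e2: "e2 \<in> topspace (S c)" "\<omega> c e2 = fst p" "z = \<theta> c p e2"
      unfolding e2_def using D(10)[OF r(1,2) z pz] D(7)[OF r(1,2) z pz] D(8)[OF r(1,2) z pz] by simp_all
    note R = relatedD[OF rel r(1,2,4,5)] and R2 = relatedD[OF rel r(1,2) e2(1,2)]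
    have "\<theta>' c p (\<phi> c e) = \<theta>' c p (\<phi> c e2)" using eq R(3) R2(3) r(6) e2(3) by simp
    then have "\<psi>' c p (\<theta>' c p (\<phi> c e)) = \<psi>' c p (\<theta>' c p (\<phi> c e2))" by simp
    then have ee: "\<phi> c e = \<phi> c e2" using D'(6)[OF r(1,2) R(1,2)] D'(6)[OF r(1,2) R2(1,2)] by simp
    have "e = \<gamma> c (\<phi> c e)" by (rule G(3)[OF r(1) r(4), symmetric])
    also have "\<dots> = e2" unfolding ee by (rule G(3)[OF r(1) e2(1)])
    finally have "e = e2" .
    then show "y = z" using r(6) e2(3) by simp
  qed
  define g where "g = inv_into (topspace T) f"
  have rel': "related S' \<omega>' \<theta>' S \<omega> \<theta> g \<gamma>"
    unfolding related_def
  proof (intro ballI impI conjI)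
    fix c p e assume c: "c \<in> charts Y" and p: "p \<in> FC c" and e: "e \<in> topspace (S' c)" "\<omega>' c e = fst p"
    show 1: "\<gamma> c e \<in> topspace (S c)" by (rule G(5)[OF c e(1)])
    note s = over_comparison_section[OF T c 1]
    show w: "\<omega> c (\<gamma> c e) = fst p" using relatedD(2)[OF rel c s(1) 1 s(2)[symmetric]] s(2) e(2) G(4)[OF c e(1)] by simp
    note R = relatedD[OF rel c p 1 w]
    have "f (\<theta> c p (\<gamma> c e)) = \<theta>' c p e" using R(3) G(4)[OF c e(1)] by simp
    then show "g (\<theta>' c p e) = \<theta> c p (\<gamma> c e)" unfolding g_def using inv_into_f_f[OF inj D(9)[OF c p 1 w]] by metis
  qed
  have m1: "continuous_map T T' f" by (rule related_continuous[OF T T' rel, THEN iffD2]) (intro ballI G(1))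
  have m2: "continuous_map T' T g" by (rule related_continuous[OF T' T rel', THEN iffD2]) (intro ballI G(2))
  have m3: "g (f y) = y" if "y \<in> topspace T" for y unfolding g_def by (rule inv_into_f_f[OF inj that])
  have m4: "f (g y) = y" if y: "y \<in> topspace T'" for y
  proof -
    obtain c p e where r: "c \<in> charts Y" "p \<in> FC c" "\<pi>' y = cls c p" "e \<in> topspace (S' c)" "\<omega>' c e = fst p" "y = \<theta>' c p e"
      using over_comparison_rep[OF T' y] .
    note R' = relatedD[OF rel' r(1,2,4,5)]
    show ?thesis unfolding r(6) R'(3) relatedD(3)[OF rel r(1,2) R'(1,2)] G(4)[OF r(1,4)] ..
  qed
  have "homeomorphic_maps T T' f g" unfolding homeomorphic_maps_def by (intro conjI ballI m1 m2 m3 m4)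
  then show "homeomorphic_map T T' f" using homeomorphic_map_maps by blast
qed

text \<open>The total space of a Whitney sum is a fibre product, and comparisons can be formed componentwise.\<close>

lemma over_comparison_product:
  assumes T: "over_comparison T \<pi> S \<omega> \<theta> \<psi>" and T': "over_comparison T' \<pi>' S' \<omega>' \<theta>' \<psi>'"
  shows "over_comparison (subtopology (prod_topology T T') {(e, f). \<pi> e = \<pi>' f}) (\<lambda>y. \<pi> (fst y))
     (\<lambda>c. subtopology (prod_topology (S c) (S' c)) {(e, f). \<omega> c e = \<omega>' c f}) (\<lambda>c y. \<omega> c (fst y))
     (\<lambda>c p y. (\<theta> c p (fst y), \<theta>' c p (snd y))) (\<lambda>c p y. (\<psi> c p (fst y), \<psi>' c p (snd y)))"
    (is "over_comparison ?T _ ?S _ _ _")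
  unfolding over_comparison_def
proof (intro conjI ballI impI)
  note D = over_comparisonD[OF T] and D' = over_comparisonD[OF T']
  show "continuous_map ?T P (\<lambda>y. \<pi> (fst y))" by (rule continuous_map_app[OF continuous_map_subtopology_fst D(1)])
  fix c assume c: "c \<in> charts Y"
  show "continuous_map (?S c) (top_of_set (cdom c)) (\<lambda>y. \<omega> c (fst y))"
    by (rule continuous_map_app[OF continuous_map_subtopology_fst D(2)[OF c]])
  let ?X = "pullback_space (FT c) fst (?S c) (\<lambda>y. \<omega> c (fst y))"
  have X: "fst y \<in> FC c" "fst (snd y) \<in> topspace (S c)" "snd (snd y) \<in> topspace (S' c)"
    "\<omega> c (fst (snd y)) = fst (fst y)" "\<omega>' c (snd (snd y)) = fst (fst y)" if "y \<in> topspace ?X" for y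
    using that unfolding topspace_pullback_space by auto
  have x1: "continuous_map ?X (pullback_space (FT c) fst (S c) (\<omega> c)) (\<lambda>y. (fst y, fst (snd y)))"
    by (rule continuous_map_into_pullback[OF continuous_map_pullback_fst continuous_map_app[OF continuous_map_pullback_snd continuous_map_subtopology_fst]])
      (simp add: X)
  have x2: "continuous_map ?X (pullback_space (FT c) fst (S' c) (\<omega>' c)) (\<lambda>y. (fst y, snd (snd y)))"
    by (rule continuous_map_into_pullback[OF continuous_map_pullback_fst continuous_map_app[OF continuous_map_pullback_snd continuous_map_subtopology_snd]])
      (simp add: X)
  show "continuous_map ?X ?T (\<lambda>y. (\<theta> c (fst y) (fst (snd y)), \<theta>' c (fst y) (snd (snd y))))"
  proof (rule continuous_map_into_subtopology[OF continuous_map_pairedI], goal_cases)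
    case 1 show ?case using continuous_map_app[OF x1 D(3)[OF c]] by simp
    case 2 show ?case using continuous_map_app[OF x2 D'(3)[OF c]] by simp
    case 3 show ?case by (rule Pi_I) (simp add: D(5)[OF c] D'(5)[OF c] X)
  qed
  let ?Z = "pullback_space (FT c) (frame_class Y c) ?T (\<lambda>y. \<pi> (fst y))"
  have Z: "fst y \<in> FC c" "fst (snd y) \<in> topspace T" "snd (snd y) \<in> topspace T'"
    "\<pi> (fst (snd y)) = cls c (fst y)" "\<pi>' (snd (snd y)) = cls c (fst y)" if "y \<in> topspace ?Z" for y
    using that unfolding topspace_pullback_space by auto
  have z1: "continuous_map ?Z (pullback_space (FT c) (frame_class Y c) T \<pi>) (\<lambda>y. (fst y, fst (snd y)))"
    by (rule continuous_map_into_pullback[OF continuous_map_pullback_fst continuous_map_app[OF continuous_map_pullback_snd continuous_map_subtopology_fst]])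
      (simp add: Z)
  have z2: "continuous_map ?Z (pullback_space (FT c) (frame_class Y c) T' \<pi>') (\<lambda>y. (fst y, snd (snd y)))"
    by (rule continuous_map_into_pullback[OF continuous_map_pullback_fst continuous_map_app[OF continuous_map_pullback_snd continuous_map_subtopology_snd]])
      (simp add: Z)
  show "continuous_map ?Z (?S c) (\<lambda>y. (\<psi> c (fst y) (fst (snd y)), \<psi>' c (fst y) (snd (snd y))))"
  proof (rule continuous_map_into_subtopology[OF continuous_map_pairedI], goal_cases)
    case 1 show ?case using continuous_map_app[OF z1 D(4)[OF c]] by simp
    case 2 show ?case using continuous_map_app[OF z2 D'(4)[OF c]] by simp
    case 3 show ?case by (rule Pi_I) (simp add: D(7)[OF c] D'(7)[OF c] Z)
  qed
  fix p assume p: "p \<in> FC c"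
  show "\<pi> (fst (\<theta> c p (fst e), \<theta>' c p (snd e))) = cls c p"
    "(\<psi> c p (fst (\<theta> c p (fst e), \<theta>' c p (snd e))), \<psi>' c p (snd (\<theta> c p (fst e), \<theta>' c p (snd e)))) = e"
    if "e \<in> topspace (?S c)" "\<omega> c (fst e) = fst p" for e
    using that D(5,6)[OF c p] D'(5,6)[OF c p] by (auto simp: prod_eq_iff)
  show "\<omega> c (fst (\<psi> c p (fst e), \<psi>' c p (snd e))) = fst p"
    "(\<theta> c p (fst (\<psi> c p (fst e), \<psi>' c p (snd e))), \<theta>' c p (snd (\<psi> c p (fst e), \<psi>' c p (snd e)))) = e"
    if "e \<in> topspace ?T" "\<pi> (fst e) = cls c p" for e
    using that D(7,8)[OF c p] D'(7,8)[OF c p] by (auto simp: prod_eq_iff)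
qed

end

context twisted_action
begin

interpretation H: group H by (rule H)

section \<open>Twisted orbibundles as families with an action of the extension\<close>

abbreviation "St \<E> \<equiv> (\<lambda>c. vtot (\<E> c))"
abbreviation "Sp \<E> \<equiv> (\<lambda>c. vproj (\<E> c))"

lemma twisted_orbibundleD:
  assumes tw: "twisted_orbibundle Y H a (O', A)"
  shows "\<And>c. c \<in> charts Y \<Longrightarrow> vector_bundle (top_of_set (cdom c)) (obun O' c)"
    "\<And>x c d W l. x \<in> carrier X \<Longrightarrow> c \<in> charts Y \<Longrightarrow> d \<in> charts Y \<Longrightarrow> local_lift (snd x) c d W l \<Longrightarrow>
      continuous_map (subtopology (vtot (obun O' c)) {e. vproj (obun O' c) e \<in> W}) (vtot (obun O' d)) (A x c W l d)"
    "\<And>x c d W l u. x \<in> carrier X \<Longrightarrow> c \<in> charts Y \<Longrightarrow> d \<in> charts Y \<Longrightarrow> local_lift (snd x) c d W l \<Longrightarrow> u \<in> W \<Longrightarrow>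
      fibre_iso (obun O' c) u (obun O' d) (l u) (A x c W l d)"
    "\<And>x y b c d W l V m u e. x \<in> carrier X \<Longrightarrow> y \<in> carrier X \<Longrightarrow> b \<in> charts Y \<Longrightarrow> c \<in> charts Y \<Longrightarrow> d \<in> charts Y \<Longrightarrow>
      local_lift (snd y) b c W l \<Longrightarrow> local_lift (snd x) c d V m \<Longrightarrow> l ` W \<subseteq> V \<Longrightarrow> u \<in> W \<Longrightarrow> e \<in> fibre (obun O' b) u \<Longrightarrow>
      A x c V m d (A y b W l c e) = A (x \<otimes>\<^bsub>X\<^esub> y) b W (compose W m l) d e"
    "\<And>z c d W l u e. norm z = 1 \<Longrightarrow> c \<in> charts Y \<Longrightarrow> d \<in> charts Y \<Longrightarrow> local_lift (\<lambda>y. y) c d W l \<Longrightarrow> u \<in> W \<Longrightarrow>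
      e \<in> fibre (obun O' c) u \<Longrightarrow> A (central H a z) c W l d e = vscl (obun O' d) z (otrans O' c W l d e)"
    "\<And>c d W l u e. c \<in> charts Y \<Longrightarrow> d \<in> charts Y \<Longrightarrow> local_lift (\<lambda>y. y) c d W l \<Longrightarrow> u \<in> W \<Longrightarrow>
      e \<in> fibre (obun O' c) u \<Longrightarrow> otrans O' c W l d e = A \<epsilon> c W l d e"
proof -
  note T = tw[unfolded twisted_orbibundle_def split_conv]
  note T1 = conjunct1[OF T, unfolded complex_orbibundle_def]
    and T2 = bspec[OF conjunct1[OF conjunct2[OF T]], unfolded orbibundle_automorphism_def]
    and T3 = conjunct1[OF conjunct2[OF conjunct2[OF T]], rule_format]
    and T4 = conjunct2[OF conjunct2[OF conjunct2[OF T]], rule_format]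
  show vb: "vector_bundle (top_of_set (cdom c)) (obun O' c)" if "c \<in> charts Y" for c
    by (rule bspec[OF conjunct1[OF T1] that])
  note cov = conjunct1[OF T2, unfolded covers_automorphism_def, rule_format]
  show "continuous_map (subtopology (vtot (obun O' c)) {e. vproj (obun O' c) e \<in> W}) (vtot (obun O' d)) (A x c W l d)"
    if "x \<in> carrier X" "c \<in> charts Y" "d \<in> charts Y" "local_lift (snd x) c d W l" for x c d W l
    by (rule conjunct1[OF cov[OF that]])
  show "fibre_iso (obun O' c) u (obun O' d) (l u) (A x c W l d)"
    if "x \<in> carrier X" "c \<in> charts Y" "d \<in> charts Y" "local_lift (snd x) c d W l" "u \<in> W" for x c d W l u
    by (rule bspec[OF conjunct2[OF cov[OF that(1-4)]] that(5)])
  show "A x c V m d (A y b W l c e) = A (x \<otimes>\<^bsub>X\<^esub> y) b W (compose W m l) d e"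
    if "x \<in> carrier X" "y \<in> carrier X" "b \<in> charts Y" "c \<in> charts Y" "d \<in> charts Y"
      "local_lift (snd y) b c W l" "local_lift (snd x) c d V m" "l ` W \<subseteq> V" "u \<in> W" "e \<in> fibre (obun O' b) u"
    for x y b c d W l V m u e
    using T3[OF that(1,2), unfolded composite_family_def, rule_format, OF that(3-5) _ that(9,10)] that(6-8) by simp
  show c4: "A (central H a z) c W l d e = vscl (obun O' d) z (otrans O' c W l d e)"
    if "norm z = 1" "c \<in> charts Y" "d \<in> charts Y" "local_lift (\<lambda>y. y) c d W l" "u \<in> W" "e \<in> fibre (obun O' c) u"
    for z c d W l u e by (rule T4[OF _ that(2-6)]) (simp add: that(1))
  show "otrans O' c W l d e = A \<epsilon> c W l d e"
    if "c \<in> charts Y" "d \<in> charts Y" "local_lift (\<lambda>y. y) c d W l" "u \<in> W" "e \<in> fibre (obun O' c) u" for c d W l u e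
  proof -
    note ot = conjunct2[OF conjunct1[OF conjunct2[OF T1], unfolded covers_automorphism_def, rule_format, OF that(1-3)], rule_format, OF that(4)]
    have f: "otrans O' c W l d e \<in> fibre (obun O' d) (l u)" by (rule fibre_iso_in[OF ot that(5)])
    have "l u \<in> topspace (top_of_set (cdom d))" using local_liftD(12)[OF that(3,4)] by simp
    then show ?thesis using c4[OF _ that, of 1] fibre_laws(3)[OF vb[OF that(2)] _ f] by (simp add: central_one)
  qed
qed

text \<open>The change of charts is part of the action of the extension, so a map is equivariant as soon as
  it commutes with the latter.\<close>

lemma equivariant_iff:
  assumes E: "torbibundle (O1, A)" and F: "torbibundle (O2, B)"
    and T: "\<And>c u e. c \<in> charts Y \<Longrightarrow> e \<in> fibre (obun O1 c) u \<Longrightarrow> T c e \<in> fibre (obun O2 c) u"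
  shows "equivariant Y H a (O1, A) (O2, B) T \<longleftrightarrow> (\<forall>x\<in>carrier X. \<forall>c\<in>charts Y. \<forall>d\<in>charts Y. \<forall>W l. local_lift (snd x) c d W l \<longrightarrow>
        (\<forall>u\<in>W. \<forall>e\<in>fibre (obun O1 c) u. T d (A x c W l d e) = B x c W l d (T c e)))" (is "_ \<longleftrightarrow> ?R")
proof
  assume "equivariant Y H a (O1, A) (O2, B) T"
  then show ?R unfolding equivariant_def split_conv by (rule conjunct2)
next
  assume R: ?R
  have 1: "T d (otrans O1 c W l d e) = otrans O2 c W l d (T c e)"
    if c: "c \<in> charts Y" and d: "d \<in> charts Y" and l: "local_lift (\<lambda>y. y) c d W l" and u: "u \<in> W" and e: "e \<in> fibre (obun O1 c) u"
    for c d W l u e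
  proof -
    have "local_lift (snd \<epsilon>) c d W l" using l one_lift[OF c] by simp
    then show ?thesis
      using R[rule_format, OF ext_one_closed c d _ u e] twisted_orbibundleD(6)[OF E c d l u e]
        twisted_orbibundleD(6)[OF F c d l u T[OF c e]] by simp
  qed
  show "equivariant Y H a (O1, A) (O2, B) T" unfolding equivariant_def split_conv
    by (intro conjI[OF _ R] ballI allI impI) (rule 1)
qed

section \<open>Corresponding bundles and their morphisms\<close>

text \<open>The bundle \<open>E\<close> over the frame bundle and the bundles \<open>\<E> c\<close> over the chart domains become isomorphic
  over the frames of each chart, compatibly with the vector space structures, with the rotations of
  frames and with the action of the extension.\<close>

definition comparison where
  "comparison E \<rho> \<E> A \<theta> \<psi> \<longleftrightarrow>
     over_comparison (vtot E) (vproj E) (St \<E>) (Sp \<E>) \<theta> \<psi> \<and>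
     (\<forall>c\<in>charts Y. \<forall>p\<in>FC c. fibre_hom (\<E> c) (fst p) E (cls c p) (\<theta> c p)) \<and>
     (\<forall>x\<in>carrier X. \<forall>Q\<in>On. \<forall>c\<in>charts Y. \<forall>d\<in>charts Y. \<forall>W l. local_lift (snd x) c d W l \<longrightarrow>
        (\<forall>p\<in>FC c. fst p \<in> W \<longrightarrow> (\<forall>e\<in>fibre (\<E> c) (fst p).
           \<theta> d (lift_frame l (rotate_frame Q p)) (A x c W l d e) = \<rho> x Q (\<theta> c p e))))"

definition corresponds where
  "corresponds = (\<lambda>(E, act) (O', A). \<exists>\<theta> \<psi>. comparison E (line_action E act) (obun O') A \<theta> \<psi>)"

lemma comparisonD:
  assumes "comparison E \<rho> \<E> A \<theta> \<psi>"
  shows "over_comparison (vtot E) (vproj E) (St \<E>) (Sp \<E>) \<theta> \<psi>"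
    "\<And>c p. c \<in> charts Y \<Longrightarrow> p \<in> FC c \<Longrightarrow> fibre_hom (\<E> c) (fst p) E (cls c p) (\<theta> c p)"
    "\<And>x Q c d W l p e. x \<in> carrier X \<Longrightarrow> Q \<in> On \<Longrightarrow> c \<in> charts Y \<Longrightarrow> d \<in> charts Y \<Longrightarrow> local_lift (snd x) c d W l \<Longrightarrow>
        p \<in> FC c \<Longrightarrow> fst p \<in> W \<Longrightarrow> e \<in> fibre (\<E> c) (fst p) \<Longrightarrow>
        \<theta> d (lift_frame l (rotate_frame Q p)) (A x c W l d e) = \<rho> x Q (\<theta> c p e)"
    "\<And>c p e. c \<in> charts Y \<Longrightarrow> p \<in> FC c \<Longrightarrow> e \<in> fibre (\<E> c) (fst p) \<Longrightarrow> \<theta> c p e \<in> fibre E (cls c p) \<and> \<psi> c p (\<theta> c p e) = e"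
    "\<And>c p e. c \<in> charts Y \<Longrightarrow> p \<in> FC c \<Longrightarrow> e \<in> fibre E (cls c p) \<Longrightarrow> \<psi> c p e \<in> fibre (\<E> c) (fst p) \<and> \<theta> c p (\<psi> c p e) = e"
    "\<And>c p e e'. c \<in> charts Y \<Longrightarrow> p \<in> FC c \<Longrightarrow> e \<in> fibre (\<E> c) (fst p) \<Longrightarrow> e' \<in> fibre (\<E> c) (fst p) \<Longrightarrow> \<theta> c p e = \<theta> c p e' \<Longrightarrow> e = e'"
proof -
  note A = assms[unfolded comparison_def]
  show o: "over_comparison (vtot E) (vproj E) (St \<E>) (Sp \<E>) \<theta> \<psi>" by (rule conjunct1[OF A])
  show h: "fibre_hom (\<E> c) (fst p) E (cls c p) (\<theta> c p)" if "c \<in> charts Y" "p \<in> FC c" for c p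
    by (rule bspec[OF bspec[OF conjunct1[OF conjunct2[OF A]] that(1)] that(2)])
  show "\<theta> d (lift_frame l (rotate_frame Q p)) (A x c W l d e) = \<rho> x Q (\<theta> c p e)"
    if "x \<in> carrier X" "Q \<in> On" "c \<in> charts Y" "d \<in> charts Y" "local_lift (snd x) c d W l" "p \<in> FC c" "fst p \<in> W"
      "e \<in> fibre (\<E> c) (fst p)" for x Q c d W l p e
    by (rule conjunct2[OF conjunct2[OF A], rule_format, OF that])
  note D = over_comparisonD[OF o]
  show t: "\<theta> c p e \<in> fibre E (cls c p) \<and> \<psi> c p (\<theta> c p e) = e" if "c \<in> charts Y" "p \<in> FC c" "e \<in> fibre (\<E> c) (fst p)" for c p e
    using fibre_homD(1)[OF h[OF that(1,2)] that(3)] D(6)[OF that(1,2) fibreD[OF that(3)]] by blast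
  show "\<psi> c p e \<in> fibre (\<E> c) (fst p) \<and> \<theta> c p (\<psi> c p e) = e" if "c \<in> charts Y" "p \<in> FC c" "e \<in> fibre E (cls c p)" for c p e
    using D(7,8,10)[OF that(1,2) fibreD[OF that(3)]] by (simp add: fibreI)
  show "e = e'" if "c \<in> charts Y" "p \<in> FC c" "e \<in> fibre (\<E> c) (fst p)" "e' \<in> fibre (\<E> c) (fst p)" "\<theta> c p e = \<theta> c p e'" for c p e e'
    using t[OF that(1-3)] t[OF that(1,2,4)] that(5) by metis
qed

text \<open>Given \<open>f\<close>, the component over a chart is determined by its values at the frames of the section.
  Equivariance under rotations shows that other frames give the same component.\<close>

lemma down:
  assumes C: "comparison E \<rho> \<E> A \<theta> \<psi>" and C': "comparison E' \<rho>' \<E>' A' \<theta>' \<psi>'"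
    and lift1: "\<And>c u e. c \<in> charts Y \<Longrightarrow> u \<in> cdom c \<Longrightarrow> e \<in> fibre (\<E> c) u \<Longrightarrow> A \<epsilon> c (cdom c) (restrict id (cdom c)) c e = e"
    and lift1': "\<And>c u e. c \<in> charts Y \<Longrightarrow> u \<in> cdom c \<Longrightarrow> e \<in> fibre (\<E>' c) u \<Longrightarrow> A' \<epsilon> c (cdom c) (restrict id (cdom c)) c e = e"
    and f: "\<And>\<xi> e. e \<in> fibre E \<xi> \<Longrightarrow> f e \<in> fibre E' \<xi>"
    and eq: "\<And>x Q e. x \<in> carrier X \<Longrightarrow> Q \<in> On \<Longrightarrow> e \<in> tot E \<Longrightarrow> f (\<rho> x Q e) = \<rho>' x Q (f e)"
  shows "\<exists>\<phi>. related (St \<E>) (Sp \<E>) \<theta> (St \<E>') (Sp \<E>') \<theta>' f \<phi>"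
proof -
  note D = comparisonD[OF C] and D' = comparisonD[OF C']
  define \<phi> where "\<phi> c e = \<psi>' c (frame_section c (vproj (\<E> c) e)) (f (\<theta> c (frame_section c (vproj (\<E> c) e)) e))" for c e
  have "\<phi> c e \<in> tot (\<E>' c) \<and> vproj (\<E>' c) (\<phi> c e) = fst p \<and> f (\<theta> c p e) = \<theta>' c p (\<phi> c e)"
    if c: "c \<in> charts Y" and p: "p \<in> FC c" and e: "e \<in> tot (\<E> c)" "vproj (\<E> c) e = fst p" for c p e
  proof -
    let ?s = "frame_section c (fst p)"
    have u: "fst p \<in> cdom c" by (rule FC_D(1)[OF p])
    have s: "?s \<in> FC c" "fst ?s = fst p" using frame_section(2,3)[OF c] u by simp_all
    define Q where "Q = trans_Q c ?s p"
    have Q: "Q \<in> On" "rotate_frame Q ?s = p" unfolding Q_def using trans_Q[OF c s(1) p s(2)] by simp_all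
    have es: "e \<in> fibre (\<E> c) (fst ?s)" using fibreI[OF e] s(2) by simp
    let ?i = "restrict id (cdom c)"
    have li: "local_lift (snd \<epsilon>) c c (cdom c) ?i"
      using local_lift_id[OF chartD(5)[OF c], of c] one_lift[OF c] by simp
    have lf: "lift_frame ?i p = p"
      using jac_identity[OF chartD(5)[OF c] u, of ?i] u unfolding lift_frame_def by (simp add: case_prod_unfold)
    have su: "fst ?s \<in> cdom c" using s(2) u by simp
    have 1: "\<theta> c p e = \<rho> \<epsilon> Q (\<theta> c ?s e)" if "e \<in> fibre (\<E> c) (fst ?s)" for e
      using D(3)[OF ext_one_closed Q(1) c c li s(1) su that] Q(2) lf lift1[OF c su that] by simp
    have 11: "\<theta>' c p e = \<rho>' \<epsilon> Q (\<theta>' c ?s e)" if "e \<in> fibre (\<E>' c) (fst ?s)" for e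
      using D'(3)[OF ext_one_closed Q(1) c c li s(1) su that] Q(2) lf lift1'[OF c su that] by simp
    have t: "\<theta> c ?s e \<in> fibre E (cls c ?s)" using D(4)[OF c s(1) es] by blast
    have \<phi>: "\<phi> c e = \<psi>' c ?s (f (\<theta> c ?s e))" unfolding \<phi>_def e(2) ..
    note ps = D'(5)[OF c s(1) f[OF t], folded \<phi>]
    have "f (\<theta> c p e) = \<rho>' \<epsilon> Q (f (\<theta> c ?s e))"
      unfolding 1[OF es] by (rule eq[OF ext_one_closed Q(1) fibreD(1)[OF t]])
    also have "\<dots> = \<theta>' c p (\<phi> c e)" using 11[OF conjunct1[OF ps]] conjunct2[OF ps] by simp
    finally show ?thesis using fibreD[OF conjunct1[OF ps]] s(2) by simp
  qed
  then show ?thesis unfolding related_def by blast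
qed

text \<open>The action of the unit is idempotent and injective on fibres.\<close>

lemma frame_action_unit:
  assumes fa: "frame_action E \<rho>" and e: "e \<in> fibre E (cls c p)" and c: "c \<in> charts Y" and p: "p \<in> FC c"
  shows "\<rho> \<epsilon> (mat 1) e = e"
proof -
  note F = frame_actionD[OF fa]
  have I: "mat 1 \<in> On" by (simp add: orthogonal_matrix_id)
  have st: "frame_push Y (snd \<epsilon>) (frame_rotate (mat 1) (cls c p)) = cls c p"
    unfolding rotate_cls rotate_one snd_one by (rule push_cls[OF H.one_closed step_refl[OF c p]])
  note iso = F(3)[OF ext_one_closed I cls_in[OF c p], unfolded st]
  note m = fibre_iso_in[OF iso e]
  have "\<rho> \<epsilon> (mat 1) (\<rho> \<epsilon> (mat 1) e) = \<rho> \<epsilon> (mat 1) e"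
    using F(4)[OF ext_one_closed ext_one_closed I I fibreD(1)[OF e]] ext_one_mult(1)[OF ext_one_closed] by simp
  then show ?thesis by (rule inj_onD[OF fibre_isoD(2)[OF iso] _ m e])
qed

text \<open>Every point upstairs is \<open>\<theta> c p e\<close> for some chart \<open>c\<close>, and \<open>f\<close> must send it to \<open>\<theta>' c p (\<phi> c e)\<close>.  Two
  ways to write the same point are related by a change of charts, with which \<open>\<phi>\<close> commutes.\<close>

lemma up:
  assumes fa: "frame_action E \<rho>"
    and C: "comparison E \<rho> \<E> A \<theta> \<psi>" and C': "comparison E' \<rho>' \<E>' A' \<theta>' \<psi>'" and fa': "frame_action E' \<rho>'"
    and A: "\<And>x c d W l u e. x \<in> carrier X \<Longrightarrow> c \<in> charts Y \<Longrightarrow> d \<in> charts Y \<Longrightarrow> local_lift (snd x) c d W l \<Longrightarrow> u \<in> W \<Longrightarrow>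
        e \<in> fibre (\<E> c) u \<Longrightarrow> A x c W l d e \<in> fibre (\<E> d) (l u)"
    and f: "\<And>c u e. c \<in> charts Y \<Longrightarrow> e \<in> fibre (\<E> c) u \<Longrightarrow> \<phi> c e \<in> fibre (\<E>' c) u"
    and eq: "\<And>x c d W l u e. x \<in> carrier X \<Longrightarrow> c \<in> charts Y \<Longrightarrow> d \<in> charts Y \<Longrightarrow> local_lift (snd x) c d W l \<Longrightarrow> u \<in> W \<Longrightarrow>
        e \<in> fibre (\<E> c) u \<Longrightarrow> \<phi> d (A x c W l d e) = A' x c W l d (\<phi> c e)"
  shows "\<exists>f. related (St \<E>) (Sp \<E>) \<theta> (St \<E>') (Sp \<E>') \<theta>' f \<phi>"
proof -
  note D = comparisonD[OF C] and D' = comparisonD[OF C']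
  note unit = frame_action_unit
  have key: "\<theta>' c p (\<phi> c e) = \<theta>' d q (\<phi> d e2)"
    if c: "c \<in> charts Y" "p \<in> FC c" "e \<in> fibre (\<E> c) (fst p)" and d: "d \<in> charts Y" "q \<in> FC d" "e2 \<in> fibre (\<E> d) (fst q)"
      and te: "\<theta> c p e = \<theta> d q e2" for c p e d q e2
  proof -
    have "cls c p = cls d q" using D(4)[OF c] D(4)[OF d] te fibreD(2) by metis
    then have "step \<one>\<^bsub>H\<^esub> c p d q" using cls_eq_iff[OF c(1,2) d(1,2)] by simp
    then obtain W l where l: "local_lift \<one>\<^bsub>H\<^esub> c d W l" "fst p \<in> W" "q = lift_frame l p" by (rule jet_stepE)
    have l1: "local_lift (snd \<epsilon>) c d W l" using l(1) by simp
    have I: "mat 1 \<in> On" by (simp add: orthogonal_matrix_id)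
    have 1: "\<theta> d q (A \<epsilon> c W l d e) = \<rho> \<epsilon> (mat 1) (\<theta> c p e)"
      using D(3)[OF ext_one_closed I c(1) d(1) l1 c(2) l(2) c(3)] l(3) by simp
    also have "\<dots> = \<theta> c p e" by (rule unit[OF fa conjunct1[OF D(4)[OF c]] c(1,2)])
    finally have "\<theta> d q (A \<epsilon> c W l d e) = \<theta> d q e2" using te by simp
    moreover have "A \<epsilon> c W l d e \<in> fibre (\<E> d) (fst q)" using A[OF ext_one_closed c(1) d(1) l1 l(2) c(3)] l(3) by simp
    ultimately have e2: "A \<epsilon> c W l d e = e2" using D(6)[OF d(1,2) _ d(3)] by simp
    have \<phi>e: "\<phi> c e \<in> fibre (\<E>' c) (fst p)" by (rule f[OF c(1,3)])
    have "\<theta>' d q (A' \<epsilon> c W l d (\<phi> c e)) = \<rho>' \<epsilon> (mat 1) (\<theta>' c p (\<phi> c e))"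
      using D'(3)[OF ext_one_closed I c(1) d(1) l1 c(2) l(2) \<phi>e] l(3) by simp
    also have "\<dots> = \<theta>' c p (\<phi> c e)" by (rule unit[OF fa' conjunct1[OF D'(4)[OF c(1,2) \<phi>e]] c(1,2)])
    finally show ?thesis using eq[OF ext_one_closed c(1) d(1) l1 l(2) c(3)] e2 by simp
  qed
  define R where "R y t \<longleftrightarrow> fst t \<in> charts Y \<and> fst (snd t) \<in> FC (fst t) \<and> snd (snd t) \<in> fibre (\<E> (fst t)) (fst (fst (snd t))) \<and>
      y = \<theta> (fst t) (fst (snd t)) (snd (snd t))" for y t
  define g where "g y = (let t = (SOME t. R y t) in \<theta>' (fst t) (fst (snd t)) (\<phi> (fst t) (snd (snd t))))" for y
  have gk: "g (\<theta> c p e) = \<theta>' c p (\<phi> c e)" if c: "c \<in> charts Y" "p \<in> FC c" "e \<in> fibre (\<E> c) (fst p)" for c p e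
  proof -
    define t where "t = (SOME t. R (\<theta> c p e) t)"
    have "R (\<theta> c p e) (c, p, e)" unfolding R_def using c by simp
    then have "R (\<theta> c p e) t" unfolding t_def by (rule someI)
    then have t: "fst t \<in> charts Y" "fst (snd t) \<in> FC (fst t)" "snd (snd t) \<in> fibre (\<E> (fst t)) (fst (fst (snd t)))"
      "\<theta> c p e = \<theta> (fst t) (fst (snd t)) (snd (snd t))" unfolding R_def by blast+
    show ?thesis unfolding g_def t_def[symmetric] Let_def by (rule key[OF c t, symmetric])
  qed
  have "related (St \<E>) (Sp \<E>) \<theta> (St \<E>') (Sp \<E>') \<theta>' g \<phi>"
    unfolding related_def
  proof (intro ballI impI)
    fix c p e assume c: "c \<in> charts Y" "p \<in> FC c" and e: "e \<in> tot (\<E> c)" "vproj (\<E> c) e = fst p"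
    note ef = fibreI[OF e]
    show "\<phi> c e \<in> tot (\<E>' c) \<and> vproj (\<E>' c) (\<phi> c e) = fst p \<and> g (\<theta> c p e) = \<theta>' c p (\<phi> c e)"
      using fibreD[OF f[OF c(1) ef]] gk[OF c ef] by simp
  qed
  then show ?thesis by blast
qed

end

lemma bundle_iso_iff:
  assumes E: "vector_bundle B E" and F: "vector_bundle B F"
  shows "bundle_iso B E F T \<longleftrightarrow> (\<forall>b\<in>topspace B. fibre_hom E b F b T) \<and> homeomorphic_map (vtot E) (vtot F) T"
proof
  assume "bundle_iso B E F T"
  then show "(\<forall>b\<in>topspace B. fibre_hom E b F b T) \<and> homeomorphic_map (vtot E) (vtot F) T"
    unfolding bundle_iso_def fibre_iso_def by blast
next
  assume R: "(\<forall>b\<in>topspace B. fibre_hom E b F b T) \<and> homeomorphic_map (vtot E) (vtot F) T"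
  then have hom: "fibre_hom E b F b T" if "b \<in> topspace B" for b using that by blast
  have h: "homeomorphic_map (vtot E) (vtot F) T" using R by blast
  note inj = homeomorphic_imp_injective_map[OF h] and surj = homeomorphic_imp_surjective_map[OF h]
  have "bij_betw T (fibre E b) (fibre F b)" if b: "b \<in> topspace B" for b
    unfolding bij_betw_def
  proof
    show "inj_on T (fibre E b)" by (rule inj_on_subset[OF inj]) (rule subsetI, erule fibreD(1))
    show "T ` fibre E b = fibre F b"
    proof (intro equalityI subsetI)
      fix y assume "y \<in> T ` fibre E b"
      then show "y \<in> fibre F b" using fibre_homD(1)[OF hom[OF b]] by blast
    next
      fix y assume y: "y \<in> fibre F b"
      then obtain e where e: "e \<in> tot E" "y = T e" using fibreD(1)[OF y] surj by blast
      have "T e \<in> fibre F (vproj E e)"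
        by (rule fibre_homD(1)[OF hom[OF vector_bundle_proj_in[OF E e(1)]] fibreI[OF e(1) refl]])
      then have "vproj E e = b" using y e(2) fibreD(2) by metis
      then show "y \<in> T ` fibre E b" using fibreI[OF e(1)] e(2) by blast
    qed
  qed
  then show "bundle_iso B E F T" unfolding bundle_iso_def fibre_iso_def using hom h by blast
qed

context twisted_action
begin

interpretation H: group H by (rule H)

abbreviation "D c \<equiv> top_of_set (cdom c)"

text \<open>Morphisms are treated separately from continuity, because both isomorphisms and the projections of
  a Whitney sum are pairs of a morphism condition and a homeomorphism condition, and these transfer
  along a comparison for different reasons.\<close>

definition twisted_morphism where
  "twisted_morphism = (\<lambda>(E, act) (E', act') f. (\<forall>\<xi>\<in>topspace P. fibre_hom E \<xi> E' \<xi> f) \<and>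
     (\<forall>l\<in>tot L. \<forall>e\<in>fibre E (gsrc \<G> (vproj L l)). f (act l e) = act' l (f e)))"

definition orbi_morphism where
  "orbi_morphism = (\<lambda>(O1, A) (O2, B) \<phi>. (\<forall>c\<in>charts Y. \<forall>u\<in>cdom c. fibre_hom (obun O1 c) u (obun O2 c) u (\<phi> c)) \<and>
     equivariant Y H a (O1, A) (O2, B) \<phi>)"

lemma twisted_bundle_vector_bundle: "tbundle (E, act) \<Longrightarrow> vector_bundle P E"
  using frame_actionD(1)[OF twisted_bundle_imp_frame_action(1)] .

lemma twisted_iso_iff:
  assumes E: "tbundle (E, act)" and E': "tbundle (E', act')"
  shows "twisted_iso \<G> \<L> (E, act) (E', act') \<longleftrightarrow>
    (\<exists>f. twisted_morphism (E, act) (E', act') f \<and> homeomorphic_map (vtot E) (vtot E') f)"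
  unfolding twisted_iso_def twisted_morphism_def split_conv groupoid_simps(1)
    bundle_iso_iff[OF twisted_bundle_vector_bundle[OF E] twisted_bundle_vector_bundle[OF E']]
  by (intro ex_cong1) (simp only: conj_ac)

lemma twisted_sum_iff:
  "twisted_sum \<G> \<L> (G, actG) (E, actE) (F, actF) \<longleftrightarrow>
    (\<exists>p q. twisted_morphism (G, actG) (E, actE) p \<and> twisted_morphism (G, actG) (F, actF) q \<and>
       homeomorphic_map (vtot G) (subtopology (prod_topology (vtot E) (vtot F)) {(e, f). vproj E e = vproj F f}) (\<lambda>x. (p x, q x)))"
  unfolding twisted_sum_def twisted_morphism_def split_conv groupoid_simps(1) whitney_sum_def
  by (intro ex_cong1) (simp only: ball_conj_distrib conj_ac)

lemma orbi_iso_iff: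
  assumes E: "torbibundle (O1, A)" and F: "torbibundle (O2, B)"
  shows "orbi_iso Y H a (O1, A) (O2, B) \<longleftrightarrow>
    (\<exists>\<phi>. orbi_morphism (O1, A) (O2, B) \<phi> \<and> (\<forall>c\<in>charts Y. homeomorphic_map (vtot (obun O1 c)) (vtot (obun O2 c)) (\<phi> c)))"
proof -
  have eq: "(\<forall>c\<in>charts Y. bundle_iso (D c) (obun O1 c) (obun O2 c) (T c)) \<longleftrightarrow>
      (\<forall>c\<in>charts Y. \<forall>u\<in>cdom c. fibre_hom (obun O1 c) u (obun O2 c) u (T c)) \<and>
      (\<forall>c\<in>charts Y. homeomorphic_map (vtot (obun O1 c)) (vtot (obun O2 c)) (T c))" for T
    by (auto simp: bundle_iso_iff[OF twisted_orbibundleD(1)[OF E] twisted_orbibundleD(1)[OF F]])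
  show ?thesis unfolding orbi_iso_def orbi_morphism_def split_conv fst_conv eq by (intro ex_cong1) (simp only: conj_ac)
qed

lemma orbi_sum_iff:
  "orbi_sum Y H a (O0, A) (O1, B) (O2, C) \<longleftrightarrow>
    (\<exists>p q. orbi_morphism (O0, A) (O1, B) p \<and> orbi_morphism (O0, A) (O2, C) q \<and>
       (\<forall>c\<in>charts Y. homeomorphic_map (vtot (obun O0 c))
          (subtopology (prod_topology (vtot (obun O1 c)) (vtot (obun O2 c))) {(e, f). vproj (obun O1 c) e = vproj (obun O2 c) f})
          (\<lambda>x. (p c x, q c x))))"
proof -
  have eq: "(\<forall>c\<in>charts Y. whitney_sum (D c) (obun O0 c) (obun O1 c) (obun O2 c) (p c) (q c)) \<longleftrightarrow>
     (\<forall>c\<in>charts Y. \<forall>u\<in>cdom c. fibre_hom (obun O0 c) u (obun O1 c) u (p c)) \<and>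
     (\<forall>c\<in>charts Y. \<forall>u\<in>cdom c. fibre_hom (obun O0 c) u (obun O2 c) u (q c)) \<and>
     (\<forall>c\<in>charts Y. homeomorphic_map (vtot (obun O0 c))
          (subtopology (prod_topology (vtot (obun O1 c)) (vtot (obun O2 c))) {(e, f). vproj (obun O1 c) e = vproj (obun O2 c) f})
          (\<lambda>x. (p c x, q c x)))" for p q
    unfolding whitney_sum_def topspace_euclidean_subtopology by (simp only: ball_conj_distrib conj_ac)
  show ?thesis unfolding orbi_sum_def orbi_morphism_def split_conv fst_conv eq by (intro ex_cong1) (simp only: conj_ac)
qed

lemma twisted_morphism_iff:
  assumes E: "tbundle (E, act)" and E': "tbundle (E', act')"
  shows "twisted_morphism (E, act) (E', act') f \<longleftrightarrow> (\<forall>\<xi>\<in>topspace P. fibre_hom E \<xi> E' \<xi> f) \<and>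
    (\<forall>x\<in>carrier X. \<forall>Q\<in>On. \<forall>e\<in>tot E. f (line_action E act x Q e) = line_action E' act' x Q (f e))"
proof (cases "\<forall>\<xi>\<in>topspace P. fibre_hom E \<xi> E' \<xi> f")
  case True
  then have hom: "fibre_hom E \<xi> E' \<xi> f" if "\<xi> \<in> topspace P" for \<xi> using that by blast
  note vb = twisted_bundle_vector_bundle[OF E]
  have fe: "vproj E e \<in> topspace P" "f e \<in> fibre E' (vproj E e)" if "e \<in> tot E" for e
  proof -
    show 1: "vproj E e \<in> topspace P" by (rule vector_bundle_proj_in[OF vb that])
    show "f e \<in> fibre E' (vproj E e)" by (rule fibre_homD(1)[OF hom[OF 1] fibreI[OF that refl]])
  qed
  have "(\<forall>l\<in>tot L. \<forall>e\<in>fibre E (gsrc \<G> (vproj L l)). f (act l e) = act' l (f e)) \<longleftrightarrow>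
    (\<forall>x\<in>carrier X. \<forall>Q\<in>On. \<forall>e\<in>tot E. f (line_action E act x Q e) = line_action E' act' x Q (f e))"
  proof (intro iffI ballI)
    fix x Q e assume R: "\<forall>l\<in>tot L. \<forall>e\<in>fibre E (gsrc \<G> (vproj L l)). f (act l e) = act' l (f e)"
      and x: "x \<in> carrier X" and Q: "Q \<in> On" and e: "e \<in> tot E"
    have "f (act (lc (vproj E e, Q) x 1) e) = act' (lc (vproj E e, Q) x 1) (f e)"
      by (rule R[rule_format, OF lc_in[OF fe(1)[OF e] Q x]]) (simp add: line_class_ops(1)[OF x] groupoid_simps fibreI[OF e])
    then show "f (line_action E act x Q e) = line_action E' act' x Q (f e)"
      unfolding line_action_def fibreD(2)[OF fe(2)[OF e]] .
  next
    fix l e assume R: "\<forall>x\<in>carrier X. \<forall>Q\<in>On. \<forall>e\<in>tot E. f (line_action E act x Q e) = line_action E' act' x Q (f e)"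
      and l: "l \<in> tot L" and e: "e \<in> fibre E (gsrc \<G> (vproj L l))"
    obtain \<xi> Q x w where lx: "\<xi> \<in> topspace P" "Q \<in> On" "x \<in> carrier X" "l = lc (\<xi>, Q) x w" using l by (rule L_cases)
    have e': "e \<in> tot E" "\<xi> = vproj E e"
      using fibreD[OF e] unfolding lx(4) line_class_ops(1)[OF lx(3)] groupoid_simps by simp_all
    note tE = twisted_bundle_imp_frame_action[OF E] and tE' = twisted_bundle_imp_frame_action[OF E']
    have m: "line_action E act x Q e \<in> fibre E (frame_push Y (snd x) (frame_rotate Q \<xi>))"
      by (rule fibre_iso_in[OF frame_actionD(3)[OF tE(1) lx(3,2,1)]]) (use e' in \<open>simp add: fibreI\<close>)
    have mP: "frame_push Y (snd x) (frame_rotate Q \<xi>) \<in> topspace P"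
      using vector_bundle_proj_in[OF vb fibreD(1)[OF m]] fibreD(2)[OF m] by simp
    have "f (act l e) = f (vscl E w (line_action E act x Q e))"
      unfolding lx(4) e'(2) tE(2)[OF lx(3,2) e'(1)] ..
    also have "\<dots> = vscl E' w (f (line_action E act x Q e))" by (rule fibre_homD(3)[OF hom[OF mP] m])
    also have "f (line_action E act x Q e) = line_action E' act' x Q (f e)" using R lx(2,3) e'(1) by blast
    also have "vscl E' w (line_action E' act' x Q (f e)) = act' (lc (vproj E' (f e), Q) x w) (f e)"
      by (rule tE'(2)[OF lx(3,2) fibreD(1)[OF fe(2)[OF e'(1)]], symmetric])
    also have "\<dots> = act' l (f e)" unfolding fibreD(2)[OF fe(2)[OF e'(1)]] lx(4) e'(2) ..
    finally show "f (act l e) = act' l (f e)" .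
  qed
  then show ?thesis unfolding twisted_morphism_def split_conv by (rule arg_cong)
next
  case False
  then show ?thesis unfolding twisted_morphism_def split_conv by (simp only: simp_thms)
qed

lemma orbi_morphism_iff:
  assumes E: "torbibundle (O1, A)" and F: "torbibundle (O2, B)"
  shows "orbi_morphism (O1, A) (O2, B) \<phi> \<longleftrightarrow> (\<forall>c\<in>charts Y. \<forall>u\<in>cdom c. fibre_hom (obun O1 c) u (obun O2 c) u (\<phi> c)) \<and>
    (\<forall>x\<in>carrier X. \<forall>c\<in>charts Y. \<forall>d\<in>charts Y. \<forall>W l. local_lift (snd x) c d W l \<longrightarrow>
        (\<forall>u\<in>W. \<forall>e\<in>fibre (obun O1 c) u. \<phi> d (A x c W l d e) = B x c W l d (\<phi> c e)))"
proof (cases "\<forall>c\<in>charts Y. \<forall>u\<in>cdom c. fibre_hom (obun O1 c) u (obun O2 c) u (\<phi> c)")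
  case True
  have m: "\<phi> c e \<in> fibre (obun O2 c) u" if c: "c \<in> charts Y" and e: "e \<in> fibre (obun O1 c) u" for c u e
  proof -
    have "u \<in> cdom c" using vector_bundle_proj_in[OF twisted_orbibundleD(1)[OF E c] fibreD(1)[OF e]] fibreD(2)[OF e] by simp
    then show ?thesis using fibre_homD(1)[OF bspec[OF bspec[OF True c]] e] by blast
  qed
  show ?thesis unfolding orbi_morphism_def split_conv
    by (rule arg_cong, rule equivariant_iff[OF E F]) (rule m)
next
  case False
  then show ?thesis unfolding orbi_morphism_def split_conv by (simp only: simp_thms)
qed

lemma fibre_over_chart:
  assumes "torbibundle (O1, A)" "c \<in> charts Y" "e \<in> fibre (obun O1 c) u"
  shows "u \<in> cdom c"
  using vector_bundle_proj_in[OF twisted_orbibundleD(1)[OF assms(1,2)] fibreD(1)[OF assms(3)]] fibreD(2)[OF assms(3)] by simp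

lemma fibre_over_frames:
  assumes "tbundle (E, act)" "e \<in> fibre E \<xi>"
  shows "\<xi> \<in> topspace P"
  using vector_bundle_proj_in[OF twisted_bundle_vector_bundle[OF assms(1)] fibreD(1)[OF assms(2)]] fibreD(2)[OF assms(2)] by simp

text \<open>The action of a restricted identity is idempotent and injective on fibres.\<close>

lemma restricted_identity_acts_trivially:
  assumes tw: "twisted_orbibundle Y H a (O1, A)" and c: "c \<in> charts Y" and U: "open U" "U \<subseteq> cdom c" and u: "u \<in> U" and e: "e \<in> fibre (obun O1 c) u"
  shows "A \<epsilon> c U (restrict id U) c e = e"
proof -
  note T = twisted_orbibundleD[OF tw]
  have li: "local_lift (snd \<epsilon>) c c U (restrict id U)" using local_lift_id[OF U] one_lift[OF c] by simp
  have cc: "compose U (restrict id U) (restrict id U) = restrict id U" by (auto simp: compose_def)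
  have im: "restrict id U ` U \<subseteq> U" by simp
  note iso = T(3)[OF ext_one_closed c c li u]
  have 1: "A \<epsilon> c U (restrict id U) c (A \<epsilon> c U (restrict id U) c e) = A \<epsilon> c U (restrict id U) c e"
    using T(4)[OF ext_one_closed ext_one_closed c c c li li im u e] unfolding cc ext_one_mult(1)[OF ext_one_closed] .
  have "A \<epsilon> c U (restrict id U) c e \<in> fibre (obun O1 c) u" using fibre_iso_in[OF iso e] u by simp
  then show ?thesis by (rule inj_onD[OF fibre_isoD(2)[OF iso] 1 _ e])
qed

lemma identity_lift_acts_trivially:
  assumes tw: "twisted_orbibundle Y H a (O1, A)" and c: "c \<in> charts Y" and e: "e \<in> fibre (obun O1 c) u"
  shows "A \<epsilon> c (cdom c) (restrict id (cdom c)) c e = e"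
  by (rule restricted_identity_acts_trivially[OF tw c chartD(5)[OF c] order_refl fibre_over_chart[OF tw c e] e])

text \<open>All conditions on \<open>f\<close> and \<open>\<phi>\<close> can be tested after applying the bijections \<open>\<theta>\<close> between fibres.\<close>

lemma morphism_transfer:
  assumes E: "tbundle (E, act)" and E': "tbundle (E', act')"
    and O1: "torbibundle (O1, A)" and O2: "torbibundle (O2, B)"
    and C: "comparison E (line_action E act) (obun O1) A \<theta> \<psi>"
    and C': "comparison E' (line_action E' act') (obun O2) B \<theta>' \<psi>'"
    and rel: "related (St (obun O1)) (Sp (obun O1)) \<theta> (St (obun O2)) (Sp (obun O2)) \<theta>' f \<phi>"
  shows "twisted_morphism (E, act) (E', act') f \<longleftrightarrow> orbi_morphism (O1, A) (O2, B) \<phi>"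
proof -
  note C1 = comparisonD[OF C] and C2 = comparisonD[OF C']
  note T1 = twisted_orbibundleD[OF O1] and T2 = twisted_orbibundleD[OF O2]
  have R: "\<phi> c e \<in> fibre (obun O2 c) (fst p)" "f (\<theta> c p e) = \<theta>' c p (\<phi> c e)"
    if "c \<in> charts Y" "p \<in> FC c" "e \<in> fibre (obun O1 c) (fst p)" for c p e
    using relatedD[OF rel that(1,2) fibreD[OF that(3)]] fibreI by simp_all
  have law1: "vadd (obun O1 c) e e' \<in> fibre (obun O1 c) u" "vscl (obun O1 c) z e \<in> fibre (obun O1 c) u"
    if "c \<in> charts Y" "e \<in> fibre (obun O1 c) u" "e' \<in> fibre (obun O1 c) u" for c u e e' z
    using fibre_laws(1,2)[OF T1(1)[OF that(1)] _ that(2)] fibre_over_chart[OF O1 that(1,2)] that(3) by simp_all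
  have law2: "vadd (obun O2 c) e e' \<in> fibre (obun O2 c) u" "vscl (obun O2 c) z e \<in> fibre (obun O2 c) u"
    if "c \<in> charts Y" "e \<in> fibre (obun O2 c) u" "e' \<in> fibre (obun O2 c) u" for c u e e' z
    using fibre_laws(1,2)[OF T2(1)[OF that(1)] _ that(2)] fibre_over_chart[OF O2 that(1,2)] that(3) by simp_all
  have lin: "(\<forall>\<xi>\<in>topspace P. fibre_hom E \<xi> E' \<xi> f) \<longleftrightarrow> (\<forall>c\<in>charts Y. \<forall>u\<in>cdom c. fibre_hom (obun O1 c) u (obun O2 c) u (\<phi> c))"
  proof (intro iffI ballI)
    fix c u assume hom: "\<forall>\<xi>\<in>topspace P. fibre_hom E \<xi> E' \<xi> f" and c: "c \<in> charts Y" and u: "u \<in> cdom c"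
    define s where "s = frame_section c u"
    have s: "s \<in> FC c" "fst s = u" unfolding s_def using frame_section[OF c] u by simp_all
    note h = fibre_homD[OF bspec[OF hom cls_in[OF c s(1)]]]
    note R = R[OF c s(1), unfolded s(2)] and inj = C2(6)[OF c s(1), unfolded s(2)]
    note h1 = fibre_homD[OF comparisonD(2)[OF C c s(1)], unfolded s(2)]
    note h2 = fibre_homD[OF comparisonD(2)[OF C' c s(1)], unfolded s(2)]
    show "fibre_hom (obun O1 c) u (obun O2 c) u (\<phi> c)"
      unfolding fibre_hom_def
    proof (intro conjI ballI allI)
      show "\<phi> c ` fibre (obun O1 c) u \<subseteq> fibre (obun O2 c) u" using R(1) by blast
      fix e assume e: "e \<in> fibre (obun O1 c) u"
      show "\<phi> c (vadd (obun O1 c) e e') = vadd (obun O2 c) (\<phi> c e) (\<phi> c e')" if e': "e' \<in> fibre (obun O1 c) u" for e'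
      proof (rule inj[OF R(1)[OF law1(1)[OF c e e']] law2(1)[OF c R(1)[OF e] R(1)[OF e']]])
        show "\<theta>' c s (\<phi> c (vadd (obun O1 c) e e')) = \<theta>' c s (vadd (obun O2 c) (\<phi> c e) (\<phi> c e'))"
          unfolding R(2)[OF law1(1)[OF c e e'], symmetric] h1(2)[OF e e'] h(2)[OF h1(1)[OF e] h1(1)[OF e']]
            h2(2)[OF R(1)[OF e] R(1)[OF e']] R(2)[OF e] R(2)[OF e'] ..
      qed
      show "\<phi> c (vscl (obun O1 c) z e) = vscl (obun O2 c) z (\<phi> c e)" for z
      proof (rule inj[OF R(1)[OF law1(2)[OF c e e]] law2(2)[OF c R(1)[OF e] R(1)[OF e]]])
        show "\<theta>' c s (\<phi> c (vscl (obun O1 c) z e)) = \<theta>' c s (vscl (obun O2 c) z (\<phi> c e))"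
          unfolding R(2)[OF law1(2)[OF c e e], symmetric] h1(3)[OF e] h(3)[OF h1(1)[OF e]] h2(3)[OF R(1)[OF e]] R(2)[OF e] ..
      qed
    qed
  next
    fix \<xi> assume hom: "\<forall>c\<in>charts Y. \<forall>u\<in>cdom c. fibre_hom (obun O1 c) u (obun O2 c) u (\<phi> c)" and \<xi>: "\<xi> \<in> topspace P"
    obtain c p where c: "c \<in> charts Y" and p: "p \<in> FC c" and \<xi>: "\<xi> = cls c p" using \<xi> by (rule frame_bundleE)
    note h = fibre_homD[OF bspec[OF bspec[OF hom c] FC_D(1)[OF p]]]
    note R = R[OF c p]
    note h1 = fibre_homD[OF comparisonD(2)[OF C c p]] and h2 = fibre_homD[OF comparisonD(2)[OF C' c p]]
    have rep: "\<exists>e0\<in>fibre (obun O1 c) (fst p). e = \<theta> c p e0" if "e \<in> fibre E \<xi>" for e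
      using C1(5)[OF c p that[unfolded \<xi>]] by metis
    show "fibre_hom E \<xi> E' \<xi> f"
      unfolding fibre_hom_def
    proof (intro conjI ballI allI)
      show "f ` fibre E \<xi> \<subseteq> fibre E' \<xi>"
      proof
        fix y assume "y \<in> f ` fibre E \<xi>"
        then obtain e where "e \<in> fibre E \<xi>" "y = f e" by blast
        then obtain e0 where e0: "e0 \<in> fibre (obun O1 c) (fst p)" "y = f (\<theta> c p e0)" using rep by blast
        show "y \<in> fibre E' \<xi>" unfolding e0(2) R(2)[OF e0(1)] \<xi> by (rule h2(1)[OF R(1)[OF e0(1)]])
      qed
      fix e assume e: "e \<in> fibre E \<xi>"
      obtain e0 where e0: "e0 \<in> fibre (obun O1 c) (fst p)" "e = \<theta> c p e0" using rep[OF e] by blast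
      show "f (vadd E e e') = vadd E' (f e) (f e')" if e': "e' \<in> fibre E \<xi>" for e'
      proof -
        obtain e1 where e1: "e1 \<in> fibre (obun O1 c) (fst p)" "e' = \<theta> c p e1" using rep[OF e'] by blast
        show ?thesis
          unfolding e0(2) e1(2) h1(2)[OF e0(1) e1(1), symmetric] R(2)[OF law1(1)[OF c e0(1) e1(1)]] h(2)[OF e0(1) e1(1)]
            h2(2)[OF R(1)[OF e0(1)] R(1)[OF e1(1)]] R(2)[OF e0(1)] R(2)[OF e1(1)] ..
      qed
      show "f (vscl E z e) = vscl E' z (f e)" for z
        unfolding e0(2) h1(3)[OF e0(1), symmetric] R(2)[OF law1(2)[OF c e0(1) e0(1)]] h(3)[OF e0(1)]
          h2(3)[OF R(1)[OF e0(1)]] R(2)[OF e0(1)] ..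
    qed
  qed
  have I: "mat 1 \<in> On" by (simp add: orthogonal_matrix_id)
  have Af: "A x c W l d e \<in> fibre (obun O1 d) (l u)" if "x \<in> carrier X" "c \<in> charts Y" "d \<in> charts Y" "local_lift (snd x) c d W l"
      "u \<in> W" "e \<in> fibre (obun O1 c) u" for x c d W l u e
    by (rule fibre_iso_in[OF T1(3)[OF that(1-5)] that(6)])
  have Bf: "B x c W l d e \<in> fibre (obun O2 d) (l u)" if "x \<in> carrier X" "c \<in> charts Y" "d \<in> charts Y" "local_lift (snd x) c d W l"
      "u \<in> W" "e \<in> fibre (obun O2 c) u" for x c d W l u e
    by (rule fibre_iso_in[OF T2(3)[OF that(1-5)] that(6)])
  have lFC: "lift_frame l p \<in> FC d" if "x \<in> carrier X" "c \<in> charts Y" "d \<in> charts Y" "local_lift (snd x) c d W l" "fst p \<in> W" "p \<in> FC c"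
    for x c d W l p
    by (rule lift_frame_FC[OF isometry that(2-6)]) (use that(1) ext_carrier in blast)
  have equ: "(\<forall>x\<in>carrier X. \<forall>Q\<in>On. \<forall>e\<in>tot E. f (line_action E act x Q e) = line_action E' act' x Q (f e)) \<longleftrightarrow>
    (\<forall>x\<in>carrier X. \<forall>c\<in>charts Y. \<forall>d\<in>charts Y. \<forall>W l. local_lift (snd x) c d W l \<longrightarrow>
        (\<forall>u\<in>W. \<forall>e\<in>fibre (obun O1 c) u. \<phi> d (A x c W l d e) = B x c W l d (\<phi> c e)))"
  proof (intro iffI ballI allI impI)
    fix x c d W l u e
    assume eq: "\<forall>x\<in>carrier X. \<forall>Q\<in>On. \<forall>e\<in>tot E. f (line_action E act x Q e) = line_action E' act' x Q (f e)"
      and x: "x \<in> carrier X" and c: "c \<in> charts Y" and d: "d \<in> charts Y" and l: "local_lift (snd x) c d W l" and u: "u \<in> W"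
      and e: "e \<in> fibre (obun O1 c) u"
    define s where "s = frame_section c u"
    have s: "s \<in> FC c" "fst s = u" unfolding s_def using frame_section[OF c] local_liftD(2)[OF l] u by auto
    have sW: "fst s \<in> W" and es: "e \<in> fibre (obun O1 c) (fst s)" using s(2) u e by simp_all
    note q = lFC[OF x c d l sW s(1)]
    have fq: "fst (lift_frame l s) = l u" using s(2) by simp
    have \<phi>e: "\<phi> c e \<in> fibre (obun O2 c) (fst s)" by (rule R(1)[OF c s(1) es])
    have Ae: "A x c W l d e \<in> fibre (obun O1 d) (fst (lift_frame l s))" unfolding fq by (rule Af[OF x c d l u e])
    have Be: "B x c W l d (\<phi> c e) \<in> fibre (obun O2 d) (fst (lift_frame l s))" unfolding fq by (rule Bf[OF x c d l u \<phi>e[unfolded s(2)]])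
    show "\<phi> d (A x c W l d e) = B x c W l d (\<phi> c e)"
    proof (rule C2(6)[OF d q R(1)[OF d q Ae] Be])
      have "\<theta>' d (lift_frame l s) (\<phi> d (A x c W l d e)) = f (\<theta> d (lift_frame l s) (A x c W l d e))" by (rule R(2)[OF d q Ae, symmetric])
      also have "\<dots> = f (line_action E act x (mat 1) (\<theta> c s e))" using C1(3)[OF x I c d l s(1) sW es] by simp
      also have "\<dots> = line_action E' act' x (mat 1) (f (\<theta> c s e))"
        using eq x I fibreD(1)[OF conjunct1[OF C1(4)[OF c s(1) es]]] by blast
      also have "\<dots> = line_action E' act' x (mat 1) (\<theta>' c s (\<phi> c e))" unfolding R(2)[OF c s(1) es] ..
      also have "\<dots> = \<theta>' d (lift_frame l s) (B x c W l d (\<phi> c e))" using C2(3)[OF x I c d l s(1) sW \<phi>e] by simp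
      finally show "\<theta>' d (lift_frame l s) (\<phi> d (A x c W l d e)) = \<theta>' d (lift_frame l s) (B x c W l d (\<phi> c e))" .
    qed
  next
    fix x Q y
    assume eq: "\<forall>x\<in>carrier X. \<forall>c\<in>charts Y. \<forall>d\<in>charts Y. \<forall>W l. local_lift (snd x) c d W l \<longrightarrow>
        (\<forall>u\<in>W. \<forall>e\<in>fibre (obun O1 c) u. \<phi> d (A x c W l d e) = B x c W l d (\<phi> c e))"
      and x: "x \<in> carrier X" and Q: "Q \<in> On" and y: "y \<in> tot E"
    obtain c p e where r: "c \<in> charts Y" "p \<in> FC c" "vproj E y = cls c p" "e \<in> tot (obun O1 c)" "vproj (obun O1 c) e = fst p" "y = \<theta> c p e"
      using over_comparison_rep[OF C1(1) y] .
    note e = fibreI[OF r(4,5)]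
    have h: "snd x \<in> carrier H" using x ext_carrier by blast
    obtain d W l where l: "d \<in> charts Y" "local_lift (snd x) c d W l" "fst p \<in> W" using step_exists[OF h r(1,2)] .
    have rq: "rotate_frame Q p \<in> FC c" "fst (rotate_frame Q p) \<in> W" using rotate_FC[OF r(2)] Q l(3) by simp_all
    note q = lFC[OF x r(1) l(1,2) rq(2,1)]
    have fq: "fst (lift_frame l (rotate_frame Q p)) = l (fst p)" by simp
    have Ae: "A x c W l d e \<in> fibre (obun O1 d) (fst (lift_frame l (rotate_frame Q p)))" unfolding fq by (rule Af[OF x r(1) l e])
    have \<phi>e: "\<phi> c e \<in> fibre (obun O2 c) (fst p)" by (rule R(1)[OF r(1,2) e])
    have "f (line_action E act x Q y) = f (\<theta> d (lift_frame l (rotate_frame Q p)) (A x c W l d e))"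
      unfolding r(6) C1(3)[OF x Q r(1) l(1,2) r(2) l(3) e] ..
    also have "\<dots> = \<theta>' d (lift_frame l (rotate_frame Q p)) (\<phi> d (A x c W l d e))" by (rule R(2)[OF l(1) q Ae])
    also have "\<phi> d (A x c W l d e) = B x c W l d (\<phi> c e)" using eq x r(1) l e by blast
    also have "\<theta>' d (lift_frame l (rotate_frame Q p)) (B x c W l d (\<phi> c e)) = line_action E' act' x Q (\<theta>' c p (\<phi> c e))"
      by (rule C2(3)[OF x Q r(1) l(1,2) r(2) l(3) \<phi>e])
    finally show "f (line_action E act x Q y) = line_action E' act' x Q (f y)" unfolding r(6) R(2)[OF r(1,2) e] .
  qed
  show ?thesis unfolding twisted_morphism_iff[OF E E'] orbi_morphism_iff[OF O1 O2] lin equ ..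
qed

lemma morphism_down:
  assumes E: "tbundle (E, act)" and E': "tbundle (E', act')"
    and O1: "torbibundle (O1, A)" and O2: "torbibundle (O2, B)"
    and C: "comparison E (line_action E act) (obun O1) A \<theta> \<psi>"
    and C': "comparison E' (line_action E' act') (obun O2) B \<theta>' \<psi>'"
    and f: "twisted_morphism (E, act) (E', act') f"
  shows "\<exists>\<phi>. related (St (obun O1)) (Sp (obun O1)) \<theta> (St (obun O2)) (Sp (obun O2)) \<theta>' f \<phi> \<and> orbi_morphism (O1, A) (O2, B) \<phi>"
proof -
  note f' = f[unfolded twisted_morphism_iff[OF E E']]
  have "\<exists>\<phi>. related (St (obun O1)) (Sp (obun O1)) \<theta> (St (obun O2)) (Sp (obun O2)) \<theta>' f \<phi>"
  proof (rule down[OF C C'])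
    show "f e \<in> fibre E' \<xi>" if "e \<in> fibre E \<xi>" for \<xi> e
      by (rule fibre_homD(1)[OF bspec[OF conjunct1[OF f'] fibre_over_frames[OF E that]] that])
    show "f (line_action E act x Q e) = line_action E' act' x Q (f e)" if "x \<in> carrier X" "Q \<in> On" "e \<in> tot E" for x Q e
      using conjunct2[OF f'] that by blast
  qed (rule identity_lift_acts_trivially[OF O1], assumption+, rule identity_lift_acts_trivially[OF O2], assumption+)
  then obtain \<phi> where rel: "related (St (obun O1)) (Sp (obun O1)) \<theta> (St (obun O2)) (Sp (obun O2)) \<theta>' f \<phi>" ..
  then show ?thesis using f morphism_transfer[OF E E' O1 O2 C C' rel] by blast
qed

lemma morphism_up:
  assumes E: "tbundle (E, act)" and E': "tbundle (E', act')"
    and O1: "torbibundle (O1, A)" and O2: "torbibundle (O2, B)"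
    and C: "comparison E (line_action E act) (obun O1) A \<theta> \<psi>"
    and C': "comparison E' (line_action E' act') (obun O2) B \<theta>' \<psi>'"
    and \<phi>: "orbi_morphism (O1, A) (O2, B) \<phi>"
  shows "\<exists>f. related (St (obun O1)) (Sp (obun O1)) \<theta> (St (obun O2)) (Sp (obun O2)) \<theta>' f \<phi> \<and> twisted_morphism (E, act) (E', act') f"
proof -
  note \<phi>' = \<phi>[unfolded orbi_morphism_iff[OF O1 O2]]
  have "\<exists>f. related (St (obun O1)) (Sp (obun O1)) \<theta> (St (obun O2)) (Sp (obun O2)) \<theta>' f \<phi>"
  proof (rule up[OF twisted_bundle_imp_frame_action(1)[OF E] C C' twisted_bundle_imp_frame_action(1)[OF E']])
    show "A x c W l d e \<in> fibre (obun O1 d) (l u)" if "x \<in> carrier X" "c \<in> charts Y" "d \<in> charts Y" "local_lift (snd x) c d W l"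
      "u \<in> W" "e \<in> fibre (obun O1 c) u" for x c d W l u e
      by (rule fibre_iso_in[OF twisted_orbibundleD(3)[OF O1 that(1-5)] that(6)])
    show "\<phi> c e \<in> fibre (obun O2 c) u" if "c \<in> charts Y" "e \<in> fibre (obun O1 c) u" for c u e
      by (rule fibre_homD(1)[OF bspec[OF bspec[OF conjunct1[OF \<phi>'] that(1)] fibre_over_chart[OF O1 that]] that(2)])
    show "\<phi> d (A x c W l d e) = B x c W l d (\<phi> c e)" if "x \<in> carrier X" "c \<in> charts Y" "d \<in> charts Y" "local_lift (snd x) c d W l"
      "u \<in> W" "e \<in> fibre (obun O1 c) u" for x c d W l u e
      using conjunct2[OF \<phi>'] that by blast
  qed
  then obtain f where rel: "related (St (obun O1)) (Sp (obun O1)) \<theta> (St (obun O2)) (Sp (obun O2)) \<theta>' f \<phi>" ..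
  then show ?thesis using \<phi> morphism_transfer[OF E E' O1 O2 C C' rel] by blast
qed

lemma isomorphism_transfer:
  assumes E: "tbundle (E, act)" and E': "tbundle (E', act')"
    and O1: "torbibundle (O1, A)" and O2: "torbibundle (O2, B)"
    and C: "corresponds (E, act) (O1, A)" and C': "corresponds (E', act') (O2, B)"
  shows "twisted_iso \<G> \<L> (E, act) (E', act') \<longleftrightarrow> orbi_iso Y H a (O1, A) (O2, B)"
proof -
  obtain \<theta> \<psi> where C: "comparison E (line_action E act) (obun O1) A \<theta> \<psi>" using C unfolding corresponds_def by auto
  obtain \<theta>' \<psi>' where C': "comparison E' (line_action E' act') (obun O2) B \<theta>' \<psi>'" using C' unfolding corresponds_def by auto
  have hm: "homeomorphic_map (vtot E) (vtot E') f \<longleftrightarrow> (\<forall>c\<in>charts Y. homeomorphic_map (vtot (obun O1 c)) (vtot (obun O2 c)) (\<phi> c))"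
    if "related (St (obun O1)) (Sp (obun O1)) \<theta> (St (obun O2)) (Sp (obun O2)) \<theta>' f \<phi>" for f \<phi>
    by (rule related_homeomorphic[OF comparisonD(1)[OF C] comparisonD(1)[OF C'] that])
  show ?thesis
    unfolding twisted_iso_iff[OF E E'] orbi_iso_iff[OF O1 O2]
  proof
    assume "\<exists>f. twisted_morphism (E, act) (E', act') f \<and> homeomorphic_map (vtot E) (vtot E') f"
    then obtain f where f: "twisted_morphism (E, act) (E', act') f" "homeomorphic_map (vtot E) (vtot E') f" by blast
    obtain \<phi> where \<phi>: "related (St (obun O1)) (Sp (obun O1)) \<theta> (St (obun O2)) (Sp (obun O2)) \<theta>' f \<phi>" "orbi_morphism (O1, A) (O2, B) \<phi>"
      using morphism_down[OF E E' O1 O2 C C' f(1)] by blast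
    show "\<exists>\<phi>. orbi_morphism (O1, A) (O2, B) \<phi> \<and> (\<forall>c\<in>charts Y. homeomorphic_map (vtot (obun O1 c)) (vtot (obun O2 c)) (\<phi> c))"
      by (intro exI[of _ \<phi>] conjI \<phi>(2) hm[OF \<phi>(1), THEN iffD1] f(2))
  next
    assume "\<exists>\<phi>. orbi_morphism (O1, A) (O2, B) \<phi> \<and> (\<forall>c\<in>charts Y. homeomorphic_map (vtot (obun O1 c)) (vtot (obun O2 c)) (\<phi> c))"
    then obtain \<phi> where \<phi>: "orbi_morphism (O1, A) (O2, B) \<phi>" "\<forall>c\<in>charts Y. homeomorphic_map (vtot (obun O1 c)) (vtot (obun O2 c)) (\<phi> c)" by blast
    obtain f where f: "related (St (obun O1)) (Sp (obun O1)) \<theta> (St (obun O2)) (Sp (obun O2)) \<theta>' f \<phi>" "twisted_morphism (E, act) (E', act') f"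
      using morphism_up[OF E E' O1 O2 C C' \<phi>(1)] by blast
    show "\<exists>f. twisted_morphism (E, act) (E', act') f \<and> homeomorphic_map (vtot E) (vtot E') f"
      by (intro exI[of _ f] conjI f(2) hm[OF f(1), THEN iffD2] \<phi>(2))
  qed
qed

text \<open>The two projections of a sum are transferred as morphisms, and the condition that they form a
  fibre product is the condition that a map between compared spaces is a homeomorphism.\<close>

lemma sum_transfer:
  assumes G: "tbundle (G, actG)" and E: "tbundle (E, actE)" and F: "tbundle (F, actF)"
    and O0: "torbibundle (O0, A)" and O1: "torbibundle (O1, B)" and O2: "torbibundle (O2, C)"
    and CG: "corresponds (G, actG) (O0, A)" and CE: "corresponds (E, actE) (O1, B)" and CF: "corresponds (F, actF) (O2, C)"
  shows "twisted_sum \<G> \<L> (G, actG) (E, actE) (F, actF) \<longleftrightarrow> orbi_sum Y H a (O0, A) (O1, B) (O2, C)"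
proof -
  obtain \<theta> \<psi> where CG: "comparison G (line_action G actG) (obun O0) A \<theta> \<psi>" using CG unfolding corresponds_def by auto
  obtain \<theta>1 \<psi>1 where CE: "comparison E (line_action E actE) (obun O1) B \<theta>1 \<psi>1" using CE unfolding corresponds_def by auto
  obtain \<theta>2 \<psi>2 where CF: "comparison F (line_action F actF) (obun O2) C \<theta>2 \<psi>2" using CF unfolding corresponds_def by auto
  let ?T = "subtopology (prod_topology (vtot E) (vtot F)) {(e, f). vproj E e = vproj F f}"
  let ?S = "\<lambda>c. subtopology (prod_topology (vtot (obun O1 c)) (vtot (obun O2 c))) {(e, f). vproj (obun O1 c) e = vproj (obun O2 c) f}"
  note prod = over_comparison_product[OF comparisonD(1)[OF CE] comparisonD(1)[OF CF]]
  have hm: "homeomorphic_map (vtot G) ?T (\<lambda>x. (p x, q x)) \<longleftrightarrow> (\<forall>c\<in>charts Y. homeomorphic_map (vtot (obun O0 c)) (?S c) (\<lambda>x. (\<phi> c x, \<eta> c x)))"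
    if p: "related (St (obun O0)) (Sp (obun O0)) \<theta> (St (obun O1)) (Sp (obun O1)) \<theta>1 p \<phi>"
      and q: "related (St (obun O0)) (Sp (obun O0)) \<theta> (St (obun O2)) (Sp (obun O2)) \<theta>2 q \<eta>" for p q \<phi> \<eta>
  proof (rule related_homeomorphic[OF comparisonD(1)[OF CG] prod])
    show "related (St (obun O0)) (Sp (obun O0)) \<theta> ?S (\<lambda>c y. vproj (obun O1 c) (fst y)) (\<lambda>c p y. (\<theta>1 c p (fst y), \<theta>2 c p (snd y)))
       (\<lambda>x. (p x, q x)) (\<lambda>c x. (\<phi> c x, \<eta> c x))"
      unfolding related_def
    proof (intro ballI impI)
      fix c r e assume c: "c \<in> charts Y" "r \<in> FC c" "e \<in> tot (obun O0 c)" "vproj (obun O0 c) e = fst r"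
      show "(\<phi> c e, \<eta> c e) \<in> topspace (?S c) \<and> vproj (obun O1 c) (fst (\<phi> c e, \<eta> c e)) = fst r \<and>
          (p (\<theta> c r e), q (\<theta> c r e)) = (\<theta>1 c r (fst (\<phi> c e, \<eta> c e)), \<theta>2 c r (snd (\<phi> c e, \<eta> c e)))"
        using relatedD[OF p c] relatedD[OF q c] by simp
    qed
  qed
  show ?thesis
    unfolding twisted_sum_iff orbi_sum_iff
  proof
    assume "\<exists>p q. twisted_morphism (G, actG) (E, actE) p \<and> twisted_morphism (G, actG) (F, actF) q \<and> homeomorphic_map (vtot G) ?T (\<lambda>x. (p x, q x))"
    then obtain p q where pq: "twisted_morphism (G, actG) (E, actE) p" "twisted_morphism (G, actG) (F, actF) q" "homeomorphic_map (vtot G) ?T (\<lambda>x. (p x, q x))"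
      by blast
    obtain \<phi> where \<phi>: "related (St (obun O0)) (Sp (obun O0)) \<theta> (St (obun O1)) (Sp (obun O1)) \<theta>1 p \<phi>" "orbi_morphism (O0, A) (O1, B) \<phi>"
      using morphism_down[OF G E O0 O1 CG CE pq(1)] by blast
    obtain \<eta> where \<eta>: "related (St (obun O0)) (Sp (obun O0)) \<theta> (St (obun O2)) (Sp (obun O2)) \<theta>2 q \<eta>" "orbi_morphism (O0, A) (O2, C) \<eta>"
      using morphism_down[OF G F O0 O2 CG CF pq(2)] by blast
    show "\<exists>p q. orbi_morphism (O0, A) (O1, B) p \<and> orbi_morphism (O0, A) (O2, C) q \<and> (\<forall>c\<in>charts Y. homeomorphic_map (vtot (obun O0 c)) (?S c) (\<lambda>x. (p c x, q c x)))"
      by (intro exI[of _ \<phi>] exI[of _ \<eta>] conjI \<phi>(2) \<eta>(2) hm[OF \<phi>(1) \<eta>(1), THEN iffD1] pq(3))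
  next
    assume "\<exists>p q. orbi_morphism (O0, A) (O1, B) p \<and> orbi_morphism (O0, A) (O2, C) q \<and> (\<forall>c\<in>charts Y. homeomorphic_map (vtot (obun O0 c)) (?S c) (\<lambda>x. (p c x, q c x)))"
    then obtain \<phi> \<eta> where pq: "orbi_morphism (O0, A) (O1, B) \<phi>" "orbi_morphism (O0, A) (O2, C) \<eta>"
      "\<forall>c\<in>charts Y. homeomorphic_map (vtot (obun O0 c)) (?S c) (\<lambda>x. (\<phi> c x, \<eta> c x))" by blast
    obtain p where p: "related (St (obun O0)) (Sp (obun O0)) \<theta> (St (obun O1)) (Sp (obun O1)) \<theta>1 p \<phi>" "twisted_morphism (G, actG) (E, actE) p"
      using morphism_up[OF G E O0 O1 CG CE pq(1)] by blast
    obtain q where q: "related (St (obun O0)) (Sp (obun O0)) \<theta> (St (obun O2)) (Sp (obun O2)) \<theta>2 q \<eta>" "twisted_morphism (G, actG) (F, actF) q"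
      using morphism_up[OF G F O0 O2 CG CF pq(2)] by blast
    show "\<exists>p q. twisted_morphism (G, actG) (E, actE) p \<and> twisted_morphism (G, actG) (F, actF) q \<and> homeomorphic_map (vtot G) ?T (\<lambda>x. (p x, q x))"
      by (intro exI[of _ p] exI[of _ q] conjI p(2) q(2) hm[OF p(1) q(1), THEN iffD2] pq(3))
  qed
qed

section \<open>Isomorphism of twisted bundles\<close>

lemma twisted_action_in:
  assumes E: "tbundle (E, act)" and x: "x \<in> carrier X" and Q: "Q \<in> On" and e: "e \<in> tot E"
  shows "line_action E act x Q e \<in> tot E"
  by (rule fibreD(1)[OF fibre_iso_in[OF frame_actionD(3)[OF twisted_bundle_imp_frame_action(1)[OF E] x Q
        vector_bundle_proj_in[OF twisted_bundle_vector_bundle[OF E] e]] fibreI[OF e refl]]])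

lemma twisted_morphism_compose:
  assumes E: "tbundle (E, actE)" and F: "tbundle (F, actF)" and G: "tbundle (G, actG)"
    and f: "twisted_morphism (E, actE) (F, actF) f" and g: "twisted_morphism (F, actF) (G, actG) g"
  shows "twisted_morphism (E, actE) (G, actG) (\<lambda>x. g (f x))"
proof -
  note f' = f[unfolded twisted_morphism_iff[OF E F]] and g' = g[unfolded twisted_morphism_iff[OF F G]]
  have fF: "f e \<in> fibre F \<xi>" if "e \<in> fibre E \<xi>" for e \<xi>
    by (rule fibre_homD(1)[OF bspec[OF conjunct1[OF f'] fibre_over_frames[OF E that]] that])
  show ?thesis
    unfolding twisted_morphism_iff[OF E G]
  proof (intro conjI ballI)
    fix \<xi> assume \<xi>: "\<xi> \<in> topspace P"
    note hf = fibre_homD[OF bspec[OF conjunct1[OF f'] \<xi>]] and hg = fibre_homD[OF bspec[OF conjunct1[OF g'] \<xi>]]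
    show "fibre_hom E \<xi> G \<xi> (\<lambda>x. g (f x))"
      unfolding fibre_hom_def using hf hg by (intro conjI ballI allI image_subsetI) simp_all
  next
    fix x Q e assume x: "x \<in> carrier X" "Q \<in> On" and e: "e \<in> tot E"
    have "f e \<in> tot F" by (rule fibreD(1)[OF fF[OF fibreI[OF e refl]]])
    then show "g (f (line_action E actE x Q e)) = line_action G actG x Q (g (f e))" using f' g' x e by simp
  qed
qed

lemma twisted_morphism_inverse:
  assumes E: "tbundle (E, actE)" and F: "tbundle (F, actF)"
    and f: "twisted_morphism (E, actE) (F, actF) f" and h: "homeomorphic_map (vtot E) (vtot F) f"
  shows "twisted_morphism (F, actF) (E, actE) (inv_into (tot E) f)"
    "homeomorphic_maps (vtot E) (vtot F) f (inv_into (tot E) f)"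
proof -
  let ?g = "inv_into (tot E) f"
  note f' = f[unfolded twisted_morphism_iff[OF E F]]
  note vE = twisted_bundle_vector_bundle[OF E] and vF = twisted_bundle_vector_bundle[OF F]
  have iso: "bundle_iso P E F f" unfolding bundle_iso_iff[OF vE vF] using f' h by blast
  note inv = bundle_iso_inverse[OF vE vF iso]
  show hm: "homeomorphic_maps (vtot E) (vtot F) f ?g" by (rule inv(2))
  note hm' = hm[unfolded homeomorphic_maps_def]
  have gf: "?g (f e) = e" if "e \<in> tot E" for e using hm' that by blast
  show "twisted_morphism (F, actF) (E, actE) ?g"
    unfolding twisted_morphism_iff[OF F E]
  proof (intro conjI ballI)
    show "fibre_hom F \<xi> E \<xi> ?g" if "\<xi> \<in> topspace P" for \<xi>
      using inv(1) that unfolding bundle_iso_def fibre_iso_def by blast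
    fix x Q y assume x: "x \<in> carrier X" "Q \<in> On" and y: "y \<in> tot F"
    obtain e where e: "e \<in> tot E" "y = f e" using y homeomorphic_imp_surjective_map[OF h] by blast
    have "line_action F actF x Q y = f (line_action E actE x Q e)" using f' x e by simp
    then show "?g (line_action F actF x Q y) = line_action E actE x Q (?g y)"
      using gf[OF twisted_action_in[OF E x e(1)]] gf[OF e(1)] e(2) by simp
  qed
qed

lemma twisted_iso_equiv: "equiv {E. tbundle E} {(E, F). E \<in> {E. tbundle E} \<and> F \<in> {E. tbundle E} \<and> twisted_iso \<G> \<L> E F}"
proof (rule equivI)
  show "{(E, F). E \<in> {E. tbundle E} \<and> F \<in> {E. tbundle E} \<and> twisted_iso \<G> \<L> E F}
    \<subseteq> {E. tbundle E} \<times> {E. tbundle E}" by blast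
  have refl: "twisted_iso \<G> \<L> (E, act) (E, act)" if E: "tbundle (E, act)" for E :: "(('n, 'y) frame, 'e) vbundle" and act
  proof -
    have "twisted_morphism (E, act) (E, act) (\<lambda>x. x)" unfolding twisted_morphism_def by (auto simp: fibre_hom_def)
    moreover have "homeomorphic_map (vtot E) (vtot E) (\<lambda>x. x)" using homeomorphic_map_id[of "vtot E" "vtot E"] by (simp add: id_def)
    ultimately show ?thesis unfolding twisted_iso_iff[OF E E] by blast
  qed
  then show "refl_on {E. tbundle E} {(E, F). E \<in> {E. tbundle E} \<and> F \<in> {E. tbundle E} \<and> twisted_iso \<G> \<L> E F}"
    by (intro refl_onI) auto
  have sym: "twisted_iso \<G> \<L> (F, actF) (E, actE)" if E: "tbundle (E, actE)" and F: "tbundle (F, actF)"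
      and i: "twisted_iso \<G> \<L> (E, actE) (F, actF)" for E F :: "(('n, 'y) frame, 'e) vbundle" and actE actF
  proof -
    obtain f where f: "twisted_morphism (E, actE) (F, actF) f" "homeomorphic_map (vtot E) (vtot F) f" using i unfolding twisted_iso_iff[OF E F] by blast
    note g = twisted_morphism_inverse[OF E F f]
    have "homeomorphic_map (vtot F) (vtot E) (inv_into (tot E) f)" using g(2) homeomorphic_maps_map by blast
    then show ?thesis unfolding twisted_iso_iff[OF F E] using g(1) by blast
  qed
  then show "sym {(E, F). E \<in> {E. tbundle E} \<and> F \<in> {E. tbundle E} \<and> twisted_iso \<G> \<L> E F}"
    by (intro symI) auto
  have trans: "twisted_iso \<G> \<L> (E, actE) (G, actG)" if E: "tbundle (E, actE)" and F: "tbundle (F, actF)"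
      and G: "tbundle (G, actG)" and i: "twisted_iso \<G> \<L> (E, actE) (F, actF)" "twisted_iso \<G> \<L> (F, actF) (G, actG)"
    for E F G :: "(('n, 'y) frame, 'e) vbundle" and actE actF actG
  proof -
    obtain f where f: "twisted_morphism (E, actE) (F, actF) f" "homeomorphic_map (vtot E) (vtot F) f" using i(1) unfolding twisted_iso_iff[OF E F] by blast
    obtain g where g: "twisted_morphism (F, actF) (G, actG) g" "homeomorphic_map (vtot F) (vtot G) g" using i(2) unfolding twisted_iso_iff[OF F G] by blast
    show ?thesis unfolding twisted_iso_iff[OF E G]
      by (intro exI[of _ "\<lambda>x. g (f x)"] conjI twisted_morphism_compose[OF E F G f(1) g(1)])
        (use homeomorphic_map_compose[OF f(2) g(2)] in \<open>simp add: o_def\<close>)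
  qed
  then show "trans {(E, F). E \<in> {E. tbundle E} \<and> F \<in> {E. tbundle E} \<and> twisted_iso \<G> \<L> E F}"
    by (intro transI) auto
qed

lemma twisted_sum_invariant:
  assumes G: "tbundle (G, actG)" and G2: "tbundle (G2, actG2)" and E: "tbundle (E, actE)"
    and F: "tbundle (F, actF)" and s: "twisted_sum \<G> \<L> (G, actG) (E, actE) (F, actF)" and i: "twisted_iso \<G> \<L> (G, actG) (G2, actG2)"
  shows "twisted_sum \<G> \<L> (G2, actG2) (E, actE) (F, actF)"
proof -
  obtain f where f: "twisted_morphism (G, actG) (G2, actG2) f" "homeomorphic_map (vtot G) (vtot G2) f" using i unfolding twisted_iso_iff[OF G G2] by blast
  let ?g = "inv_into (tot G) f"
  note g = twisted_morphism_inverse[OF G G2 f]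
  have hg: "homeomorphic_map (vtot G2) (vtot G) ?g" using g(2) homeomorphic_maps_map by blast
  obtain p q where pq: "twisted_morphism (G, actG) (E, actE) p" "twisted_morphism (G, actG) (F, actF) q"
    "homeomorphic_map (vtot G) (subtopology (prod_topology (vtot E) (vtot F)) {(e, f). vproj E e = vproj F f}) (\<lambda>x. (p x, q x))"
    using s unfolding twisted_sum_iff by blast
  show ?thesis unfolding twisted_sum_iff
    by (intro exI[of _ "\<lambda>x. p (?g x)"] exI[of _ "\<lambda>x. q (?g x)"] conjI twisted_morphism_compose[OF G2 G E g(1) pq(1)]
        twisted_morphism_compose[OF G2 G F g(1) pq(2)])
      (use homeomorphic_map_compose[OF hg pq(3)] in \<open>simp add: o_def\<close>)
qed

end

section \<open>From twisted bundles to orbibundles\<close>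

lemma fibre_hom_compose:
  assumes "fibre_hom E b F c T" "fibre_hom F c G d S"
  shows "fibre_hom E b G d (\<lambda>e. S (T e))"
  unfolding fibre_hom_def
proof (intro conjI ballI allI image_subsetI)
  note t = fibre_homD[OF assms(1)] and s = fibre_homD[OF assms(2)]
  fix e assume e: "e \<in> fibre E b"
  show "S (T e) \<in> fibre G d" by (rule s(1)[OF t(1)[OF e]])
  show "S (T (vadd E e e')) = vadd G (S (T e)) (S (T e'))" if e': "e' \<in> fibre E b" for e'
    unfolding t(2)[OF e e'] by (rule s(2)[OF t(1)[OF e] t(1)[OF e']])
  show "S (T (vscl E z e)) = vscl G z (S (T e))" for z unfolding t(3)[OF e] by (rule s(3)[OF t(1)[OF e]])
qed

lemma fibre_iso_compose:
  assumes T: "fibre_iso E b F c T" and S: "fibre_iso F c G d S"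
  shows "fibre_iso E b G d (\<lambda>e. S (T e))"
  unfolding fibre_iso_def
proof
  show "fibre_hom E b G d (\<lambda>e. S (T e))" by (rule fibre_hom_compose[OF fibre_isoD(1)[OF T] fibre_isoD(1)[OF S]])
  have "bij_betw (S \<circ> T) (fibre E b) (fibre G d)"
    by (rule bij_betw_trans[of _ _ "fibre F c"]) (use T S in \<open>simp_all add: fibre_iso_def\<close>)
  then show "bij_betw (\<lambda>e. S (T e)) (fibre E b) (fibre G d)" by (simp add: o_def)
qed

context twisted_action
begin

interpretation H: group H by (rule H)

lemma continuous_map_trans_Q:
  assumes c: "c \<in> charts Y" and f: "continuous_map Z (FT c) f" and g: "continuous_map Z (FT c) g"
    and fg: "\<And>z. z \<in> topspace Z \<Longrightarrow> fst (f z) = fst (g z)"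
  shows "continuous_map Z (top_of_set On) (\<lambda>z. trans_Q c (f z) (g z))"
proof (rule continuous_map_into_subtopology)
  have FC: "f z \<in> FC c" "g z \<in> FC c" if "z \<in> topspace Z" for z
    using continuous_map_image_subset_topspace[OF f] continuous_map_image_subset_topspace[OF g] that by auto
  show "(\<lambda>z. trans_Q c (f z) (g z)) \<in> topspace Z \<rightarrow> On"
    by (rule Pi_I) (use trans_Q(1)[OF c FC fg] in blast)
  have "continuous_map Z euclidean (\<lambda>z. (f z, g z))"
    by (intro continuous_map_euclidean_pair continuous_map_into_fulltopology[OF f] continuous_map_into_fulltopology[OF g])
  from continuous_map_into_euclidean_compose[OF this _ continuous_on_trans_Q[OF c]]
  show "continuous_map Z euclidean (\<lambda>z. trans_Q c (f z) (g z))" using FC_D(1)[OF FC(1)] by (simp add: Pi_iff)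
qed

lemma continuous_map_lift_frame:
  assumes h: "h \<in> carrier H" and c: "c \<in> charts Y" and d: "d \<in> charts Y" and l: "local_lift h c d W l"
    and f: "continuous_map Z (FT c) f" and W: "\<And>z. z \<in> topspace Z \<Longrightarrow> fst (f z) \<in> W"
  shows "continuous_map Z (FT d) (\<lambda>z. lift_frame l (f z))"
proof (rule continuous_map_into_subtopology)
  have FC: "f z \<in> FC c" if "z \<in> topspace Z" for z using continuous_map_image_subset_topspace[OF f] that by auto
  show "(\<lambda>z. lift_frame l (f z)) \<in> topspace Z \<rightarrow> FC d"
    by (rule Pi_I) (rule lift_frame_FC[OF isometry[OF h] c d l W FC])
  show "continuous_map Z euclidean (\<lambda>z. lift_frame l (f z))"
    by (rule continuous_map_into_euclidean_compose[OF continuous_map_into_fulltopology[OF f] _ continuous_on_lift_frame[OF local_liftD(6)[OF l]]])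
      (simp add: Pi_iff mem_Times_iff W)
qed

lemma continuous_map_rotate_frame:
  assumes Q: "continuous_map Z (top_of_set On) Q" and f: "continuous_map Z (FT c) f"
  shows "continuous_map Z (FT c) (\<lambda>z. rotate_frame (Q z) (f z))"
proof (rule continuous_map_into_subtopology)
  have FC: "f z \<in> FC c" "Q z \<in> On" if "z \<in> topspace Z" for z
    using continuous_map_image_subset_topspace[OF f] continuous_map_image_subset_topspace[OF Q] that by auto
  show "(\<lambda>z. rotate_frame (Q z) (f z)) \<in> topspace Z \<rightarrow> FC c"
    by (rule Pi_I) (rule rotate_FC[OF FC(1)], assumption, use FC(2) in blast)
  have "continuous_map Z euclidean (\<lambda>z. (Q z, f z))"
    by (intro continuous_map_euclidean_pair continuous_map_into_fulltopology[OF f] continuous_map_into_fulltopology[OF Q])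
  from continuous_map_into_euclidean_compose[OF this _ continuous_on_rotate_frame, of UNIV]
  show "continuous_map Z euclidean (\<lambda>z. rotate_frame (Q z) (f z))" by simp
qed

lemma continuous_map_section:
  assumes c: "c \<in> charts Y" and u: "continuous_map Z (D c) u"
  shows "continuous_map Z (FT c) (\<lambda>z. frame_section c (u z))"
proof (rule continuous_map_app[OF u])
  show "continuous_map (D c) (FT c) (frame_section c)" using frame_section(1,2)[OF c] by simp
qed

lemma frame_action_lift:
  assumes fa: "frame_action E \<rho>" and x: "x \<in> carrier X" and Q: "Q \<in> On" and c: "c \<in> charts Y" and d: "d \<in> charts Y"
    and l: "local_lift (snd x) c d W l" and p: "p \<in> FC c" "fst p \<in> W"
  shows "fibre_iso E (cls c p) E (cls d (lift_frame l (rotate_frame Q p))) (\<rho> x Q)"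
proof -
  have h: "snd x \<in> carrier H" using x ext_carrier by blast
  have "step (snd x) c (rotate_frame Q p) d (lift_frame l (rotate_frame Q p))" by (rule jet_stepI[OF c d l]) (simp add: p(2))
  then have "frame_push Y (snd x) (frame_rotate Q (cls c p)) = cls d (lift_frame l (rotate_frame Q p))"
    unfolding rotate_cls by (rule push_cls[OF h])
  then show ?thesis using frame_actionD(3)[OF fa x Q cls_in[OF c p(1)]] by simp
qed

lemma lift_frame_identity:
  assumes c: "c \<in> charts Y" and p: "fst p \<in> cdom c"
  shows "lift_frame (restrict id (cdom c)) p = p"
  using jac_identity[OF chartD(5)[OF c] p, of "restrict id (cdom c)"] p unfolding lift_frame_def by (simp add: case_prod_unfold)

lemma identity_lift: "c \<in> charts Y \<Longrightarrow> local_lift (snd \<epsilon>) c c (cdom c) (restrict id (cdom c))"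
  using local_lift_id[OF chartD(5), of c c] one_lift[of c] by simp

lemma frame_action_rotate:
  assumes fa: "frame_action E \<rho>" and Q: "Q \<in> On" and c: "c \<in> charts Y" and p: "p \<in> FC c"
  shows "fibre_iso E (cls c p) E (cls c (rotate_frame Q p)) (\<rho> \<epsilon> Q)"
  using frame_action_lift[OF fa ext_one_closed Q c c identity_lift[OF c] p FC_D(1)[OF p]] lift_frame_identity[OF c, of "rotate_frame Q p"]
    FC_D(1)[OF p] by simp

lemma lift_frame_composite:
  fixes b c d :: "('n, 'y) chart"
  assumes l: "local_lift h b c W l" and m: "local_lift k c d V m" and sub: "l ` W \<subseteq> V" and p: "fst p \<in> W"
  shows "lift_frame (compose W m l) p = lift_frame m (lift_frame l p)"
proof -
  have "jac (compose W m l) (fst p) = jac m (l (fst p)) ** jac l (fst p)"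
    by (rule jac_compose[OF local_liftD(6)[OF l] p local_liftD(6)[OF m] _ local_liftD(1)[OF l] p]) (use sub p in \<open>auto simp: compose_def\<close>)
  then show ?thesis unfolding lift_frame_def using p by (cases p) (simp add: compose_def matrix_mul_assoc)
qed

text \<open>The changes of charts can be defined as the action of the unit of the extension; all conditions on
  them are then special cases of those on the action.\<close>

lemma twisted_orbibundleI:
  assumes vb: "\<And>c. c \<in> charts Y \<Longrightarrow> vector_bundle (D c) (\<E> c)"
    and cont: "\<And>x c d W l. x \<in> carrier X \<Longrightarrow> c \<in> charts Y \<Longrightarrow> d \<in> charts Y \<Longrightarrow> local_lift (snd x) c d W l \<Longrightarrow>
      continuous_map (subtopology (vtot (\<E> c)) {e. vproj (\<E> c) e \<in> W}) (vtot (\<E> d)) (A x c W l d)"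
    and iso: "\<And>x c d W l u. x \<in> carrier X \<Longrightarrow> c \<in> charts Y \<Longrightarrow> d \<in> charts Y \<Longrightarrow> local_lift (snd x) c d W l \<Longrightarrow> u \<in> W \<Longrightarrow>
      fibre_iso (\<E> c) u (\<E> d) (l u) (A x c W l d)"
    and comp: "\<And>x y b c d W l V m u e. x \<in> carrier X \<Longrightarrow> y \<in> carrier X \<Longrightarrow> b \<in> charts Y \<Longrightarrow> c \<in> charts Y \<Longrightarrow> d \<in> charts Y \<Longrightarrow>
      local_lift (snd y) b c W l \<Longrightarrow> local_lift (snd x) c d V m \<Longrightarrow> l ` W \<subseteq> V \<Longrightarrow> u \<in> W \<Longrightarrow> e \<in> fibre (\<E> b) u \<Longrightarrow>
      A x c V m d (A y b W l c e) = A (x \<otimes>\<^bsub>X\<^esub> y) b W (compose W m l) d e"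
    and centr: "\<And>z c d W l u e. norm z = 1 \<Longrightarrow> c \<in> charts Y \<Longrightarrow> d \<in> charts Y \<Longrightarrow> local_lift (snd \<epsilon>) c d W l \<Longrightarrow> u \<in> W \<Longrightarrow>
      e \<in> fibre (\<E> c) u \<Longrightarrow> A (central H a z) c W l d e = vscl (\<E> d) z (A \<epsilon> c W l d e)"
  shows "torbibundle (\<lparr>obun = \<E>, otrans = A \<epsilon>\<rparr>, A)"
proof -
  have ol: "local_lift (snd \<epsilon>) c d W l" if "c \<in> charts Y" "local_lift (\<lambda>y. y) c d W l" for c d W l
    using that one_lift by simp
  have cov: "covers_automorphism Y (snd x) \<E> (A x)" if "x \<in> carrier X" for x
    unfolding covers_automorphism_def by (intro ballI allI impI conjI cont iso that)
  have cov1: "covers_automorphism Y (\<lambda>y. y) \<E> (A \<epsilon>)"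
    unfolding covers_automorphism_def by (intro ballI allI impI conjI cont iso ext_one_closed ol)
  have cf: "composite_family Y \<E> (snd x) (A x) (snd y) (A y) (A (x \<otimes>\<^bsub>X\<^esub> y))" if "x \<in> carrier X" "y \<in> carrier X" for x y
    unfolding composite_family_def by (intro ballI allI impI, elim conjE, rule comp[OF that])
  have cfr: "composite_family Y \<E> (snd x) (A x) (\<lambda>y. y) (A \<epsilon>) (A x)" if x: "x \<in> carrier X" for x
    unfolding composite_family_def
  proof (intro ballI allI impI, elim conjE)
    fix b c d W l V m u e assume "b \<in> charts Y" "c \<in> charts Y" "d \<in> charts Y" "u \<in> W" "e \<in> fibre (\<E> b) u"
      "local_lift (\<lambda>y. y) b c W l" "local_lift (snd x) c d V m" "l ` W \<subseteq> V"
    then show "A x c V m d (A \<epsilon> b W l c e) = A x b W (compose W m l) d e"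
      using comp[OF x ext_one_closed, of b c d W l V m u e] ext_one_mult(2)[OF x] ol by simp
  qed
  have cfl: "composite_family Y \<E> (\<lambda>y. y) (A \<epsilon>) (snd x) (A x) (A x)" if x: "x \<in> carrier X" for x
    unfolding composite_family_def
  proof (intro ballI allI impI, elim conjE)
    fix b c d W l V m u e assume "b \<in> charts Y" "c \<in> charts Y" "d \<in> charts Y" "u \<in> W" "e \<in> fibre (\<E> b) u"
      "local_lift (snd x) b c W l" "local_lift (\<lambda>y. y) c d V m" "l ` W \<subseteq> V"
    then show "A \<epsilon> c V m d (A x b W l c e) = A x b W (compose W m l) d e"
      using comp[OF ext_one_closed x, of b c d W l V m u e] ext_one_mult(1)[OF x] ol by simp
  qed
  have cf1: "composite_family Y \<E> (\<lambda>y. y) (A \<epsilon>) (\<lambda>y. y) (A \<epsilon>) (A \<epsilon>)"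
    unfolding composite_family_def
  proof (intro ballI allI impI, elim conjE)
    fix b c d W l V m u e assume "b \<in> charts Y" "c \<in> charts Y" "d \<in> charts Y" "u \<in> W" "e \<in> fibre (\<E> b) u"
      "local_lift (\<lambda>y. y) b c W l" "local_lift (\<lambda>y. y) c d V m" "l ` W \<subseteq> V"
    then show "A \<epsilon> c V m d (A \<epsilon> b W l c e) = A \<epsilon> b W (compose W m l) d e"
      using comp[OF ext_one_closed ext_one_closed, of b c d W l V m u e] ext_one_mult(1)[OF ext_one_closed] ol by simp
  qed
  show ?thesis
    unfolding twisted_orbibundle_def split_conv complex_orbibundle_def orbibundle_automorphism_def orbibundle.simps
    by (intro conjI ballI allI impI vb cov cov1 cf cf1 cfr cfl centr ol) simp_all
qed

text \<open>Over a chart domain, the orbibundle is the pullback of \<open>E\<close> along the section of orthonormal frames.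
  A local lift \<open>l\<close> carries the frame of the section at \<open>u\<close> to a frame at \<open>l u\<close>, which a unique
  orthogonal matrix \<open>q\<close> rotates into the frame of the section.  So \<open>x\<close> acts by \<open>\<rho> x q\<close>, and the
  uniqueness of \<open>q\<close> makes this functorial.\<close>

theorem twisted_bundle_has_orbibundle:
  fixes E :: "(('n, 'y) frame, 'e) vbundle"
  assumes E: "tbundle (E, act)"
  shows "\<exists>(O1 :: ('n, 'y, (real^'n) \<times> (nat \<Rightarrow> complex)) orbibundle) A.
    torbibundle (O1, A) \<and> corresponds (E, act) (O1, A)"
proof -
  define \<rho> where "\<rho> = line_action E act"
  note fa = twisted_bundle_imp_frame_action(1)[OF E, folded \<rho>_def]
  note F = frame_actionD[OF fa] note vb = F(1)
  define \<beta> where "\<beta> c u = cls c (frame_section c u)" for c u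
  have sec: "frame_section c u \<in> FC c" "fst (frame_section c u) = u" if "c \<in> charts Y" "u \<in> cdom c" for c u
    using frame_section(2,3)[OF that(1)] that(2) by simp_all
  have \<beta>P: "\<beta> c u \<in> topspace P" if "c \<in> charts Y" "u \<in> cdom c" for c u unfolding \<beta>_def by (rule cls_in[OF that(1) sec(1)[OF that]])
  have c\<beta>: "continuous_map (D c) P (\<beta> c)" if c: "c \<in> charts Y" for c
  proof -
    have "continuous_map (D c) (FT c) (frame_section c)" using frame_section(1,2)[OF c] by simp
    from continuous_map_app[OF this continuous_frame_class[OF c]] show ?thesis unfolding \<beta>_def .
  qed
  define E0 where "E0 c = pullback_bundle (D c) (\<beta> c) E" for c
  have vb0: "vector_bundle (D c) (E0 c)" if "c \<in> charts Y" for c unfolding E0_def by (rule vector_bundle_pullback[OF vb c\<beta>[OF that]])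
  have tot0: "tot (E0 c) = {(u, e). u \<in> cdom c \<and> e \<in> tot E \<and> \<beta> c u = vproj E e}" for c
    unfolding E0_def pullback_bundle_def by (simp add: topspace_pullback_space)
  have "\<exists>j :: 'e \<Rightarrow> nat \<Rightarrow> complex. inj_on j (fibre E \<xi>)" if "\<xi> \<in> topspace P" for \<xi>
    using fibre_coordinates[OF vb that] by blast
  then have "\<forall>\<xi>. \<exists>j :: 'e \<Rightarrow> nat \<Rightarrow> complex. \<xi> \<in> topspace P \<longrightarrow> inj_on j (fibre E \<xi>)" by blast
  then obtain j :: "_ \<Rightarrow> 'e \<Rightarrow> nat \<Rightarrow> complex" where j: "\<forall>\<xi>. \<xi> \<in> topspace P \<longrightarrow> inj_on (j \<xi>) (fibre E \<xi>)"
    by (rule choice[THEN exE])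
  \<comment> \<open>\<open>j\<close> embeds the fibres into sequences, so \<open>K c\<close> moves the pullback to the required type.\<close>
  define K where "K c y = (fst y, j (\<beta> c (fst y)) (snd y))" for c and y :: "(real^'n) \<times> 'e"
  have Kinj: "inj_on (K c) (tot (E0 c))" if c: "c \<in> charts Y" for c
  proof (rule inj_onI)
    fix y z assume y: "y \<in> tot (E0 c)" and z: "z \<in> tot (E0 c)" and eq: "K c y = K c z"
    have f: "fst y = fst z" using eq unfolding K_def by simp
    have "snd y \<in> fibre E (\<beta> c (fst y))" "snd z \<in> fibre E (\<beta> c (fst y))" "fst y \<in> cdom c"
      using y z f unfolding tot0 by (auto intro: fibreI)
    then have "snd y = snd z" using eq f inj_onD[OF j[rule_format, OF \<beta>P[OF c]]] unfolding K_def by simp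
    then show "y = z" using f by (simp add: prod_eq_iff)
  qed
  define EE where "EE c = transport_bundle (K c) (E0 c)" for c
  have vbE: "vector_bundle (D c) (EE c)" and isoK: "bundle_iso (D c) (E0 c) (EE c) (K c)" if "c \<in> charts Y" for c
    unfolding EE_def by (rule transport_bundle[OF vb0[OF that] Kinj[OF that]])+
  define J where "J c = inv_into (tot (E0 c)) (K c)" for c
  note inv = bundle_iso_inverse[OF vb0 vbE isoK, folded J_def]
  have cK: "continuous_map (vtot (E0 c)) (vtot (EE c)) (K c)" and cJ: "continuous_map (vtot (EE c)) (vtot (E0 c)) (J c)"
    and JK: "\<And>y. y \<in> tot (E0 c) \<Longrightarrow> J c (K c y) = y" and KJ: "\<And>y. y \<in> tot (EE c) \<Longrightarrow> K c (J c y) = y"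
    if c: "c \<in> charts Y" for c
    using inv(2)[OF c c c, unfolded homeomorphic_maps_def] by simp_all
  have fib0: "fibre (E0 c) u = {u} \<times> fibre E (\<beta> c u)" if "u \<in> cdom c" for c u
    unfolding E0_def by (rule fibre_pullback_bundle) (simp add: that)
  have ops0: "vadd (E0 c) (u, e) (u, e') = (u, vadd E e e')" "vscl (E0 c) z (u, e) = (u, vscl E z e)" for c u e e' z
    unfolding E0_def pullback_bundle_def by simp_all
  have over: "u \<in> cdom c" if "c \<in> charts Y" "y \<in> fibre (EE c) u" for c u y
    using vector_bundle_proj_in[OF vbE[OF that(1)] fibreD(1)[OF that(2)]] fibreD(2)[OF that(2)] by simp
  have k: "fibre_iso E (\<beta> c u) (EE c) u (\<lambda>e. K c (u, e))" if c: "c \<in> charts Y" and u: "u \<in> cdom c" for c u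
  proof -
    have "fibre_iso E (\<beta> c u) (E0 c) u (\<lambda>e. (u, e))"
      unfolding fibre_iso_def fibre_hom_def bij_betw_def by (auto simp: fib0[OF u] ops0 inj_on_def)
    moreover have "fibre_iso (E0 c) u (EE c) u (K c)" using isoK[OF c] u unfolding bundle_iso_def by simp
    ultimately show ?thesis by (rule fibre_iso_compose)
  qed
  have i: "fibre_iso (EE c) u E (\<beta> c u) (\<lambda>y. snd (J c y))" if c: "c \<in> charts Y" and u: "u \<in> cdom c" for c u
  proof -
    have "fibre_iso (EE c) u (E0 c) u (J c)" using inv(1)[OF c c c] u unfolding bundle_iso_def by simp
    moreover have "fibre_iso (E0 c) u E (\<beta> c u) snd"
      unfolding fibre_iso_def fibre_hom_def bij_betw_def by (auto simp: fib0[OF u] ops0 inj_on_def)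
    ultimately show ?thesis by (rule fibre_iso_compose)
  qed
  have fstJ: "fst (J c y) = u" if c: "c \<in> charts Y" and y: "y \<in> fibre (EE c) u" for c u y
  proof -
    have u: "u \<in> cdom c" by (rule over[OF c y])
    have "J c y \<in> fibre (E0 c) u"
      by (rule bundle_isoD(1)[OF inv(1)[OF c c c] _ y]) (simp add: u)
    then show ?thesis unfolding fib0[OF u] by auto
  qed
  have ik: "snd (J c (K c (u, e))) = e" if c: "c \<in> charts Y" and u: "u \<in> cdom c" and e: "e \<in> fibre E (\<beta> c u)" for c u e
    using JK[OF c, of "(u, e)"] fibreD[OF e] u unfolding tot0 by simp
  have ki: "K c (u, snd (J c y)) = y" if c: "c \<in> charts Y" and y: "y \<in> fibre (EE c) u" for c u y
    using KJ[OF c fibreD(1)[OF y]] fstJ[OF c y] by (metis prod.collapse)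
  \<comment> \<open>\<open>q c d l u\<close> rotates the image of the frame at \<open>u\<close> into the frame of the section at \<open>l u\<close>.\<close>
  define q where "q c d l u = trans_Q d (lift_frame l (frame_section c u)) (frame_section d (l u))" for c d :: "('n, 'y) chart" and l u
  have q: "q c d l u \<in> On" "rotate_frame (q c d l u) (lift_frame l (frame_section c u)) = frame_section d (l u)"
      "lift_frame l (frame_section c u) \<in> FC d" "u \<in> cdom c" "l u \<in> cdom d"
    if c: "c \<in> charts Y" and d: "d \<in> charts Y" and h: "h \<in> carrier H" and l: "local_lift h c d W l" and u: "u \<in> W" for c d h W l u
  proof -
    show uc: "u \<in> cdom c" and lu: "l u \<in> cdom d" using local_liftD(2,12)[OF l] u by auto
    show lf: "lift_frame l (frame_section c u) \<in> FC d"
      by (rule lift_frame_FC[OF isometry[OF h] c d l _ sec(1)[OF c uc]]) (simp add: sec(2)[OF c uc] u)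
    have "fst (lift_frame l (frame_section c u)) = fst (frame_section d (l u))" using sec(2)[OF c uc] sec(2)[OF d lu] by simp
    note t = trans_Q[OF d lf sec(1)[OF d lu] this]
    show "q c d l u \<in> On" "rotate_frame (q c d l u) (lift_frame l (frame_section c u)) = frame_section d (l u)"
      unfolding q_def using t by simp_all
  qed
  define A where "A x c W l d y = K d (l (fst (J c y)), \<rho> x (q c d l (fst (J c y))) (snd (J c y)))"
    for x and c d :: "('n, 'y) chart" and W :: "(real^'n) set" and l y
  have Ay: "A x c W l d y = K d (l u, \<rho> x (q c d l u) (snd (J c y)))" if "c \<in> charts Y" "y \<in> fibre (EE c) u" for x c d W l u y
    unfolding A_def fstJ[OF that] ..
  have xH: "snd x \<in> carrier H" if "x \<in> carrier X" for x using that ext_carrier by blast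
  have \<rho>q: "fibre_iso E (\<beta> c u) E (\<beta> d (l u)) (\<rho> x (q c d l u))"
    if x: "x \<in> carrier X" and c: "c \<in> charts Y" and d: "d \<in> charts Y" and l: "local_lift (snd x) c d W l" and u: "u \<in> W" for x c d W l u
  proof -
    note Q = q[OF c d xH[OF x] l u]
    have su: "fst (frame_section c u) \<in> W" using sec(2)[OF c Q(4)] u by simp
    have "lift_frame l (rotate_frame (q c d l u) (frame_section c u)) = frame_section d (l u)"
      using Q(2) rotate_lift[of "q c d l u" l "frame_section c u"] by simp
    then show ?thesis using frame_action_lift[OF fa x Q(1) c d l sec(1)[OF c Q(4)] su] unfolding \<beta>_def by simp
  qed
  have iso: "fibre_iso (EE c) u (EE d) (l u) (A x c W l d)"
    if x: "x \<in> carrier X" and c: "c \<in> charts Y" and d: "d \<in> charts Y" and l: "local_lift (snd x) c d W l" and u: "u \<in> W" for x c d W l u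
  proof -
    note Q = q[OF c d xH[OF x] l u]
    have "fibre_iso (EE c) u (EE d) (l u) (\<lambda>y. K d (l u, \<rho> x (q c d l u) (snd (J c y))))"
      by (rule fibre_iso_compose[OF fibre_iso_compose[OF i[OF c Q(4)] \<rho>q[OF x c d l u]] k[OF d Q(5)]])
    then show ?thesis by (rule fibre_iso_cong[OF _ _ vbE[OF c]]) (simp_all add: Ay[OF c] Q(4))
  qed
  have cont: "continuous_map (subtopology (vtot (EE c)) {e. vproj (EE c) e \<in> W}) (vtot (EE d)) (A x c W l d)"
    if x: "x \<in> carrier X" and c: "c \<in> charts Y" and d: "d \<in> charts Y" and l: "local_lift (snd x) c d W l" for x c d W l
  proof -
    let ?Z = "subtopology (vtot (EE c)) {e. vproj (EE c) e \<in> W}"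
    have Z: "fst (J c y) \<in> W" "fst (J c y) \<in> cdom c" "snd (J c y) \<in> fibre E (\<beta> c (fst (J c y)))" if "y \<in> topspace ?Z" for y
    proof -
      have y: "y \<in> fibre (EE c) (vproj (EE c) y)" "vproj (EE c) y \<in> W" using that by (auto intro: fibreI)
      show "fst (J c y) \<in> W" "fst (J c y) \<in> cdom c" using fstJ[OF c y(1)] y(2) over[OF c y(1)] by simp_all
      show "snd (J c y) \<in> fibre E (\<beta> c (fst (J c y)))"
        using fibre_iso_in[OF i[OF c over[OF c y(1)]] y(1)] fstJ[OF c y(1)] by simp
    qed
    have J0: "continuous_map ?Z (pullback_space (D c) (\<beta> c) (vtot E) (vproj E)) (J c)"
      using continuous_map_from_subtopology[OF cJ[OF c]] unfolding E0_def pullback_bundle_def by simp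
    note J1 = continuous_map_app[OF J0 continuous_map_pullback_fst] and J2 = continuous_map_app[OF J0 continuous_map_pullback_snd]
    have lu: "continuous_map ?Z (D d) (\<lambda>y. l (fst (J c y)))"
    proof (rule continuous_map_into_subtopology)
      show "continuous_map ?Z euclidean (\<lambda>y. l (fst (J c y)))"
        by (rule continuous_map_into_euclidean_compose[OF continuous_map_into_fulltopology[OF J1] _ smooth_on_imp_continuous_on[OF local_liftD(6)[OF l]]])
          (simp add: Pi_iff Z(1)[unfolded topspace_subtopology])
      show "(\<lambda>y. l (fst (J c y))) \<in> topspace ?Z \<rightarrow> cdom d" by (rule Pi_I, rule local_liftD(12)[OF l Z(1)])
    qed
    have s1: "continuous_map ?Z (FT d) (\<lambda>y. lift_frame l (frame_section c (fst (J c y))))"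
      by (rule continuous_map_lift_frame[OF xH[OF x] c d l continuous_map_section[OF c J1]]) (simp only: frame_section(3)[OF c] Z(1))
    have cq: "continuous_map ?Z (top_of_set On) (\<lambda>y. q c d l (fst (J c y)))"
      unfolding q_def by (rule continuous_map_trans_Q[OF d s1 continuous_map_section[OF d lu]])
        (simp only: fst_lift_frame frame_section(3)[OF c] frame_section(3)[OF d])
    from continuous_map_app[OF continuous_map_pairedI[OF cq J2] F(2)[OF x]]
    have r: "continuous_map ?Z (vtot E) (\<lambda>y. \<rho> x (q c d l (fst (J c y))) (snd (J c y)))" by simp
    have pr: "\<beta> d (l (fst (J c y))) = vproj E (\<rho> x (q c d l (fst (J c y))) (snd (J c y)))" if "y \<in> topspace ?Z" for y
      using fibreD(2)[OF fibre_iso_in[OF \<rho>q[OF x c d l Z(1)[OF that]] Z(3)[OF that]]] by simp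
    have "continuous_map ?Z (vtot (E0 d)) (\<lambda>y. (l (fst (J c y)), \<rho> x (q c d l (fst (J c y))) (snd (J c y))))"
      unfolding E0_def pullback_bundle_def vbundle.simps by (rule continuous_map_into_pullback[OF lu r]) (rule pr)
    from continuous_map_app[OF this cK[OF d]] show ?thesis unfolding A_def .
  qed
  have Aim: "A x c W l d y \<in> fibre (EE d) (l u)" "snd (J d (A x c W l d y)) = \<rho> x (q c d l u) (snd (J c y))"
      "snd (J c y) \<in> fibre E (\<beta> c u)" "\<rho> x (q c d l u) (snd (J c y)) \<in> fibre E (\<beta> d (l u))"
    if x: "x \<in> carrier X" and c: "c \<in> charts Y" and d: "d \<in> charts Y" and l: "local_lift (snd x) c d W l" and u: "u \<in> W"
      and y: "y \<in> fibre (EE c) u" for x c d W l u y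
  proof -
    note Q = q[OF c d xH[OF x] l u]
    show "A x c W l d y \<in> fibre (EE d) (l u)" by (rule fibre_iso_in[OF iso[OF x c d l u] y])
    show 1: "snd (J c y) \<in> fibre E (\<beta> c u)" by (rule fibre_iso_in[OF i[OF c Q(4)] y])
    show 2: "\<rho> x (q c d l u) (snd (J c y)) \<in> fibre E (\<beta> d (l u))" by (rule fibre_iso_in[OF \<rho>q[OF x c d l u] 1])
    show "snd (J d (A x c W l d y)) = \<rho> x (q c d l u) (snd (J c y))" unfolding Ay[OF c y] by (rule ik[OF d Q(5) 2])
  qed
  have comp: "A x c V m d (A y b W l c e) = A (x \<otimes>\<^bsub>X\<^esub> y) b W (compose W m l) d e"
    if x: "x \<in> carrier X" and y: "y \<in> carrier X" and b: "b \<in> charts Y" and c: "c \<in> charts Y" and d: "d \<in> charts Y"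
      and l: "local_lift (snd y) b c W l" and m: "local_lift (snd x) c d V m" and sub: "l ` W \<subseteq> V" and u: "u \<in> W" and e: "e \<in> fibre (EE b) u"
    for x y b c d W l V m u e
  proof -
    have luV: "l u \<in> V" using sub u by blast
    note Q1 = q[OF b c xH[OF y] l u] and Q2 = q[OF c d xH[OF x] m luV]
    note A1 = Aim[OF y b c l u e]
    have xy: "x \<otimes>\<^bsub>X\<^esub> y \<in> carrier X" by (rule ext_mult_closed[OF x y])
    have ml: "local_lift (snd (x \<otimes>\<^bsub>X\<^esub> y)) b d W (compose W m l)"
    proof -
      have "local_lift (\<lambda>z. snd x (snd y z)) b d W (compose W m l)" by (rule local_lift_compose[OF l m sub])
      moreover have "snd (x \<otimes>\<^bsub>X\<^esub> y) (cmap b v) = snd x (snd y (cmap b v))" if "v \<in> cdom b" for v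
        unfolding snd_mult by (rule mult_app[OF xH[OF x] xH[OF y] chartD(2)[OF b that]])
      ultimately show ?thesis using local_lift_cong[of b "snd (x \<otimes>\<^bsub>X\<^esub> y)" "\<lambda>z. snd x (snd y z)"] by blast
    qed
    note Q3 = q[OF b d xH[OF xy] ml u]
    have cu: "compose W m l u = m (l u)" using u by (simp add: compose_def)
    have su: "fst (frame_section b u) \<in> W" using sec(2)[OF b Q1(4)] u by simp
    \<comment> \<open>Rotations act freely on frames, so the cocycle identity for \<open>q\<close> can be tested on one frame.\<close>
    have qq: "q b d (compose W m l) u = q c d m (l u) ** q b c l u"
    proof (rule rotate_cancel[OF d Q3(3)])
      have "rotate_frame (q c d m (l u) ** q b c l u) (lift_frame (compose W m l) (frame_section b u))
          = rotate_frame (q c d m (l u)) (lift_frame m (rotate_frame (q b c l u) (lift_frame l (frame_section b u))))"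
        unfolding lift_frame_composite[OF l m sub su] rotate_rotate[symmetric] rotate_lift ..
      also have "\<dots> = frame_section d (m (l u))" unfolding Q1(2) Q2(2) ..
      finally show "rotate_frame (q b d (compose W m l) u) (lift_frame (compose W m l) (frame_section b u)) =
          rotate_frame (q c d m (l u) ** q b c l u) (lift_frame (compose W m l) (frame_section b u))"
        unfolding Q3(2) cu by simp
    qed
    have AA: "A (x \<otimes>\<^bsub>X\<^esub> y) b W (compose W m l) d e =
        K d (compose W m l u, \<rho> (x \<otimes>\<^bsub>X\<^esub> y) (q b d (compose W m l) u) (snd (J b e)))" by (rule Ay[OF b e])
    show ?thesis
      unfolding AA cu qq F(4)[OF y x Q1(1) Q2(1) fibreD(1)[OF A1(3)], symmetric] A1(2)[symmetric]
      by (rule Ay[OF c A1(1)])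
  qed
  have centr: "A (central H a z) c W l d e = vscl (EE d) z (A \<epsilon> c W l d e)"
    if z: "norm z = 1" and c: "c \<in> charts Y" and d: "d \<in> charts Y" and l: "local_lift (snd \<epsilon>) c d W l" and u: "u \<in> W"
      and e: "e \<in> fibre (EE c) u" for z c d W l u e
  proof -
    note Q = q[OF c d xH[OF ext_one_closed] l u] and A1 = Aim[OF ext_one_closed c d l u e]
    have "central H a z = (z * fst \<epsilon>, snd \<epsilon>)"
      using central_mult[OF ext_one_closed, of z] ext_one_mult(2)[OF central_closed[OF z]] by simp
    then have "\<rho> (central H a z) (q c d l u) (snd (J c e)) = vscl E z (\<rho> \<epsilon> (q c d l u) (snd (J c e)))"
      using F(5)[OF ext_one_closed z Q(1) fibreD(1)[OF A1(3)]] by simp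
    then show ?thesis unfolding Ay[OF c e] using fibre_homD(3)[OF fibre_isoD(1)[OF k[OF d Q(5)]] A1(4)] by simp
  qed
  have tw: "torbibundle (\<lparr>obun = EE, otrans = A \<epsilon>\<rparr>, A)"
    by (rule twisted_orbibundleI[OF vbE cont iso comp centr])
  define \<theta> where "\<theta> c p y = \<rho> \<epsilon> (trans_Q c (frame_section c (fst p)) p) (snd (J c y))" for c p y
  define \<psi> where "\<psi> c p e = K c (fst p, \<rho> \<epsilon> (trans_Q c p (frame_section c (fst p))) e)" for c p e
  have t: "trans_Q c (frame_section c (fst p)) p \<in> On" "rotate_frame (trans_Q c (frame_section c (fst p)) p) (frame_section c (fst p)) = p"
      "trans_Q c p (frame_section c (fst p)) \<in> On" "rotate_frame (trans_Q c p (frame_section c (fst p))) p = frame_section c (fst p)"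
      "fst p \<in> cdom c" "frame_section c (fst p) \<in> FC c"
    if c: "c \<in> charts Y" and p: "p \<in> FC c" for c p
  proof -
    show u: "fst p \<in> cdom c" by (rule FC_D(1)[OF p])
    note s = sec[OF c u]
    show "frame_section c (fst p) \<in> FC c" by (rule s(1))
    show "trans_Q c (frame_section c (fst p)) p \<in> On" "rotate_frame (trans_Q c (frame_section c (fst p)) p) (frame_section c (fst p)) = p"
      using trans_Q[OF c s(1) p s(2)] by simp_all
    show "trans_Q c p (frame_section c (fst p)) \<in> On" "rotate_frame (trans_Q c p (frame_section c (fst p))) p = frame_section c (fst p)"
      using trans_Q[OF c p s(1) s(2)[symmetric]] by simp_all
  qed
  have r1: "fibre_iso E (\<beta> c (fst p)) E (cls c p) (\<rho> \<epsilon> (trans_Q c (frame_section c (fst p)) p))"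
    and r2: "fibre_iso E (cls c p) E (\<beta> c (fst p)) (\<rho> \<epsilon> (trans_Q c p (frame_section c (fst p))))"
    if c: "c \<in> charts Y" and p: "p \<in> FC c" for c p
    using frame_action_rotate[OF fa t(1)[OF c p] c t(6)[OF c p]] frame_action_rotate[OF fa t(3)[OF c p] c p]
    unfolding \<beta>_def t(2)[OF c p] t(4)[OF c p] by simp_all
  have th: "fibre_hom (EE c) (fst p) E (cls c p) (\<theta> c p)" if c: "c \<in> charts Y" and p: "p \<in> FC c" for c p
    unfolding \<theta>_def by (rule fibre_isoD(1)[OF fibre_iso_compose[OF i[OF c t(5)[OF c p]] r1[OF c p]]])
  have ph: "fibre_hom E (cls c p) (EE c) (fst p) (\<psi> c p)" if c: "c \<in> charts Y" and p: "p \<in> FC c" for c p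
    unfolding \<psi>_def by (rule fibre_isoD(1)[OF fibre_iso_compose[OF r2[OF c p] k[OF c t(5)[OF c p]]]])
  have ts: "trans_Q c p (frame_section c (fst p)) ** trans_Q c (frame_section c (fst p)) p = mat 1"
      "trans_Q c (frame_section c (fst p)) p ** trans_Q c p (frame_section c (fst p)) = mat 1"
    if c: "c \<in> charts Y" and p: "p \<in> FC c" for c p
  proof -
    show "trans_Q c p (frame_section c (fst p)) ** trans_Q c (frame_section c (fst p)) p = mat 1"
      by (rule rotate_cancel[OF c t(6)[OF c p]]) (simp add: rotate_rotate[symmetric] t(2,4)[OF c p])
    show "trans_Q c (frame_section c (fst p)) p ** trans_Q c p (frame_section c (fst p)) = mat 1"
      by (rule rotate_cancel[OF c p]) (simp add: rotate_rotate[symmetric] t(2,4)[OF c p])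
  qed
  have \<psi>\<theta>: "\<psi> c p (\<theta> c p y) = y" if c: "c \<in> charts Y" and p: "p \<in> FC c" and y: "y \<in> fibre (EE c) (fst p)" for c p y
  proof -
    have e: "snd (J c y) \<in> fibre E (\<beta> c (fst p))" by (rule fibre_iso_in[OF i[OF c t(5)[OF c p]] y])
    have "\<psi> c p (\<theta> c p y) = K c (fst p, \<rho> \<epsilon> (mat 1) (snd (J c y)))"
      unfolding \<psi>_def \<theta>_def F(4)[OF ext_one_closed ext_one_closed t(1,3)[OF c p] fibreD(1)[OF e]] ts(1)[OF c p] ext_one_mult(1)[OF ext_one_closed] ..
    also have "\<rho> \<epsilon> (mat 1) (snd (J c y)) = snd (J c y)" by (rule frame_action_unit[OF fa e[unfolded \<beta>_def] c t(6)[OF c p]])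
    finally show ?thesis using ki[OF c y] by simp
  qed
  have \<theta>\<psi>: "\<theta> c p (\<psi> c p e) = e" if c: "c \<in> charts Y" and p: "p \<in> FC c" and e: "e \<in> fibre E (cls c p)" for c p e
  proof -
    have m: "\<rho> \<epsilon> (trans_Q c p (frame_section c (fst p))) e \<in> fibre E (\<beta> c (fst p))" by (rule fibre_iso_in[OF r2[OF c p] e])
    have "\<theta> c p (\<psi> c p e) = \<rho> \<epsilon> (mat 1) e"
      unfolding \<psi>_def \<theta>_def ik[OF c t(5)[OF c p] m] F(4)[OF ext_one_closed ext_one_closed t(3,1)[OF c p] fibreD(1)[OF e]]
        ts(2)[OF c p] ext_one_mult(1)[OF ext_one_closed] ..
    also have "\<dots> = e" by (rule frame_action_unit[OF fa e c p])
    finally show ?thesis .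
  qed
  have oc: "over_comparison (vtot E) (vproj E) (St EE) (Sp EE) \<theta> \<psi>"
    unfolding over_comparison_def
  proof (intro conjI ballI impI)
    show "continuous_map (vtot E) P (vproj E)" by (rule vector_bundle_proj[OF vb])
    fix c assume c: "c \<in> charts Y"
    show "continuous_map (vtot (EE c)) (D c) (vproj (EE c))" by (rule vector_bundle_proj[OF vbE[OF c]])
    let ?Z = "pullback_space (FT c) fst (vtot (EE c)) (vproj (EE c))"
    have fz: "continuous_map Z (D c) (\<lambda>y. fst (g y))" if g: "continuous_map Z (FT c) g" for Z and g :: "'z \<Rightarrow> _"
    proof (rule continuous_map_into_subtopology[OF continuous_map_euclidean_fst[OF continuous_map_into_fulltopology[OF g]]], rule Pi_I)
      show "fst (g y) \<in> cdom c" if "y \<in> topspace Z" for y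
        using continuous_map_image_subset_topspace[OF g] that by (auto intro: FC_D(1))
    qed
    note Z1 = continuous_map_pullback_fst[of "FT c" fst "vtot (EE c)" "vproj (EE c)"]
    have J0: "continuous_map ?Z (pullback_space (D c) (\<beta> c) (vtot E) (vproj E)) (\<lambda>y. J c (snd y))"
      using continuous_map_app[OF continuous_map_pullback_snd cJ[OF c]] unfolding E0_def pullback_bundle_def by simp
    have "continuous_map ?Z (top_of_set On) (\<lambda>y. trans_Q c (frame_section c (fst (fst y))) (fst y))"
      by (rule continuous_map_trans_Q[OF c continuous_map_section[OF c fz[OF Z1]] Z1]) (rule frame_section(3)[OF c])
    from continuous_map_app[OF continuous_map_pairedI[OF this continuous_map_app[OF J0 continuous_map_pullback_snd]] F(2)[OF ext_one_closed]]
    show "continuous_map ?Z (vtot E) (\<lambda>y. \<theta> c (fst y) (snd y))" unfolding \<theta>_def by simp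
    let ?V = "pullback_space (FT c) (frame_class Y c) (vtot E) (vproj E)"
    note V1 = continuous_map_pullback_fst[of "FT c" "frame_class Y c" "vtot E" "vproj E"]
    have "continuous_map ?V (top_of_set On) (\<lambda>y. trans_Q c (fst y) (frame_section c (fst (fst y))))"
      by (rule continuous_map_trans_Q[OF c V1 continuous_map_section[OF c fz[OF V1]]]) (rule frame_section(3)[OF c, symmetric])
    from continuous_map_app[OF continuous_map_pairedI[OF this continuous_map_pullback_snd] F(2)[OF ext_one_closed]]
    have r: "continuous_map ?V (vtot E) (\<lambda>y. \<rho> \<epsilon> (trans_Q c (fst y) (frame_section c (fst (fst y)))) (snd y))" by simp
    have pr: "\<beta> c (fst (fst y)) = vproj E (\<rho> \<epsilon> (trans_Q c (fst y) (frame_section c (fst (fst y)))) (snd y))" if "y \<in> topspace ?V" for y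
    proof -
      have "fst y \<in> FC c" "snd y \<in> fibre E (cls c (fst y))" using that unfolding topspace_pullback_space by (auto intro: fibreI)
      from fibreD(2)[OF fibre_iso_in[OF r2[OF c this(1)] this(2)]] show ?thesis by simp
    qed
    have "continuous_map ?V (vtot (E0 c)) (\<lambda>y. (fst (fst y), \<rho> \<epsilon> (trans_Q c (fst y) (frame_section c (fst (fst y)))) (snd y)))"
      unfolding E0_def pullback_bundle_def vbundle.simps by (rule continuous_map_into_pullback[OF fz[OF V1] r]) (rule pr)
    from continuous_map_app[OF this cK[OF c]] show "continuous_map ?V (vtot (EE c)) (\<lambda>y. \<psi> c (fst y) (snd y))" unfolding \<psi>_def .
    fix p assume p: "p \<in> FC c"
    show "vproj E (\<theta> c p e) = cls c p" "\<psi> c p (\<theta> c p e) = e" if "e \<in> tot (EE c)" "vproj (EE c) e = fst p" for e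
      using fibreD(2)[OF fibre_homD(1)[OF th[OF c p] fibreI[OF that]]] \<psi>\<theta>[OF c p fibreI[OF that]] by simp_all
    show "vproj (EE c) (\<psi> c p e) = fst p" "\<theta> c p (\<psi> c p e) = e" if "e \<in> tot E" "vproj E e = cls c p" for e
      using fibreD(2)[OF fibre_homD(1)[OF ph[OF c p] fibreI[OF that]]] \<theta>\<psi>[OF c p fibreI[OF that]] by simp_all
  qed
  have compat: "\<theta> d (lift_frame l (rotate_frame Q p)) (A x c W l d e) = \<rho> x Q (\<theta> c p e)"
    if x: "x \<in> carrier X" and Q: "Q \<in> On" and c: "c \<in> charts Y" and d: "d \<in> charts Y" and l: "local_lift (snd x) c d W l"
      and p: "p \<in> FC c" "fst p \<in> W" and e: "e \<in> fibre (EE c) (fst p)" for x Q c d W l p e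
  proof -
    note q1 = q[OF c d xH[OF x] l p(2)] and A1 = Aim[OF x c d l p(2) e]
    let ?p' = "lift_frame l (rotate_frame Q p)"
    have rp: "rotate_frame Q p \<in> FC c" using rotate_FC[OF p(1)] Q by simp
    have p': "?p' \<in> FC d" by (rule lift_frame_FC[OF isometry[OF xH[OF x]] c d l _ rp]) (simp add: p(2))
    have fp': "fst ?p' = l (fst p)" by simp
    note t2 = t[OF d p', unfolded fp'] and t1 = t[OF c p(1)]
    have "\<theta> d ?p' (A x c W l d e) = \<rho> \<epsilon> (trans_Q d (frame_section d (l (fst p))) ?p') (\<rho> x (q c d l (fst p)) (snd (J c e)))"
      unfolding \<theta>_def A1(2) fp' ..
    also have "\<dots> = \<rho> x (trans_Q d (frame_section d (l (fst p))) ?p' ** q c d l (fst p)) (snd (J c e))"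
      unfolding F(4)[OF x ext_one_closed q1(1) t2(1) fibreD(1)[OF A1(3)]] ext_one_mult(1)[OF x] ..
    also have "trans_Q d (frame_section d (l (fst p))) ?p' ** q c d l (fst p) = Q ** trans_Q c (frame_section c (fst p)) p"
    proof (rule rotate_cancel[OF d q1(3)])
      show "rotate_frame (trans_Q d (frame_section d (l (fst p))) ?p' ** q c d l (fst p)) (lift_frame l (frame_section c (fst p)))
        = rotate_frame (Q ** trans_Q c (frame_section c (fst p)) p) (lift_frame l (frame_section c (fst p)))"
        unfolding rotate_rotate[symmetric] q1(2) t2(2) unfolding rotate_lift t1(2) ..
    qed
    also have "\<rho> x (Q ** trans_Q c (frame_section c (fst p)) p) (snd (J c e)) = \<rho> x Q (\<theta> c p e)"
      unfolding \<theta>_def F(4)[OF ext_one_closed x t1(1) Q fibreD(1)[OF A1(3)]] ext_one_mult(2)[OF x] ..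
    finally show ?thesis .
  qed
  have "comparison E \<rho> EE A \<theta> \<psi>"
    unfolding comparison_def by (intro conjI oc ballI allI impI th compat)
  then have "corresponds (E, act) (\<lparr>obun = EE, otrans = A \<epsilon>\<rparr>, A)"
    unfolding corresponds_def split_conv orbibundle.simps \<rho>_def by blast
  then show ?thesis using tw by blast
qed

end

section \<open>Transfer in an orbibundle along jets\<close>

locale orbibundle_action = twisted_action Y \<mu> H a
  for Y :: "('n::finite, 'y) orbifold" and \<mu> :: "('n, 'y) metric" and H :: "('y \<Rightarrow> 'y, 'm) monoid_scheme"
    and a :: "('y \<Rightarrow> 'y) \<times> ('y \<Rightarrow> 'y) \<Rightarrow> complex" +
  fixes O1 :: "('n, 'y, 'e) orbibundle" and A :: "complex \<times> ('y \<Rightarrow> 'y) \<Rightarrow> ('n, 'y, 'e) lift_family"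
  assumes tw: "twisted_orbibundle Y H a (O1, A)"
begin

interpretation H: group H by (rule H)

abbreviation "Ob c \<equiv> obun O1 c"

lemmas T = twisted_orbibundleD[OF tw]

lemma snd_in: "x \<in> carrier X \<Longrightarrow> snd x \<in> carrier H"
  unfolding ext_carrier by blast

text \<open>A lift of a given automorphism is determined near \<open>u\<close> by its 1-jet at \<open>u\<close>, and the action of a lift
  does not change when the lift is restricted.\<close>

lemma action_by_jet:
  assumes x: "x \<in> carrier X" and c: "c \<in> charts Y" and d: "d \<in> charts Y"
    and l: "local_lift (snd x) c d W l" and l': "local_lift (snd x) c d W' l'" and u: "u \<in> W" "u \<in> W'"
    and eq: "l u = l' u" "jac l u = jac l' u" and e: "e \<in> fibre (Ob c) u"
  shows "A x c W l d e = A x c W' l' d e"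
proof -
  have h: "inj_on (snd x) (cmap c ` cdom c)"
    by (rule inj_on_subset[OF bij_betw_imp_inj_on[OF orbifold_automorphism_inverse(2)[OF Y automorphism[OF snd_in[OF x]]]]])
      (use chartD(2)[OF c] in blast)
  obtain U where U: "open U" "u \<in> U" "U \<subseteq> W" "U \<subseteq> W'" "\<forall>x\<in>U. l x = l' x"
    using local_lift_jet[OF chartD(1)[OF c] h l l' u eq] by blast
  have Uc: "U \<subseteq> cdom c" using U(3) local_liftD(2)[OF l] by blast
  have li: "local_lift (snd \<epsilon>) c c U (restrict id U)" using local_lift_id[OF U(1) Uc] one_lift[OF c] by simp
  have im: "restrict id U ` U \<subseteq> W" "restrict id U ` U \<subseteq> W'" using U(3,4) by auto
  have cl: "compose U l (restrict id U) = compose U l' (restrict id U)" using U(5) by (auto simp: compose_def fun_eq_iff)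
  have "A x c W l d (A \<epsilon> c U (restrict id U) c e) = A x c W' l' d (A \<epsilon> c U (restrict id U) c e)"
    unfolding T(4)[OF x ext_one_closed c c d li l im(1) U(2) e] T(4)[OF x ext_one_closed c c d li l' im(2) U(2) e] cl ..
  then show ?thesis unfolding restricted_identity_acts_trivially[OF tw c U(1) Uc U(2) e] .
qed

text \<open>The action of \<open>x\<close> from the fibre at the frame \<open>p\<close> to the fibre at the frame \<open>q\<close>, along any lift
  that carries \<open>p\<close> to \<open>q\<close>.  Two such lifts have the same 1-jet, since frames are invertible.\<close>

definition transfer where
  "transfer x c p d q e = (SOME e'. \<exists>W l. local_lift (snd x) c d W l \<and> fst p \<in> W \<and> q = lift_frame l p \<and> e' = A x c W l d e)"

lemma lift_frame_jet:
  assumes c: "c \<in> charts Y" and p: "p \<in> FC c" and eq: "lift_frame l p = lift_frame l' p"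
  shows "l (fst p) = l' (fst p)" "jac l (fst p) = jac l' (fst p)"
proof -
  show "l (fst p) = l' (fst p)" using eq by (metis fst_lift_frame)
  have "jac l (fst p) ** snd p = jac l' (fst p) ** snd p" using eq unfolding lift_frame_def by (simp add: case_prod_unfold)
  moreover obtain B where "snd p ** B = mat 1" using FC_invertible[OF c p] unfolding invertible_def by blast
  ultimately show "jac l (fst p) = jac l' (fst p)" by (metis matrix_mul_assoc matrix_mul_rid)
qed

lemma transfer_eq:
  assumes x: "x \<in> carrier X" and c: "c \<in> charts Y" and d: "d \<in> charts Y" and l: "local_lift (snd x) c d W l"
    and p: "p \<in> FC c" "fst p \<in> W" and e: "e \<in> fibre (Ob c) (fst p)"
  shows "transfer x c p d (lift_frame l p) e = A x c W l d e"
  unfolding transfer_def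
proof (rule some_equality)
  show "\<exists>W' l'. local_lift (snd x) c d W' l' \<and> fst p \<in> W' \<and> lift_frame l p = lift_frame l' p \<and> A x c W l d e = A x c W' l' d e"
    by (intro exI conjI, rule l, rule p(2), rule refl, rule refl)
  fix e' assume "\<exists>W' l'. local_lift (snd x) c d W' l' \<and> fst p \<in> W' \<and> lift_frame l p = lift_frame l' p \<and> e' = A x c W' l' d e"
  then obtain W' l' where l': "local_lift (snd x) c d W' l'" "fst p \<in> W'" "lift_frame l p = lift_frame l' p" "e' = A x c W' l' d e"
    by (elim exE conjE) (rule that)
  show "e' = A x c W l d e" unfolding l'(4)
    by (rule action_by_jet[OF x c d l'(1) l l'(2) p(2) lift_frame_jet[OF c p(1) l'(3)[symmetric]] e])
qed

lemma transfer_iso: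
  assumes x: "x \<in> carrier X" and st: "step (snd x) c p d q" and p: "p \<in> FC c"
  shows "fibre_iso (Ob c) (fst p) (Ob d) (fst q) (transfer x c p d q)"
proof -
  obtain W l where l: "c \<in> charts Y" "d \<in> charts Y" "local_lift (snd x) c d W l" "fst p \<in> W" "q = lift_frame l p"
    using st by (rule jet_stepE)
  have "fst p \<in> topspace (D c)" using FC_D(1)[OF p] by simp
  from fibre_iso_cong[OF T(3)[OF x l(1,2,3,4)] transfer_eq[OF x l(1-3) p l(4), symmetric] T(1)[OF l(1)] this]
  show ?thesis unfolding l(5) by simp
qed

text \<open>Composition of lifts requires that the image of the first lies in the domain of the second, which
  is achieved by shrinking the domain of the first.\<close>

lemma transfer_compose:
  assumes x: "x \<in> carrier X" and y: "y \<in> carrier X" and st: "step (snd x) b p c q" "step (snd y) c q d r"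
    and p: "p \<in> FC b" and e: "e \<in> fibre (Ob b) (fst p)"
  shows "transfer y c q d r (transfer x b p c q e) = transfer (y \<otimes>\<^bsub>X\<^esub> x) b p d r e"
proof -
  obtain W l where l: "b \<in> charts Y" "c \<in> charts Y" "local_lift (snd x) b c W l" "fst p \<in> W" "q = lift_frame l p"
    using st(1) by (rule jet_stepE)
  obtain V m where m: "d \<in> charts Y" "local_lift (snd y) c d V m" "fst q \<in> V" "r = lift_frame m q"
    using st(2) by (rule jet_stepE)
  have lp: "l (fst p) \<in> V" using m(3) l(5) by simp
  obtain W' where W': "open W'" "W' \<subseteq> W" "l ` W' \<subseteq> V" "fst p \<in> W'" "local_lift (snd x) b c W' (restrict l W')"
    "local_lift (\<lambda>z. snd y (snd x z)) b d W' (compose W' m l)" "lift_frame (compose W' m l) p = lift_frame m (lift_frame l p)"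
    by (rule lift_frame_compose[OF l(3) m(2) l(4) lp])
  have q: "q \<in> FC c" by (rule step_FC[OF snd_in[OF x] st(1) p])
  have "der (restrict l W') (fst p) = der l (fst p)" by (rule der_cong[OF W'(1,4)]) simp
  then have lr: "lift_frame (restrict l W') p = q" unfolding l(5) lift_frame_def using W'(4) by (simp add: case_prod_unfold)
  note te = transfer_eq[OF x l(1,2) W'(5) p W'(4) e, unfolded lr]
  have e': "A x b W' (restrict l W') c e \<in> fibre (Ob c) (fst q)"
    using fibre_iso_in[OF transfer_iso[OF x st(1) p] e] unfolding te .
  have ml: "local_lift (snd (y \<otimes>\<^bsub>X\<^esub> x)) b d W' (compose W' m l)"
  proof -
    have "snd (y \<otimes>\<^bsub>X\<^esub> x) (cmap b v) = snd y (snd x (cmap b v))" if "v \<in> cdom b" for v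
      unfolding snd_mult by (rule mult_app[OF snd_in[OF y] snd_in[OF x] chartD(2)[OF l(1) that]])
    then show ?thesis using W'(6) local_lift_cong[of b "snd (y \<otimes>\<^bsub>X\<^esub> x)" "\<lambda>z. snd y (snd x z)"] by blast
  qed
  have cr: "compose W' m (restrict l W') = compose W' m l" by (auto simp: compose_def)
  have im: "restrict l W' ` W' \<subseteq> V" using W'(3) by simp
  have "transfer y c q d r (transfer x b p c q e) = A y c V m d (A x b W' (restrict l W') c e)"
    unfolding te m(4) by (rule transfer_eq[OF y l(2) m(1,2) q m(3) e'])
  also have "\<dots> = A (y \<otimes>\<^bsub>X\<^esub> x) b W' (compose W' m l) d e"
    unfolding T(4)[OF y x l(1,2) m(1) W'(5) m(2) im W'(4) e] cr ..
  also have "\<dots> = transfer (y \<otimes>\<^bsub>X\<^esub> x) b p d (lift_frame (compose W' m l) p) e"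
    by (rule transfer_eq[OF ext_mult_closed[OF y x] l(1) m(1) ml p W'(4) e, symmetric])
  also have "lift_frame (compose W' m l) p = r" unfolding W'(7) m(4) l(5) ..
  finally show ?thesis .
qed

lemma transfer_refl:
  assumes c: "c \<in> charts Y" and p: "p \<in> FC c" and e: "e \<in> fibre (Ob c) (fst p)"
  shows "transfer \<epsilon> c p c p e = e"
  using transfer_eq[OF ext_one_closed c c identity_lift[OF c] p FC_D(1)[OF p] e] lift_frame_identity[OF c FC_D(1)[OF p]]
    restricted_identity_acts_trivially[OF tw c chartD(5)[OF c] order_refl FC_D(1)[OF p] e] by simp

lemma rotate_inj:
  assumes "Q \<in> On" "rotate_frame Q p = rotate_frame Q q"
  shows "p = q"
proof -
  have "transpose Q ** Q = mat 1" using assms(1) unfolding orthogonal_matrix_def by simp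
  then show ?thesis using arg_cong[OF assms(2), of "rotate_frame (transpose Q)"] unfolding rotate_rotate by simp
qed

lemma transfer_rotate:
  assumes "Q \<in> On"
  shows "transfer x c (rotate_frame Q p) d (rotate_frame Q q) e = transfer x c p d q e"
proof -
  have "rotate_frame Q q = lift_frame l (rotate_frame Q p) \<longleftrightarrow> q = lift_frame l p" for l
    unfolding rotate_lift[symmetric] using rotate_inj[OF assms] by metis
  then show ?thesis unfolding transfer_def by simp
qed

lemma transfer_central:
  assumes x: "x \<in> carrier X" and z: "norm z = 1" and st: "step (snd x) c p d q" and p: "p \<in> FC c" and e: "e \<in> fibre (Ob c) (fst p)"
  shows "transfer (z * fst x, snd x) c p d q e = vscl (Ob d) z (transfer x c p d q e)"
proof -
  have d: "d \<in> charts Y" using jet_step_charts[OF st] by blast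
  have q: "q \<in> FC d" by (rule step_FC[OF snd_in[OF x] st p])
  note g = fibre_iso_in[OF transfer_iso[OF x st p] e]
  note qd = FC_D(1)[OF q]
  have cz: "snd (central H a z) = snd \<epsilon>" unfolding central_def by simp
  note il = identity_lift[OF d]
  have il': "local_lift (\<lambda>y. y) d d (cdom d) (restrict id (cdom d))" by (rule local_lift_id[OF chartD(5)[OF d] order_refl])
  have st1: "step (snd (central H a z)) d q d q" unfolding cz snd_one by (rule step_refl[OF d q])
  have "transfer (central H a z \<otimes>\<^bsub>X\<^esub> x) c p d q e = transfer (central H a z) d q d q (transfer x c p d q e)"
    by (rule transfer_compose[OF x central_closed[OF z] st st1 p e, symmetric])
  also have "\<dots> = A (central H a z) d (cdom d) (restrict id (cdom d)) d (transfer x c p d q e)"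
    using transfer_eq[OF central_closed[OF z] d d il[folded cz] q qd g] unfolding lift_frame_identity[OF d qd] .
  also have "\<dots> = vscl (Ob d) z (A \<epsilon> d (cdom d) (restrict id (cdom d)) d (transfer x c p d q e))"
    unfolding T(5)[OF z d d il' qd g] T(6)[OF d d il' qd g] ..
  also have "A \<epsilon> d (cdom d) (restrict id (cdom d)) d (transfer x c p d q e) = transfer x c p d q e"
    by (rule restricted_identity_acts_trivially[OF tw d chartD(5)[OF d] order_refl qd g])
  finally show ?thesis unfolding central_mult[OF x] .
qed

section \<open>The bundle over the frame bundle\<close>

definition rep :: "('n, 'y) frame \<Rightarrow> ('n, 'y) chart \<times> (real^'n) \<times> (real^'n^'n)" where
  "rep \<xi> = (SOME t. fst t \<in> charts Y \<and> snd t \<in> FC (fst t) \<and> \<xi> = cls (fst t) (snd t))"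

abbreviation "rc \<xi> \<equiv> fst (rep \<xi>)"
abbreviation "rp \<xi> \<equiv> snd (rep \<xi>)"
abbreviation "F \<xi> \<equiv> fibre (Ob (rc \<xi>)) (fst (rp \<xi>))"

lemma rep:
  assumes "\<xi> \<in> topspace P"
  shows "rc \<xi> \<in> charts Y" "rp \<xi> \<in> FC (rc \<xi>)" "cls (rc \<xi>) (rp \<xi>) = \<xi>"
proof -
  obtain c p where "c \<in> charts Y" "p \<in> FC c" "\<xi> = cls c p" using assms by (rule frame_bundleE)
  then have "fst (c, p) \<in> charts Y \<and> snd (c, p) \<in> FC (fst (c, p)) \<and> \<xi> = cls (fst (c, p)) (snd (c, p))" by simp
  from someI[of "\<lambda>t. fst t \<in> charts Y \<and> snd t \<in> FC (fst t) \<and> \<xi> = cls (fst t) (snd t)", OF this]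
  show "rc \<xi> \<in> charts Y" "rp \<xi> \<in> FC (rc \<xi>)" "cls (rc \<xi>) (rp \<xi>) = \<xi>" unfolding rep_def by simp_all
qed

lemma step_rep:
  assumes "c \<in> charts Y" "p \<in> FC c"
  shows "step (snd \<epsilon>) c p (rc (cls c p)) (rp (cls c p))" "step (snd \<epsilon>) (rc (cls c p)) (rp (cls c p)) c p"
  using rep[OF cls_in[OF assms]] cls_eq_iff[OF assms rep(1,2)[OF cls_in[OF assms]]] cls_eq_iff[OF rep(1,2)[OF cls_in[OF assms]] assms]
  unfolding snd_one by simp_all

text \<open>The fibre at a class of frames is the fibre at a chosen representative, encoded by coordinates so
  that the total space is a set of pairs of a frame and a sequence of complex numbers.\<close>

definition fibre_code :: "('n, 'y) frame \<Rightarrow> 'e \<Rightarrow> nat \<Rightarrow> complex" where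
  "fibre_code \<xi> = (SOME j. inj_on j (F \<xi>))"

lemma fibre_code: "\<xi> \<in> topspace P \<Longrightarrow> inj_on (fibre_code \<xi>) (F \<xi>)"
proof -
  assume \<xi>: "\<xi> \<in> topspace P"
  have "fst (rp \<xi>) \<in> topspace (D (rc \<xi>))" using FC_D(1)[OF rep(2)[OF \<xi>]] by simp
  from fibre_coordinates[OF T(1)[OF rep(1)[OF \<xi>]] this] have "\<exists>j :: 'e \<Rightarrow> nat \<Rightarrow> complex. inj_on j (F \<xi>)"
    by (elim exE conjE) (rule exI)
  then show ?thesis unfolding fibre_code_def by (rule someI_ex)
qed

definition enc where "enc \<xi> f = (\<xi>, fibre_code \<xi> f)"
definition dec where "dec y = inv_into (F (fst y)) (fibre_code (fst y)) (snd y)"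

lemma fst_enc [simp]: "fst (enc \<xi> f) = \<xi>" unfolding enc_def by simp

lemma dec_enc: "\<xi> \<in> topspace P \<Longrightarrow> f \<in> F \<xi> \<Longrightarrow> dec (enc \<xi> f) = f"
  unfolding dec_def enc_def fst_conv snd_conv by (rule inv_into_f_f[OF fibre_code])

definition "\<theta> c p e = enc (cls c p) (transfer \<epsilon> c p (rc (cls c p)) (rp (cls c p)) e)"
definition "\<psi> c p y = transfer \<epsilon> (rc (fst y)) (rp (fst y)) c p (dec y)"
definition "points = {enc \<xi> f | \<xi> f. \<xi> \<in> topspace P \<and> f \<in> F \<xi>}"
abbreviation "XS c \<equiv> pullback_space (FT c) fst (vtot (Ob c)) (vproj (Ob c))"

text \<open>The total space is glued from the pullbacks of the orbibundle to the frames over the charts.\<close>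

definition frame_vbundle :: "(('n, 'y) frame, ('n, 'y) frame \<times> (nat \<Rightarrow> complex)) vbundle" where
  "frame_vbundle = \<lparr>vtot = final_topology points (charts Y) XS (\<lambda>c t. \<theta> c (fst t) (snd t)), vproj = fst,
     vadd = (\<lambda>y y'. enc (fst y) (vadd (Ob (rc (fst y))) (dec y) (dec y'))),
     vscl = (\<lambda>z y. enc (fst y) (vscl (Ob (rc (fst y))) z (dec y)))\<rparr>"

abbreviation "EB \<equiv> frame_vbundle"

definition "push x Q \<xi> = frame_push Y (snd x) (frame_rotate Q \<xi>)"
definition "\<rho> x Q y = enc (push x Q (fst y))
  (transfer x (rc (fst y)) (rotate_frame Q (rp (fst y))) (rc (push x Q (fst y))) (rp (push x Q (fst y))) (dec y))"

lemma mem_XS: "(p, e) \<in> topspace (XS c) \<longleftrightarrow> p \<in> FC c \<and> e \<in> fibre (Ob c) (fst p)"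
  unfolding topspace_pullback_space fibre_def by auto

lemma transfer_to_rep:
  assumes "c \<in> charts Y" "p \<in> FC c" "e \<in> fibre (Ob c) (fst p)"
  shows "transfer \<epsilon> c p (rc (cls c p)) (rp (cls c p)) e \<in> F (cls c p)"
  by (rule fibre_iso_in[OF transfer_iso[OF ext_one_closed step_rep(1)[OF assms(1,2)] assms(2)] assms(3)])

lemma \<theta>_in_points: "c \<in> charts Y \<Longrightarrow> t \<in> topspace (XS c) \<Longrightarrow> \<theta> c (fst t) (snd t) \<in> points"
  unfolding points_def \<theta>_def using transfer_to_rep[of c "fst t" "snd t"] cls_in[of c "fst t"] mem_XS[of "fst t" "snd t" c] by auto

lemma bundle_simps: "vtot EB = final_topology points (charts Y) XS (\<lambda>c t. \<theta> c (fst t) (snd t))" "vproj EB = fst"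
    "vadd EB y y' = enc (fst y) (vadd (Ob (rc (fst y))) (dec y) (dec y'))"
    "vscl EB z y = enc (fst y) (vscl (Ob (rc (fst y))) z (dec y))"
  unfolding frame_vbundle_def by simp_all

lemma topspace_EB: "tot EB = points"
  unfolding bundle_simps by (rule topspace_final_topology) (rule \<theta>_in_points)

lemma fibre_EB: "\<xi> \<in> topspace P \<Longrightarrow> fibre EB \<xi> = enc \<xi> ` F \<xi>"
  unfolding fibre_def[of EB] topspace_EB bundle_simps(2) points_def by auto

lemma fibre_EB_base: "y \<in> fibre EB \<xi> \<Longrightarrow> \<xi> \<in> topspace P" "y \<in> fibre EB \<xi> \<Longrightarrow> fst y = \<xi>"
    "y \<in> tot EB \<Longrightarrow> y \<in> fibre EB (fst y)" "y \<in> tot EB \<Longrightarrow> fst y \<in> topspace P"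
  unfolding fibre_def[of EB] topspace_EB bundle_simps(2) points_def by auto

lemma dec_in: "y \<in> fibre EB \<xi> \<Longrightarrow> dec y \<in> F \<xi>" and enc_dec: "y \<in> fibre EB \<xi> \<Longrightarrow> enc \<xi> (dec y) = y"
proof -
  assume y: "y \<in> fibre EB \<xi>"
  note \<xi> = fibre_EB_base(1)[OF y]
  obtain f where "y = enc \<xi> f" "f \<in> F \<xi>" using y unfolding fibre_EB[OF \<xi>] by (rule imageE)
  then show "dec y \<in> F \<xi>" "enc \<xi> (dec y) = y" using dec_enc[OF \<xi>] by simp_all
qed

lemma enc_iso:
  assumes \<xi>: "\<xi> \<in> topspace P"
  shows "fibre_iso (Ob (rc \<xi>)) (fst (rp \<xi>)) EB \<xi> (enc \<xi>)"
  unfolding fibre_iso_def fibre_hom_def bij_betw_def fibre_EB[OF \<xi>]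
proof (intro conjI ballI allI refl subset_refl)
  show "enc \<xi> (vadd (Ob (rc \<xi>)) e e') = vadd EB (enc \<xi> e) (enc \<xi> e')" if "e \<in> F \<xi>" "e' \<in> F \<xi>" for e e'
    unfolding bundle_simps fst_enc dec_enc[OF \<xi> that(1)] dec_enc[OF \<xi> that(2)] ..
  show "enc \<xi> (vscl (Ob (rc \<xi>)) z e) = vscl EB z (enc \<xi> e)" if "e \<in> F \<xi>" for e z
    unfolding bundle_simps fst_enc dec_enc[OF \<xi> that] ..
  show "inj_on (enc \<xi>) (F \<xi>)" by (rule inj_on_inverseI[of _ dec]) (rule dec_enc[OF \<xi>])
qed

lemma dec_iso:
  assumes \<xi>: "\<xi> \<in> topspace P"
  shows "fibre_iso EB \<xi> (Ob (rc \<xi>)) (fst (rp \<xi>)) dec"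
proof -
  have ob: "fst (rp \<xi>) \<in> topspace (D (rc \<xi>))" using FC_D(1)[OF rep(2)[OF \<xi>]] by simp
  note L = fibre_laws[OF T(1)[OF rep(1)[OF \<xi>]] ob]
  have 1: "dec ` fibre EB \<xi> = F \<xi>"
    unfolding fibre_EB[OF \<xi>] image_image by (simp add: dec_enc[OF \<xi>])
  have 2: "dec (vadd EB y y') = vadd (Ob (rc \<xi>)) (dec y) (dec y')" if "y \<in> fibre EB \<xi>" "y' \<in> fibre EB \<xi>" for y y'
    unfolding bundle_simps fibre_EB_base(2)[OF that(1)] by (rule dec_enc[OF \<xi> L(1)[OF dec_in[OF that(1)] dec_in[OF that(2)]]])
  have 3: "dec (vscl EB z y) = vscl (Ob (rc \<xi>)) z (dec y)" if "y \<in> fibre EB \<xi>" for y z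
    unfolding bundle_simps fibre_EB_base(2)[OF that] by (rule dec_enc[OF \<xi> L(2)[OF dec_in[OF that]]])
  have 4: "inj_on dec (fibre EB \<xi>)" by (rule inj_on_inverseI[of _ "enc \<xi>"]) (rule enc_dec)
  show ?thesis unfolding fibre_iso_def fibre_hom_def bij_betw_def by (intro conjI ballI allI eq_refl 1 2 3 4)
qed

lemma \<theta>_iso:
  assumes c: "c \<in> charts Y" and p: "p \<in> FC c"
  shows "fibre_iso (Ob c) (fst p) EB (cls c p) (\<theta> c p)"
  unfolding \<theta>_def by (rule fibre_iso_compose[OF transfer_iso[OF ext_one_closed step_rep(1)[OF c p] p] enc_iso[OF cls_in[OF c p]]])

lemma \<psi>_in:
  assumes c: "c \<in> charts Y" and p: "p \<in> FC c" and y: "y \<in> fibre EB (cls c p)"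
  shows "\<psi> c p y \<in> fibre (Ob c) (fst p)" "\<theta> c p (\<psi> c p y) = y"
proof -
  note r = rep[OF cls_in[OF c p]] and s = step_rep[OF c p] and dy = dec_in[OF y]
  have \<psi>: "\<psi> c p y = transfer \<epsilon> (rc (cls c p)) (rp (cls c p)) c p (dec y)" unfolding \<psi>_def fibre_EB_base(2)[OF y] ..
  show "\<psi> c p y \<in> fibre (Ob c) (fst p)" unfolding \<psi>
    by (rule fibre_iso_in[OF transfer_iso[OF ext_one_closed s(2) r(2)] dy])
  show "\<theta> c p (\<psi> c p y) = y"
    unfolding \<theta>_def \<psi> transfer_compose[OF ext_one_closed ext_one_closed s(2,1) r(2) dy] ext_one_mult(1)[OF ext_one_closed]
      transfer_refl[OF r(1,2) dy] by (rule enc_dec[OF y])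
qed

lemma \<psi>_\<theta>:
  assumes c: "c \<in> charts Y" and p: "p \<in> FC c" and e: "e \<in> fibre (Ob c) (fst p)"
  shows "\<psi> c p (\<theta> c p e) = e"
proof -
  have m: "\<theta> c p e \<in> fibre EB (cls c p)" by (rule fibre_iso_in[OF \<theta>_iso[OF c p] e])
  show ?thesis by (rule inj_onD[OF fibre_isoD(2)[OF \<theta>_iso[OF c p]] \<psi>_in(2)[OF c p m] \<psi>_in(1)[OF c p m] e])
qed

lemma \<theta>_step:
  assumes st: "step (snd \<epsilon>) c p d q" and p: "p \<in> FC c" and e: "e \<in> fibre (Ob c) (fst p)"
  shows "\<theta> d q (transfer \<epsilon> c p d q e) = \<theta> c p e"
proof -
  have cd: "c \<in> charts Y" "d \<in> charts Y" using jet_step_charts[OF st] by blast+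
  have q: "q \<in> FC d" by (rule step_FC[OF _ st p]) simp
  have eq: "cls d q = cls c p" using cls_eq_iff[OF cd(1) p cd(2) q] st by simp
  show ?thesis
    unfolding \<theta>_def
      transfer_compose[OF ext_one_closed ext_one_closed st step_rep(1)[OF cd(2) q] p e] ext_one_mult(1)[OF ext_one_closed]
    unfolding eq ..
qed

lemma push_step:
  assumes x: "x \<in> carrier X" and Q: "Q \<in> On" and \<xi>: "\<xi> \<in> topspace P"
  shows "push x Q \<xi> \<in> topspace P" "step (snd x) (rc \<xi>) (rotate_frame Q (rp \<xi>)) (rc (push x Q \<xi>)) (rp (push x Q \<xi>))"
    "rotate_frame Q (rp \<xi>) \<in> FC (rc \<xi>)"
proof -
  note r = rep[OF \<xi>] and h = snd_in[OF x]
  show rp: "rotate_frame Q (rp \<xi>) \<in> FC (rc \<xi>)" by (rule rotate_FC[OF r(2)]) (use Q in simp)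
  obtain d W l where l: "d \<in> charts Y" "local_lift (snd x) (rc \<xi>) d W l" "fst (rotate_frame Q (rp \<xi>)) \<in> W"
    by (rule step_exists[OF h r(1) rp])
  let ?q = "lift_frame l (rotate_frame Q (rp \<xi>))"
  have st: "step (snd x) (rc \<xi>) (rotate_frame Q (rp \<xi>)) d ?q" by (rule jet_stepI[OF r(1) l])
  have q: "?q \<in> FC d" by (rule step_FC[OF h st rp])
  have pu: "push x Q \<xi> = cls d ?q" unfolding push_def using push_cls[OF h st] unfolding rotate_cls[symmetric] r(3) .
  show "push x Q \<xi> \<in> topspace P" unfolding pu by (rule cls_in[OF l(1) q])
  show "step (snd x) (rc \<xi>) (rotate_frame Q (rp \<xi>)) (rc (push x Q \<xi>)) (rp (push x Q \<xi>))"
    using step_mult[OF h H.one_closed st step_rep(1)[OF l(1) q, unfolded snd_one]] h unfolding pu by simp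
qed

lemma \<rho>_fibre:
  assumes x: "x \<in> carrier X" and Q: "Q \<in> On" and \<xi>: "\<xi> \<in> topspace P" and E: "vector_bundle P EB"
  shows "fibre_iso EB \<xi> EB (push x Q \<xi>) (\<rho> x Q)"
proof -
  note s = push_step[OF x Q \<xi>]
  note i = fibre_iso_compose[OF fibre_iso_compose[OF dec_iso[OF \<xi>] transfer_iso[OF x s(2,3), unfolded fst_rotate_frame]] enc_iso[OF s(1)]]
  show ?thesis by (rule fibre_iso_cong[OF i _ E \<xi>]) (simp add: \<rho>_def fibre_EB_base(2))
qed

lemma \<rho>_image:
  assumes x: "x \<in> carrier X" and Q: "Q \<in> On" and y: "y \<in> fibre EB \<xi>"
  shows "transfer x (rc \<xi>) (rotate_frame Q (rp \<xi>)) (rc (push x Q \<xi>)) (rp (push x Q \<xi>)) (dec y) \<in> F (push x Q \<xi>)"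
    "\<rho> x Q y \<in> fibre EB (push x Q \<xi>)"
proof -
  note s = push_step[OF x Q fibre_EB_base(1)[OF y]]
  show 1: "transfer x (rc \<xi>) (rotate_frame Q (rp \<xi>)) (rc (push x Q \<xi>)) (rp (push x Q \<xi>)) (dec y) \<in> F (push x Q \<xi>)"
    by (rule fibre_iso_in[OF transfer_iso[OF x s(2,3), unfolded fst_rotate_frame] dec_in[OF y]])
  show "\<rho> x Q y \<in> fibre EB (push x Q \<xi>)" unfolding \<rho>_def fibre_EB_base(2)[OF y]
    by (rule fibre_iso_in[OF enc_iso[OF s(1)] 1])
qed

lemma \<rho>_compose:
  assumes x: "x \<in> carrier X" and y: "y \<in> carrier X" and Q: "Q \<in> On" and Q': "Q' \<in> On" and e: "e \<in> tot EB"
  shows "\<rho> y Q' (\<rho> x Q e) = \<rho> (y \<otimes>\<^bsub>X\<^esub> x) (Q' ** Q) e"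
proof -
  note f = fibre_EB_base(3)[OF e] and \<xi> = fibre_EB_base(4)[OF e]
  let ?\<xi>1 = "push x Q (fst e)" let ?\<xi>2 = "push y Q' ?\<xi>1"
  note s1 = push_step[OF x Q \<xi>] note s2 = push_step[OF y Q' s1(1)]
  have QQ: "Q' ** Q \<in> On" using Q Q' by (simp add: orthogonal_matrix_mul)
  have st1: "step (snd x) (rc (fst e)) (rotate_frame (Q' ** Q) (rp (fst e))) (rc ?\<xi>1) (rotate_frame Q' (rp ?\<xi>1))"
    unfolding rotate_rotate[symmetric] by (rule jet_step_rotate[OF s1(2)])
  have rq: "rotate_frame (Q' ** Q) (rp (fst e)) \<in> FC (rc (fst e))" by (rule rotate_FC[OF rep(2)[OF \<xi>]]) (use QQ in simp)
  have st: "step (snd (y \<otimes>\<^bsub>X\<^esub> x)) (rc (fst e)) (rotate_frame (Q' ** Q) (rp (fst e))) (rc ?\<xi>2) (rp ?\<xi>2)"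
    unfolding snd_mult by (rule step_mult[OF snd_in[OF x] snd_in[OF y] st1 s2(2)])
  have pu: "push (y \<otimes>\<^bsub>X\<^esub> x) (Q' ** Q) (fst e) = ?\<xi>2"
    using push_cls[OF snd_in[OF ext_mult_closed[OF y x]] st] rep(3)[OF \<xi>] rep(3)[OF s2(1)]
    unfolding rotate_cls[symmetric] push_def[of "y \<otimes>\<^bsub>X\<^esub> x"] by simp
  have d: "dec (\<rho> x Q e) = transfer x (rc (fst e)) (rotate_frame (Q' ** Q) (rp (fst e))) (rc ?\<xi>1) (rotate_frame Q' (rp ?\<xi>1)) (dec e)"
    unfolding \<rho>_def rotate_rotate[symmetric] transfer_rotate[OF Q'] by (rule dec_enc[OF s1(1) \<rho>_image(1)[OF x Q f]])
  have de: "dec e \<in> fibre (Ob (rc (fst e))) (fst (rotate_frame (Q' ** Q) (rp (fst e))))" unfolding fst_rotate_frame by (rule dec_in[OF f])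
  have f1: "fst (\<rho> x Q e) = ?\<xi>1" unfolding \<rho>_def by simp
  show ?thesis
    unfolding \<rho>_def[of y] \<rho>_def[of "y \<otimes>\<^bsub>X\<^esub> x"] f1 d transfer_compose[OF x y st1 s2(2) rq de] pu ..
qed

lemma \<rho>_central:
  assumes x: "x \<in> carrier X" and z: "norm z = 1" and Q: "Q \<in> On" and e: "e \<in> tot EB"
  shows "\<rho> (z * fst x, snd x) Q e = vscl EB z (\<rho> x Q e)"
proof -
  note f = fibre_EB_base(3)[OF e] and \<xi> = fibre_EB_base(4)[OF e]
  note s = push_step[OF x Q \<xi>]
  have pu: "push (z * fst x, snd x) Q (fst e) = push x Q (fst e)" unfolding push_def by simp
  have de: "dec e \<in> fibre (Ob (rc (fst e))) (fst (rotate_frame Q (rp (fst e))))" unfolding fst_rotate_frame by (rule dec_in[OF f])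
  have d: "dec (\<rho> x Q e) = transfer x (rc (fst e)) (rotate_frame Q (rp (fst e))) (rc (push x Q (fst e))) (rp (push x Q (fst e))) (dec e)"
    unfolding \<rho>_def by (rule dec_enc[OF s(1) \<rho>_image(1)[OF x Q f]])
  have f1: "fst (\<rho> x Q e) = push x Q (fst e)" unfolding \<rho>_def by simp
  show ?thesis unfolding bundle_simps d f1 \<rho>_def[of "(z * fst x, snd x)"] pu transfer_central[OF x z s(2,3) de] ..
qed

text \<open>Both sides are transfers of \<open>e\<close> from \<open>p\<close>, rotated by \<open>Q\<close>, to the representative of the target
  class.\<close>

lemma \<theta>_equivariant:
  assumes x: "x \<in> carrier X" and Q: "Q \<in> On" and c: "c \<in> charts Y" and d: "d \<in> charts Y" and l: "local_lift (snd x) c d W l"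
    and p: "p \<in> FC c" "fst p \<in> W" and e: "e \<in> fibre (Ob c) (fst p)"
  shows "\<theta> d (lift_frame l (rotate_frame Q p)) (A x c W l d e) = \<rho> x Q (\<theta> c p e)"
proof -
  let ?\<xi> = "cls c p" let ?rp = "rotate_frame Q p" let ?q = "lift_frame l ?rp" let ?\<eta> = "push x Q ?\<xi>"
  note \<xi> = cls_in[OF c p(1)] note s = push_step[OF x Q \<xi>] and sr = step_rep(1)[OF c p(1)]
  have rpF: "?rp \<in> FC c" by (rule rotate_FC[OF p(1)]) (use Q in simp)
  have pW: "fst ?rp \<in> W" using p(2) by simp
  have st: "step (snd x) c ?rp d ?q" by (rule jet_stepI[OF c d l pW])
  have q: "?q \<in> FC d" by (rule step_FC[OF snd_in[OF x] st rpF])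
  have e1: "e \<in> fibre (Ob c) (fst ?rp)" unfolding fst_rotate_frame by (rule e)
  have pu: "?\<eta> = cls d ?q" unfolding push_def rotate_cls by (rule push_cls[OF snd_in[OF x] st])
  have sr': "step (snd \<epsilon>) c ?rp (rc ?\<xi>) (rotate_frame Q (rp ?\<xi>))" by (rule jet_step_rotate[OF sr])
  have "\<theta> d ?q (A x c W l d e) = enc ?\<eta> (transfer \<epsilon> d ?q (rc ?\<eta>) (rp ?\<eta>) (transfer x c ?rp d ?q e))"
    unfolding \<theta>_def pu transfer_eq[OF x c d l rpF pW e1] ..
  also have "\<dots> = enc ?\<eta> (transfer x c ?rp (rc ?\<eta>) (rp ?\<eta>) e)"
    unfolding transfer_compose[OF x ext_one_closed st step_rep(1)[OF d q, folded pu] rpF e1] ext_one_mult(1)[OF x] ..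
  also have "transfer x c ?rp (rc ?\<eta>) (rp ?\<eta>) e = transfer x (rc ?\<xi>) (rotate_frame Q (rp ?\<xi>)) (rc ?\<eta>) (rp ?\<eta>)
      (transfer \<epsilon> c ?rp (rc ?\<xi>) (rotate_frame Q (rp ?\<xi>)) e)"
    unfolding transfer_compose[OF ext_one_closed x sr' s(2) rpF e1] ext_one_mult(2)[OF x] ..
  also have "transfer \<epsilon> c ?rp (rc ?\<xi>) (rotate_frame Q (rp ?\<xi>)) e = dec (\<theta> c p e)"
    unfolding transfer_rotate[OF Q] \<theta>_def by (rule dec_enc[OF \<xi> transfer_to_rep[OF c p(1) e], symmetric])
  also have "enc ?\<eta> (transfer x (rc ?\<xi>) (rotate_frame Q (rp ?\<xi>)) (rc ?\<eta>) (rp ?\<eta>) (dec (\<theta> c p e))) = \<rho> x Q (\<theta> c p e)"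
    unfolding \<rho>_def[of x Q] by (simp add: \<theta>_def)
  finally show ?thesis .
qed

end

context orbibundle_action
begin

interpretation H: group H by (rule H)

section \<open>The topology of the bundle over the frame bundle\<close>

lemma continuous_\<theta>:
  assumes "c \<in> charts Y"
  shows "continuous_map (XS c) (vtot EB) (\<lambda>t. \<theta> c (fst t) (snd t))"
  unfolding bundle_simps
  by (rule continuous_map_into_final_topology[of "charts Y" XS "\<lambda>c t. \<theta> c (fst t) (snd t)", OF \<theta>_in_points assms])

lemma continuous_EB_proj: "continuous_map (vtot EB) P fst"
  unfolding bundle_simps
proof (rule continuous_map_from_final_topology)
  show "\<theta> c (fst t) (snd t) \<in> points" if "c \<in> charts Y" "t \<in> topspace (XS c)" for c t by (rule \<theta>_in_points[OF that])
  show "fst \<in> points \<rightarrow> topspace P" unfolding points_def by auto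
  show "continuous_map (XS c) P (\<lambda>t. fst (\<theta> c (fst t) (snd t)))" if "c \<in> charts Y" for c
    unfolding \<theta>_def fst_enc by (rule continuous_map_app[OF continuous_map_pullback_fst continuous_frame_class[OF that]])
qed

lemma \<theta>_lift:
  assumes d: "d \<in> charts Y" and c: "c \<in> charts Y" and l: "local_lift (snd \<epsilon>) d c W l"
    and q: "q \<in> FC d" "fst q \<in> W" and e: "e \<in> fibre (Ob d) (fst q)"
  shows "\<theta> c (lift_frame l q) (A \<epsilon> d W l c e) = \<theta> d q e"
  using \<theta>_step[OF jet_stepI[OF d c l q(2)] q(1) e] unfolding transfer_eq[OF ext_one_closed d c l q e] .

lemma openin_frames_over:
  assumes "openin (D c) V"
  shows "openin (FT c) {p \<in> FC c. fst p \<in> V}"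
proof -
  have "continuous_map (FT c) (D c) fst"
    by (rule continuous_map_into_subtopology) (auto simp: continuous_on_fst intro!: FC_D(1) continuous_intros)
  from openin_continuous_map_preimage[OF this assms] show ?thesis by simp
qed

lemma openin_lift_domain: "local_lift h c d W l \<Longrightarrow> openin (D c) W"
  using local_liftD(1,2)[of h c d W l] by (simp add: openin_open_eq open_subset)

text \<open>The same reason as for the openness of the maps to the frame bundle: a change of charts that
  identifies two points of the pullbacks identifies neighbourhoods of them.\<close>

lemma open_\<theta>:
  assumes c: "c \<in> charts Y"
  shows "open_map (XS c) (vtot EB) (\<lambda>t. \<theta> c (fst t) (snd t))"
  unfolding open_map_def
proof (intro allI impI)
  fix O' assume O': "openin (XS c) O'"
  then have sub: "O' \<subseteq> topspace (XS c)" by (rule openin_subset)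
  let ?I = "(\<lambda>t. \<theta> c (fst t) (snd t)) ` O'"
  have "openin (XS d) {s \<in> topspace (XS d). \<theta> d (fst s) (snd s) \<in> ?I}" if d: "d \<in> charts Y" for d
  proof (rule openin_subopen[THEN iffD2], intro ballI)
    fix s assume "s \<in> {s \<in> topspace (XS d). \<theta> d (fst s) (snd s) \<in> ?I}"
    then have sX: "s \<in> topspace (XS d)" and sI: "\<theta> d (fst s) (snd s) \<in> ?I" by simp_all
    obtain t where t: "t \<in> O'" "\<theta> d (fst s) (snd s) = \<theta> c (fst t) (snd t)" using sI by blast
    have tX: "t \<in> topspace (XS c)" using t(1) sub by blast
    have q: "fst s \<in> FC d" "snd s \<in> fibre (Ob d) (fst (fst s))" using sX mem_XS[of "fst s" "snd s" d] by simp_all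
    have p: "fst t \<in> FC c" "snd t \<in> fibre (Ob c) (fst (fst t))" using tX mem_XS[of "fst t" "snd t" c] by simp_all
    have "cls d (fst s) = cls c (fst t)" using arg_cong[OF t(2), of fst] unfolding \<theta>_def fst_enc .
    then have "step \<one>\<^bsub>H\<^esub> d (fst s) c (fst t)" using cls_eq_iff[OF d q(1) c p(1)] by blast
    then obtain W l where l: "local_lift \<one>\<^bsub>H\<^esub> d c W l" "fst (fst s) \<in> W" "fst t = lift_frame l (fst s)" by (rule jet_stepE)
    have l1: "local_lift (snd \<epsilon>) d c W l" using l(1) by simp
    define S0 where "S0 = {s \<in> topspace (XS d). fst s \<in> {p \<in> FC d. fst p \<in> W}}"
    have S0: "openin (XS d) S0" unfolding S0_def
      by (rule openin_continuous_map_preimage[OF continuous_map_pullback_fst openin_frames_over[OF openin_lift_domain[OF l(1)]]])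
    let ?S = "subtopology (XS d) S0"
    have tS: "topspace ?S = S0" unfolding topspace_subtopology S0_def by blast
    have S0D: "fst z \<in> FC d" "fst (fst z) \<in> W" "snd z \<in> fibre (Ob d) (fst (fst z))" if "z \<in> S0" for z
      using that mem_XS[of "fst z" "snd z" d] unfolding S0_def by simp_all
    \<comment> \<open>The change of charts on the pullbacks; \<open>\<theta>\<close> takes the same value at \<open>z\<close> and \<open>?\<Lambda> z\<close>.\<close>
    let ?\<Lambda> = "\<lambda>z. (lift_frame l (fst z), A \<epsilon> d W l c (snd z))"
    have im: "A \<epsilon> d W l c (snd z) \<in> fibre (Ob c) (fst (lift_frame l (fst z)))" if "z \<in> S0" for z
      unfolding fst_lift_frame by (rule fibre_iso_in[OF T(3)[OF ext_one_closed d c l1 S0D(2)[OF that]] S0D(3)[OF that]])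
    have f1: "continuous_map ?S (FT c) (\<lambda>z. lift_frame l (fst z))"
      by (rule continuous_map_lift_frame[OF H.one_closed d c l(1) continuous_map_from_subtopology[OF continuous_map_pullback_fst]])
        (use S0D(2) tS in blast)
    have "continuous_map ?S (subtopology (vtot (Ob d)) {e. vproj (Ob d) e \<in> W}) snd"
    proof (rule continuous_map_into_subtopology[OF continuous_map_from_subtopology[OF continuous_map_pullback_snd]], rule Pi_I)
      show "snd z \<in> {e. vproj (Ob d) e \<in> W}" if "z \<in> topspace ?S" for z
        using S0D(2,3)[of z] fibreD(2) that unfolding tS by (metis mem_Collect_eq)
    qed
    from continuous_map_app[OF this T(2)[OF ext_one_closed d c l1]]
    have f2: "continuous_map ?S (vtot (Ob c)) (\<lambda>z. A \<epsilon> d W l c (snd z))" .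
    have f: "continuous_map ?S (XS c) ?\<Lambda>"
    proof (rule continuous_map_into_pullback[OF f1 f2])
      show "fst (lift_frame l (fst z)) = vproj (Ob c) (A \<epsilon> d W l c (snd z))" if "z \<in> topspace ?S" for z
        using fibreD(2)[OF im] that unfolding tS by simp
    qed
    define N where "N = {z \<in> topspace ?S. ?\<Lambda> z \<in> O'}"
    have N: "openin (XS d) N" unfolding N_def by (rule openin_trans_full[OF openin_continuous_map_preimage[OF f O'] S0])
    have th: "\<theta> c (lift_frame l (fst z)) (A \<epsilon> d W l c (snd z)) = \<theta> d (fst z) (snd z)" if "z \<in> S0" for z
      by (rule \<theta>_lift[OF d c l1 S0D[OF that]])
    have sS: "s \<in> S0" unfolding S0_def using sX q(1) l(2) by simp
    have "\<theta> c (fst t) (A \<epsilon> d W l c (snd s)) = \<theta> c (fst t) (snd t)" using th[OF sS] t(2) l(3) by simp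
    then have "A \<epsilon> d W l c (snd s) = snd t"
      by (rule inj_onD[OF fibre_isoD(2)[OF \<theta>_iso[OF c p(1)]] _ _ p(2)]) (use im[OF sS] l(3) in simp)
    then have "?\<Lambda> s = t" using l(3) by (simp add: prod_eq_iff)
    then have "s \<in> N" unfolding N_def tS using sS t(1) by simp
    moreover have "N \<subseteq> {s \<in> topspace (XS d). \<theta> d (fst s) (snd s) \<in> ?I}"
    proof
      fix z assume "z \<in> N"
      then have z: "z \<in> S0" "?\<Lambda> z \<in> O'" unfolding N_def tS by simp_all
      have "\<theta> d (fst z) (snd z) \<in> ?I" using imageI[OF z(2), of "\<lambda>t. \<theta> c (fst t) (snd t)"] th[OF z(1)] by simp
      then show "z \<in> {s \<in> topspace (XS d). \<theta> d (fst s) (snd s) \<in> ?I}" using z(1) unfolding S0_def by simp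
    qed
    ultimately show "\<exists>N. openin (XS d) N \<and> s \<in> N \<and> N \<subseteq> {s \<in> topspace (XS d). \<theta> d (fst s) (snd s) \<in> ?I}"
      using N by (intro exI[of _ N] conjI)
  qed
  moreover have "?I \<subseteq> points" using sub \<theta>_in_points[OF c] by blast
  ultimately show "openin (vtot EB) ?I" unfolding bundle_simps openin_final_topology by (intro conjI ballI)
qed

text \<open>The map from the frames over a chart to the frame bundle is open and locally injective, hence a
  local homeomorphism.\<close>

lemma local_section:
  assumes c: "c \<in> charts Y" and p0: "p0 \<in> N" and N: "openin (FT c) N"
  obtains O' s where "openin (FT c) O'" "p0 \<in> O'" "O' \<subseteq> N" "openin P (frame_class Y c ` O')"
    "continuous_map (subtopology P (frame_class Y c ` O')) (FT c) s"
    "\<And>\<xi>. \<xi> \<in> frame_class Y c ` O' \<Longrightarrow> s \<xi> \<in> O' \<and> cls c (s \<xi>) = \<xi>" "\<And>p. p \<in> O' \<Longrightarrow> s (cls c p) = p"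
proof -
  have "p0 \<in> FC c" using openin_subset[OF N] p0 by auto
  then obtain O1 where O1: "openin (FT c) O1" "p0 \<in> O1" "inj_on (frame_class Y c) O1"
    using frame_class_locally_injective[OF c] by blast
  define O' where "O' = O1 \<inter> N"
  let ?B = "frame_class Y c ` O'"
  have op: "openin (FT c) O'" unfolding O'_def by (rule openin_Int[OF O1(1) N])
  have inj: "inj_on (frame_class Y c) O'" unfolding O'_def by (rule inj_on_subset[OF O1(3)]) simp
  have sub: "O' \<subseteq> FC c" using openin_subset[OF op] by simp
  have om: "openin P (frame_class Y c ` U)" if "openin (FT c) U" for U
    using open_frame_class[OF c] that unfolding open_map_def by blast
  define s where "s = inv_into O' (frame_class Y c)"
  have s1: "s \<xi> \<in> O' \<and> cls c (s \<xi>) = \<xi>" if "\<xi> \<in> ?B" for \<xi>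
    unfolding s_def using inv_into_into[OF that] f_inv_into_f[OF that] by simp
  have s2: "s (cls c p) = p" if "p \<in> O'" for p unfolding s_def by (rule inv_into_f_f[OF inj that])
  have cs: "continuous_map (subtopology P ?B) (FT c) s"
    unfolding continuous_map
  proof (intro conjI allI impI)
    show "s ` topspace (subtopology P ?B) \<subseteq> topspace (FT c)" using s1 sub by auto
    fix U assume U: "openin (FT c) U"
    have "{\<xi> \<in> topspace (subtopology P ?B). s \<xi> \<in> U} = frame_class Y c ` (O' \<inter> U)"
    proof (rule Set.set_eqI)
      fix \<xi>
      have "\<xi> \<in> topspace P" if "\<xi> \<in> ?B" using openin_subset[OF om[OF op]] that by blast
      then show "\<xi> \<in> {\<xi> \<in> topspace (subtopology P ?B). s \<xi> \<in> U} \<longleftrightarrow> \<xi> \<in> frame_class Y c ` (O' \<inter> U)"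
        using s1[of \<xi>] s2 by (auto simp: image_iff)
    qed
    moreover have "openin P (frame_class Y c ` (O' \<inter> U))" by (rule om[OF openin_Int[OF op U]])
    ultimately show "openin (subtopology P ?B) {\<xi> \<in> topspace (subtopology P ?B). s \<xi> \<in> U}"
      by (simp add: openin_open_subtopology om[OF op] image_mono)
  qed
  show thesis
    by (rule that[OF op _ _ om[OF op] cs s1 s2]) (use O1(2) p0 in \<open>simp_all add: O'_def\<close>)
qed

text \<open>Over the image of \<open>O'\<close> the map \<open>\<theta> c\<close> is a quotient map, as it is open, and \<open>\<psi>\<close> becomes a projection
  when composed with it.\<close>

lemma continuous_\<psi>_section:
  assumes c: "c \<in> charts Y" and op: "openin (FT c) O'" and s: "\<And>\<xi>. \<xi> \<in> frame_class Y c ` O' \<Longrightarrow> s \<xi> \<in> O' \<and> cls c (s \<xi>) = \<xi>"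
    and s': "\<And>p. p \<in> O' \<Longrightarrow> s (cls c p) = p"
  shows "continuous_map (subtopology (vtot EB) {y. fst y \<in> frame_class Y c ` O'}) (vtot (Ob c)) (\<lambda>y. \<psi> c (s (fst y)) y)"
proof -
  let ?B = "frame_class Y c ` O'" let ?q = "\<lambda>t. \<theta> c (fst t) (snd t)"
  let ?EB = "subtopology (vtot EB) {y. fst y \<in> ?B}"
  define OX where "OX = {t \<in> topspace (XS c). fst t \<in> O'}"
  have OX: "openin (XS c) OX" unfolding OX_def by (rule openin_continuous_map_preimage[OF continuous_map_pullback_fst op])
  have sub: "O' \<subseteq> FC c" using openin_subset[OF op] by simp
  have tX: "topspace (subtopology (XS c) OX) = OX" unfolding topspace_subtopology OX_def by blast
  have im: "?q t \<in> {y. fst y \<in> ?B}" if "t \<in> OX" for t using that unfolding OX_def \<theta>_def by simp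
  have "quotient_map (subtopology (XS c) OX) ?EB ?q"
  proof (rule continuous_open_imp_quotient_map)
    show "continuous_map (subtopology (XS c) OX) ?EB ?q"
      by (rule continuous_map_into_subtopology[OF continuous_map_from_subtopology[OF continuous_\<theta>[OF c]]], rule Pi_I) (use im tX in blast)
    show "open_map (subtopology (XS c) OX) ?EB ?q"
      by (rule open_map_into_subtopology[OF open_map_from_subtopology[OF open_\<theta>[OF c] OX]], rule Pi_I) (use im tX in blast)
    show "?q ` topspace (subtopology (XS c) OX) = topspace ?EB"
    proof
      show "?q ` topspace (subtopology (XS c) OX) \<subseteq> topspace ?EB"
        unfolding tX topspace_subtopology topspace_EB using im \<theta>_in_points[OF c] unfolding OX_def by blast
      show "topspace ?EB \<subseteq> ?q ` topspace (subtopology (XS c) OX)"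
      proof
        fix y assume "y \<in> topspace ?EB"
        then have y: "y \<in> tot EB" "fst y \<in> ?B" by simp_all
        note sy = s[OF y(2)]
        have sF: "s (fst y) \<in> FC c" using sy sub by blast
        have yf: "y \<in> fibre EB (cls c (s (fst y)))" using fibre_EB_base(3)[OF y(1)] sy by simp
        have "(s (fst y), \<psi> c (s (fst y)) y) \<in> OX" unfolding OX_def using mem_XS[of "s (fst y)" _ c] sF sy \<psi>_in(1)[OF c sF yf] by simp
        then show "y \<in> ?q ` topspace (subtopology (XS c) OX)" unfolding tX
          by (rule rev_image_eqI) (simp add: \<psi>_in(2)[OF c sF yf])
      qed
    qed
  qed
  then show ?thesis
  proof (rule continuous_compose_quotient_map)
    show "continuous_map (subtopology (XS c) OX) (vtot (Ob c)) ((\<lambda>y. \<psi> c (s (fst y)) y) \<circ> ?q)"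
    proof (rule continuous_map_eq[OF continuous_map_from_subtopology[OF continuous_map_pullback_snd]])
      fix t assume "t \<in> topspace (subtopology (XS c) OX)"
      then have t: "t \<in> topspace (XS c)" "fst t \<in> O'" unfolding tX OX_def by simp_all
      have "snd t \<in> fibre (Ob c) (fst (fst t))" "fst t \<in> FC c" using t(1) mem_XS[of "fst t" "snd t" c] by simp_all
      note \<psi>_\<theta>[OF c this(2,1)]
      moreover have "fst (\<theta> c (fst t) (snd t)) = cls c (fst t)" unfolding \<theta>_def by simp
      ultimately show "snd t = ((\<lambda>y. \<psi> c (s (fst y)) y) \<circ> ?q) t" unfolding o_def by (simp add: s'[OF t(2)])
    qed
  qed
qed

lemma continuous_\<psi>:
  assumes c: "c \<in> charts Y"
  shows "continuous_map (pullback_space (FT c) (frame_class Y c) (vtot EB) (vproj EB)) (vtot (Ob c)) (\<lambda>y. \<psi> c (fst y) (snd y))"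
    (is "continuous_map ?Z _ _")
proof (rule continuous_map_locally)
  fix z assume z: "z \<in> topspace ?Z"
  have p: "fst z \<in> FC c" using z unfolding topspace_pullback_space by auto
  obtain O' s where O': "openin (FT c) O'" "fst z \<in> O'"
    and s: "\<And>\<xi>. \<xi> \<in> frame_class Y c ` O' \<Longrightarrow> s \<xi> \<in> O' \<and> cls c (s \<xi>) = \<xi>" "\<And>p. p \<in> O' \<Longrightarrow> s (cls c p) = p"
    by (rule local_section[OF c, of "fst z" "FC c"]) (use p in auto)
  define U where "U = {t \<in> topspace ?Z. fst t \<in> O'}"
  have U: "openin ?Z U" unfolding U_def by (rule openin_continuous_map_preimage[OF continuous_map_pullback_fst O'(1)])
  have tU: "topspace (subtopology ?Z U) = U" unfolding topspace_subtopology U_def by blast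
  have UD: "fst t \<in> O'" "cls c (fst t) = fst (snd t)" if "t \<in> U" for t
    using that unfolding U_def topspace_pullback_space bundle_simps(2) by auto
  have "continuous_map (subtopology ?Z U) (subtopology (vtot EB) {y. fst y \<in> frame_class Y c ` O'}) snd"
  proof (rule continuous_map_into_subtopology[OF continuous_map_from_subtopology[OF continuous_map_pullback_snd]], rule Pi_I)
    show "snd t \<in> {y. fst y \<in> frame_class Y c ` O'}" if "t \<in> topspace (subtopology ?Z U)" for t
      using imageI[OF UD(1)[of t], of "frame_class Y c"] UD(2)[of t] that unfolding tU by simp
  qed
  from continuous_map_app[OF this continuous_\<psi>_section[OF c O'(1) s]]
  have "continuous_map (subtopology ?Z U) (vtot (Ob c)) (\<lambda>t. \<psi> c (s (fst (snd t))) (snd t))" by simp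
  then have "continuous_map (subtopology ?Z U) (vtot (Ob c)) (\<lambda>t. \<psi> c (fst t) (snd t))"
  proof (rule continuous_map_eq)
    show "\<psi> c (s (fst (snd t))) (snd t) = \<psi> c (fst t) (snd t)" if "t \<in> topspace (subtopology ?Z U)" for t
      using s(2)[OF UD(1)[of t]] UD(2)[of t] that unfolding tU by simp
  qed
  moreover have "z \<in> U" unfolding U_def using z O'(2) by simp
  ultimately show "\<exists>U. openin ?Z U \<and> z \<in> U \<and> continuous_map (subtopology ?Z U) (vtot (Ob c)) (\<lambda>y. \<psi> c (fst y) (snd y))"
    using U by (intro exI[of _ U] conjI)
qed

lemma EB_closed:
  assumes "y \<in> fibre EB \<xi>"
  shows "y' \<in> fibre EB \<xi> \<Longrightarrow> vadd EB y y' \<in> fibre EB \<xi>" "vscl EB z y \<in> fibre EB \<xi>"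
proof -
  note \<xi> = fibre_EB_base(1)[OF assms]
  have "fst (rp \<xi>) \<in> topspace (D (rc \<xi>))" using FC_D(1)[OF rep(2)[OF \<xi>]] by simp
  note L = fibre_laws[OF T(1)[OF rep(1)[OF \<xi>]] this]
  show "vadd EB y y' \<in> fibre EB \<xi>" if "y' \<in> fibre EB \<xi>"
    unfolding bundle_simps(3) fibre_EB_base(2)[OF assms] fibre_EB[OF \<xi>] by (rule imageI[OF L(1)[OF dec_in[OF assms] dec_in[OF that]]])
  show "vscl EB z y \<in> fibre EB \<xi>"
    unfolding bundle_simps(4) fibre_EB_base(2)[OF assms] fibre_EB[OF \<xi>] by (rule imageI[OF L(2)[OF dec_in[OF assms]]])
qed

lemma \<psi>_linear:
  assumes c: "c \<in> charts Y" and p: "p \<in> FC c" and y: "y \<in> fibre EB (cls c p)"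
  shows "y' \<in> fibre EB (cls c p) \<Longrightarrow> \<psi> c p (vadd EB y y') = vadd (Ob c) (\<psi> c p y) (\<psi> c p y')"
    "\<psi> c p (vscl EB z y) = vscl (Ob c) z (\<psi> c p y)"
proof -
  note \<xi> = cls_in[OF c p]
  note h = fibre_homD[OF fibre_isoD(1)[OF fibre_iso_compose[OF dec_iso[OF \<xi>] transfer_iso[OF ext_one_closed step_rep(2)[OF c p] rep(2)[OF \<xi>]]]]]
  have f: "\<psi> c p y = transfer \<epsilon> (rc (cls c p)) (rp (cls c p)) c p (dec y)" if "y \<in> fibre EB (cls c p)" for y
    unfolding \<psi>_def fibre_EB_base(2)[OF that] ..
  show "\<psi> c p (vadd EB y y') = vadd (Ob c) (\<psi> c p y) (\<psi> c p y')" if "y' \<in> fibre EB (cls c p)"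
    unfolding f[OF y] f[OF that] f[OF EB_closed(1)[OF y that]] by (rule h(2)[OF y that])
  show "\<psi> c p (vscl EB z y) = vscl (Ob c) z (\<psi> c p y)"
    unfolding f[OF y] f[OF EB_closed(2)[OF y]] by (rule h(3)[OF y])
qed

text \<open>A local section of the frames over a chart carries local trivializations of the orbibundle to local
  trivializations of the glued bundle.\<close>

lemma vector_bundle_EB: "vector_bundle P EB"
proof (rule vector_bundleI)
  show "continuous_map (vtot EB) P (vproj EB)" unfolding bundle_simps(2) by (rule continuous_EB_proj)
  fix \<xi>0 assume "\<xi>0 \<in> topspace P"
  then obtain c p0 where c: "c \<in> charts Y" and p0: "p0 \<in> FC c" and \<xi>0: "\<xi>0 = cls c p0" by (rule frame_bundleE)
  have "fst p0 \<in> topspace (D c)" using FC_D(1)[OF p0] by simp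
  then obtain V k f g where V: "fst p0 \<in> V" and bc: "bundle_chart (D c) (Ob c) V k f g" by (rule vector_bundleE[OF T(1)[OF c]])
  note C = bundle_chartD[OF bc]
  have pN: "p0 \<in> {p \<in> FC c. fst p \<in> V}" using p0 V by simp
  obtain O' s where O': "openin (FT c) O'" "p0 \<in> O'" "O' \<subseteq> {p \<in> FC c. fst p \<in> V}" and B: "openin P (frame_class Y c ` O')"
    and cs: "continuous_map (subtopology P (frame_class Y c ` O')) (FT c) s"
    and s: "\<And>\<xi>. \<xi> \<in> frame_class Y c ` O' \<Longrightarrow> s \<xi> \<in> O' \<and> cls c (s \<xi>) = \<xi>" "\<And>p. p \<in> O' \<Longrightarrow> s (cls c p) = p"
    by (rule local_section[OF c pN openin_frames_over[OF C(1)]]) (rule that, (assumption | blast)+)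
  let ?B = "frame_class Y c ` O'"
  have sV: "s \<xi> \<in> FC c" "fst (s \<xi>) \<in> V" "cls c (s \<xi>) = \<xi>" if "\<xi> \<in> ?B" for \<xi> using s(1)[OF that] O'(3) by auto
  define fE where "fE y = (fst y, snd (f (\<psi> c (s (fst y)) y)))" for y :: "('n, 'y) frame \<times> (nat \<Rightarrow> complex)"
  define gE where "gE t = \<theta> c (s (fst t)) (g (fst (s (fst t)), snd t))" for t
  have in_f: "y \<in> fibre EB (cls c (s \<xi>))" if "\<xi> \<in> ?B" "y \<in> fibre EB \<xi>" for \<xi> y using sV(3)[OF that(1)] that(2) by simp
  have \<psi>f: "\<psi> c (s \<xi>) y \<in> tot (Ob c)" "vproj (Ob c) (\<psi> c (s \<xi>) y) = fst (s \<xi>)" "\<psi> c (s \<xi>) y \<in> fibre (Ob c) (fst (s \<xi>))"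
    "\<theta> c (s \<xi>) (\<psi> c (s \<xi>) y) = y" if "\<xi> \<in> ?B" "y \<in> fibre EB \<xi>" for \<xi> y
    using \<psi>_in[OF c sV(1)[OF that(1)] in_f[OF that]] fibreD by simp_all
  have gf: "g (fst (s \<xi>), x) \<in> fibre (Ob c) (fst (s \<xi>))" if "\<xi> \<in> ?B" "x \<in> topspace (coordinate_space k)" for \<xi> x
  proof (rule fibreI)
    show "vproj (Ob c) (g (fst (s \<xi>), x)) = fst (s \<xi>)" by (rule C(7)[OF sV(2)[OF that(1)] that(2)])
    show "g (fst (s \<xi>), x) \<in> tot (Ob c)"
      using continuous_map_image_subset_topspace[OF C(4)] sV(2)[OF that(1)] C(2) that(2) by (auto simp: image_subset_iff)
  qed
  have "bundle_chart P EB ?B k fE gE"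
    unfolding bundle_chart_def
  proof (intro conjI ballI allI impI)
    show "openin P ?B" by (rule B)
    let ?EB = "subtopology (vtot EB) {e. vproj EB e \<in> ?B}"
    have tE: "e \<in> fibre EB (fst e)" "fst e \<in> ?B" if "e \<in> topspace ?EB" for e
      using that fibre_EB_base(3)[of e] unfolding bundle_simps(2) by simp_all
    have "continuous_map ?EB (subtopology (vtot (Ob c)) {e. vproj (Ob c) e \<in> V}) (\<lambda>y. \<psi> c (s (fst y)) y)"
    proof (rule continuous_map_into_subtopology, unfold bundle_simps(2), rule continuous_\<psi>_section[OF c O'(1) s], assumption, assumption, rule Pi_I)
      show "\<psi> c (s (fst e)) e \<in> {e. vproj (Ob c) e \<in> V}" if "e \<in> topspace (subtopology (vtot EB) {e. fst e \<in> ?B})" for e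
        using \<psi>f(2)[OF tE(2,1)[OF that[folded bundle_simps(2)]]] sV(2)[OF tE(2)[OF that[folded bundle_simps(2)]]] by simp
    qed
    note cf = continuous_map_app[OF continuous_map_app[OF this C(3)] continuous_map_snd]
    have c1: "continuous_map ?EB P fst" by (rule continuous_map_from_subtopology[OF continuous_EB_proj])
    show "continuous_map ?EB (prod_topology P (coordinate_space k)) fE" unfolding fE_def by (rule continuous_map_pairedI[OF c1 cf])
    let ?T = "prod_topology (subtopology P ?B) (coordinate_space k)"
    have tT: "fst t \<in> ?B" "snd t \<in> topspace (coordinate_space k)" if "t \<in> topspace ?T" for t
      using that by (auto simp: topspace_prod_topology)
    have g1: "continuous_map ?T (FT c) (\<lambda>t. s (fst t))" by (rule continuous_map_app[OF continuous_map_fst cs])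
    have g2: "continuous_map ?T (subtopology (D c) V) (\<lambda>t. fst (s (fst t)))"
    proof (rule continuous_map_into_subtopology, rule continuous_map_into_subtopology)
      show "continuous_map ?T euclidean (\<lambda>t. fst (s (fst t)))" by (rule continuous_map_euclidean_fst[OF continuous_map_into_fulltopology[OF g1]])
      show "(\<lambda>t. fst (s (fst t))) \<in> topspace ?T \<rightarrow> cdom c" by (rule Pi_I, rule FC_D(1)[OF sV(1)[OF tT(1)]])
      show "(\<lambda>t. fst (s (fst t))) \<in> topspace ?T \<rightarrow> V" by (rule Pi_I, rule sV(2)[OF tT(1)])
    qed
    have g3: "continuous_map ?T (vtot (Ob c)) (\<lambda>t. g (fst (s (fst t)), snd t))"
      by (rule continuous_map_app[OF continuous_map_pairedI[OF g2 continuous_map_snd] C(4)])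
    have g4: "continuous_map ?T (XS c) (\<lambda>t. (s (fst t), g (fst (s (fst t)), snd t)))"
      by (rule continuous_map_into_pullback[OF g1 g3]) (rule fibreD(2)[OF gf[OF tT], symmetric])
    show "continuous_map ?T (vtot EB) gE" using continuous_map_app[OF g4 continuous_\<theta>[OF c]] unfolding gE_def by simp
    show "fst (fE e) = vproj EB e" for e unfolding fE_def bundle_simps(2) by simp
    show "gE (fE e) = e" if "e \<in> tot EB" "vproj EB e \<in> ?B" for e
    proof -
      have e: "e \<in> fibre EB (fst e)" "fst e \<in> ?B" using fibre_EB_base(3)[OF that(1)] that(2) unfolding bundle_simps(2) by simp_all
      note \<psi>e = \<psi>f[OF e(2,1)]
      have v: "vproj (Ob c) (\<psi> c (s (fst e)) e) \<in> V" unfolding \<psi>e(2) by (rule sV(2)[OF e(2)])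
      have "(fst (s (fst e)), snd (f (\<psi> c (s (fst e)) e))) = f (\<psi> c (s (fst e)) e)"
        using C(5)[OF \<psi>e(1) v] \<psi>e(2) by (simp add: prod_eq_iff)
      then have "g (fst (s (fst e)), snd (f (\<psi> c (s (fst e)) e))) = \<psi> c (s (fst e)) e" using C(6)[OF \<psi>e(1) v] by simp
      then show ?thesis unfolding gE_def fE_def fst_conv snd_conv using \<psi>e(4) by simp
    qed
    fix \<xi> assume \<xi>: "\<xi> \<in> ?B"
    show 1: "vproj EB (gE (\<xi>, x)) = \<xi>" for x unfolding bundle_simps(2) gE_def \<theta>_def using sV(3)[OF \<xi>] by simp
    show "fE (gE (\<xi>, x)) = (\<xi>, x)" if "x \<in> topspace (coordinate_space k)" for x
    proof -
      have "\<psi> c (s \<xi>) (gE (\<xi>, x)) = g (fst (s \<xi>), x)" unfolding gE_def fst_conv snd_conv by (rule \<psi>_\<theta>[OF c sV(1)[OF \<xi>] gf[OF \<xi> that]])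
      then show ?thesis using 1[of x] C(8)[OF sV(2)[OF \<xi>] that] unfolding fE_def bundle_simps(2) by simp
    qed
    fix e assume e: "e \<in> fibre EB \<xi>"
    note \<psi>l = \<psi>_linear[OF c sV(1)[OF \<xi>] in_f[OF \<xi> e]]
    show "vadd EB e e' \<in> fibre EB \<xi>" if "e' \<in> fibre EB \<xi>" for e' by (rule EB_closed(1)[OF e that])
    show "snd (fE (vadd EB e e')) = (\<lambda>i\<in>{..<k}. snd (fE e) i + snd (fE e') i)" if e': "e' \<in> fibre EB \<xi>" for e'
      unfolding fE_def snd_conv fibre_EB_base(2)[OF e] fibre_EB_base(2)[OF e'] fibre_EB_base(2)[OF EB_closed(1)[OF e e']] \<psi>l(1)[OF in_f[OF \<xi> e']]
      by (rule C(10)[OF sV(2)[OF \<xi>] \<psi>f(3)[OF \<xi> e] \<psi>f(3)[OF \<xi> e']])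
    show "vscl EB z e \<in> fibre EB \<xi>" for z by (rule EB_closed(2)[OF e])
    show "snd (fE (vscl EB z e)) = (\<lambda>i\<in>{..<k}. z * snd (fE e) i)" for z
      unfolding fE_def snd_conv fibre_EB_base(2)[OF e] fibre_EB_base(2)[OF EB_closed(2)[OF e]] \<psi>l(2)
      by (rule C(12)[OF sV(2)[OF \<xi>] \<psi>f(3)[OF \<xi> e]])
  qed
  moreover have "\<xi>0 \<in> ?B" unfolding \<xi>0 by (rule imageI[OF O'(2)])
  ultimately show "\<exists>V k f g. \<xi>0 \<in> V \<and> bundle_chart P EB V k f g" by (intro exI conjI)
qed

text \<open>Locally the action is computed by a single lift, applied to a local section of frames.\<close>

lemma continuous_\<rho>:
  assumes x: "x \<in> carrier X"
  shows "continuous_map (prod_topology (top_of_set On) (vtot EB)) (vtot EB) (\<lambda>y. \<rho> x (fst y) (snd y))" (is "continuous_map ?Z _ _")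
proof (rule continuous_map_locally)
  fix z assume z: "z \<in> topspace ?Z"
  have z2: "snd z \<in> tot EB" using z by (auto simp: topspace_prod_topology)
  note \<xi>0 = fibre_EB_base(4)[OF z2]
  obtain c p0 where c: "c \<in> charts Y" and p0: "p0 \<in> FC c" and e0: "fst (snd z) = cls c p0" using \<xi>0 by (rule frame_bundleE)
  obtain d W l where d: "d \<in> charts Y" and l: "local_lift (snd x) c d W l" "fst p0 \<in> W" by (rule step_exists[OF snd_in[OF x] c p0])
  have pN: "p0 \<in> {p \<in> FC c. fst p \<in> W}" using p0 l(2) by simp
  obtain O' s where O': "openin (FT c) O'" "p0 \<in> O'" "O' \<subseteq> {p \<in> FC c. fst p \<in> W}" and B: "openin P (frame_class Y c ` O')"
    and cs: "continuous_map (subtopology P (frame_class Y c ` O')) (FT c) s"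
    and s: "\<And>\<xi>. \<xi> \<in> frame_class Y c ` O' \<Longrightarrow> s \<xi> \<in> O' \<and> cls c (s \<xi>) = \<xi>" "\<And>p. p \<in> O' \<Longrightarrow> s (cls c p) = p"
    by (rule local_section[OF c pN openin_frames_over[OF openin_lift_domain[OF l(1)]]]) (rule that, (assumption | blast)+)
  let ?B = "frame_class Y c ` O'"
  have sV: "s \<xi> \<in> FC c" "fst (s \<xi>) \<in> W" "cls c (s \<xi>) = \<xi>" if "\<xi> \<in> ?B" for \<xi> using s(1)[OF that] O'(3) by auto
  have c0: "continuous_map ?Z P (\<lambda>t. fst (snd t))" by (rule continuous_map_app[OF continuous_map_snd continuous_EB_proj])
  define U where "U = {t \<in> topspace ?Z. fst (snd t) \<in> ?B}"
  have U: "openin ?Z U" unfolding U_def by (rule openin_continuous_map_preimage[OF c0 B])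
  let ?U = "subtopology ?Z U"
  have tU: "fst t \<in> On" "snd t \<in> fibre EB (fst (snd t))" "fst (snd t) \<in> ?B" if "t \<in> topspace ?U" for t
    using that fibre_EB_base(3)[of "snd t"] unfolding U_def by (auto simp: topspace_prod_topology)
  have tf: "\<psi> c (s (fst (snd t))) (snd t) \<in> fibre (Ob c) (fst (s (fst (snd t))))" "\<theta> c (s (fst (snd t))) (\<psi> c (s (fst (snd t))) (snd t)) = snd t"
    if "t \<in> topspace ?U" for t
  proof -
    have "snd t \<in> fibre EB (cls c (s (fst (snd t))))" unfolding sV(3)[OF tU(3)[OF that]] by (rule tU(2)[OF that])
    from \<psi>_in[OF c sV(1)[OF tU(3)[OF that]] this]
    show "\<psi> c (s (fst (snd t))) (snd t) \<in> fibre (Ob c) (fst (s (fst (snd t))))" "\<theta> c (s (fst (snd t))) (\<psi> c (s (fst (snd t))) (snd t)) = snd t" .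
  qed
  have cU: "continuous_map ?U (subtopology P ?B) (\<lambda>t. fst (snd t))"
    by (rule continuous_map_into_subtopology[OF continuous_map_from_subtopology[OF c0]], rule Pi_I, rule tU(3))
  have c1: "continuous_map ?U (FT c) (\<lambda>t. s (fst (snd t)))" by (rule continuous_map_app[OF cU cs])
  have c2: "continuous_map ?U (FT c) (\<lambda>t. rotate_frame (fst t) (s (fst (snd t))))"
    by (rule continuous_map_rotate_frame[OF continuous_map_from_subtopology[OF continuous_map_fst] c1])
  have c3: "continuous_map ?U (FT d) (\<lambda>t. lift_frame l (rotate_frame (fst t) (s (fst (snd t)))))"
    by (rule continuous_map_lift_frame[OF snd_in[OF x] c d l(1) c2]) (simp only: fst_rotate_frame sV(2)[OF tU(3)])
  have "continuous_map ?U (subtopology (vtot EB) {y. fst y \<in> ?B}) snd"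
    by (rule continuous_map_into_subtopology[OF continuous_map_from_subtopology[OF continuous_map_snd]], rule Pi_I) (use tU(3) in simp)
  from continuous_map_app[OF this continuous_\<psi>_section[OF c O'(1) s]]
  have c4: "continuous_map ?U (vtot (Ob c)) (\<lambda>t. \<psi> c (s (fst (snd t))) (snd t))" by simp
  have c5: "continuous_map ?U (subtopology (vtot (Ob c)) {e. vproj (Ob c) e \<in> W}) (\<lambda>t. \<psi> c (s (fst (snd t))) (snd t))"
    by (rule continuous_map_into_subtopology[OF c4], rule Pi_I) (use fibreD(2)[OF tf(1)] sV(2)[OF tU(3)] in simp)
  note c6 = continuous_map_app[OF c5 T(2)[OF x c d l(1)]]
  have c7: "continuous_map ?U (XS d) (\<lambda>t. (lift_frame l (rotate_frame (fst t) (s (fst (snd t)))), A x c W l d (\<psi> c (s (fst (snd t))) (snd t))))"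
  proof (rule continuous_map_into_pullback[OF c3 c6])
    fix t assume t: "t \<in> topspace ?U"
    from fibreD(2)[OF fibre_iso_in[OF T(3)[OF x c d l(1) sV(2)[OF tU(3)[OF t]]] tf(1)[OF t]]]
    show "fst (lift_frame l (rotate_frame (fst t) (s (fst (snd t))))) = vproj (Ob d) (A x c W l d (\<psi> c (s (fst (snd t))) (snd t)))" by simp
  qed
  from continuous_map_app[OF c7 continuous_\<theta>[OF d]]
  have "continuous_map ?U (vtot EB) (\<lambda>t. \<theta> d (lift_frame l (rotate_frame (fst t) (s (fst (snd t))))) (A x c W l d (\<psi> c (s (fst (snd t))) (snd t))))"
    by simp
  then have "continuous_map ?U (vtot EB) (\<lambda>t. \<rho> x (fst t) (snd t))"
  proof (rule continuous_map_eq)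
    fix t assume t: "t \<in> topspace ?U"
    show "\<theta> d (lift_frame l (rotate_frame (fst t) (s (fst (snd t))))) (A x c W l d (\<psi> c (s (fst (snd t))) (snd t))) = \<rho> x (fst t) (snd t)"
      unfolding \<theta>_equivariant[OF x tU(1)[OF t] c d l(1) sV(1,2)[OF tU(3)[OF t]] tf(1)[OF t]] tf(2)[OF t] ..
  qed
  moreover have "z \<in> U" unfolding U_def using z e0 O'(2) by simp
  ultimately show "\<exists>U. openin ?Z U \<and> z \<in> U \<and> continuous_map (subtopology ?Z U) (vtot EB) (\<lambda>y. \<rho> x (fst y) (snd y))"
    using U by (intro exI[of _ U] conjI)
qed

theorem orbibundle_has_twisted_bundle:
  "\<exists>(E :: (('n, 'y) frame, ('n, 'y) frame \<times> (nat \<Rightarrow> complex)) vbundle) act.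
    tbundle (E, act) \<and> corresponds (E, act) (O1, A)"
proof -
  have fa: "frame_action EB \<rho>"
    unfolding frame_action_def
  proof (intro conjI ballI vector_bundle_EB continuous_\<rho>)
    show "fibre_iso EB \<xi> EB (frame_push Y (snd x) (frame_rotate Q \<xi>)) (\<rho> x Q)" if "x \<in> carrier X" "Q \<in> On" "\<xi> \<in> topspace P" for x Q \<xi>
      using \<rho>_fibre[OF that vector_bundle_EB] unfolding push_def .
    show "\<rho> y Q' (\<rho> x Q e) = \<rho> (y \<otimes>\<^bsub>X\<^esub> x) (Q' ** Q) e"
      if "x \<in> carrier X" "y \<in> carrier X" "Q \<in> On" "Q' \<in> On" "e \<in> tot EB" for x y Q Q' e by (rule \<rho>_compose[OF that])
    show "\<rho> (z * fst x, snd x) Q e = vscl EB z (\<rho> x Q e)"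
      if "x \<in> carrier X" "z \<in> sphere 0 1" "Q \<in> On" "e \<in> tot EB" for x z Q e
      by (rule \<rho>_central[OF that(1) _ that(3,4)]) (use that(2) in simp)
  qed
  note tb = frame_action_imp_twisted_bundle[OF fa]
  have oc: "over_comparison (vtot EB) (vproj EB) (St Ob) (Sp Ob) \<theta> \<psi>"
    unfolding over_comparison_def
  proof (intro conjI ballI impI continuous_\<theta> continuous_\<psi>)
    show "continuous_map (vtot EB) P (vproj EB)" by (rule vector_bundle_proj[OF vector_bundle_EB])
    fix c assume c: "c \<in> charts Y"
    show "continuous_map (vtot (Ob c)) (D c) (vproj (Ob c))" by (rule vector_bundle_proj[OF T(1)[OF c]])
    fix p assume p: "p \<in> FC c"
    show "vproj EB (\<theta> c p e) = cls c p" for e unfolding bundle_simps(2) \<theta>_def by simp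
    show "\<psi> c p (\<theta> c p e) = e" if "e \<in> tot (Ob c)" "vproj (Ob c) e = fst p" for e
      by (rule \<psi>_\<theta>[OF c p fibreI[OF that]])
    show "vproj (Ob c) (\<psi> c p e) = fst p" "\<theta> c p (\<psi> c p e) = e" if "e \<in> tot EB" "vproj EB e = cls c p" for e
      using fibreD(2)[OF \<psi>_in(1)[OF c p fibreI[OF that]]] \<psi>_in(2)[OF c p fibreI[OF that]] .
  qed
  let ?act = "\<lambda>l e. vscl EB (line_weight l) (\<rho> (1, snd (vproj L l)) (snd (fst (vproj L l))) e)"
  have "comparison EB (line_action EB ?act) Ob A \<theta> \<psi>"
    unfolding comparison_def
  proof (intro conjI oc ballI allI impI)
    show "fibre_hom (Ob c) (fst p) EB (cls c p) (\<theta> c p)" if "c \<in> charts Y" "p \<in> FC c" for c p by (rule fibre_isoD(1)[OF \<theta>_iso[OF that]])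
    show "\<theta> d (lift_frame l (rotate_frame Q p)) (A x c W l d e) = line_action EB ?act x Q (\<theta> c p e)"
      if x: "x \<in> carrier X" and Q: "Q \<in> On" and c: "c \<in> charts Y" and d: "d \<in> charts Y" and l: "local_lift (snd x) c d W l"
        and p: "p \<in> FC c" "fst p \<in> W" and e: "e \<in> fibre (Ob c) (fst p)" for x Q c d W l p e
    proof -
      have "\<theta> c p e \<in> tot EB" by (rule fibreD(1)[OF fibre_iso_in[OF \<theta>_iso[OF c p(1)] e]])
      from tb(2)[OF x Q this] show ?thesis using \<theta>_equivariant[OF x Q c d l p e] by simp
    qed
  qed
  then have "corresponds (EB, ?act) (O1, A)" unfolding corresponds_def split_conv by (intro exI)
  with tb(1) show ?thesis by (intro exI conjI)
qed

end

section \<open>The isomorphism\<close>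

lemma B2_subset_Z2:
  assumes H: "group H"
  shows "B2 H \<subseteq> carrier (Z2 H)"
proof
  interpret group H by (rule H)
  fix f assume "f \<in> B2 H"
  then obtain b where f: "f = (\<lambda>(g, h)\<in>carrier H \<times> carrier H. b g * b h / b (g \<otimes>\<^bsub>H\<^esub> h))" and b: "b \<in> carrier H \<rightarrow> sphere 0 1"
    unfolding B2_def by blast
  have n: "norm (b g) = 1" "b g \<noteq> 0" if "g \<in> carrier H" for g
  proof -
    show "norm (b g) = 1" using b that by (auto simp: Pi_iff)
    then show "b g \<noteq> 0" by auto
  qed
  have "f \<in> carrier H \<times> carrier H \<rightarrow>\<^sub>E sphere 0 1"
    unfolding f by (auto simp: n norm_mult norm_divide)
  moreover have "f (g, h) * f (g \<otimes>\<^bsub>H\<^esub> h, k) = f (g, h \<otimes>\<^bsub>H\<^esub> k) * f (h, k)"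
    if "g \<in> carrier H" "h \<in> carrier H" "k \<in> carrier H" for g h k
    unfolding f using that by (simp add: n m_assoc field_simps)
  ultimately show "f \<in> carrier (Z2 H)" unfolding Z2_def by simp
qed

text \<open>A class in the quotient consists of cocycles because coboundaries are cocycles.\<close>

lemma class_subset_Z2:
  assumes H: "group H" and \<alpha>: "\<alpha> \<in> carrier (H2 H)"
  shows "\<alpha> \<subseteq> carrier (Z2 H)"
proof -
  interpret group H by (rule H)
  have closed: "b \<otimes>\<^bsub>Z2 H\<^esub> z \<in> carrier (Z2 H)" if b: "b \<in> carrier (Z2 H)" and z: "z \<in> carrier (Z2 H)" for b z
  proof -
    have c: "b (g, h) * b (g \<otimes>\<^bsub>H\<^esub> h, k) = b (g, h \<otimes>\<^bsub>H\<^esub> k) * b (h, k)" "z (g, h) * z (g \<otimes>\<^bsub>H\<^esub> h, k) = z (g, h \<otimes>\<^bsub>H\<^esub> k) * z (h, k)"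
      if "g \<in> carrier H" "h \<in> carrier H" "k \<in> carrier H" for g h k
      using b z that unfolding Z2_def by simp_all
    have n: "norm (b t) = 1" "norm (z t) = 1" if "t \<in> carrier H \<times> carrier H" for t
      using b z that unfolding Z2_def by (auto simp: PiE_iff)
    have "(\<lambda>t\<in>carrier H \<times> carrier H. b t * z t) \<in> carrier H \<times> carrier H \<rightarrow>\<^sub>E sphere 0 1"
      by (auto simp: n norm_mult)
    moreover have "b (g, h) * z (g, h) * (b (g \<otimes>\<^bsub>H\<^esub> h, k) * z (g \<otimes>\<^bsub>H\<^esub> h, k)) = b (g, h \<otimes>\<^bsub>H\<^esub> k) * z (g, h \<otimes>\<^bsub>H\<^esub> k) * (b (h, k) * z (h, k))"
      if "g \<in> carrier H" "h \<in> carrier H" "k \<in> carrier H" for g h k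
      using arg_cong2[OF c[OF that], of "(*)"] by (simp add: mult_ac)
    ultimately show ?thesis unfolding Z2_def by simp
  qed
  obtain z where z: "z \<in> carrier (Z2 H)" "\<alpha> = B2 H #>\<^bsub>Z2 H\<^esub> z"
    using \<alpha> unfolding H2_def FactGroup_def RCOSETS_def by auto
  show ?thesis unfolding z(2) r_coset_def using closed[OF _ z(1)] B2_subset_Z2[OF H] by blast
qed

context twisted_action
begin

lemma K_gpd_iso_K_AR: "K_gpd \<G> \<L> \<cong> K_AR Y H a"
  unfolding K_gpd_def K_AR_def
proof (rule grothendieck_group_iso[where C = corresponds])
  let ?S = "{E :: (('n, 'y) frame, ('n, 'y) frame \<times> (nat \<Rightarrow> complex)) vbundle \<times> _. tbundle E}"
  let ?S' = "{\<E> :: ('n, 'y, (real^'n) \<times> (nat \<Rightarrow> complex)) orbibundle \<times> _. torbibundle \<E>}"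
  show "equiv ?S {(E, F). E \<in> ?S \<and> F \<in> ?S \<and> twisted_iso \<G> \<L> E F}" by (rule twisted_iso_equiv)
  show "\<exists>E'\<in>?S'. corresponds E E'" if "E \<in> ?S" for E
  proof -
    obtain E1 act where E: "E = (E1, act)" by (rule prod.exhaust)
    have "tbundle (E1, act)" using that unfolding E by simp
    from twisted_bundle_has_orbibundle[OF this] obtain O1 :: "('n, 'y, (real^'n) \<times> (nat \<Rightarrow> complex)) orbibundle" and A
      where "torbibundle (O1, A)" "corresponds (E1, act) (O1, A)" by (elim exE conjE) (rule that)
    then show ?thesis unfolding E by (intro bexI[of _ "(O1, A)"]) simp_all
  qed
  show "\<exists>E\<in>?S. corresponds E E'" if "E' \<in> ?S'" for E'
  proof -
    obtain O1 A where E': "E' = (O1, A)" by (rule prod.exhaust)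
    have "torbibundle (O1, A)" using that unfolding E' by simp
    then interpret orbibundle_action Y \<mu> H a O1 A by unfold_locales
    from orbibundle_has_twisted_bundle obtain E :: "(('n, 'y) frame, ('n, 'y) frame \<times> (nat \<Rightarrow> complex)) vbundle" and act
      where "tbundle (E, act)" "corresponds (E, act) (O1, A)" by (elim exE conjE) (rule that)
    then show ?thesis unfolding E' by (intro bexI[of _ "(E, act)"]) simp_all
  qed
  show "twisted_iso \<G> \<L> E F \<longleftrightarrow> orbi_iso Y H a E' F'"
    if "E \<in> ?S" "F \<in> ?S" "E' \<in> ?S'" "F' \<in> ?S'" "corresponds E E'" "corresponds F F'" for E F E' F'
    using that isomorphism_transfer[of "fst E" "snd E" "fst F" "snd F" "fst E'" "snd E'" "fst F'" "snd F'"] by simp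
  show "twisted_sum \<G> \<L> G E F \<longleftrightarrow> orbi_sum Y H a G' E' F'"
    if "G \<in> ?S" "E \<in> ?S" "F \<in> ?S" "G' \<in> ?S'" "E' \<in> ?S'" "F' \<in> ?S'" "corresponds G G'" "corresponds E E'" "corresponds F F'"
    for G E F G' E' F'
    using that sum_transfer[of "fst G" "snd G" "fst E" "snd E" "fst F" "snd F" "fst G'" "snd G'" "fst E'" "snd E'" "fst F'" "snd F'"] by simp
  show "twisted_sum \<G> \<L> G2 E F"
    if "G \<in> ?S" "G2 \<in> ?S" "E \<in> ?S" "F \<in> ?S" "twisted_sum \<G> \<L> G E F" "twisted_iso \<G> \<L> G G2" for G G2 E F
    using that twisted_sum_invariant[of "fst G" "snd G" "fst G2" "snd G2" "fst E" "snd E" "fst F" "snd F"] by simp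
qed

end

theorem theorem7p2p8:
  fixes X :: "('n::finite, 'x) orbifold" and Y :: "('n, 'y) orbifold"
    and p :: "'y \<Rightarrow> 'x" and \<mu> :: "('n, 'y) metric"
    and \<alpha> :: "(('y \<Rightarrow> 'y) \<times> ('y \<Rightarrow> 'y) \<Rightarrow> complex) set"
    and a :: "('y \<Rightarrow> 'y) \<times> ('y \<Rightarrow> 'y) \<Rightarrow> complex"
  defines "H \<equiv> deck_group Y p"
  assumes "effective_orbifold X" and "effective_orbifold Y"
    and "universal_orbifold_cover Y X p"
    and "riemannian_metric Y \<mu>" and "\<forall>h\<in>carrier H. isometric Y \<mu> h"
    and "\<alpha> \<in> carrier (H2 H)" and "a \<in> \<alpha>"
  shows "K_gpd (orbifold_groupoid Y \<mu> H) (discrete_torsion_gerbe Y \<mu> H a) \<cong> K_AR Y H a"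
proof -
  have H: "group H" unfolding H_def by (rule group_deck_group) fact
  have "orbifold_action Y \<mu> H"
  proof (rule orbifold_action.intro)
    show "effective_orbifold Y" "riemannian_metric Y \<mu>" "group H" by fact+
    show "orbifold_automorphism Y h" "isometric Y \<mu> h" if "h \<in> carrier H" for h
      using that assms(6) unfolding H_def deck_group_def by simp_all
    show "(h \<otimes>\<^bsub>H\<^esub> k) y = h (k y)" if "y \<in> topspace (ospace Y)" for h k y
      using that unfolding H_def deck_group_def by (simp add: compose_def)
    show "\<one>\<^bsub>H\<^esub> y = y" if "y \<in> topspace (ospace Y)" for y
      using that unfolding H_def deck_group_def by simp
  qed
  moreover have "a \<in> carrier (Z2 H)" using class_subset_Z2[OF H assms(7)] assms(8) by blast
  ultimately interpret twisted_action Y \<mu> H a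
    by (intro twisted_action.intro twisted_action_axioms.intro)
  show ?thesis by (rule K_gpd_iso_K_AR)
qed

end
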